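(* Let $(M,\Omega)$ be a symplectic manifold of dimension $2n$. A symplectic connection $\nabla\in\mathcal{S}(M,\Omega)$ is critical if and only if the Hamiltonian vector field $\mathsf{H}_{\mathcal{K}(\nabla)}$ generated by $\mathcal{K}(\nabla)$ is an infinitesimal automorphism of $\nabla$, that is, $\mathfrak{L}_{\mathsf{H}_{\mathcal{K}(\nabla)}}\nabla=0$.
   Context: Abstract index notation is used. Indices are raised and lowered by $X_i=X^p\Omega_{pi}$, $X^i=\Omega^{ip}X_p$, where $\Omega^{ip}\Omega_{pj}=-\delta_j{}^i$. A symplectic connection is a torsion-free affine connection $\nabla$ with $\nabla\Omega=0$; $\mathcal{S}(M,\Omega)$ is the affine space of these, modeled on $\Gamma(S^3(T^*M))$ ($\nabla+t\Pi$ has difference tensor $t\Pi_{ij}{}^k=t\,\Omega^{kp}\Pi_{ijp}$ with $\nabla$). Curvature: $\nabla_i\nabla_jX^k-\nabla_j\nabla_iX^k=R_{ijp}{}^kX^p$, $R_{ij}=R_{pij}{}^p$, $R_{ijkl}=R_{ijk}{}^p\Omega_{pl}$. Define $$\mathcal{K}(\nabla)=\nabla^i\nabla^jR_{ij}-\tfrac12R^{ij}R_{ij}+\tfrac14R^{ijkl}R_{ijkl}\in C^\infty(M).$$ The connection $\nabla$ is critical if it is a critical point, with respect to arbitrary compactly supported variations $\nabla+t\Pi$, $\Pi\in\Gamma(S^3(T^*M))$ compactly supported, of $\mathcal{E}(\nabla)=\int_M\mathcal{K}(\nabla)^2\,\tfrac{\Omega^n}{n!}$ (if $M$ is noncompact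 this means $\tfrac{d}{dt}|_{t=0}\int_M(\mathcal{K}(\nabla+t\Pi)^2-\mathcal{K}(\nabla)^2)\tfrac{\Omega^n}{n!}=0$ for all such $\Pi$). The Hamiltonian vector field of $f$ is $\mathsf{H}_f^i=\Omega^{pi}df_p$. The Lie derivative of a connection is $(\mathfrak{L}_X\nabla)_{ij}{}^k=\nabla_i\nabla_jX^k+X^pR_{pij}{}^k$. *)

theory Defs
  imports "HOL-Analysis.Analysis" "HOL-Combinatorics.Permutations"
begin

section \<open>Smooth manifolds\<close>

text \<open>
  A manifold is a topology \<open>X\<close> together with a smooth atlas \<open>A\<close> modelled on \<open>real ^ 'n\<close>. A chart is
  a pair of its domain and its coordinate map; the values of the coordinate map outside of the
  domain are irrelevant. Manifolds have no boundary, are Hausdorff and second countable, and need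
  not be connected. The atlas need not be maximal.
\<close>

type_synonym ('m, 'n) chart = "'m set \<times> ('m \<Rightarrow> real ^ 'n)"

abbreviation chart_dom :: "('m, 'n::finite) chart \<Rightarrow> 'm set" where
  "chart_dom c \<equiv> fst c"

abbreviation coords :: "('m, 'n::finite) chart \<Rightarrow> 'm \<Rightarrow> real ^ 'n" where
  "coords c \<equiv> snd c"

abbreviation param :: "('m, 'n::finite) chart \<Rightarrow> real ^ 'n \<Rightarrow> 'm" where
  "param c \<equiv> inv_into (chart_dom c) (coords c)"

definition partial_deriv :: "'n \<Rightarrow> (real ^ 'n \<Rightarrow> real) \<Rightarrow> real ^ 'n \<Rightarrow> real" where
  "partial_deriv i f x = frechet_derivative f (at x) (axis i 1)"

fun iterated_partial_deriv :: "'n list \<Rightarrow> (real ^ 'n \<Rightarrow> real) \<Rightarrow> real ^ 'n \<Rightarrow> real" where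
  "iterated_partial_deriv [] f = f"
| "iterated_partial_deriv (i # is) f = partial_deriv i (iterated_partial_deriv is f)"

text \<open>
  For open \<open>S\<close> this is \<open>C\<^sup>\<infinity>\<close>: all iterated partial derivatives are differentiable on \<open>S\<close>, hence exist
  to every order and are continuous.
\<close>

definition smooth_on_open :: "(real ^ 'n) set \<Rightarrow> (real ^ 'n \<Rightarrow> real) \<Rightarrow> bool" where
  "smooth_on_open S f \<longleftrightarrow> (\<forall>is. \<forall>x\<in>S. iterated_partial_deriv is f differentiable (at x))"

text \<open>Smoothness, read in the chart \<open>c\<close>, of a function on an open subset \<open>V\<close> of \<open>chart_dom c\<close>.\<close>

definition smooth_in_chart :: "('m, 'n::finite) chart \<Rightarrow> 'm set \<Rightarrow> ('m \<Rightarrow> real) \<Rightarrow> bool" where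
  "smooth_in_chart c V f \<longleftrightarrow> smooth_on_open (coords c ` V) (f \<circ> param c)"

definition is_chart :: "'m topology \<Rightarrow> ('m, 'n::finite) chart \<Rightarrow> bool" where
  "is_chart X c \<longleftrightarrow>
     openin X (chart_dom c) \<and> open (coords c ` chart_dom c) \<and>
     homeomorphic_map (subtopology X (chart_dom c)) (top_of_set (coords c ` chart_dom c)) (coords c)"

definition smooth_manifold :: "'m topology \<Rightarrow> ('m, 'n::finite) chart set \<Rightarrow> bool" where
  "smooth_manifold X A \<longleftrightarrow>
     Hausdorff_space X \<and> second_countable X \<and>
     (\<forall>c\<in>A. is_chart X c) \<and> (\<Union>c\<in>A. chart_dom c) = topspace X \<and>
     (\<forall>c\<in>A. \<forall>d\<in>A. \<forall>a. smooth_in_chart c (chart_dom c \<inter> chart_dom d) (\<lambda>p. coords d p $ a))"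

text \<open>
  The coordinate vector field \<open>\<partial>/\<partial>x\<^sup>i\<close> of the chart \<open>c\<close> applied to a function; meaningful at points of
  \<open>chart_dom c\<close>.
\<close>

definition pd :: "('m, 'n::finite) chart \<Rightarrow> 'n \<Rightarrow> ('m \<Rightarrow> real) \<Rightarrow> 'm \<Rightarrow> real" where
  "pd c i f p = partial_deriv i (f \<circ> param c) (coords c p)"

text \<open>The Jacobian \<open>\<partial>y\<^sup>a/\<partial>x\<^sup>i\<close>, where \<open>x\<close> and \<open>y\<close> are the coordinates of \<open>c\<close> and \<open>d\<close>.\<close>

definition jac :: "('m, 'n::finite) chart \<Rightarrow> ('m, 'n) chart \<Rightarrow> 'n \<Rightarrow> 'n \<Rightarrow> 'm \<Rightarrow> real" where
  "jac c d i a p = pd c i (\<lambda>q. coords d q $ a) p"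


section \<open>Tensor fields and affine connections\<close>

text \<open>
  Tensor fields and connections are given by their components with respect to each chart of the
  atlas, as functions of the point, subject to smoothness and the transformation law on overlaps.
  The components \<open>T c i j p\<close> matter only for \<open>c \<in> A\<close> and \<open>p \<in> chart_dom c\<close>. Index slots are in the order in
  which the indices are written in abstract index notation, from left to right.
\<close>

type_synonym ('m, 'n) field1 = "('m, 'n) chart \<Rightarrow> 'n \<Rightarrow> 'm \<Rightarrow> real"
type_synonym ('m, 'n) field2 = "('m, 'n) chart \<Rightarrow> 'n \<Rightarrow> 'n \<Rightarrow> 'm \<Rightarrow> real"
type_synonym ('m, 'n) field3 = "('m, 'n) chart \<Rightarrow> 'n \<Rightarrow> 'n \<Rightarrow> 'n \<Rightarrow> 'm \<Rightarrow> real"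
type_synonym ('m, 'n) field4 = "('m, 'n) chart \<Rightarrow> 'n \<Rightarrow> 'n \<Rightarrow> 'n \<Rightarrow> 'n \<Rightarrow> 'm \<Rightarrow> real"

definition covariant_tensor2 :: "('m, 'n::finite) chart set \<Rightarrow> ('m, 'n) field2 \<Rightarrow> bool" where
  "covariant_tensor2 A T \<longleftrightarrow>
     (\<forall>c\<in>A. \<forall>i j. smooth_in_chart c (chart_dom c) (T c i j)) \<and>
     (\<forall>c\<in>A. \<forall>d\<in>A. \<forall>p\<in>chart_dom c \<inter> chart_dom d. \<forall>i j.
        T c i j p = (\<Sum>a\<in>UNIV. \<Sum>b\<in>UNIV. jac c d i a p * jac c d j b p * T d a b p))"

definition covariant_tensor3 :: "('m, 'n::finite) chart set \<Rightarrow> ('m, 'n) field3 \<Rightarrow> bool" where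
  "covariant_tensor3 A T \<longleftrightarrow>
     (\<forall>c\<in>A. \<forall>i j k. smooth_in_chart c (chart_dom c) (T c i j k)) \<and>
     (\<forall>c\<in>A. \<forall>d\<in>A. \<forall>p\<in>chart_dom c \<inter> chart_dom d. \<forall>i j k.
        T c i j k p = (\<Sum>a\<in>UNIV. \<Sum>b\<in>UNIV. \<Sum>e\<in>UNIV.
          jac c d i a p * jac c d j b p * jac c d k e p * T d a b e p))"

text \<open>Sections of \<open>S\<^sup>3(T\<^sup>*M)\<close>.\<close>

definition symmetric_tensor3 :: "('m, 'n::finite) chart set \<Rightarrow> ('m, 'n) field3 \<Rightarrow> bool" where
  "symmetric_tensor3 A T \<longleftrightarrow> covariant_tensor3 A T \<and>
     (\<forall>c\<in>A. \<forall>p\<in>chart_dom c. \<forall>i j k. T c i j k p = T c j i k p \<and> T c i j k p = T c i k j p)"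

definition compactly_supported3 ::
  "'m topology \<Rightarrow> ('m, 'n::finite) chart set \<Rightarrow> ('m, 'n) field3 \<Rightarrow> bool" where
  "compactly_supported3 X A T \<longleftrightarrow>
     (\<exists>K. compactin X K \<and> (\<forall>c\<in>A. \<forall>p\<in>chart_dom c - K. \<forall>i j k. T c i j k p = 0))"

text \<open>
  \<open>G c i j k\<close> is the Christoffel symbol \<open>\<Gamma>\<^sub>i\<^sub>j\<^sup>k\<close>, with the convention
  \<open>\<nabla>\<^sub>i X\<^sup>k = \<partial>\<^sub>i X\<^sup>k + \<Gamma>\<^sub>i\<^sub>q\<^sup>k X\<^sup>q\<close>. The transformation law is
  \<open>\<Gamma>\<^sub>i\<^sub>j\<^sup>k \<partial>y\<^sup>a/\<partial>x\<^sup>k = \<partial>\<^sup>2y\<^sup>a/\<partial>x\<^sup>i\<partial>x\<^sup>j + \<partial>y\<^sup>b/\<partial>x\<^sup>i \<partial>y\<^sup>e/\<partial>x\<^sup>j \<Gamma>'\<^sub>b\<^sub>e\<^sup>a\<close>.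
\<close>

definition affine_connection :: "('m, 'n::finite) chart set \<Rightarrow> ('m, 'n) field3 \<Rightarrow> bool" where
  "affine_connection A G \<longleftrightarrow>
     (\<forall>c\<in>A. \<forall>i j k. smooth_in_chart c (chart_dom c) (G c i j k)) \<and>
     (\<forall>c\<in>A. \<forall>d\<in>A. \<forall>p\<in>chart_dom c \<inter> chart_dom d. \<forall>i j a.
        (\<Sum>k\<in>UNIV. G c i j k p * jac c d k a p) =
          pd c i (jac c d j a) p +
          (\<Sum>b\<in>UNIV. \<Sum>e\<in>UNIV. jac c d i b p * jac c d j e p * G d b e a p))"

definition torsion_free :: "('m, 'n::finite) chart set \<Rightarrow> ('m, 'n) field3 \<Rightarrow> bool" where
  "torsion_free A G \<longleftrightarrow> (\<forall>c\<in>A. \<forall>p\<in>chart_dom c. \<forall>i j k. G c i j k p = G c j i k p)"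

text \<open>
  Covariant derivatives in a fixed chart; the index of the derivative always comes first:
  \<open>\<nabla>\<^sub>i X\<^sup>k\<close>, \<open>\<nabla>\<^sub>i T\<^sub>j\<^sup>k\<close>, \<open>\<nabla>\<^sub>i T\<^sub>j\<^sub>k\<close> and \<open>\<nabla>\<^sub>i T\<^sub>j\<^sub>k\<^sub>l\<close>.
\<close>

definition nabla_vec :: "('m, 'n::finite) field3 \<Rightarrow> ('m, 'n) field1 \<Rightarrow> ('m, 'n) field2" where
  "nabla_vec G Y c i k p = pd c i (Y c k) p + (\<Sum>q\<in>UNIV. G c i q k p * Y c q p)"

definition nabla_endo :: "('m, 'n::finite) field3 \<Rightarrow> ('m, 'n) field2 \<Rightarrow> ('m, 'n) field3" where
  "nabla_endo G T c i j k p = pd c i (T c j k) p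
     - (\<Sum>q\<in>UNIV. G c i j q p * T c q k p)
     + (\<Sum>q\<in>UNIV. G c i q k p * T c j q p)"

definition nabla_cov2 :: "('m, 'n::finite) field3 \<Rightarrow> ('m, 'n) field2 \<Rightarrow> ('m, 'n) field3" where
  "nabla_cov2 G T c i j k p = pd c i (T c j k) p
     - (\<Sum>q\<in>UNIV. G c i j q p * T c q k p)
     - (\<Sum>q\<in>UNIV. G c i k q p * T c j q p)"

definition nabla_cov3 :: "('m, 'n::finite) field3 \<Rightarrow> ('m, 'n) field3 \<Rightarrow> ('m, 'n) field4" where
  "nabla_cov3 G T c i j k l p = pd c i (T c j k l) p
     - (\<Sum>q\<in>UNIV. G c i j q p * T c q k l p)
     - (\<Sum>q\<in>UNIV. G c i k q p * T c j q l p)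
     - (\<Sum>q\<in>UNIV. G c i l q p * T c j k q p)"

text \<open>
  The curvature \<open>R\<^sub>i\<^sub>j\<^sub>p\<^sup>k\<close> is determined by \<open>\<nabla>\<^sub>i\<nabla>\<^sub>jX\<^sup>k - \<nabla>\<^sub>j\<nabla>\<^sub>iX\<^sup>k = R\<^sub>i\<^sub>j\<^sub>p\<^sup>k X\<^sup>p\<close>; its components are read
  off by taking for \<open>X\<close> the coordinate vector field with index \<open>p\<close> (the variable \<open>s\<close> below).
\<close>

definition coord_vec :: "'n \<Rightarrow> ('m, 'n::finite) field1" where
  "coord_vec s c k p = (if k = s then 1 else 0)"

definition curvature :: "('m, 'n::finite) field3 \<Rightarrow> ('m, 'n) field4" where
  "curvature G c i j s k p =
     nabla_endo G (nabla_vec G (coord_vec s)) c i j k p -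
     nabla_endo G (nabla_vec G (coord_vec s)) c j i k p"

definition ricci :: "('m, 'n::finite) field3 \<Rightarrow> ('m, 'n) field2" where
  "ricci G c i j p = (\<Sum>q\<in>UNIV. curvature G c q i j q p)"

text \<open>\<open>(\<LL>\<^sub>Y\<nabla>)\<^sub>i\<^sub>j\<^sup>k = \<nabla>\<^sub>i\<nabla>\<^sub>jY\<^sup>k + Y\<^sup>q R\<^sub>q\<^sub>i\<^sub>j\<^sup>k\<close>.\<close>

definition lie_connection :: "('m, 'n::finite) field1 \<Rightarrow> ('m, 'n) field3 \<Rightarrow> ('m, 'n) field3" where
  "lie_connection Y G c i j k p =
     nabla_endo G (nabla_vec G Y) c i j k p + (\<Sum>q\<in>UNIV. Y c q p * curvature G c q i j k p)"

definition infinitesimal_automorphism ::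
  "('m, 'n::finite) chart set \<Rightarrow> ('m, 'n) field1 \<Rightarrow> ('m, 'n) field3 \<Rightarrow> bool" where
  "infinitesimal_automorphism A Y G \<longleftrightarrow>
     (\<forall>c\<in>A. \<forall>p\<in>chart_dom c. \<forall>i j k. lie_connection Y G c i j k p = 0)"


section \<open>Symplectic forms and symplectic connections\<close>

definition symplectic_form :: "('m, 'n::finite) chart set \<Rightarrow> ('m, 'n) field2 \<Rightarrow> bool" where
  "symplectic_form A Om \<longleftrightarrow> covariant_tensor2 A Om \<and>
     (\<forall>c\<in>A. \<forall>p\<in>chart_dom c.
        (\<forall>i j. Om c i j p = - Om c j i p) \<and>
        invertible (\<chi> i j. Om c i j p) \<and>
        (\<forall>i j k. pd c i (Om c j k) p + pd c j (Om c k i) p + pd c k (Om c i j) p = 0))"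

text \<open>\<open>\<Omega>\<^sup>i\<^sup>j\<close>, determined by \<open>\<Omega>\<^sup>i\<^sup>p\<Omega>\<^sub>p\<^sub>j = -\<delta>\<^sub>j\<^sup>i\<close>, and so minus the inverse matrix of \<open>\<Omega>\<^sub>i\<^sub>j\<close>.\<close>

definition Om_up :: "('m, 'n::finite) field2 \<Rightarrow> ('m, 'n) field2" where
  "Om_up Om c i j p = - matrix_inv (\<chi> a b. Om c a b p) $ i $ j"

definition symplectic_connection ::
  "('m, 'n::finite) chart set \<Rightarrow> ('m, 'n) field2 \<Rightarrow> ('m, 'n) field3 \<Rightarrow> bool" where
  "symplectic_connection A Om G \<longleftrightarrow> affine_connection A G \<and> torsion_free A G \<and>
     (\<forall>c\<in>A. \<forall>p\<in>chart_dom c. \<forall>i j k. nabla_cov2 G Om c i j k p = 0)"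

text \<open>\<open>\<nabla> + t\<Pi>\<close>, with difference tensor \<open>t\<Pi>\<^sub>i\<^sub>j\<^sup>k = t \<Omega>\<^sup>k\<^sup>q\<Pi>\<^sub>i\<^sub>j\<^sub>q\<close> from \<open>\<nabla>\<close>.\<close>

definition varied_connection ::
  "('m, 'n::finite) field2 \<Rightarrow> ('m, 'n) field3 \<Rightarrow> real \<Rightarrow> ('m, 'n) field3 \<Rightarrow> ('m, 'n) field3" where
  "varied_connection Om G t P c i j k p =
     G c i j k p + t * (\<Sum>q\<in>UNIV. Om_up Om c k q p * P c i j q p)"

text \<open>\<open>(\<H>\<^sub>f)\<^sup>i = \<Omega>\<^sup>q\<^sup>i df\<^sub>q\<close>.\<close>

definition hamiltonian_vec :: "('m, 'n::finite) field2 \<Rightarrow> ('m \<Rightarrow> real) \<Rightarrow> ('m, 'n) field1" where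
  "hamiltonian_vec Om f c i p = (\<Sum>q\<in>UNIV. Om_up Om c q i p * pd c q f p)"


section \<open>The function \<open>\<K>(\<nabla>)\<close>\<close>

text \<open>\<open>R\<^sub>i\<^sub>j\<^sub>k\<^sub>l = R\<^sub>i\<^sub>j\<^sub>k\<^sup>q \<Omega>\<^sub>q\<^sub>l\<close>.\<close>

definition curvature_low ::
  "('m, 'n::finite) field2 \<Rightarrow> ('m, 'n) field3 \<Rightarrow> ('m, 'n) field4" where
  "curvature_low Om G c i j k l p = (\<Sum>q\<in>UNIV. curvature G c i j k q p * Om c q l p)"

definition raise2 :: "('m, 'n::finite) field2 \<Rightarrow> ('m, 'n) field2 \<Rightarrow> ('m, 'n) field2" where
  "raise2 Om T c i j p =
     (\<Sum>a\<in>UNIV. \<Sum>b\<in>UNIV. Om_up Om c i a p * Om_up Om c j b p * T c a b p)"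

definition raise4 :: "('m, 'n::finite) field2 \<Rightarrow> ('m, 'n) field4 \<Rightarrow> ('m, 'n) field4" where
  "raise4 Om T c i j k l p =
     (\<Sum>a\<in>UNIV. \<Sum>b\<in>UNIV. \<Sum>e\<in>UNIV. \<Sum>f\<in>UNIV.
        Om_up Om c i a p * Om_up Om c j b p * Om_up Om c k e p * Om_up Om c l f p * T c a b e f p)"

text \<open>\<open>\<nabla>\<^sup>i\<nabla>\<^sup>jR\<^sub>i\<^sub>j = \<Omega>\<^sup>i\<^sup>a\<Omega>\<^sup>j\<^sup>b\<nabla>\<^sub>a\<nabla>\<^sub>bR\<^sub>i\<^sub>j\<close>.\<close>

definition divdiv_ricci ::
  "('m, 'n::finite) field2 \<Rightarrow> ('m, 'n) field3 \<Rightarrow> ('m, 'n) chart \<Rightarrow> 'm \<Rightarrow> real" where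
  "divdiv_ricci Om G c p =
     (\<Sum>i\<in>UNIV. \<Sum>j\<in>UNIV. \<Sum>a\<in>UNIV. \<Sum>b\<in>UNIV.
        Om_up Om c i a p * Om_up Om c j b p * nabla_cov3 G (nabla_cov2 G (ricci G)) c a b i j p)"

definition K_in_chart ::
  "('m, 'n::finite) field2 \<Rightarrow> ('m, 'n) field3 \<Rightarrow> ('m, 'n) chart \<Rightarrow> 'm \<Rightarrow> real" where
  "K_in_chart Om G c p =
     divdiv_ricci Om G c p
     - 1 / 2 * (\<Sum>i\<in>UNIV. \<Sum>j\<in>UNIV. raise2 Om (ricci G) c i j p * ricci G c i j p)
     + 1 / 4 * (\<Sum>i\<in>UNIV. \<Sum>j\<in>UNIV. \<Sum>k\<in>UNIV. \<Sum>l\<in>UNIV.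
         raise4 Om (curvature_low Om G) c i j k l p * curvature_low Om G c i j k l p)"

text \<open>
  \<open>K_in_chart\<close> is a full contraction of tensors, so its value at \<open>p\<close> is the same in all charts around
  \<open>p\<close>; any one of them may be chosen.
\<close>

definition K_curv ::
  "('m, 'n::finite) chart set \<Rightarrow> ('m, 'n) field2 \<Rightarrow> ('m, 'n) field3 \<Rightarrow> 'm \<Rightarrow> real" where
  "K_curv A Om G p = K_in_chart Om G (SOME c. c \<in> A \<and> p \<in> chart_dom c) p"


section \<open>The volume \<open>\<Omega>\<^sup>n/n!\<close> and critical connections\<close>

text \<open>
  The value of \<open>\<Omega> \<and> \<dots> \<and> \<Omega>\<close> (\<open>m\<close> factors) on the coordinate vector fields with indices
  \<open>e 0, \<dots>, e (2 * m - 1)\<close>, with \<open>dx\<^sup>1 \<and> \<dots> \<and> dx\<^sup>k\<close> normalised to be \<open>1\<close> on \<open>\<partial>\<^sub>1, \<dots>, \<partial>\<^sub>k\<close>.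
\<close>

definition wedge_power ::
  "('m, 'n::finite) field2 \<Rightarrow> nat \<Rightarrow> ('m, 'n) chart \<Rightarrow> (nat \<Rightarrow> 'n) \<Rightarrow> 'm \<Rightarrow> real" where
  "wedge_power Om m c e p =
     1 / 2 ^ m * (\<Sum>s | s permutes {..<2 * m}.
        of_int (sign s) * (\<Prod>k<m. Om c (e (s (2 * k))) (e (s (2 * k + 1))) p))"

text \<open>
  \<open>M\<close> is oriented by \<open>\<Omega>\<^sup>n\<close>, so integration of \<open>f \<Omega>\<^sup>n/n!\<close> is, in a chart, integration of \<open>f\<close> against the
  absolute value of the coefficient of \<open>\<Omega>\<^sup>n/n!\<close>. This does not depend on the enumeration
  \<open>from_nat_into UNIV\<close> of the index type.
\<close>

definition volume_density ::
  "('m, 'n::finite) field2 \<Rightarrow> ('m, 'n) chart \<Rightarrow> 'm \<Rightarrow> real" where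
  "volume_density Om c p =
     (let m = CARD('n) div 2 in \<bar>wedge_power Om m c (from_nat_into UNIV) p / fact m\<bar>)"

text \<open>The unique Borel measure on \<open>M\<close> given on each chart domain by the density of \<open>\<Omega>\<^sup>n/n!\<close>.\<close>

definition symplectic_measure ::
  "'m topology \<Rightarrow> ('m, 'n::finite) chart set \<Rightarrow> ('m, 'n) field2 \<Rightarrow> 'm measure" where
  "symplectic_measure X A Om = (SOME \<mu>.
     space \<mu> = topspace X \<and>
     sets \<mu> = sigma_sets (topspace X) {U. openin X U} \<and>
     (\<forall>c\<in>A. \<forall>B\<in>sets \<mu>. B \<subseteq> chart_dom c \<longrightarrow>
        emeasure \<mu> B =
          (\<integral>\<^sup>+x\<in>coords c ` B. ennreal (volume_density Om c (param c x)) \<partial>lborel)))"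

text \<open>
  The integrand is continuous with compact support. For compact \<open>M\<close> the integral is the difference
  of the energies of \<open>\<nabla> + t\<Pi>\<close> and \<open>\<nabla>\<close>.
\<close>

definition energy_difference ::
  "'m topology \<Rightarrow> ('m, 'n::finite) chart set \<Rightarrow> ('m, 'n) field2 \<Rightarrow> ('m, 'n) field3 \<Rightarrow>
     ('m, 'n) field3 \<Rightarrow> real \<Rightarrow> real" where
  "energy_difference X A Om G P t =
     (\<integral>p. (K_curv A Om (varied_connection Om G t P) p)\<^sup>2 - (K_curv A Om G p)\<^sup>2
        \<partial>symplectic_measure X A Om)"

definition critical_connection ::
  "'m topology \<Rightarrow> ('m, 'n::finite) chart set \<Rightarrow> ('m, 'n) field2 \<Rightarrow> ('m, 'n) field3 \<Rightarrow> bool" where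
  "critical_connection X A Om G \<longleftrightarrow>
     (\<forall>P. symmetric_tensor3 A P \<and> compactly_supported3 X A P \<longrightarrow>
        (energy_difference X A Om G P has_real_derivative 0) (at 0))"

end

(*
  Along Nabla + t Pi the function K(Nabla) is, at each point, a polynomial in t of degree at most 4.
  For its linear coefficient dK(Pi) and an arbitrary smooth f there is an identity
    f dK(Pi) = div Y + <L, Pi>,
  where Y is a vector field depending linearly on Pi and vanishing off the support of Pi, and L is,
  with the upper index lowered and up to sign, the Lie derivative of Nabla along the Hamiltonian
  vector field of f, which is a symmetric 3-tensor. (This says that K is a moment map for the group
  of Hamiltonian diffeomorphisms.) Hence with f = K(Nabla) the first variation of the energy is
  2 int K dK(Pi) = 2 int <L, Pi>, and it vanishes for all Pi if and only if L = 0. As Pi may be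
  supported in a chart and be of the form h du.du.du with a cutoff function h, only integrals in a
  chart are needed for the "only if" part; in the "if" part Pi is cut into pieces supported in
  charts.
*)

theory Submission
  imports Defs
begin

text \<open>The coefficients -1/2 and 1/4 of K are what makes the identity for f dK(Pi) close up.
  Two integrations by parts of f times the double divergence of the varied Ricci tensor leave the
  Hessian of f against dRic(Pi); as dRic(Pi) is a divergence of Pi, a third one gives the derivative
  of the Hessian. The varied squared curvature yields, through the contracted second Bianchi
  identity, f Nabla Ric and the contraction of df with the curvature that belongs to the Lie
  derivative. With these coefficients the terms f Nabla Ric cancel, and so do the products of df and
  Ric. Integration by parts in a chart works because Nabla Omega = 0 makes the volume density
  parallel: a divergence times the density is a sum of coordinate derivatives. All components are
  given chart by chart. Invariance is proved for the curvature and for K; the coefficients of K in t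
  then agree on overlaps because a polynomial function determines them, and this makes dK(Pi) a
  global function. The energy difference is a polynomial in t as well, so its derivative is read
  off.\<close>

section \<open>Smooth functions on Euclidean space\<close>

lemma partial_deriv_eqI:
  "(f has_derivative f') (at x) \<Longrightarrow> partial_deriv i f x = f' (axis i 1)"
  unfolding partial_deriv_def using frechet_derivative_at by metis

lemma has_derivative_partial_deriv:
  fixes f :: "real ^ 'n::finite \<Rightarrow> real"
  assumes "f differentiable (at x)"
  shows "(f has_derivative (\<lambda>h. \<Sum>i\<in>UNIV. h $ i * partial_deriv i f x)) (at x)"
proof -
  let ?D = "frechet_derivative f (at x)"
  have D: "(f has_derivative ?D) (at x)"
    using assms frechet_derivative_works by blast
  then have lin: "linear ?D"
    by (simp add: assms linear_frechet_derivative)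
  have "?D = (\<lambda>h. \<Sum>i\<in>UNIV. h $ i * partial_deriv i f x)"
  proof
    fix h
    have "?D h = ?D (\<Sum>i\<in>UNIV. h $ i *s axis i 1)"
      by (simp add: basis_expansion)
    also have "\<dots> = (\<Sum>i\<in>UNIV. h $ i * ?D (axis i 1))"
      by (simp add: linear_sum[OF lin] linear_cmul[OF lin] scalar_mult_eq_scaleR)
    finally show "?D h = (\<Sum>i\<in>UNIV. h $ i * partial_deriv i f x)"
      by (simp add: partial_deriv_def)
  qed
  with D show ?thesis by simp
qed

text \<open>\<open>frechet_derivative\<close> is a choice from the set of all derivatives, and this
  set depends only on the function near \<open>x\<close>. Hence the equality covers points without a
  derivative as well.\<close>

lemma partial_deriv_cong:
  assumes "open S" "x \<in> S" "\<And>y. y \<in> S \<Longrightarrow> f y = g y"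
  shows "partial_deriv i f x = partial_deriv i g x"
proof -
  have "(f has_derivative D) (at x) \<longleftrightarrow> (g has_derivative D) (at x)" for D
    using has_derivative_transform_within_open[of f D x UNIV S g]
      has_derivative_transform_within_open[of g D x UNIV S f] assms by auto
  then show ?thesis
    unfolding partial_deriv_def frechet_derivative_def by simp
qed

lemma partial_deriv_const [simp]: "partial_deriv i (\<lambda>x. k) x = 0"
  by (simp add: partial_deriv_def)

lemma partial_deriv_component [simp]: "partial_deriv i (\<lambda>x. x $ j) x = (if i = j then 1 else 0)"
proof -
  have "((\<lambda>x. x $ j) has_derivative (\<lambda>h. h $ j)) (at x)"
    by (rule bounded_linear_imp_has_derivative[OF bounded_linear_vec_nth])
  then show ?thesis by (simp add: partial_deriv_eqI axis_def)
qed

lemma partial_deriv_add: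
  assumes "f differentiable (at x)" "g differentiable (at x)"
  shows "partial_deriv i (\<lambda>x. f x + g x) x = partial_deriv i f x + partial_deriv i g x"
proof -
  have "((\<lambda>x. f x + g x) has_derivative (\<lambda>h. frechet_derivative f (at x) h + frechet_derivative g (at x) h)) (at x)"
    using assms frechet_derivative_works by (intro has_derivative_add) auto
  from partial_deriv_eqI[OF this] show ?thesis by (simp add: partial_deriv_def)
qed

lemma partial_deriv_mult:
  fixes f :: "real ^ 'n::finite \<Rightarrow> real"
  assumes "f differentiable (at x)" "g differentiable (at x)"
  shows "partial_deriv i (\<lambda>x. f x * g x) x = f x * partial_deriv i g x + partial_deriv i f x * g x"
proof -
  have "((\<lambda>x. f x * g x) has_derivative (\<lambda>h. f x * frechet_derivative g (at x) h + frechet_derivative f (at x) h * g x)) (at x)"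
    using assms frechet_derivative_works by (intro has_derivative_mult) auto
  from partial_deriv_eqI[OF this] show ?thesis by (simp add: partial_deriv_def)
qed

lemma partial_deriv_compose:
  fixes f :: "real ^ 'n::finite \<Rightarrow> real" and g :: "real ^ 'm::finite \<Rightarrow> real ^ 'n"
  assumes "\<And>a. (\<lambda>x. g x $ a) differentiable (at x)" "f differentiable (at (g x))"
  shows "(\<lambda>x. f (g x)) differentiable (at x)"
    "partial_deriv i (\<lambda>x. f (g x)) x =
      (\<Sum>a\<in>UNIV. partial_deriv i (\<lambda>x. g x $ a) x * partial_deriv a f (g x))"
proof -
  have "(g has_derivative (\<lambda>h. \<chi> a. frechet_derivative (\<lambda>x. g x $ a) (at x) h)) (at x)"
    using assms(1) frechet_derivative_works
    by (subst has_derivative_componentwise_within)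
       (auto simp: Basis_vec_def inner_axis)
  from has_derivative_compose[OF this has_derivative_partial_deriv[OF assms(2)]]
  have D: "((\<lambda>x. f (g x)) has_derivative (\<lambda>h. \<Sum>a\<in>UNIV. frechet_derivative (\<lambda>x. g x $ a) (at x) h * partial_deriv a f (g x))) (at x)"
    by simp
  show "(\<lambda>x. f (g x)) differentiable (at x)"
    using D differentiable_def by blast
  show "partial_deriv i (\<lambda>x. f (g x)) x =
      (\<Sum>a\<in>UNIV. partial_deriv i (\<lambda>x. g x $ a) x * partial_deriv a f (g x))"
    by (subst partial_deriv_eqI[OF D]) (simp add: partial_deriv_def)
qed

text \<open>Unlike \<open>iterated_partial_deriv\<close>, this recursion differentiates the innermost function first.\<close>

primrec diffn :: "nat \<Rightarrow> (real ^ 'n) set \<Rightarrow> (real ^ 'n::finite \<Rightarrow> real) \<Rightarrow> bool" where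
  "diffn 0 S f \<longleftrightarrow> (\<forall>x\<in>S. f differentiable (at x))"
| "diffn (Suc n) S f \<longleftrightarrow> (\<forall>x\<in>S. f differentiable (at x)) \<and> (\<forall>i. diffn n S (partial_deriv i f))"

lemma iterated_partial_deriv_snoc:
  "iterated_partial_deriv (is @ [i]) f = iterated_partial_deriv is (partial_deriv i f)"
  by (induction "is") auto

text \<open>The last index of a list belongs to the innermost derivative, the one that
  \<open>diffn\<close> strips first; hence lists are taken apart from the right.\<close>

lemma diffn_iff:
  fixes f :: "real ^ 'n::finite \<Rightarrow> real"
  shows "diffn n S f \<longleftrightarrow> (\<forall>is. length is \<le> n \<longrightarrow> (\<forall>x\<in>S. iterated_partial_deriv is f differentiable (at x)))"
proof (induction n arbitrary: f)
  case (Suc n)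
  show ?case (is "_ \<longleftrightarrow> ?R")
  proof
    assume L: "diffn (Suc n) S f"
    show ?R
    proof (intro allI impI ballI)
      fix "is" :: "'n list" and x assume "length is \<le> Suc n" "x \<in> S"
      then show "iterated_partial_deriv is f differentiable (at x)"
        using L Suc by (cases "is" rule: rev_cases) (auto simp: iterated_partial_deriv_snoc)
    qed
  next
    assume R: ?R
    have "\<forall>x\<in>S. f differentiable (at x)"
      using R[rule_format, of "[]"] by simp
    moreover have "diffn n S (partial_deriv i f)" for i
      unfolding Suc using R[rule_format, of "_ @ [i]"] by (simp add: iterated_partial_deriv_snoc)
    ultimately show "diffn (Suc n) S f" by simp
  qed
qed auto

lemma smooth_on_open_iff: "smooth_on_open S f \<longleftrightarrow> (\<forall>n. diffn n S f)"
  unfolding smooth_on_open_def diffn_iff by blast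

lemma diffn_differentiable: "diffn n S f \<Longrightarrow> x \<in> S \<Longrightarrow> f differentiable (at x)"
  by (cases n) auto

lemma diffn_Suc_D: "diffn (Suc n) S f \<Longrightarrow> diffn n S f"
  by (induction n arbitrary: f) auto

lemma differentiable_cong_open:
  assumes "open S" "x \<in> S" "\<And>y. y \<in> S \<Longrightarrow> f y = g y" "f differentiable (at x)"
  shows "g differentiable (at x)"
proof -
  obtain D where "(f has_derivative D) (at x)"
    using assms(4) unfolding differentiable_def by blast
  from has_derivative_transform_within_open[OF this assms(1,2,3)]
  show ?thesis unfolding differentiable_def by blast
qed

lemma diffn_cong:
  assumes "open S"
  shows "(\<And>x. x \<in> S \<Longrightarrow> f x = g x) \<Longrightarrow> diffn n S f \<Longrightarrow> diffn n S g"
proof (induction n arbitrary: f g)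
  case 0
  then show ?case
    using differentiable_cong_open[OF assms, of _ f g] by auto
next
  case (Suc n)
  have "\<forall>x\<in>S. g differentiable (at x)"
    using Suc.prems differentiable_cong_open[OF assms, of _ f g] by auto
  moreover have "diffn n S (partial_deriv i g)" for i
  proof (rule Suc.IH)
    show "diffn n S (partial_deriv i f)" using Suc.prems by simp
    show "partial_deriv i f x = partial_deriv i g x" if "x \<in> S" for x
      using partial_deriv_cong[OF assms that, of f g] Suc.prems by simp
  qed
  ultimately show ?case by simp
qed

lemma diffn_const: "diffn n S (\<lambda>x. k)"
proof (induction n arbitrary: k)
  case (Suc n)
  have "partial_deriv i (\<lambda>x. k) = (\<lambda>x. 0)" for i :: 'a
    by auto
  with Suc show ?case by simp
qed auto

lemma diffn_component: "diffn n S (\<lambda>x. x $ i)"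
proof (cases n)
  case 0
  then show ?thesis
    by (simp add: bounded_linear_imp_differentiable bounded_linear_vec_nth)
next
  case (Suc m)
  have "partial_deriv j (\<lambda>x. x $ i) = (\<lambda>x. if j = i then 1 else 0)" for j
    by auto
  with Suc show ?thesis
    by (simp add: bounded_linear_imp_differentiable bounded_linear_vec_nth diffn_const)
qed

lemma diffn_add:
  assumes "open S"
  shows "diffn n S f \<Longrightarrow> diffn n S g \<Longrightarrow> diffn n S (\<lambda>x. f x + g x)"
proof (induction n arbitrary: f g)
  case (Suc n)
  have "diffn n S (partial_deriv i (\<lambda>x. f x + g x))" for i
  proof (rule diffn_cong[OF assms])
    show "diffn n S (\<lambda>x. partial_deriv i f x + partial_deriv i g x)"
      using Suc by simp
    show "partial_deriv i f x + partial_deriv i g x = partial_deriv i (\<lambda>x. f x + g x) x" if "x \<in> S" for x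
      using Suc.prems that by (simp add: partial_deriv_add)
  qed
  with Suc.prems show ?case by (auto intro: differentiable_add)
qed (auto intro: differentiable_add)

lemma diffn_mult:
  assumes "open S"
  shows "diffn n S f \<Longrightarrow> diffn n S g \<Longrightarrow> diffn n S (\<lambda>x. f x * g x)"
proof (induction n arbitrary: f g)
  case (Suc n)
  have "diffn n S (partial_deriv i (\<lambda>x. f x * g x))" for i
  proof (rule diffn_cong[OF assms])
    show "diffn n S (\<lambda>x. f x * partial_deriv i g x + partial_deriv i f x * g x)"
      using Suc.prems diffn_Suc_D[OF Suc.prems(1)] diffn_Suc_D[OF Suc.prems(2)]
      by (simp add: diffn_add[OF assms] Suc.IH)
    show "f x * partial_deriv i g x + partial_deriv i f x * g x = partial_deriv i (\<lambda>x. f x * g x) x"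
      if "x \<in> S" for x
      using Suc.prems that by (simp add: partial_deriv_mult)
  qed
  with Suc.prems show ?case by (auto intro: differentiable_mult)
qed (auto intro: differentiable_mult)

lemma diffn_sum:
  assumes "open S" "finite I" "\<And>i. i \<in> I \<Longrightarrow> diffn n S (f i)"
  shows "diffn n S (\<lambda>x. \<Sum>i\<in>I. f i x)"
  using assms(2,3)
  by (induction I rule: finite_induct) (auto intro: diffn_const diffn_add[OF assms(1)])

lemma diffn_compose:
  fixes f :: "real ^ 'n::finite \<Rightarrow> real" and g :: "real ^ 'm::finite \<Rightarrow> real ^ 'n"
  assumes "open S" "g ` S \<subseteq> T"
  shows "(\<And>a. diffn n S (\<lambda>x. g x $ a)) \<Longrightarrow> diffn n T f \<Longrightarrow> diffn n S (\<lambda>x. f (g x))"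
proof (induction n arbitrary: f)
  case 0
  have "(\<lambda>x. f (g x)) differentiable (at x)" if "x \<in> S" for x
    by (rule partial_deriv_compose(1)) (use 0 assms that in auto)
  then show ?case by simp
next
  case (Suc n)
  have T: "g x \<in> T" if "x \<in> S" for x
    using assms that by auto
  have "diffn n S (partial_deriv i (\<lambda>x. f (g x)))" for i
  proof (rule diffn_cong[OF assms(1)])
    show "diffn n S (\<lambda>x. \<Sum>a\<in>UNIV. partial_deriv i (\<lambda>x. g x $ a) x * partial_deriv a f (g x))"
    proof (rule diffn_sum[OF assms(1) finite], rule diffn_mult[OF assms(1)])
      fix a
      show "diffn n S (\<lambda>x. partial_deriv i (\<lambda>x. g x $ a) x)"
        using Suc.prems(1)[of a] by simp
      show "diffn n S (\<lambda>x. partial_deriv a f (g x))"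
        by (rule Suc.IH) (use Suc.prems(2) diffn_Suc_D[OF Suc.prems(1)] in auto)
    qed
    show "(\<Sum>a\<in>UNIV. partial_deriv i (\<lambda>x. g x $ a) x * partial_deriv a f (g x)) =
        partial_deriv i (\<lambda>x. f (g x)) x" if "x \<in> S" for x
      by (rule partial_deriv_compose(2)[symmetric]) (use Suc.prems that T in auto)
  qed
  moreover have "(\<lambda>x. f (g x)) differentiable (at x)" if "x \<in> S" for x
    by (rule partial_deriv_compose(1)) (use Suc.prems that T in auto)
  ultimately show ?case by simp
qed

text \<open>The derivative of 1/f is -(1/f)^2 times that of f, so the induction hypothesis is used
  for the same reciprocal and \<open>f\<close> stays fixed.\<close>

lemma diffn_inverse:
  assumes "open S" and nz: "\<And>x. x \<in> S \<Longrightarrow> f x \<noteq> 0"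
  shows "diffn n S f \<Longrightarrow> diffn n S (\<lambda>x. inverse (f x))"
proof (induction n)
  case (Suc n)
  have "diffn n S (partial_deriv i (\<lambda>x. inverse (f x)))" for i
  proof (rule diffn_cong[OF assms(1)])
    have "diffn n S (\<lambda>x. inverse (f x))"
      using Suc diffn_Suc_D by blast
    then show "diffn n S (\<lambda>x. (- 1) * ((inverse (f x) * inverse (f x)) * partial_deriv i f x))"
      using Suc.prems by (intro diffn_mult diffn_const assms) auto
    show "(- 1) * ((inverse (f x) * inverse (f x)) * partial_deriv i f x) = partial_deriv i (\<lambda>x. inverse (f x)) x"
      if "x \<in> S" for x
    proof -
      have "(f has_derivative frechet_derivative f (at x)) (at x)"
        using Suc.prems that frechet_derivative_works by auto
      from Deriv.has_derivative_inverse[OF nz[OF that] this]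
      show ?thesis
        by (subst partial_deriv_eqI, assumption) (simp add: partial_deriv_def)
    qed
  qed
  with Suc.prems nz show ?case by (auto intro: differentiable_inverse)
qed (use nz in \<open>auto intro: differentiable_inverse\<close>)

lemma smooth_on_openD: "smooth_on_open S f \<Longrightarrow> x \<in> S \<Longrightarrow> f differentiable (at x)"
  using smooth_on_open_iff diffn_differentiable by blast

lemma smooth_on_open_partial: "smooth_on_open S f \<Longrightarrow> smooth_on_open S (partial_deriv i f)"
  unfolding smooth_on_open_iff by (metis diffn.simps(2))

lemma smooth_on_open_subset: "smooth_on_open S f \<Longrightarrow> T \<subseteq> S \<Longrightarrow> smooth_on_open T f"
  unfolding smooth_on_open_def by blast

lemma smooth_on_open_Un: "smooth_on_open S f \<Longrightarrow> smooth_on_open T f \<Longrightarrow> smooth_on_open (S \<union> T) f"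
  unfolding smooth_on_open_def by blast

lemma smooth_on_open_cong:
  "open S \<Longrightarrow> (\<And>x. x \<in> S \<Longrightarrow> f x = g x) \<Longrightarrow> smooth_on_open S f \<longleftrightarrow> smooth_on_open S g"
  unfolding smooth_on_open_iff using diffn_cong[of S f g] diffn_cong[of S g f] by auto

lemma smooth_on_open_const: "smooth_on_open S (\<lambda>x. k)"
  by (simp add: smooth_on_open_iff diffn_const)

lemma smooth_on_open_component: "smooth_on_open S (\<lambda>x. x $ i)"
  by (simp add: smooth_on_open_iff diffn_component)

lemma smooth_on_open_add:
  "open S \<Longrightarrow> smooth_on_open S f \<Longrightarrow> smooth_on_open S g \<Longrightarrow> smooth_on_open S (\<lambda>x. f x + g x)"
  by (simp add: smooth_on_open_iff diffn_add)

lemma smooth_on_open_mult: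
  "open S \<Longrightarrow> smooth_on_open S f \<Longrightarrow> smooth_on_open S g \<Longrightarrow> smooth_on_open S (\<lambda>x. f x * g x)"
  by (simp add: smooth_on_open_iff diffn_mult)

lemma smooth_on_open_inverse:
  "open S \<Longrightarrow> (\<And>x. x \<in> S \<Longrightarrow> f x \<noteq> 0) \<Longrightarrow> smooth_on_open S f \<Longrightarrow> smooth_on_open S (\<lambda>x. inverse (f x))"
  by (simp add: smooth_on_open_iff diffn_inverse)

lemma smooth_on_open_compose:
  fixes f :: "real ^ 'n::finite \<Rightarrow> real" and g :: "real ^ 'm::finite \<Rightarrow> real ^ 'n"
  assumes "open S" "g ` S \<subseteq> T" "\<And>a. smooth_on_open S (\<lambda>x. g x $ a)" "smooth_on_open T f"
  shows "smooth_on_open S (\<lambda>x. f (g x))"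
  unfolding smooth_on_open_iff
  by (rule allI, rule diffn_compose[where T = T]) (use assms in \<open>auto simp: smooth_on_open_iff\<close>)

lemma smooth_on_open_continuous_on: "smooth_on_open S f \<Longrightarrow> continuous_on S f"
  by (meson continuous_at_imp_continuous_on differentiable_imp_continuous_within smooth_on_openD)

section \<open>Symmetry of second partial derivatives\<close>

lemma has_real_derivative_along_axis:
  fixes f :: "real ^ 'n::finite \<Rightarrow> real"
  assumes "f differentiable (at (x + s *\<^sub>R axis i 1))"
  shows "((\<lambda>s. f (x + s *\<^sub>R axis i 1)) has_real_derivative partial_deriv i f (x + s *\<^sub>R axis i 1)) (at s)"
proof -
  let ?D = "frechet_derivative f (at (x + s *\<^sub>R axis i 1))"
  have D: "(f has_derivative ?D) (at (x + s *\<^sub>R axis i 1))"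
    using assms frechet_derivative_works by blast
  have "((\<lambda>s. x + s *\<^sub>R axis i 1) has_derivative (\<lambda>h. h *\<^sub>R axis i (1::real))) (at s)"
    by (auto intro!: derivative_eq_intros)
  from has_derivative_compose[OF this D]
  have "((\<lambda>s. f (x + s *\<^sub>R axis i 1)) has_derivative (\<lambda>h. ?D (h *\<^sub>R axis i 1))) (at s)" .
  moreover have "(\<lambda>h. ?D (h *\<^sub>R axis i 1)) = (*) (partial_deriv i f (x + s *\<^sub>R axis i 1))"
    using linear_frechet_derivative[OF assms] by (auto simp: partial_deriv_def linear_cmul)
  ultimately show ?thesis by (simp add: has_field_derivative_def)
qed

text \<open>The mean value theorem is applied twice: in direction \<open>i\<close> to the difference
  of two translates of \<open>f\<close>, then in direction \<open>j\<close> to the partial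
  derivative found. The parallelogram of side \<open>h\<close> lies in the ball of radius
  \<open>2 * h\<close>.\<close>

lemma second_difference_mvt:
  fixes f :: "real ^ 'n::finite \<Rightarrow> real"
  assumes S: "cball x (2 * h) \<subseteq> S" "h > 0"
    and f: "\<And>y. y \<in> S \<Longrightarrow> f differentiable (at y)"
    and fi: "\<And>y. y \<in> S \<Longrightarrow> partial_deriv i f differentiable (at y)"
  obtains y where "y \<in> cball x (2 * h)"
    "f (x + h *\<^sub>R axis i 1 + h *\<^sub>R axis j 1) - f (x + h *\<^sub>R axis i 1) - f (x + h *\<^sub>R axis j 1) + f x
      = h * (h * partial_deriv j (partial_deriv i f) y)"
proof -
  define u where "u = (axis i 1 :: real ^ 'n)"
  define v where "v = (axis j 1 :: real ^ 'n)"
  have mem: "x + s *\<^sub>R u + t *\<^sub>R v \<in> cball x (2 * h)" if "0 \<le> s" "s \<le> h" "0 \<le> t" "t \<le> h" for s t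
  proof -
    have "norm (- (s *\<^sub>R u) - t *\<^sub>R v) \<le> norm (- (s *\<^sub>R u)) + norm (t *\<^sub>R v)"
      by (rule norm_triangle_ineq4)
    also have "\<dots> \<le> 2 * h" using that by (simp add: u_def v_def)
    finally show ?thesis by (simp add: dist_norm diff_diff_eq[symmetric])
  qed
  have "\<exists>s. 0 < s \<and> s < h \<and>
      (f (x + h *\<^sub>R v + h *\<^sub>R u) - f (x + h *\<^sub>R u)) - (f (x + h *\<^sub>R v + 0 *\<^sub>R u) - f (x + 0 *\<^sub>R u))
      = (h - 0) * (partial_deriv i f (x + h *\<^sub>R v + s *\<^sub>R u) - partial_deriv i f (x + s *\<^sub>R u))"
  proof (rule MVT2)
    fix s assume s: "0 \<le> s" "s \<le> h"
    have "x + h *\<^sub>R v + s *\<^sub>R u \<in> S" "x + s *\<^sub>R u \<in> S"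
      using mem[of s h] mem[of s 0] s S by (auto simp: algebra_simps)
    then show "((\<lambda>s. f (x + h *\<^sub>R v + s *\<^sub>R u) - f (x + s *\<^sub>R u)) has_real_derivative
        partial_deriv i f (x + h *\<^sub>R v + s *\<^sub>R u) - partial_deriv i f (x + s *\<^sub>R u)) (at s)"
      unfolding u_def by (intro DERIV_diff has_real_derivative_along_axis f)
  qed (use S in auto)
  then obtain s where s: "0 < s" "s < h"
    "f (x + h *\<^sub>R v + h *\<^sub>R u) - f (x + h *\<^sub>R u) - f (x + h *\<^sub>R v) + f x
      = h * (partial_deriv i f (x + h *\<^sub>R v + s *\<^sub>R u) - partial_deriv i f (x + s *\<^sub>R u))"
    by auto
  have "\<exists>t. 0 < t \<and> t < h \<and>
      partial_deriv i f (x + s *\<^sub>R u + h *\<^sub>R v) - partial_deriv i f (x + s *\<^sub>R u + 0 *\<^sub>R v)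
      = (h - 0) * partial_deriv j (partial_deriv i f) (x + s *\<^sub>R u + t *\<^sub>R v)"
  proof (rule MVT2)
    fix t assume t: "0 \<le> t" "t \<le> h"
    have "x + s *\<^sub>R u + t *\<^sub>R v \<in> S"
      using mem[of s t] s t S by auto
    then show "((\<lambda>t. partial_deriv i f (x + s *\<^sub>R u + t *\<^sub>R v)) has_real_derivative
        partial_deriv j (partial_deriv i f) (x + s *\<^sub>R u + t *\<^sub>R v)) (at t)"
      unfolding v_def by (intro has_real_derivative_along_axis fi)
  qed (use S in auto)
  then obtain t where t: "0 < t" "t < h"
    "partial_deriv i f (x + s *\<^sub>R u + h *\<^sub>R v) - partial_deriv i f (x + s *\<^sub>R u)
      = h * partial_deriv j (partial_deriv i f) (x + s *\<^sub>R u + t *\<^sub>R v)"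
    by auto
  have "x + s *\<^sub>R u + t *\<^sub>R v \<in> cball x (2 * h)"
    using mem s t by auto
  moreover have "f (x + h *\<^sub>R u + h *\<^sub>R v) - f (x + h *\<^sub>R u) - f (x + h *\<^sub>R v) + f x
      = h * (h * partial_deriv j (partial_deriv i f) (x + s *\<^sub>R u + t *\<^sub>R v))"
    using s(3) t(3) by (simp add: algebra_simps)
  ultimately show ?thesis using that unfolding u_def v_def by blast
qed

text \<open>The second difference is the same for (i, j) and (j, i), so the two mixed derivatives
  take a common value at points \<open>z\<close> and \<open>y\<close> close to \<open>x\<close>.
  Continuity of both at \<open>x\<close> does the rest.\<close>

lemma partial_deriv_commute:
  fixes f :: "real ^ 'n::finite \<Rightarrow> real"
  assumes "open S" "x \<in> S" and f: "smooth_on_open S f"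
  shows "partial_deriv i (partial_deriv j f) x = partial_deriv j (partial_deriv i f) x"
proof (rule ccontr)
  let ?a = "partial_deriv i (partial_deriv j f)" and ?b = "partial_deriv j (partial_deriv i f)"
  assume "?a x \<noteq> ?b x"
  define e where "e = \<bar>?a x - ?b x\<bar> / 2"
  have e: "e > 0" using \<open>?a x \<noteq> ?b x\<close> by (simp add: e_def)
  have "isCont ?a x" "isCont ?b x"
    using f assms(2) by (auto intro!: differentiable_imp_continuous_within smooth_on_openD smooth_on_open_partial)
  then obtain d1 d2 where d: "d1 > 0" "\<And>y. dist y x < d1 \<Longrightarrow> dist (?a y) (?a x) < e"
    "d2 > 0" "\<And>y. dist y x < d2 \<Longrightarrow> dist (?b y) (?b x) < e"
    using e unfolding continuous_at_eps_delta by (metis (no_types, lifting))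
  obtain r where r: "r > 0" "cball x r \<subseteq> S"
    using assms open_contains_cball by blast
  \<comment> \<open>\<open>y\<close> and \<open>z\<close> will lie within \<open>2 * h\<close> of
    \<open>x\<close>, which is half of the least of the three radii.\<close>
  define h where "h = min r (min d1 d2) / 4"
  have h: "h > 0" "2 * h < d1" "2 * h < d2" "2 * h \<le> r"
    using r d by (auto simp: h_def)
  have S: "cball x (2 * h) \<subseteq> S" using r h by auto
  obtain y where y: "y \<in> cball x (2 * h)"
    "f (x + h *\<^sub>R axis i 1 + h *\<^sub>R axis j 1) - f (x + h *\<^sub>R axis i 1) - f (x + h *\<^sub>R axis j 1) + f x = h * (h * ?b y)"
    using second_difference_mvt[OF S h(1), of f i j] f smooth_on_openD smooth_on_open_partial by metis
  obtain z where z: "z \<in> cball x (2 * h)"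
    "f (x + h *\<^sub>R axis j 1 + h *\<^sub>R axis i 1) - f (x + h *\<^sub>R axis j 1) - f (x + h *\<^sub>R axis i 1) + f x = h * (h * ?a z)"
    using second_difference_mvt[OF S h(1), of f j i] f smooth_on_openD smooth_on_open_partial by metis
  have yz: "dist z x < d1" "dist y x < d2"
    using y z h by (auto simp: dist_commute)
  have "h * (h * ?b y) = h * (h * ?a z)"
    unfolding y(2)[symmetric] z(2)[symmetric] by (simp add: algebra_simps)
  then have "?a z = ?b y" using h by simp
  moreover have "dist (?a z) (?a x) < e" "dist (?b y) (?b x) < e"
    using d yz by auto
  ultimately have "\<bar>?a x - ?b x\<bar> < 2 * e" by (simp add: dist_real_def)
  then show False by (simp add: e_def)
qed

section \<open>Calculus in charts\<close>

definition mdiff :: "('m, 'n::finite) chart \<Rightarrow> ('m \<Rightarrow> real) \<Rightarrow> 'm \<Rightarrow> bool" where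
  "mdiff c f p \<longleftrightarrow> (f \<circ> param c) differentiable (at (coords c p))"

lemma pd_const [simp]: "pd c i (\<lambda>p. k) p = 0"
  by (simp add: pd_def o_def)

lemma mdiff_const [simp, intro]: "mdiff c (\<lambda>p. k) p"
  by (simp add: mdiff_def o_def)

lemma pd_add: "mdiff c f p \<Longrightarrow> mdiff c g p \<Longrightarrow> pd c i (\<lambda>p. f p + g p) p = pd c i f p + pd c i g p"
  using partial_deriv_add[of "f \<circ> param c" "coords c p" "g \<circ> param c" i]
  by (simp add: pd_def mdiff_def o_def)

lemma mdiff_add [intro]: "mdiff c f p \<Longrightarrow> mdiff c g p \<Longrightarrow> mdiff c (\<lambda>p. f p + g p) p"
  using differentiable_add[of "f \<circ> param c" "at (coords c p)" "g \<circ> param c"]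
  by (simp add: mdiff_def o_def)

text \<open>Stated at every point \<open>p\<close>, also outside of the chart domain, where
  \<open>param c (coords c p)\<close> may differ from \<open>p\<close>; \<open>pd_mult'\<close> is
  the form on the domain.\<close>

lemma pd_mult:
  "mdiff c f p \<Longrightarrow> mdiff c g p \<Longrightarrow> pd c i (\<lambda>p. f p * g p) p = f (param c (coords c p)) * pd c i g p + pd c i f p * g (param c (coords c p))"
  using partial_deriv_mult[of "f \<circ> param c" "coords c p" "g \<circ> param c" i]
  by (simp add: pd_def mdiff_def o_def)

lemma mdiff_mult [intro]: "mdiff c f p \<Longrightarrow> mdiff c g p \<Longrightarrow> mdiff c (\<lambda>p. f p * g p) p"
  using differentiable_mult[of "f \<circ> param c" "coords c p" UNIV "g \<circ> param c"]
  by (simp add: mdiff_def o_def)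

lemma mdiff_sum [intro]:
  "(\<And>a. a \<in> I \<Longrightarrow> mdiff c (f a) p) \<Longrightarrow> mdiff c (\<lambda>p. \<Sum>a\<in>I. f a p) p"
  by (induction I rule: infinite_finite_induct) auto

lemma pd_sum:
  "(\<And>a. a \<in> I \<Longrightarrow> mdiff c (f a) p) \<Longrightarrow> pd c i (\<lambda>p. \<Sum>a\<in>I. f a p) p = (\<Sum>a\<in>I. pd c i (f a) p)"
  by (induction I rule: infinite_finite_induct) (auto simp: pd_add mdiff_sum)

abbreviation sm :: "('m, 'n::finite) chart \<Rightarrow> ('m \<Rightarrow> real) \<Rightarrow> bool" where
  "sm c f \<equiv> smooth_in_chart c (chart_dom c) f"

lemma smooth_in_chart_subset: "smooth_in_chart c V f \<Longrightarrow> W \<subseteq> V \<Longrightarrow> smooth_in_chart c W f"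
  unfolding smooth_in_chart_def by (meson image_mono smooth_on_open_subset)

lemma smooth_in_chart_mdiff: "smooth_in_chart c V f \<Longrightarrow> p \<in> V \<Longrightarrow> mdiff c f p"
  unfolding smooth_in_chart_def mdiff_def by (simp add: smooth_on_openD)

section \<open>Calculus inside one chart\<close>

locale chart =
  fixes X :: "'m topology" and c :: "('m, 'n::finite) chart"
  assumes chart: "is_chart X c"
begin

abbreviation dom where "dom \<equiv> chart_dom c"

lemma openin_dom: "openin X dom"
  using chart by (simp add: is_chart_def)

lemma open_coords_dom: "open (coords c ` dom)"
  using chart by (simp add: is_chart_def)

lemma homeo: "homeomorphic_map (subtopology X dom) (top_of_set (coords c ` dom)) (coords c)"
  using chart by (simp add: is_chart_def)

lemma dom_subset: "dom \<subseteq> topspace X"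
  using openin_dom openin_subset by blast

lemma inj_coords: "inj_on (coords c) dom"
  using homeomorphic_imp_injective_map[OF homeo] dom_subset by (simp add: inf.absorb2)

lemma param_coords [simp]: "p \<in> dom \<Longrightarrow> param c (coords c p) = p"
  using inj_coords by simp

lemma coords_param [simp]: "x \<in> coords c ` dom \<Longrightarrow> coords c (param c x) = x"
  by (rule f_inv_into_f)

lemma param_dom: "x \<in> coords c ` dom \<Longrightarrow> param c x \<in> dom"
  by (rule inv_into_into)

lemma open_coords:
  assumes "openin X V" "V \<subseteq> dom"
  shows "open (coords c ` V)"
proof -
  have "openin (subtopology X dom) V"
    using assms openin_open_subtopology[OF openin_dom] by blast
  then have "openin (top_of_set (coords c ` dom)) (coords c ` V)"
    using homeomorphic_imp_open_map[OF homeo] by (simp add: open_map_def)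
  then show ?thesis
    using open_coords_dom openin_open_trans by blast
qed

lemma openin_preimage:
  assumes "open W"
  shows "openin X {p \<in> dom. coords c p \<in> W}"
proof -
  have "openin (top_of_set (coords c ` dom)) (coords c ` dom \<inter> W)"
    using assms by auto
  from openin_continuous_map_preimage[OF homeomorphic_imp_continuous_map[OF homeo] this]
  have "openin (subtopology X dom) {p \<in> dom. coords c p \<in> W}"
    by (rule back_subst[where P = "openin (subtopology X dom)"]) (use dom_subset in auto)
  then show ?thesis
    using openin_dom openin_trans_full by blast
qed

lemma continuous_map_of_continuous_on:
  assumes "continuous_on (coords c ` dom) (f \<circ> param c)"
  shows "continuous_map (subtopology X dom) euclideanreal f"
proof -
  have "continuous_map (subtopology X dom) euclideanreal ((f \<circ> param c) \<circ> coords c)"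
    using assms homeomorphic_imp_continuous_map[OF homeo]
    by (intro continuous_map_compose[where X' = "top_of_set (coords c ` dom)"]) auto
  then show ?thesis
    by (rule continuous_map_eq) (auto simp: dom_subset inf.absorb2)
qed

lemma pd_cong:
  assumes "openin X V" "p \<in> V" "V \<subseteq> dom" "\<And>q. q \<in> V \<Longrightarrow> f q = g q"
  shows "pd c i f p = pd c i g p"
  unfolding pd_def
proof (rule partial_deriv_cong[OF open_coords[OF assms(1,3)]])
  fix x assume "x \<in> coords c ` V"
  then obtain q where "q \<in> V" "x = coords c q" by blast
  then show "(f \<circ> param c) x = (g \<circ> param c) x"
    using assms(3,4) by (auto simp: subset_iff)
qed (use assms in auto)

lemma pd_cong_dom: "p \<in> dom \<Longrightarrow> (\<And>q. q \<in> dom \<Longrightarrow> f q = g q) \<Longrightarrow> pd c i f p = pd c i g p"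
  by (rule pd_cong[OF openin_dom _ order_refl])

lemma smooth_cong:
  assumes "openin X V" "V \<subseteq> dom" "\<And>q. q \<in> V \<Longrightarrow> f q = g q"
  shows "smooth_in_chart c V f \<longleftrightarrow> smooth_in_chart c V g"
  unfolding smooth_in_chart_def
proof (rule smooth_on_open_cong[OF open_coords[OF assms(1,2)]])
  fix x assume "x \<in> coords c ` V"
  then obtain q where "q \<in> V" "x = coords c q" by blast
  then show "(f \<circ> param c) x = (g \<circ> param c) x"
    using assms(2,3) by (auto simp: subset_iff)
qed

lemma sm_cong: "(\<And>q. q \<in> dom \<Longrightarrow> f q = g q) \<Longrightarrow> sm c f \<longleftrightarrow> sm c g"
  by (rule smooth_cong[OF openin_dom order_refl])

lemma mdiff_cong:
  assumes "openin X V" "p \<in> V" "V \<subseteq> dom" "\<And>q. q \<in> V \<Longrightarrow> f q = g q" "mdiff c f p"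
  shows "mdiff c g p"
  unfolding mdiff_def
proof (rule differentiable_cong_open[OF open_coords[OF assms(1,3)]])
  show "(f \<circ> param c) differentiable at (coords c p)"
    using assms(5) by (simp add: mdiff_def)
  fix x assume "x \<in> coords c ` V"
  then obtain q where "q \<in> V" "x = coords c q" by blast
  then show "(f \<circ> param c) x = (g \<circ> param c) x"
    using assms(3,4) by (auto simp: subset_iff)
qed (use assms in auto)

lemma pd_mult':
  "p \<in> dom \<Longrightarrow> mdiff c f p \<Longrightarrow> mdiff c g p \<Longrightarrow>
    pd c i (\<lambda>p. f p * g p) p = f p * pd c i g p + pd c i f p * g p"
  by (simp add: pd_mult)

lemma smooth_pd:
  assumes "openin X V" "V \<subseteq> dom" "smooth_in_chart c V f"
  shows "smooth_in_chart c V (pd c i f)"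
proof -
  have *: "partial_deriv i (f \<circ> param c) x = (pd c i f \<circ> param c) x" if x: "x \<in> coords c ` V" for x
  proof -
    have "x \<in> coords c ` dom" using x assms(2) by blast
    then show ?thesis by (simp add: pd_def)
  qed
  have "smooth_on_open (coords c ` V) (partial_deriv i (f \<circ> param c))"
    using assms(3) by (simp add: smooth_in_chart_def smooth_on_open_partial)
  then have "smooth_on_open (coords c ` V) (pd c i f \<circ> param c)"
    by (rule smooth_on_open_cong[OF open_coords[OF assms(1,2)] *, THEN iffD1, rotated])
  then show ?thesis
    unfolding smooth_in_chart_def .
qed

lemma pd_commute:
  assumes "openin X V" "V \<subseteq> dom" "smooth_in_chart c V f" "p \<in> V"
  shows "pd c i (pd c j f) p = pd c j (pd c i f) p"
proof -
  let ?U = "coords c ` V"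
  have U: "open ?U" by (rule open_coords[OF assms(1,2)])
  have *: "(pd c k f \<circ> param c) x = partial_deriv k (f \<circ> param c) x" if x: "x \<in> ?U" for x k
  proof -
    have "x \<in> coords c ` dom" using x assms(2) by blast
    then show ?thesis by (simp add: pd_def)
  qed
  have "pd c l (pd c k f) p = partial_deriv l (partial_deriv k (f \<circ> param c)) (coords c p)" for l k
    unfolding pd_def[of c l] using assms(4) by (intro partial_deriv_cong[OF U _ *]) auto
  then show ?thesis
    using partial_deriv_commute[OF U, of "coords c p" "f \<circ> param c" i j] assms
    by (simp add: smooth_in_chart_def)
qed

lemma sm_pd [intro]: "sm c f \<Longrightarrow> sm c (pd c i f)"
  by (rule smooth_pd[OF openin_dom order_refl])

lemma sm_mdiff: "sm c f \<Longrightarrow> p \<in> dom \<Longrightarrow> mdiff c f p"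
  by (rule smooth_in_chart_mdiff)

lemma sm_const [intro]: "sm c (\<lambda>p. k)"
  by (simp add: smooth_in_chart_def o_def smooth_on_open_const)

lemma sm_add [intro]: "sm c f \<Longrightarrow> sm c g \<Longrightarrow> sm c (\<lambda>p. f p + g p)"
  using smooth_on_open_add[OF open_coords_dom] by (simp add: smooth_in_chart_def o_def)

lemma sm_mult [intro]: "sm c f \<Longrightarrow> sm c g \<Longrightarrow> sm c (\<lambda>p. f p * g p)"
  using smooth_on_open_mult[OF open_coords_dom] by (simp add: smooth_in_chart_def o_def)

lemma sm_uminus [intro]: "sm c f \<Longrightarrow> sm c (\<lambda>p. - f p)"
  using sm_mult[OF sm_const[of "- 1"]] by simp

lemma sm_diff [intro]: "sm c f \<Longrightarrow> sm c g \<Longrightarrow> sm c (\<lambda>p. f p - g p)"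
  using sm_add[OF _ sm_uminus] by fastforce

lemma sm_sum [intro]: "(\<And>a. a \<in> I \<Longrightarrow> sm c (f a)) \<Longrightarrow> sm c (\<lambda>p. \<Sum>a\<in>I. f a p)"
  by (induction I rule: infinite_finite_induct) auto

lemma sm_prod [intro]: "(\<And>a. a \<in> I \<Longrightarrow> sm c (f a)) \<Longrightarrow> sm c (\<lambda>p. \<Prod>a\<in>I. f a p)"
  by (induction I rule: infinite_finite_induct) auto

lemma sm_inverse: "(\<And>p. p \<in> dom \<Longrightarrow> f p \<noteq> 0) \<Longrightarrow> sm c f \<Longrightarrow> sm c (\<lambda>p. inverse (f p))"
  using smooth_on_open_inverse[OF open_coords_dom, of "f \<circ> param c"] param_dom
  by (simp add: smooth_in_chart_def o_def)

lemma pd_uminus: "mdiff c f p \<Longrightarrow> p \<in> dom \<Longrightarrow> pd c i (\<lambda>p. - f p) p = - pd c i f p"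
  using pd_mult'[of p "\<lambda>p. - 1" f] by simp

lemma mdiff_uminus: "mdiff c f p \<Longrightarrow> mdiff c (\<lambda>p. - f p) p"
  using mdiff_mult[of c "\<lambda>p. - 1" p f] by simp

lemma pd_diff:
  "mdiff c f p \<Longrightarrow> mdiff c g p \<Longrightarrow> p \<in> dom \<Longrightarrow> pd c i (\<lambda>p. f p - g p) p = pd c i f p - pd c i g p"
  using pd_add[of c f p "\<lambda>p. - g p"] by (simp add: mdiff_uminus pd_uminus)

lemma sm_pd_commute: "sm c f \<Longrightarrow> p \<in> dom \<Longrightarrow> pd c i (pd c j f) p = pd c j (pd c i f) p"
  by (rule pd_commute[OF openin_dom order_refl])

lemma pd_coord: "p \<in> dom \<Longrightarrow> pd c i (\<lambda>q. coords c q $ k) p = (if i = k then 1 else 0)"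
proof -
  assume p: "p \<in> dom"
  have "partial_deriv i ((\<lambda>q. coords c q $ k) \<circ> param c) (coords c p) = partial_deriv i (\<lambda>x. x $ k) (coords c p)"
    using p by (intro partial_deriv_cong[OF open_coords_dom]) auto
  then show ?thesis by (simp add: pd_def)
qed

lemma sm_continuous_map: "sm c f \<Longrightarrow> continuous_map (subtopology X dom) euclideanreal f"
  unfolding smooth_in_chart_def
  by (rule continuous_map_of_continuous_on, rule smooth_on_open_continuous_on)

end

section \<open>Changes of charts\<close>

locale smooth_mfd =
  fixes X :: "'m topology" and A :: "('m, 'n::finite) chart set"
  assumes mfd: "smooth_manifold X A"
begin

lemma chart_ax: "c \<in> A \<Longrightarrow> chart X c"
  using mfd by (simp add: smooth_manifold_def chart_def)

lemma Hausdorff: "Hausdorff_space X" and second_countable: "second_countable X"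
  and cover: "(\<Union>c\<in>A. chart_dom c) = topspace X"
  and transition: "c \<in> A \<Longrightarrow> d \<in> A \<Longrightarrow>
    smooth_in_chart c (chart_dom c \<inter> chart_dom d) (\<lambda>p. coords d p $ a)"
  using mfd by (auto simp: smooth_manifold_def)

lemma openin_overlap: "c \<in> A \<Longrightarrow> d \<in> A \<Longrightarrow> openin X (chart_dom c \<inter> chart_dom d)"
  by (simp add: chart.openin_dom chart_ax openin_Int)

lemma jac_smooth:
  "c \<in> A \<Longrightarrow> d \<in> A \<Longrightarrow> smooth_in_chart c (chart_dom c \<inter> chart_dom d) (jac c d i a)"
  unfolding jac_def[abs_def] by (rule chart.smooth_pd[OF chart_ax openin_overlap _ transition]) auto

lemma jac_mdiff:
  "c \<in> A \<Longrightarrow> d \<in> A \<Longrightarrow> p \<in> chart_dom c \<inter> chart_dom d \<Longrightarrow> mdiff c (jac c d i a) p"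
  by (rule smooth_in_chart_mdiff[OF jac_smooth])

text \<open>Reading \<open>f\<close> in \<open>c\<close> is reading it in \<open>d\<close> after the
  transition map, which is written by components because \<open>partial_deriv_compose\<close> and
  \<open>smooth_on_open_compose\<close> speak of components.\<close>

lemma coords_eq:
  assumes "c \<in> A" "d \<in> A" "x \<in> coords c ` (chart_dom c \<inter> chart_dom d)"
  shows "(\<lambda>x. f (param d (\<chi> a. coords d (param c x) $ a))) x = (f \<circ> param c) x"
  using assms chart.param_coords[OF chart_ax] by auto

lemma pd_chain:
  assumes "c \<in> A" "d \<in> A" "p \<in> chart_dom c \<inter> chart_dom d" "mdiff d f p"
  shows "mdiff c f p" "pd c i f p = (\<Sum>a\<in>UNIV. jac c d i a p * pd d a f p)"
proof -
  let ?V = "chart_dom c \<inter> chart_dom d" and ?g = "\<lambda>x. \<chi> a. coords d (param c x) $ a"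
  have V: "open (coords c ` ?V)" "coords c p \<in> coords c ` ?V"
    using chart.open_coords[OF chart_ax openin_overlap] assms by auto
  have p: "param c (coords c p) = p"
    using assms chart.param_coords[OF chart_ax] by blast
  have g: "(\<lambda>x. ?g x $ a) differentiable at (coords c p)" for a
    using smooth_in_chart_mdiff[OF transition[OF assms(1,2)] assms(3)] by (simp add: mdiff_def o_def)
  have f: "(f \<circ> param d) differentiable at (?g (coords c p))"
    using assms(4) by (simp add: mdiff_def p)
  note compose = partial_deriv_compose[where f = "f \<circ> param d" and g = ?g and x = "coords c p", OF g f]
  have eq: "((f \<circ> param d) (?g x)) = (f \<circ> param c) x" if "x \<in> coords c ` ?V" for x
    using coords_eq[OF assms(1,2) that] by simp
  show "mdiff c f p"
    unfolding mdiff_def using differentiable_cong_open[OF V eq compose(1)] by (simp add: o_def)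
  have "pd c i f p = partial_deriv i (\<lambda>x. (f \<circ> param d) (?g x)) (coords c p)"
    unfolding pd_def by (rule partial_deriv_cong[OF V eq, symmetric])
  also have "\<dots> = (\<Sum>a\<in>UNIV. jac c d i a p * pd d a f p)"
    unfolding compose(2) by (simp add: jac_def pd_def p o_def)
  finally show "pd c i f p = (\<Sum>a\<in>UNIV. jac c d i a p * pd d a f p)" .
qed

lemma smooth_change:
  assumes "c \<in> A" "d \<in> A" "openin X V" "V \<subseteq> chart_dom c \<inter> chart_dom d" "smooth_in_chart d V f"
  shows "smooth_in_chart c V f"
proof -
  let ?g = "\<lambda>x. \<chi> a. coords d (param c x) $ a"
  have V: "open (coords c ` V)"
    using chart.open_coords[OF chart_ax[OF assms(1)] assms(3)] assms by auto
  have "smooth_on_open (coords c ` V) (\<lambda>x. (f \<circ> param d) (?g x))"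
  proof (rule smooth_on_open_compose[OF V])
    show "?g ` coords c ` V \<subseteq> coords d ` V"
      using assms(4) chart.param_coords[OF chart_ax[OF assms(1)]] by (auto simp: subset_iff)
    show "smooth_on_open (coords c ` V) (\<lambda>x. ?g x $ a)" for a
      using smooth_in_chart_subset[OF transition[OF assms(1,2)] assms(4)] by (simp add: smooth_in_chart_def o_def)
    show "smooth_on_open (coords d ` V) (f \<circ> param d)"
      using assms(5) by (simp add: smooth_in_chart_def)
  qed
  moreover have "(f \<circ> param d) (?g x) = (f \<circ> param c) x" if "x \<in> coords c ` V" for x
    using coords_eq[OF assms(1,2), of x f] that assms(4) by auto
  ultimately have "smooth_on_open (coords c ` V) (f \<circ> param c)"
    by (subst (asm) smooth_on_open_cong[OF V]) auto
  then show ?thesis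
    unfolding smooth_in_chart_def .
qed

text \<open>The chain rule through \<open>d\<close>, applied to a coordinate function of
  \<open>c\<close>, whose derivatives in \<open>c\<close> are Kronecker deltas.\<close>

lemma jac_inverse:
  assumes "c \<in> A" "d \<in> A" "p \<in> chart_dom c \<inter> chart_dom d"
  shows "(\<Sum>a\<in>UNIV. jac c d i a p * jac d c a k p) = (if i = k then 1 else 0)"
proof -
  have "mdiff d (\<lambda>q. coords c q $ k) p"
    using smooth_in_chart_mdiff[OF transition[OF assms(2,1)], of p] assms(3) by blast
  from pd_chain(2)[OF assms this, of i] chart.pd_coord[OF chart_ax[OF assms(1)], of p i k] assms(3)
  show ?thesis by (simp add: jac_def)
qed

end

section \<open>Covariant tensors indexed by lists\<close>

text \<open>
  A covariant tensor of rank \<open>r\<close> is a function on index lists of length \<open>r\<close>. The operators below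
  recurse over the slots, which treats all ranks at once: \<open>slot M\<close> is the action of the matrix \<open>M\<close>
  as a derivation, \<open>transf J\<close> is the change of coordinates, and \<open>pairing w n\<close> contracts corresponding
  slots with \<open>w\<close>.
\<close>

primrec slot :: "('n::finite \<Rightarrow> 'n \<Rightarrow> real) \<Rightarrow> 'n list \<Rightarrow> ('n list \<Rightarrow> real) \<Rightarrow> real" where
  "slot M [] T = 0"
| "slot M (j # I) T = (\<Sum>q\<in>UNIV. M j q * T (q # I)) + slot M I (\<lambda>I. T (j # I))"

primrec transf :: "('n::finite \<Rightarrow> 'n \<Rightarrow> real) \<Rightarrow> 'n list \<Rightarrow> ('n list \<Rightarrow> real) \<Rightarrow> real" where
  "transf J [] T = T []"
| "transf J (j # I) T = (\<Sum>a\<in>UNIV. J j a * transf J I (\<lambda>A. T (a # A)))"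

primrec pairing :: "('n::finite \<Rightarrow> 'n \<Rightarrow> real) \<Rightarrow> nat \<Rightarrow> ('n list \<Rightarrow> 'n list \<Rightarrow> real) \<Rightarrow> real" where
  "pairing w 0 Q = Q [] []"
| "pairing w (Suc n) Q =
     (\<Sum>i\<in>UNIV. \<Sum>a\<in>UNIV. w i a * pairing w n (\<lambda>A I. Q (a # A) (i # I)))"

text \<open>The covariant derivative of a covariant tensor of any rank, with the index
  \<open>i\<close> kept outside of the list. Under iteration an inner derivative index is thus a
  mere label and receives no Christoffel term of its own: \<open>nab G c i (nab G c j T)\<close> is
  the operator for \<open>i\<close> after the operator for \<open>j\<close>. For the genuine second
  covariant derivative the index has to become the head of the list, as in
  \<open>tensorial_nab\<close>.\<close>

definition nab :: "('m, 'n::finite) field3 \<Rightarrow> ('m, 'n) chart \<Rightarrow> 'n \<Rightarrow> ('n list \<Rightarrow> 'm \<Rightarrow> real) \<Rightarrow> 'n list \<Rightarrow> 'm \<Rightarrow> real" where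
  "nab G c i T I p = pd c i (T I) p - slot (\<lambda>j q. G c i j q p) I (\<lambda>I. T I p)"

lemma slot_cong: "(\<And>A. length A = length I \<Longrightarrow> S A = T A) \<Longrightarrow> slot M I S = slot M I T"
proof (induction I arbitrary: S T)
  case (Cons j I)
  have "slot M I (\<lambda>I. S (j # I)) = slot M I (\<lambda>I. T (j # I))"
    by (rule Cons.IH) (simp add: Cons.prems)
  with Cons.prems show ?case by simp
qed simp

lemma slot_add: "slot M I (\<lambda>A. S A + T A) = slot M I S + slot M I T"
  by (induction I arbitrary: S T) (simp_all add: algebra_simps sum.distrib)

lemma slot_zero [simp]: "slot M I (\<lambda>A. 0) = 0"
  by (induction I) simp_all

lemma slot_cmult: "slot M I (\<lambda>A. k * T A) = k * slot M I T"
  by (induction I arbitrary: T) (simp_all add: algebra_simps sum_distrib_left)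

lemma slot_diff: "slot M I (\<lambda>A. S A - T A) = slot M I S - slot M I T"
  using slot_add[of M I S "\<lambda>A. - 1 * T A"] by (simp add: slot_cmult[of M I "- 1" T, simplified])

lemma slot_sum: "slot M I (\<lambda>A. \<Sum>x\<in>B. T x A) = (\<Sum>x\<in>B. slot M I (T x))"
  by (induction B rule: infinite_finite_induct) (simp_all add: slot_add)

lemma slot_lin: "slot M I (\<lambda>A. \<Sum>x\<in>B. k x * T x A) = (\<Sum>x\<in>B. k x * slot M I (T x))"
  by (simp add: slot_sum slot_cmult)

lemma transf_cong: "(\<And>A. length A = length I \<Longrightarrow> S A = T A) \<Longrightarrow> transf J I S = transf J I T"
proof (induction I arbitrary: S T)
  case (Cons j I)
  have "transf J I (\<lambda>A. S (a # A)) = transf J I (\<lambda>A. T (a # A))" for a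
    by (rule Cons.IH) (simp add: Cons.prems)
  then show ?case by simp
qed simp

lemma transf_add: "transf J I (\<lambda>A. S A + T A) = transf J I S + transf J I T"
  by (induction I arbitrary: S T) (simp_all add: algebra_simps sum.distrib)

lemma transf_zero [simp]: "transf J I (\<lambda>A. 0) = 0"
  by (induction I) simp_all

lemma transf_cmult: "transf J I (\<lambda>A. k * T A) = k * transf J I T"
  by (induction I arbitrary: T) (simp_all add: algebra_simps sum_distrib_left)

lemma transf_diff: "transf J I (\<lambda>A. S A - T A) = transf J I S - transf J I T"
  using transf_add[of J I S "\<lambda>A. - 1 * T A"] by (simp add: transf_cmult[of J I "- 1" T, simplified])

lemma transf_sum: "transf J I (\<lambda>A. \<Sum>x\<in>B. T x A) = (\<Sum>x\<in>B. transf J I (T x))"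
  by (induction B rule: infinite_finite_induct) (simp_all add: transf_add)

lemma transf_lin: "transf J I (\<lambda>A. \<Sum>x\<in>B. k x * T x A) = (\<Sum>x\<in>B. k x * transf J I (T x))"
  by (simp add: transf_sum transf_cmult)

lemma pairing_cong:
  "(\<And>A I. length A = n \<Longrightarrow> length I = n \<Longrightarrow> Q A I = Q' A I) \<Longrightarrow> pairing w n Q = pairing w n Q'"
proof (induction n arbitrary: Q Q')
  case (Suc n)
  have "pairing w n (\<lambda>A I. Q (a # A) (i # I)) = pairing w n (\<lambda>A I. Q' (a # A) (i # I))" for a i
    by (rule Suc.IH) (simp add: Suc.prems)
  then show ?case by simp
qed simp

lemma pairing_add: "pairing w n (\<lambda>A I. Q A I + Q' A I) = pairing w n Q + pairing w n Q'"
  by (induction n arbitrary: Q Q') (simp_all add: algebra_simps sum.distrib)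

lemma pairing_zero [simp]: "pairing w n (\<lambda>A I. 0) = 0"
  by (induction n) simp_all

lemma pairing_cmult: "pairing w n (\<lambda>A I. k * Q A I) = k * pairing w n Q"
  by (induction n arbitrary: Q) (simp_all add: algebra_simps sum_distrib_left)

lemma pairing_diff: "pairing w n (\<lambda>A I. Q A I - Q' A I) = pairing w n Q - pairing w n Q'"
  using pairing_add[of w n Q "\<lambda>A I. - 1 * Q' A I"] by (simp add: pairing_cmult[of w n "- 1" Q', simplified])

lemma pairing_sum: "pairing w n (\<lambda>A I. \<Sum>x\<in>B. Q x A I) = (\<Sum>x\<in>B. pairing w n (Q x))"
  by (induction B rule: infinite_finite_induct) (simp_all add: pairing_add)

lemma pairing_lin: "pairing w n (\<lambda>A I. \<Sum>x\<in>B. k x * Q x A I) = (\<Sum>x\<in>B. k x * pairing w n (Q x))"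
  by (simp add: pairing_sum pairing_cmult)

text \<open>One slot at a time: \<open>transf\<close> and \<open>pairing\<close> are linear, so the
  two Jacobians of the first slots can be pulled out and absorbed into \<open>w\<close>.\<close>

lemma pairing_trans:
  assumes w: "\<And>a b. (\<Sum>i\<in>UNIV. \<Sum>k\<in>UNIV. w i k * (J i a * J k b)) = w' a b"
  shows "pairing w n (\<lambda>A I. transf J A (\<lambda>A'. transf J I (\<lambda>I'. Q A' I'))) = pairing w' n Q"
proof (induction n arbitrary: Q)
  case (Suc n)
  let ?P = "\<lambda>a b. pairing w' n (\<lambda>A I. Q (b # A) (a # I))"
  have "pairing w (Suc n) (\<lambda>A I. transf J A (\<lambda>A'. transf J I (\<lambda>I'. Q A' I'))) =
    (\<Sum>i\<in>UNIV. \<Sum>k\<in>UNIV. w i k * (\<Sum>a\<in>UNIV. J i a * (\<Sum>b\<in>UNIV. J k b *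
      pairing w n (\<lambda>A I. transf J A (\<lambda>A'. transf J I (\<lambda>I'. Q (b # A') (a # I')))))))"
    by (simp add: transf_lin pairing_lin)
  also have "\<dots> = (\<Sum>i\<in>UNIV. \<Sum>k\<in>UNIV. \<Sum>a\<in>UNIV. \<Sum>b\<in>UNIV. w i k * (J i a * J k b) * ?P a b)"
    by (simp add: Suc sum_distrib_left mult_ac)
  also have "\<dots> = (\<Sum>i\<in>UNIV. \<Sum>a\<in>UNIV. \<Sum>k\<in>UNIV. \<Sum>b\<in>UNIV. w i k * (J i a * J k b) * ?P a b)"
    by (rule sum.cong[OF refl sum.swap])
  also have "\<dots> = (\<Sum>a\<in>UNIV. \<Sum>i\<in>UNIV. \<Sum>k\<in>UNIV. \<Sum>b\<in>UNIV. w i k * (J i a * J k b) * ?P a b)"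
    by (rule sum.swap)
  also have "\<dots> = (\<Sum>a\<in>UNIV. \<Sum>i\<in>UNIV. \<Sum>b\<in>UNIV. \<Sum>k\<in>UNIV. w i k * (J i a * J k b) * ?P a b)"
    by (intro sum.cong refl sum.swap)
  also have "\<dots> = (\<Sum>a\<in>UNIV. \<Sum>b\<in>UNIV. \<Sum>i\<in>UNIV. \<Sum>k\<in>UNIV. w i k * (J i a * J k b) * ?P a b)"
    by (intro sum.cong refl sum.swap)
  also have "\<dots> = pairing w' (Suc n) Q"
    by (simp add: w[symmetric] sum_distrib_right)
  finally show ?case .
qed simp

lemma sum_quad_rename:
  fixes F :: "'n::finite \<Rightarrow> real"
  shows "(\<Sum>a\<in>UNIV. (\<Sum>b\<in>UNIV. \<Sum>e\<in>UNIV. J b * K e * g b e a) * F a)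
    = (\<Sum>b\<in>UNIV. J b * (\<Sum>a\<in>UNIV. K a * (\<Sum>q\<in>UNIV. g b a q * F q)))"
proof -
  have "(\<Sum>a\<in>UNIV. (\<Sum>b\<in>UNIV. \<Sum>e\<in>UNIV. J b * K e * g b e a) * F a)
    = (\<Sum>a\<in>UNIV. \<Sum>b\<in>UNIV. \<Sum>e\<in>UNIV. J b * K e * g b e a * F a)"
    by (simp add: sum_distrib_right)
  also have "\<dots> = (\<Sum>b\<in>UNIV. \<Sum>a\<in>UNIV. \<Sum>e\<in>UNIV. J b * K e * g b e a * F a)"
    by (rule sum.swap)
  also have "\<dots> = (\<Sum>b\<in>UNIV. \<Sum>e\<in>UNIV. \<Sum>a\<in>UNIV. J b * K e * g b e a * F a)"
    by (intro sum.cong refl sum.swap)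
  also have "\<dots> = (\<Sum>b\<in>UNIV. J b * (\<Sum>a\<in>UNIV. K a * (\<Sum>q\<in>UNIV. g b a q * F q)))"
    by (simp add: sum_distrib_left mult_ac)
  finally show ?thesis .
qed

section \<open>Covariant derivatives of tensors are tensors\<close>

context smooth_mfd
begin

lemma mdiff_trans:
  assumes "c \<in> A" "d \<in> A" "p \<in> chart_dom c \<inter> chart_dom d"
  shows "(\<And>B. length B = length I \<Longrightarrow> mdiff d (T B) p) \<Longrightarrow>
    mdiff c (\<lambda>q. transf (\<lambda>j a. jac c d j a q) I (\<lambda>B. T B q)) p"
proof (induction I arbitrary: T)
  case Nil
  then show ?case using pd_chain(1)[OF assms] by simp
next
  case (Cons j I)
  have "mdiff c (\<lambda>q. transf (\<lambda>j a. jac c d j a q) I (\<lambda>B. T (a # B) q)) p" for a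
    by (rule Cons.IH) (use Cons.prems in simp)
  then show ?case
    by (simp add: mdiff_sum mdiff_mult jac_mdiff[OF assms])
qed

text \<open>Induction on the slots. The law for the connection replaces the derivative of the
  Jacobian of the first slot by \<open>L - N\<close>, where \<open>L\<close> contains the symbols of
  \<open>c\<close> and \<open>N\<close> those of \<open>d\<close>. The part with \<open>L\<close>
  cancels against the action of \<open>slot\<close> on the first slot in \<open>c\<close>; the part
  with \<open>N\<close> is its action in \<open>d\<close>.\<close>

lemma nab_trans_aux:
  assumes cd: "c \<in> A" "d \<in> A" "p \<in> chart_dom c \<inter> chart_dom d" and G: "affine_connection A G"
  shows "(\<And>B. length B = length I \<Longrightarrow> mdiff d (T B) p) \<Longrightarrow>
    pd c i (\<lambda>q. transf (\<lambda>j a. jac c d j a q) I (\<lambda>B. T B q)) p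
      - slot (\<lambda>j k. G c i j k p) I (\<lambda>I. transf (\<lambda>j a. jac c d j a p) I (\<lambda>B. T B p))
    = (\<Sum>b\<in>UNIV. jac c d i b p * transf (\<lambda>j a. jac c d j a p) I (\<lambda>B. nab G d b T B p))"
proof (induction I arbitrary: T)
  case Nil
  then show ?case using pd_chain(2)[OF cd] by (simp add: nab_def)
next
  case (Cons j I)
  let ?J = "\<lambda>j a. jac c d j a p"
  let ?Tr = "\<lambda>I T q. transf (\<lambda>j a. jac c d j a q) I (\<lambda>B. T B q)"
  have T: "mdiff d (T (a # B)) p" if "length B = length I" for a B
    using Cons.prems that by simp
  have p: "p \<in> chart_dom c" using cd by simp
  have law: "(\<Sum>k\<in>UNIV. G c i j k p * jac c d k a p) = pd c i (jac c d j a) p +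
          (\<Sum>b\<in>UNIV. \<Sum>e\<in>UNIV. jac c d i b p * jac c d j e p * G d b e a p)" for a
    using G cd unfolding affine_connection_def by blast
  define L where "L a = (\<Sum>k\<in>UNIV. G c i j k p * jac c d k a p)" for a
  define N where "N a = (\<Sum>b\<in>UNIV. \<Sum>e\<in>UNIV. jac c d i b p * jac c d j e p * G d b e a p)" for a
  have LN: "pd c i (jac c d j a) p = L a - N a" for a
    using law[of a] by (simp add: L_def N_def)
  have 1: "pd c i (\<lambda>q. ?Tr (j # I) T q) p
    = (\<Sum>a\<in>UNIV. ?J j a * pd c i (\<lambda>q. ?Tr I (\<lambda>B. T (a # B)) q) p + pd c i (jac c d j a) p * ?Tr I (\<lambda>B. T (a # B)) p)"
    using p T
    by (simp add: pd_sum mdiff_mult jac_mdiff[OF cd] mdiff_trans[OF cd] chart.pd_mult'[OF chart_ax[OF cd(1)]])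
  have 2: "slot (\<lambda>j k. G c i j k p) (j # I) (\<lambda>I. ?Tr I T p)
    = (\<Sum>a\<in>UNIV. L a * ?Tr I (\<lambda>B. T (a # B)) p)
      + (\<Sum>a\<in>UNIV. ?J j a * slot (\<lambda>j k. G c i j k p) I (\<lambda>I. ?Tr I (\<lambda>B. T (a # B)) p))"
    unfolding L_def
    by (simp add: slot_lin) (simp add: sum_distrib_left sum_distrib_right mult_ac, rule sum.swap)
  have 3: "pd c i (\<lambda>q. ?Tr I (\<lambda>B. T (a # B)) q) p - slot (\<lambda>j k. G c i j k p) I (\<lambda>I. ?Tr I (\<lambda>B. T (a # B)) p)
    = (\<Sum>b\<in>UNIV. ?J i b * transf ?J I (\<lambda>B. nab G d b (\<lambda>B. T (a # B)) B p))" for a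
    by (rule Cons.IH) (simp add: T)
  have "pd c i (\<lambda>q. ?Tr (j # I) T q) p - slot (\<lambda>j k. G c i j k p) (j # I) (\<lambda>I. ?Tr I T p)
    = (\<Sum>a\<in>UNIV. ?J j a * (pd c i (\<lambda>q. ?Tr I (\<lambda>B. T (a # B)) q) p - slot (\<lambda>j k. G c i j k p) I (\<lambda>I. ?Tr I (\<lambda>B. T (a # B)) p)))
      - (\<Sum>a\<in>UNIV. N a * ?Tr I (\<lambda>B. T (a # B)) p)"
    unfolding 1 2 LN by (simp add: left_diff_distrib right_diff_distrib sum.distrib sum_subtractf)
  also have "\<dots> = (\<Sum>a\<in>UNIV. ?J j a * (\<Sum>b\<in>UNIV. ?J i b * transf ?J I (\<lambda>B. nab G d b (\<lambda>B. T (a # B)) B p)))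
      - (\<Sum>b\<in>UNIV. ?J i b * (\<Sum>a\<in>UNIV. ?J j a * (\<Sum>q\<in>UNIV. G d b a q p * ?Tr I (\<lambda>B. T (q # B)) p)))"
    unfolding N_def sum_quad_rename 3 ..
  also have "\<dots> = (\<Sum>b\<in>UNIV. ?J i b * (\<Sum>a\<in>UNIV. ?J j a * (transf ?J I (\<lambda>B. nab G d b (\<lambda>B. T (a # B)) B p)
        - (\<Sum>q\<in>UNIV. G d b a q p * ?Tr I (\<lambda>B. T (q # B)) p))))"
    by (simp add: right_diff_distrib sum_subtractf sum_distrib_left mult_ac) (rule sum.swap)
  also have "\<dots> = (\<Sum>b\<in>UNIV. ?J i b * transf ?J (j # I) (\<lambda>B. nab G d b T B p))"
    by (simp add: transf_lin[symmetric] transf_diff[symmetric]) (simp add: nab_def algebra_simps)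
  finally show ?case .
qed

definition tensorial :: "nat \<Rightarrow> (('m, 'n) chart \<Rightarrow> 'n list \<Rightarrow> 'm \<Rightarrow> real) \<Rightarrow> bool" where
  "tensorial r T \<longleftrightarrow>
     (\<forall>c\<in>A. \<forall>I. length I = r \<longrightarrow> sm c (T c I)) \<and>
     (\<forall>c\<in>A. \<forall>d\<in>A. \<forall>p\<in>chart_dom c \<inter> chart_dom d. \<forall>I. length I = r \<longrightarrow>
        T c I p = transf (\<lambda>j a. jac c d j a p) I (\<lambda>B. T d B p))"

lemma tensorialD:
  assumes "tensorial r T" "c \<in> A" "length I = r"
  shows "sm c (T c I)"
    "d \<in> A \<Longrightarrow> p \<in> chart_dom c \<inter> chart_dom d \<Longrightarrow> T c I p = transf (\<lambda>j a. jac c d j a p) I (\<lambda>B. T d B p)"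
  using assms unfolding tensorial_def by blast+

lemma sm_nab:
  assumes "c \<in> A" "\<And>i j k. sm c (G c i j k)"
  shows "(\<And>B. length B = length I \<Longrightarrow> sm c (T B)) \<Longrightarrow> sm c (nab G c i T I)"
proof -
  interpret chart X c by (rule chart_ax[OF assms(1)])
  have "(\<And>B. length B = length I \<Longrightarrow> sm c (T B)) \<Longrightarrow> sm c (\<lambda>p. slot (\<lambda>j q. G c i j q p) I (\<lambda>I. T I p))" for T
    by (induction I arbitrary: T) (auto intro!: sm_const sm_add sm_sum sm_mult assms)
  then show "(\<And>B. length B = length I \<Longrightarrow> sm c (T B)) \<Longrightarrow> sm c (nab G c i T I)"
    unfolding nab_def[abs_def] by (intro sm_diff sm_pd) auto
qed

lemma tensorial_nab:
  assumes G: "affine_connection A G" and T: "tensorial r T"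
  shows "tensorial (Suc r) (\<lambda>c I. nab G c (hd I) (T c) (tl I))"
  unfolding tensorial_def
proof (intro conjI ballI allI impI)
  fix c I assume c: "c \<in> A" "length (I :: 'n list) = Suc r"
  show "sm c (nab G c (hd I) (T c) (tl I))"
    using c G T by (intro sm_nab) (auto simp: affine_connection_def tensorialD)
next
  fix c d p I assume cd: "c \<in> A" "d \<in> A" "p \<in> chart_dom c \<inter> chart_dom d" and "length (I :: 'n list) = Suc r"
  then obtain i I' where I: "I = i # I'" "length I' = r" by (cases I) auto
  interpret chart X c by (rule chart_ax[OF cd(1)])
  have eq: "T c B q = transf (\<lambda>j a. jac c d j a q) B (\<lambda>B. T d B q)"
    if "length B = r" "q \<in> chart_dom c \<inter> chart_dom d" for B q
    using tensorialD(2)[OF T] cd that by blast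
  have "pd c i (T c I') p = pd c i (\<lambda>q. transf (\<lambda>j a. jac c d j a q) I' (\<lambda>B. T d B q)) p"
    using cd I eq by (intro pd_cong[OF openin_overlap[OF cd(1,2)]]) auto
  moreover have "slot (\<lambda>j k. G c i j k p) I' (\<lambda>I. T c I p)
      = slot (\<lambda>j k. G c i j k p) I' (\<lambda>I. transf (\<lambda>j a. jac c d j a p) I (\<lambda>B. T d B p))"
    using eq[OF _ cd(3)] I by (intro slot_cong) auto
  moreover have "mdiff d (T d B) p" if "length B = length I'" for B
    using smooth_in_chart_mdiff[OF tensorialD(1)[OF T cd(2)]] that I cd(3) by auto
  ultimately have "nab G c i (T c) I' p =
      (\<Sum>b\<in>UNIV. jac c d i b p * transf (\<lambda>j a. jac c d j a p) I' (\<lambda>B. nab G d b (T d) B p))"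
    using nab_trans_aux[OF cd G, of I' "T d" i] by (simp add: nab_def)
  then show "nab G c (hd I) (T c) (tl I) p =
      transf (\<lambda>j a. jac c d j a p) I (\<lambda>I. nab G d (hd I) (T d) (tl I) p)"
    by (simp add: I)
qed

end

section \<open>Symplectic connections in a chart\<close>

lemma antisym_sym_sum:
  fixes w s :: "'n::finite \<Rightarrow> 'n \<Rightarrow> real"
  assumes "\<And>i a. w i a = - w a i" "\<And>i a. s i a = s a i"
  shows "(\<Sum>i\<in>UNIV. \<Sum>a\<in>UNIV. w i a * s i a) = 0"
proof -
  have "(\<Sum>i\<in>UNIV. \<Sum>a\<in>UNIV. w i a * s i a) = (\<Sum>i\<in>UNIV. \<Sum>a\<in>UNIV. w a i * s a i)"
    by (rule sum.swap)
  also have "\<dots> = (\<Sum>i\<in>UNIV. \<Sum>a\<in>UNIV. - (w i a * s i a))"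
    by (intro sum.cong refl) (metis assms mult_minus_left)
  finally show ?thesis by (simp add: sum_negf)
qed

lemma matrix_inv_inverse:
  fixes M :: "real ^ 'n ^ 'n"
  assumes "invertible M"
  shows "M ** matrix_inv M = mat 1" "matrix_inv M ** M = mat 1"
  using someI_ex[OF assms[unfolded invertible_def]] unfolding matrix_inv_def by auto

text \<open>Matrix product for functions of two indices, the form in which Christoffel symbols,
  \<open>om\<close> and \<open>w\<close> meet inside sums.\<close>

definition mm :: "('n::finite \<Rightarrow> 'n \<Rightarrow> real) \<Rightarrow> ('n \<Rightarrow> 'n \<Rightarrow> real) \<Rightarrow> 'n \<Rightarrow> 'n \<Rightarrow> real" where
  "mm M N i j = (\<Sum>q\<in>UNIV. M i q * N q j)"

lemma mm_assoc: "mm (mm L M) N i j = mm L (mm M N) i j"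
proof -
  have "mm (mm L M) N i j = (\<Sum>q\<in>UNIV. \<Sum>r\<in>UNIV. L i r * M r q * N q j)"
    by (simp add: mm_def sum_distrib_right)
  also have "\<dots> = (\<Sum>r\<in>UNIV. \<Sum>q\<in>UNIV. L i r * M r q * N q j)"
    by (rule sum.swap)
  finally show ?thesis by (simp add: mm_def sum_distrib_left mult_ac)
qed

text \<open>For the products of \<open>om\<close> and \<open>w\<close>, which are minus the identity
  by the convention for raising indices.\<close>

lemma mm_neg_delta:
  assumes "\<And>i j. M i j = (if i = j then - 1 else 0)"
  shows "mm M N i j = - N i j" "mm N M i j = - N i j"
  by (simp_all add: mm_def assms if_distrib if_distribR sum.delta' sum.delta cong: if_cong)

lemma mm_delta_sum: "(\<Sum>q\<in>UNIV. f q * (if q = s then 1 else (0::real))) = f (s :: 'n::finite)"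
  by (simp add: if_distrib cong: if_cong)

text \<open>Terms in which \<open>M\<close> and \<open>N\<close> act on different slots cancel; in
  each single slot the matrix commutator is left.\<close>

lemma slot_commutator:
  "slot M I (\<lambda>I. slot N I T) - slot N I (\<lambda>I. slot M I T)
    = slot (\<lambda>s k. mm M N s k - mm N M s k) I T"
proof (induction I arbitrary: T)
  case (Cons j I)
  have *: "(\<Sum>q\<in>UNIV. M j q * (\<Sum>r\<in>UNIV. N q r * T (r # I))) = (\<Sum>r\<in>UNIV. mm M N j r * T (r # I))" for M N
  proof -
    have "(\<Sum>q\<in>UNIV. M j q * (\<Sum>r\<in>UNIV. N q r * T (r # I))) = (\<Sum>q\<in>UNIV. \<Sum>r\<in>UNIV. M j q * N q r * T (r # I))"
      by (simp add: sum_distrib_left mult_ac)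
    also have "\<dots> = (\<Sum>r\<in>UNIV. \<Sum>q\<in>UNIV. M j q * N q r * T (r # I))"
      by (rule sum.swap)
    finally show ?thesis by (simp add: mm_def sum_distrib_right)
  qed
  show ?case
    using Cons.IH[of "\<lambda>I. T (j # I)"]
    by (simp add: slot_add slot_lin distrib_left sum.distrib * left_diff_distrib sum_subtractf)
qed simp

text \<open>What the computations in one chart use of a symplectic connection. The varied
  connections satisfy it again (\<open>sympl_chart_Gt\<close>), so every formula proved here applies
  along the whole variation.\<close>

locale sympl_chart = chart X c for X :: "'m topology" and c :: "('m, 'n::finite) chart" +
  fixes Om :: "('m, 'n) field2" and G :: "('m, 'n) field3"
  assumes sm_Om: "sm c (Om c i j)" and sm_G: "sm c (G c i j k)"
    and Om_antisym: "p \<in> chart_dom c \<Longrightarrow> Om c i j p = - Om c j i p"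
    and Om_inv: "p \<in> chart_dom c \<Longrightarrow> invertible (\<chi> i j. Om c i j p)"
    and G_sym: "p \<in> chart_dom c \<Longrightarrow> G c i j k p = G c j i k p"
    and parallel: "p \<in> chart_dom c \<Longrightarrow> nabla_cov2 G Om c i j k p = 0"
begin

abbreviation w where "w i j p \<equiv> Om_up Om c i j p"
abbreviation om where "om i j p \<equiv> Om c i j p"

lemmas sm_rules [simp] = sm_const sm_add sm_mult sm_uminus sm_diff sm_sum sm_pd sm_prod
declare sm_Om [simp] sm_G [simp]

lemma pd_sm_mult: "sm c f \<Longrightarrow> sm c g \<Longrightarrow> p \<in> dom \<Longrightarrow>
    pd c i (\<lambda>p. f p * g p) p = f p * pd c i g p + pd c i f p * g p"
  by (simp add: pd_mult' sm_mdiff)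

lemma pd_sm_add: "sm c f \<Longrightarrow> sm c g \<Longrightarrow> p \<in> dom \<Longrightarrow>
    pd c i (\<lambda>p. f p + g p) p = pd c i f p + pd c i g p"
  by (simp add: pd_add sm_mdiff)

lemma pd_sm_diff: "sm c f \<Longrightarrow> sm c g \<Longrightarrow> p \<in> dom \<Longrightarrow>
    pd c i (\<lambda>p. f p - g p) p = pd c i f p - pd c i g p"
  by (simp add: pd_diff sm_mdiff)

lemma pd_sm_uminus: "sm c f \<Longrightarrow> p \<in> dom \<Longrightarrow> pd c i (\<lambda>p. - f p) p = - pd c i f p"
  by (simp add: pd_uminus sm_mdiff)

lemma pd_sm_sum: "(\<And>a. sm c (f a)) \<Longrightarrow> p \<in> dom \<Longrightarrow>
    pd c i (\<lambda>p. \<Sum>a\<in>I. f a p) p = (\<Sum>a\<in>I. pd c i (f a) p)"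
  by (simp add: pd_sum sm_mdiff)

lemmas pd_rules = pd_sm_mult pd_sm_add pd_sm_diff pd_sm_uminus pd_sm_sum

lemma w_om: "p \<in> dom \<Longrightarrow> (\<Sum>q\<in>UNIV. w i q p * om q j p) = (if i = j then - 1 else 0)"
  using Om_inv[of p] matrix_inv_inverse(2)[of "\<chi> i j. Om c i j p"]
  by (simp add: Om_up_def vec_eq_iff matrix_matrix_mult_def mat_def sum_negf)

lemma om_w: "p \<in> dom \<Longrightarrow> (\<Sum>q\<in>UNIV. om i q p * w q j p) = (if i = j then - 1 else 0)"
  using Om_inv[of p] matrix_inv_inverse(1)[of "\<chi> i j. Om c i j p"]
  by (simp add: Om_up_def vec_eq_iff matrix_matrix_mult_def mat_def sum_negf)

lemma mm_w_om: "p \<in> dom \<Longrightarrow> mm (\<lambda>i j. w i j p) (\<lambda>i j. om i j p) i j = (if i = j then - 1 else 0)"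
  by (simp add: mm_def w_om)

lemma mm_om_w: "p \<in> dom \<Longrightarrow> mm (\<lambda>i j. om i j p) (\<lambda>i j. w i j p) i j = (if i = j then - 1 else 0)"
  by (simp add: mm_def om_w)

text \<open>Minus the transpose of \<open>w\<close> inverts \<open>om\<close> in the same way as
  \<open>w\<close>, and inverses are unique.\<close>

lemma w_antisym: "p \<in> dom \<Longrightarrow> w i j p = - w j i p"
proof -
  assume p: "p \<in> dom"
  let ?w = "\<lambda>i j. w i j p" and ?o = "\<lambda>i j. om i j p" and ?v = "\<lambda>i j. - w j i p"
  have "mm ?v ?o a b = (if a = b then - 1 else 0)" for a b
    using om_w[OF p, of b a] Om_antisym[OF p, of _ b] by (simp add: mm_def sum_negf mult_ac)
  then have "- w i j p = mm (mm ?v ?o) ?w i j"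
    by (simp add: mm_neg_delta)
  also have "\<dots> = w j i p"
    by (simp add: mm_assoc mm_neg_delta(2)[of "mm ?o ?w", OF mm_om_w[OF p]])
  finally show ?thesis by simp
qed

text \<open>By Cramer's rule an entry of the inverse is a quotient of two determinants, which are
  polynomials in the smooth entries of \<open>om\<close>.\<close>

lemma sm_w [simp]: "sm c (Om_up Om c i j)"
proof -
  let ?M = "\<lambda>p. \<chi> a b. (Om c a b p :: real)"
  let ?N = "\<lambda>p. \<chi> a b. if b = i then if a = j then 1 else 0 else (Om c a b p :: real)"
  have det: "det (?M p) \<noteq> 0" if "p \<in> dom" for p
    using Om_inv[OF that] invertible_det_nz by blast
  have "Om_up Om c i j p = - (det (?N p) * inverse (det (?M p)))" if p: "p \<in> dom" for p
  proof -
    have "?M p *v (\<chi> k. matrix_inv (?M p) $ k $ j) = axis j 1"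
      using matrix_inv_inverse(1)[OF Om_inv[OF p]]
      by (simp add: vec_eq_iff matrix_matrix_mult_def matrix_vector_mult_def mat_def axis_def)
    from cramer[OF det[OF p], THEN iffD1, OF this]
    have "matrix_inv (?M p) $ i $ j = det (\<chi> a b. if b = i then axis j 1 $ a else ?M p $ a $ b) / det (?M p)"
      by (simp add: vec_eq_iff)
    then show ?thesis
      by (simp add: Om_up_def axis_def divide_inverse cong: if_cong)
  qed
  moreover have "sm c (\<lambda>p. if b = i then k else Om c a b p)" for a b k
    by (cases "b = i") simp_all
  then have "sm c (\<lambda>p. - (det (?N p) * inverse (det (?M p))))"
    unfolding det_def by (intro sm_uminus sm_mult sm_inverse sm_sum sm_prod) (simp_all add: det[unfolded det_def, simplified])
  ultimately show ?thesis
    by (subst sm_cong[where g = "\<lambda>p. - (det (?N p) * inverse (det (?M p)))"]) auto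
qed

lemma pd_om: "p \<in> dom \<Longrightarrow> pd c k (Om c i j) p = (\<Sum>q\<in>UNIV. G c k i q p * om q j p) + (\<Sum>q\<in>UNIV. G c k j q p * om i q p)"
  using parallel[of p k i j] by (simp add: nabla_cov2_def)

text \<open>The inverse of a parallel form is parallel: the product of \<open>w\<close> and
  \<open>om\<close> is constant, so its derivative vanishes and can be solved for the derivative of
  \<open>w\<close>.\<close>

lemma pd_w:
  assumes p: "p \<in> dom"
  shows "pd c k (Om_up Om c i j) p = - (\<Sum>q\<in>UNIV. G c k q i p * w q j p) - (\<Sum>q\<in>UNIV. G c k q j p * w i q p)"
proof -
  let ?w = "\<lambda>i j. w i j p" and ?o = "\<lambda>i j. om i j p" and ?g = "\<lambda>q r. G c k q r p" and ?h = "\<lambda>q r. G c k r q p"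
  let ?d = "\<lambda>i j. pd c k (Om_up Om c i j) p"
  have 1: "mm ?d ?o a b + (\<Sum>q\<in>UNIV. w a q p * pd c k (Om c q b) p) = 0" for a b
  proof -
    have "pd c k (\<lambda>p. \<Sum>q\<in>UNIV. w a q p * om q b p) p = pd c k (\<lambda>p. if a = b then - 1 else 0) p"
      by (rule pd_cong_dom[OF p]) (simp add: w_om)
    then show ?thesis
      by (simp add: pd_rules p mm_def sum.distrib add.commute)
  qed
  have 2: "(\<Sum>q\<in>UNIV. w a q p * pd c k (Om c q b) p) = mm ?w (mm ?g ?o) a b + mm (mm ?w ?o) ?h a b" for a b
    by (simp add: pd_om p mm_assoc) (simp add: mm_def distrib_left sum.distrib mult_ac)
  have "mm ?d ?o a b = - mm ?w (mm ?g ?o) a b + ?h a b" for a b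
    using 1[of a b] 2[of a b] mm_neg_delta(1)[of "mm ?w ?o" ?h a b, OF mm_w_om[OF p]] by simp
  then have "mm (mm ?d ?o) ?w i j = - mm (mm ?w (mm ?g ?o)) ?w i j + mm ?h ?w i j"
    by (simp add: mm_def left_diff_distrib sum_subtractf distrib_right sum.distrib sum_negf)
  moreover have "mm (mm ?d ?o) ?w i j = - ?d i j"
    by (simp add: mm_assoc mm_neg_delta(2)[of "mm ?o ?w", OF mm_om_w[OF p]])
  moreover have "mm (mm ?w (mm ?g ?o)) ?w i j = - mm ?w ?g i j"
  proof -
    have "mm (mm ?g ?o) ?w = (\<lambda>a b. - ?g a b)"
      by (simp add: mm_assoc mm_neg_delta(2)[of "mm ?o ?w", OF mm_om_w[OF p]] fun_eq_iff)
    then show ?thesis by (simp add: mm_assoc) (simp add: mm_def sum_negf)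
  qed
  ultimately show ?thesis by (simp add: mm_def mult_ac)
qed

section \<open>Leibniz rules for the covariant derivative and for contractions\<close>

lemma sm_slot [simp]:
  "(\<And>i k. sm c (M i k)) \<Longrightarrow> (\<And>B. sm c (T B)) \<Longrightarrow> sm c (\<lambda>p. slot (\<lambda>j q. M j q p) I (\<lambda>I. T I p))"
  by (induction I arbitrary: T) simp_all

lemma sm_nab [simp]: "(\<And>B. sm c (T B)) \<Longrightarrow> sm c (nab G c i T I)"
  unfolding nab_def[abs_def] by simp

lemma sm_pairing [simp]:
  "(\<And>B C. sm c (Q B C)) \<Longrightarrow> sm c (\<lambda>p. pairing (\<lambda>i j. w i j p) n (\<lambda>B C. Q B C p))"
  by (induction n arbitrary: Q) simp_all

lemma pd_slot:
  assumes "\<And>i k. sm c (M i k)" and p: "p \<in> dom"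
  shows "(\<And>B. sm c (T B)) \<Longrightarrow> pd c i (\<lambda>p. slot (\<lambda>j q. M j q p) I (\<lambda>I. T I p)) p
    = slot (\<lambda>j q. pd c i (M j q) p) I (\<lambda>I. T I p) + slot (\<lambda>j q. M j q p) I (\<lambda>I. pd c i (T I) p)"
proof (induction I arbitrary: T)
  case (Cons j I)
  then show ?case
    by (simp add: pd_rules assms sum.distrib)
qed simp

lemma nab_cong:
  assumes "p \<in> dom" "\<And>q B. q \<in> dom \<Longrightarrow> S B q = T B q"
  shows "nab G c i S I p = nab G c i T I p"
  unfolding nab_def using pd_cong_dom[OF assms(1), of "S I" "T I"] assms by simp

lemma nab_diff:
  "(\<And>B. sm c (S B)) \<Longrightarrow> (\<And>B. sm c (T B)) \<Longrightarrow> p \<in> dom \<Longrightarrow>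
    nab G c i (\<lambda>B p. S B p - T B p) I p = nab G c i S I p - nab G c i T I p"
  by (simp add: nab_def pd_rules slot_diff)

lemma nab_mult:
  "sm c f \<Longrightarrow> (\<And>B. sm c (T B)) \<Longrightarrow> p \<in> dom \<Longrightarrow>
    nab G c i (\<lambda>B p. f p * T B p) I p = f p * nab G c i T I p + pd c i f p * T I p"
  by (simp add: nab_def pd_rules slot_cmult algebra_simps)

lemma nab_Cons:
  "nab G c k T (a # I) p = nab G c k (\<lambda>I. T (a # I)) I p - (\<Sum>q\<in>UNIV. G c k a q p * T (q # I) p)"
  by (simp add: nab_def)

text \<open>\<open>pd_w\<close> under a contraction: a derivative that hits \<open>w\<close> is the
  same as connection terms acting on the two contracted indices.\<close>

lemma w_sum_rename:
  assumes p: "p \<in> dom"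
  shows "(\<Sum>i\<in>UNIV. \<Sum>a\<in>UNIV. pd c k (Om_up Om c i a) p * Y a i)
    = - (\<Sum>i\<in>UNIV. \<Sum>a\<in>UNIV. w i a p * (\<Sum>q\<in>UNIV. G c k a q p * Y q i))
      - (\<Sum>i\<in>UNIV. \<Sum>a\<in>UNIV. w i a p * (\<Sum>q\<in>UNIV. G c k i q p * Y a q))"
proof -
  have 1: "(\<Sum>i\<in>UNIV. \<Sum>a\<in>UNIV. (\<Sum>q\<in>UNIV. G c k q i p * w q a p) * Y a i)
    = (\<Sum>i\<in>UNIV. \<Sum>a\<in>UNIV. w i a p * (\<Sum>q\<in>UNIV. G c k i q p * Y a q))"
  proof -
    have "(\<Sum>i\<in>UNIV. \<Sum>a\<in>UNIV. (\<Sum>q\<in>UNIV. G c k q i p * w q a p) * Y a i)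
      = (\<Sum>a\<in>UNIV. \<Sum>i\<in>UNIV. \<Sum>q\<in>UNIV. w q a p * (G c k q i p * Y a i))"
      by (subst sum.swap) (simp add: sum_distrib_left mult_ac)
    also have "\<dots> = (\<Sum>a\<in>UNIV. \<Sum>q\<in>UNIV. \<Sum>i\<in>UNIV. w q a p * (G c k q i p * Y a i))"
      by (intro sum.cong refl sum.swap)
    also have "\<dots> = (\<Sum>q\<in>UNIV. \<Sum>a\<in>UNIV. \<Sum>i\<in>UNIV. w q a p * (G c k q i p * Y a i))"
      by (rule sum.swap)
    finally show ?thesis by (simp add: sum_distrib_left)
  qed
  have 2: "(\<Sum>i\<in>UNIV. \<Sum>a\<in>UNIV. (\<Sum>q\<in>UNIV. G c k q a p * w i q p) * Y a i)
    = (\<Sum>i\<in>UNIV. \<Sum>a\<in>UNIV. w i a p * (\<Sum>q\<in>UNIV. G c k a q p * Y q i))"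
  proof (rule sum.cong[OF refl])
    fix i
    have "(\<Sum>a\<in>UNIV. (\<Sum>q\<in>UNIV. G c k q a p * w i q p) * Y a i)
      = (\<Sum>a\<in>UNIV. \<Sum>q\<in>UNIV. w i q p * (G c k q a p * Y a i))"
      by (simp add: sum_distrib_left mult_ac)
    also have "\<dots> = (\<Sum>q\<in>UNIV. \<Sum>a\<in>UNIV. w i q p * (G c k q a p * Y a i))"
      by (rule sum.swap)
    finally show "(\<Sum>a\<in>UNIV. (\<Sum>q\<in>UNIV. G c k q a p * w i q p) * Y a i)
      = (\<Sum>a\<in>UNIV. w i a p * (\<Sum>q\<in>UNIV. G c k a q p * Y q i))"
      by (simp add: sum_distrib_left)
  qed
  have "(\<Sum>i\<in>UNIV. \<Sum>a\<in>UNIV. pd c k (Om_up Om c i a) p * Y a i)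
    = - (\<Sum>i\<in>UNIV. \<Sum>a\<in>UNIV. (\<Sum>q\<in>UNIV. G c k q i p * w q a p) * Y a i)
      - (\<Sum>i\<in>UNIV. \<Sum>a\<in>UNIV. (\<Sum>q\<in>UNIV. G c k q a p * w i q p) * Y a i)"
    by (simp add: pd_w p left_diff_distrib sum_subtractf sum_negf)
  then show ?thesis unfolding 1 2 by simp
qed

abbreviation pr where "pr n Q p \<equiv> pairing (\<lambda>i j. w i j p) n (\<lambda>B C. Q B C p)"

text \<open>The derivatives of the factors \<open>w\<close> supply exactly the Christoffel terms
  that turn the plain derivatives of \<open>S\<close> and \<open>T\<close> into covariant
  ones.\<close>

lemma pd_pairing:
  assumes p: "p \<in> dom"
  shows "(\<And>B. sm c (S B)) \<Longrightarrow> (\<And>B. sm c (T B)) \<Longrightarrow>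
    pd c k (pr n (\<lambda>B C p. T B p * S C p)) p
    = pr n (\<lambda>B C p. nab G c k T B p * S C p) p + pr n (\<lambda>B C p. T B p * nab G c k S C p) p"
proof (induction n arbitrary: S T)
  case 0
  then show ?case by (simp add: pd_rules p nab_def)
next
  case (Suc n)
  let ?Y = "\<lambda>a i. pr n (\<lambda>B C p. T (a # B) p * S (i # C) p) p"
  have IH: "pd c k (pr n (\<lambda>B C p. T (a # B) p * S (i # C) p)) p
      = pr n (\<lambda>B C p. nab G c k (\<lambda>B. T (a # B)) B p * S (i # C) p) p
        + pr n (\<lambda>B C p. T (a # B) p * nab G c k (\<lambda>C. S (i # C)) C p) p" for a i
    by (rule Suc.IH) (simp_all add: Suc.prems)
  have "pd c k (pr (Suc n) (\<lambda>B C p. T B p * S C p)) p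
    = (\<Sum>i\<in>UNIV. \<Sum>a\<in>UNIV. w i a p * pd c k (pr n (\<lambda>B C p. T (a # B) p * S (i # C) p)) p)
      + (\<Sum>i\<in>UNIV. \<Sum>a\<in>UNIV. pd c k (Om_up Om c i a) p * ?Y a i)"
    by (simp add: pd_rules p Suc.prems sum.distrib)
  also have "\<dots> = (\<Sum>i\<in>UNIV. \<Sum>a\<in>UNIV. w i a p * (pr n (\<lambda>B C p. nab G c k (\<lambda>B. T (a # B)) B p * S (i # C) p) p
        - (\<Sum>q\<in>UNIV. G c k a q p * ?Y q i)))
      + (\<Sum>i\<in>UNIV. \<Sum>a\<in>UNIV. w i a p * (pr n (\<lambda>B C p. T (a # B) p * nab G c k (\<lambda>C. S (i # C)) C p) p
        - (\<Sum>q\<in>UNIV. G c k i q p * ?Y a q)))"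
    unfolding IH w_sum_rename[OF p] by (simp add: right_diff_distrib distrib_left sum.distrib sum_subtractf)
  also have "\<dots> = pr (Suc n) (\<lambda>B C p. nab G c k T B p * S C p) p + pr (Suc n) (\<lambda>B C p. T B p * nab G c k S C p) p"
    by (simp add: nab_Cons left_diff_distrib right_diff_distrib pairing_diff sum_distrib_right sum_distrib_left
        mult.assoc mult.left_commute[of "T _ _"] pairing_lin)
  finally show ?case .
qed

lemma w_G_zero: "p \<in> dom \<Longrightarrow> (\<Sum>i\<in>UNIV. \<Sum>a\<in>UNIV. w i a p * (\<Sum>q\<in>UNIV. G c i a q p * F q)) = 0"
  by (rule antisym_sym_sum[OF w_antisym]) (auto simp: G_sym)

text \<open>The pointwise form of integration by parts: up to the divergence on the left, the
  derivative moves from \<open>T\<close> to \<open>S\<close>. The connection term of the free index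
  \<open>a\<close> drops out because \<open>w\<close> is antisymmetric and the connection
  symmetric.\<close>

lemma divergence_pairing:
  assumes p: "p \<in> dom" and "\<And>B. sm c (S B)" "\<And>B. sm c (T B)"
  shows "(\<Sum>i\<in>UNIV. \<Sum>a\<in>UNIV. w i a p * pd c i (pr n (\<lambda>B C p. T (a # B) p * S C p)) p)
    = pr (Suc n) (\<lambda>B C p. T B p * nab G c (hd C) S (tl C) p) p
      + (\<Sum>i\<in>UNIV. \<Sum>a\<in>UNIV. w i a p * pr n (\<lambda>B C p. nab G c i T (a # B) p * S C p) p)"
proof -
  let ?Z = "\<lambda>q. pr n (\<lambda>B C p. T (q # B) p * S C p) p"
  have "pr n (\<lambda>B C p. nab G c i T (a # B) p * S C p) p
      = pr n (\<lambda>B C p. nab G c i (\<lambda>B. T (a # B)) B p * S C p) p - (\<Sum>q\<in>UNIV. G c i a q p * ?Z q)" for i a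
    by (simp add: nab_Cons left_diff_distrib pairing_diff sum_distrib_right mult.assoc pairing_lin)
  then show ?thesis
    using w_G_zero[OF p, of ?Z]
    by (simp add: pd_pairing p assms right_diff_distrib distrib_left sum.distrib sum_subtractf)
qed

text \<open>Since \<open>w\<close> is parallel, taking traces with it commutes with
  \<open>nab\<close>.\<close>

lemma nab_trace:
  assumes p: "p \<in> dom" and T: "\<And>B. sm c (T B)"
  shows "nab G c k (\<lambda>I p. \<Sum>i\<in>UNIV. \<Sum>a\<in>UNIV. w i a p * T (i # a # I) p) I p
    = (\<Sum>i\<in>UNIV. \<Sum>a\<in>UNIV. w i a p * nab G c k T (i # a # I) p)"
proof -
  have "nab G c k (\<lambda>I p. \<Sum>i\<in>UNIV. \<Sum>a\<in>UNIV. w i a p * T (i # a # I) p) I p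
    = (\<Sum>i\<in>UNIV. \<Sum>a\<in>UNIV. w i a p * nab G c k (\<lambda>I. T (i # a # I)) I p)
      + (\<Sum>i\<in>UNIV. \<Sum>a\<in>UNIV. pd c k (Om_up Om c i a) p * T (i # a # I) p)"
    by (simp add: nab_def pd_rules p T slot_sum slot_cmult right_diff_distrib sum.distrib sum_subtractf)
  then show ?thesis
    unfolding w_sum_rename[OF p] by (simp add: nab_Cons right_diff_distrib sum_subtractf)
qed

end

section \<open>The curvature and its identities\<close>

context sympl_chart
begin

lemma nabla_vec_coord_vec: "nabla_vec G (coord_vec s) c j k = G c j s k"
proof
  fix p
  have "(\<Sum>q\<in>UNIV. G c j q k p * coord_vec s c q p) = G c j s k p"
    unfolding coord_vec_def by (rule mm_delta_sum)
  then show "nabla_vec G (coord_vec s) c j k p = G c j s k p"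
    by (simp add: nabla_vec_def coord_vec_def[abs_def])
qed

lemma curvature_eq:
  assumes "p \<in> dom"
  shows "curvature G c i j s k p = pd c i (G c j s k) p - pd c j (G c i s k) p
    + (\<Sum>q\<in>UNIV. G c i q k p * G c j s q p) - (\<Sum>q\<in>UNIV. G c j q k p * G c i s q p)"
  by (simp add: curvature_def nabla_endo_def nabla_vec_coord_vec G_sym[OF assms, of i j])

text \<open>The right-hand side of \<open>curvature_eq\<close>, which holds on the domain only, as a
  function from which smoothness can be read off.\<close>

definition curv :: "'n \<Rightarrow> 'n \<Rightarrow> 'n \<Rightarrow> 'n \<Rightarrow> 'm \<Rightarrow> real" where
  "curv i j s k p = pd c i (G c j s k) p - pd c j (G c i s k) p
    + (\<Sum>q\<in>UNIV. G c i q k p * G c j s q p) - (\<Sum>q\<in>UNIV. G c j q k p * G c i s q p)"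

lemma curvature_curv: "p \<in> dom \<Longrightarrow> curvature G c i j s k p = curv i j s k p"
  by (simp add: curvature_eq curv_def)

lemma sm_curv [simp]: "sm c (curv i j s k)"
  unfolding curv_def[abs_def] by simp

lemma sm_curvature [simp]: "sm c (curvature G c i j s k)"
  using sm_cong[of "curvature G c i j s k" "curv i j s k"] curvature_curv by simp

lemma sm_curvature_low [simp]: "sm c (curvature_low Om G c i j k l)"
  unfolding curvature_low_def[abs_def] by simp

lemma sm_ricci [simp]: "sm c (ricci G c i j)"
  unfolding ricci_def[abs_def] by simp

lemma curvature_antisym: "curvature G c i j s k p = - curvature G c j i s k p"
  by (simp add: curvature_def)

lemma curvature_low_antisym: "curvature_low Om G c i j k l p = - curvature_low Om G c j i k l p"
  by (simp add: curvature_low_def curvature_antisym[of i j] sum_negf)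

text \<open>The Ricci identity, with a minus sign because the slots are covariant. As
  \<open>i\<close> and \<open>j\<close> are labels for \<open>nab\<close>, the commutator is that of
  the two operators; its part without derivatives of \<open>T\<close> is the curvature acting on the
  slots, by \<open>slot_commutator\<close>.\<close>

lemma nab_commutator:
  assumes p: "p \<in> dom" and T: "\<And>B. sm c (T B)"
  shows "nab G c i (nab G c j T) I p - nab G c j (nab G c i T) I p
    = - slot (\<lambda>s k. curvature G c i j s k p) I (\<lambda>I. T I p)"
proof -
  let ?M = "\<lambda>i s k. G c i s k p"
  have 1: "nab G c i (nab G c j T) I p = pd c i (pd c j (T I)) p
      - slot (\<lambda>s k. pd c i (G c j s k) p) I (\<lambda>I. T I p) - slot (?M j) I (\<lambda>I. pd c i (T I) p)
      - slot (?M i) I (\<lambda>I. pd c j (T I) p) + slot (?M i) I (\<lambda>I. slot (?M j) I (\<lambda>I. T I p))" for i j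
    unfolding nab_def[abs_def] by (simp add: pd_rules pd_slot p T slot_diff)
  have "slot (\<lambda>s k. curvature G c i j s k p) I (\<lambda>I. T I p)
    = slot (\<lambda>s k. pd c i (G c j s k) p) I (\<lambda>I. T I p) - slot (\<lambda>s k. pd c j (G c i s k) p) I (\<lambda>I. T I p)
     - slot (\<lambda>s k. mm (?M i) (?M j) s k - mm (?M j) (?M i) s k) I (\<lambda>I. T I p)"
  proof -
    have lin: "slot (\<lambda>s k. P s k - Q s k - S s k) I T = slot P I T - slot Q I T - slot S I T" for P Q S :: "'n \<Rightarrow> 'n \<Rightarrow> real" and I T
      by (induction I arbitrary: T) (simp_all add: left_diff_distrib sum_subtractf)
    show ?thesis
      unfolding lin[symmetric] by (simp add: curvature_eq[OF p] mm_def mult_ac algebra_simps)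
  qed
  then show ?thesis
    unfolding 1 slot_commutator[symmetric] using sm_pd_commute[OF T p, of i j] by simp
qed

text \<open>The Ricci identity for the parallel form: all its second derivatives vanish, so the
  curvature acts trivially on \<Omega>. With \<Omega> antisymmetric this is the symmetry in the last
  two indices.\<close>

lemma curvature_low_sym:
  assumes p: "p \<in> dom"
  shows "curvature_low Om G c i j k l p = curvature_low Om G c i j l k p"
proof -
  let ?T = "\<lambda>L. Om c (L ! 0) (L ! Suc 0)"
  have nT: "nab G c a ?T [k, l] q = 0" if "q \<in> dom" for a q k l
    using parallel[OF that, of a k l] by (simp add: nab_def nabla_cov2_def)
  have "nab G c a (nab G c b ?T) [k, l] p = 0" for a b
  proof -
    have "pd c a (nab G c b ?T [k, l]) p = pd c a (\<lambda>p. 0) p"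
      by (rule pd_cong_dom[OF p nT])
    then show ?thesis
      unfolding nab_def[of G c a] by (simp add: nT[OF p])
  qed
  from nab_commutator[OF p, of ?T i j "[k, l]", unfolded this]
  have "(\<Sum>q\<in>UNIV. curvature G c i j k q p * om q l p) + (\<Sum>q\<in>UNIV. curvature G c i j l q p * om k q p) = 0"
    by simp
  moreover have "(\<Sum>q\<in>UNIV. curvature G c i j l q p * om k q p) = - (\<Sum>q\<in>UNIV. curvature G c i j l q p * om q k p)"
    unfolding sum_negf[symmetric] by (intro sum.cong refl) (simp add: Om_antisym[OF p, of k])
  ultimately show ?thesis
    by (simp add: curvature_low_def)
qed

lemma bianchi1:
  assumes p: "p \<in> dom"
  shows "curvature G c i j s k p + curvature G c j s i k p + curvature G c s i j k p = 0"
proof -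
  have "pd c a (G c b d k) p = pd c a (G c d b k) p" for a b d
    by (rule pd_cong_dom[OF p]) (rule G_sym)
  from this[of i j s] this[of j s i] this[of s i j] show ?thesis
    by (simp add: curvature_eq[OF p] G_sym[OF p, of j s] G_sym[OF p, of i s] G_sym[OF p, of j i])
qed

lemma bianchi1_low:
  assumes p: "p \<in> dom"
  shows "curvature_low Om G c i j s k p + curvature_low Om G c j s i k p + curvature_low Om G c s i j k p = 0"
proof -
  have "curvature_low Om G c i j s k p + curvature_low Om G c j s i k p + curvature_low Om G c s i j k p
    = (\<Sum>q\<in>UNIV. (curvature G c i j s q p + curvature G c j s i q p + curvature G c s i j q p) * om q k p)"
    by (simp add: curvature_low_def distrib_right sum.distrib)
  then show ?thesis by (simp add: bianchi1[OF p])
qed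

text \<open>Lowering an index with \<open>om\<close> and contracting it with \<open>w\<close> gives
  the trace up to the sign in the product of \<open>om\<close> and \<open>w\<close>.\<close>

lemma om_trace:
  assumes p: "p \<in> dom"
  shows "(\<Sum>i\<in>UNIV. \<Sum>a\<in>UNIV. w i a p * (\<Sum>q\<in>UNIV. Y a q * om q i p)) = - (\<Sum>a\<in>UNIV. Y a a)"
proof -
  have "(\<Sum>i\<in>UNIV. \<Sum>a\<in>UNIV. w i a p * (\<Sum>q\<in>UNIV. Y a q * om q i p))
    = (\<Sum>a\<in>UNIV. \<Sum>i\<in>UNIV. \<Sum>q\<in>UNIV. Y a q * (om q i p * w i a p))"
    by (subst sum.swap) (simp add: sum_distrib_left mult_ac)
  also have "\<dots> = (\<Sum>a\<in>UNIV. \<Sum>q\<in>UNIV. Y a q * (\<Sum>i\<in>UNIV. om q i p * w i a p))"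
    by (simp add: sum_distrib_left) (intro sum.cong refl sum.swap)
  also have "\<dots> = - (\<Sum>a\<in>UNIV. \<Sum>q\<in>UNIV. Y a q * (if q = a then 1 else 0))"
    by (simp add: om_w[OF p] sum_negf[symmetric] if_distrib cong: if_cong)
  finally show ?thesis by (simp add: mm_delta_sum)
qed

lemma ricci_trace:
  "p \<in> dom \<Longrightarrow> (\<Sum>i\<in>UNIV. \<Sum>a\<in>UNIV. w i a p * curvature_low Om G c a e f i p) = - ricci G c e f p"
  by (simp add: curvature_low_def ricci_def om_trace)

text \<open>The first Bianchi identity and the symmetry of the last two indices express the trace
  over the antisymmetric pair by two traces of Ricci type, which agree because \<open>w\<close> is
  antisymmetric.\<close>

lemma curvature_low_trace12:
  assumes p: "p \<in> dom"
  shows "(\<Sum>i\<in>UNIV. \<Sum>a\<in>UNIV. w i a p * curvature_low Om G c i a e f p) = 2 * ricci G c e f p"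
proof -
  let ?R = "\<lambda>i j k l. curvature_low Om G c i j k l p"
  have "?R i a e f = - ?R a e f i + ?R i e f a" for i a
    using bianchi1_low[OF p, of i a e f] curvature_low_antisym[of e i a f p]
      curvature_low_sym[OF p, of a e i f] curvature_low_sym[OF p, of i e a f] by simp
  then have "(\<Sum>i\<in>UNIV. \<Sum>a\<in>UNIV. w i a p * ?R i a e f)
    = - (\<Sum>i\<in>UNIV. \<Sum>a\<in>UNIV. w i a p * ?R a e f i) + (\<Sum>i\<in>UNIV. \<Sum>a\<in>UNIV. w i a p * ?R i e f a)"
    by (simp add: right_diff_distrib sum_subtractf)
  moreover have "(\<Sum>i\<in>UNIV. \<Sum>a\<in>UNIV. w i a p * ?R i e f a) = - (\<Sum>i\<in>UNIV. \<Sum>a\<in>UNIV. w i a p * ?R a e f i)"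
  proof -
    have "(\<Sum>i\<in>UNIV. \<Sum>a\<in>UNIV. w i a p * ?R i e f a) = (\<Sum>i\<in>UNIV. \<Sum>a\<in>UNIV. w a i p * ?R a e f i)"
      by (rule sum.swap)
    also have "\<dots> = (\<Sum>i\<in>UNIV. \<Sum>a\<in>UNIV. - (w i a p * ?R a e f i))"
      by (intro sum.cong refl) (metis w_antisym[OF p] mult_minus_left)
    finally show ?thesis by (simp add: sum_negf)
  qed
  ultimately show ?thesis by (simp add: ricci_trace[OF p])
qed

text \<open>The second Bianchi identity is the Jacobi identity for the operators \<open>nab G c i\<close>.\<close>

lemma bianchi2_aux:
  assumes p: "p \<in> dom"
  defines "D \<equiv> \<lambda>i j k s l. pd c i (curvature G c j k s l) p
    - (\<Sum>q\<in>UNIV. G c i s q p * curvature G c j k q l p) + (\<Sum>q\<in>UNIV. curvature G c j k s q p * G c i q l p)"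
  shows "D i j k s l + D j k i s l + D k i j s l = 0"
proof -
  \<comment> \<open>The coordinate covector with index \<open>l\<close>. The curvature acting on it
    in the slot \<open>s\<close> returns the component with upper index \<open>l\<close>.\<close>
  let ?T = "\<lambda>L (p :: 'm). if hd L = l then (1::real) else 0"
  let ?N = "nab G c"
  have T: "sm c (?T B)" for B by simp
  \<comment> \<open>The double commutator of the operators for \<open>i\<close>, \<open>j\<close>
    and \<open>k\<close>, applied to \<open>?T\<close>.\<close>
  define E where "E i j k = (?N i (?N j (?N k ?T)) [s] p - ?N i (?N k (?N j ?T)) [s] p)
      - (?N j (?N k (?N i ?T)) [s] p - ?N k (?N j (?N i ?T)) [s] p)" for i j k
  have E: "E i j k = - D i j k s l" for i j k
  proof -
    let ?S = "\<lambda>I p. slot (\<lambda>s q. curvature G c j k s q p) I (\<lambda>I. ?T I p)"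
    have "?N i (?N j (?N k ?T)) [s] p - ?N i (?N k (?N j ?T)) [s] p
      = ?N i (\<lambda>I p. ?N j (?N k ?T) I p - ?N k (?N j ?T) I p) [s] p"
      by (rule nab_diff[symmetric]) (simp_all add: p)
    also have "\<dots> = ?N i (\<lambda>I p. - ?S I p) [s] p"
      by (rule nab_cong[OF p]) (rule nab_commutator, simp_all)
    also have "\<dots> = - pd c i (curvature G c j k s l) p + (\<Sum>q\<in>UNIV. G c i s q p * curvature G c j k q l p)"
      by (simp add: nab_def mm_delta_sum pd_sm_uminus p sum_negf)
    finally have 1: "?N i (?N j (?N k ?T)) [s] p - ?N i (?N k (?N j ?T)) [s] p = \<dots>" .
    have "?N j (?N k (?N i ?T)) [s] p - ?N k (?N j (?N i ?T)) [s] p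
      = - slot (\<lambda>s q. curvature G c j k s q p) [s] (\<lambda>I. ?N i ?T I p)"
      by (rule nab_commutator[OF p]) simp
    also have "\<dots> = (\<Sum>q\<in>UNIV. curvature G c j k s q p * G c i q l p)"
      by (simp add: nab_def mm_delta_sum sum_negf)
    finally show ?thesis
      unfolding E_def 1 by (simp add: D_def)
  qed
  have "E i j k + E j k i + E k i j = 0"
    by (simp add: E_def)
  then show ?thesis by (simp add: E)
qed

definition RL where "RL L = curvature_low Om G c (L ! 0) (L ! 1) (L ! 2) (L ! 3)"
definition RicL where "RicL L = ricci G c (L ! 0) (L ! 1)"

lemma sm_RL [simp]: "sm c (RL L)" and sm_RicL [simp]: "sm c (RicL L)"
  by (simp_all add: RL_def RicL_def)

lemma nab_RL_antisym:
  assumes p: "p \<in> dom"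
  shows "nab G c i RL [j, k, s, l] p = - nab G c i RL [k, j, s, l] p"
proof -
  have "curvature_low Om G c j k s l = (\<lambda>p. - curvature_low Om G c k j s l p)" for j k s l
    using curvature_low_antisym by blast
  then have "pd c i (curvature_low Om G c j k s l) p = - pd c i (curvature_low Om G c k j s l) p"
    using pd_sm_uminus[OF sm_curvature_low p] by metis
  moreover have "(\<Sum>q\<in>UNIV. f q * curvature_low Om G c (a q) (b q) (d q) (e q) p)
      = - (\<Sum>q\<in>UNIV. f q * curvature_low Om G c (b q) (a q) (d q) (e q) p)" for f a b d e
    unfolding sum_negf[symmetric] by (intro sum.cong refl) (subst curvature_low_antisym, simp)
  note this[of _ "\<lambda>_. j" "\<lambda>q. q"] this[of _ "\<lambda>q. q" "\<lambda>_. k"]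
    this[of _ "\<lambda>_. j" "\<lambda>_. k" "\<lambda>_. s" "\<lambda>q. q"] this[of _ "\<lambda>_. j" "\<lambda>_. k" "\<lambda>q. q" "\<lambda>_. l"]
  ultimately show ?thesis
    by (simp add: nab_def RL_def)
qed

text \<open>Since \<Omega> is parallel, lowering the last index of \<open>bianchi2_aux\<close>
  produces the covariant derivative except for the connection terms of the first two curvature
  indices. These cancel in the cyclic sum: the connection is symmetric and the curvature
  antisymmetric.\<close>

lemma bianchi2:
  assumes p: "p \<in> dom"
  shows "nab G c i RL [j, k, s, l] p + nab G c j RL [k, i, s, l] p + nab G c k RL [i, j, s, l] p = 0"
proof -
  let ?D = "\<lambda>i j k s l. pd c i (curvature G c j k s l) p
    - (\<Sum>q\<in>UNIV. G c i s q p * curvature G c j k q l p) + (\<Sum>q\<in>UNIV. curvature G c j k s q p * G c i q l p)"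
  let ?R = "\<lambda>i j k l. curvature_low Om G c i j k l p"
  have N: "nab G c i RL [j, k, s, l] p = (\<Sum>q\<in>UNIV. ?D i j k s q * om q l p)
    - (\<Sum>q\<in>UNIV. G c i j q p * ?R q k s l) - (\<Sum>q\<in>UNIV. G c i k q p * ?R j q s l)" for i j k
  proof -
    let ?C = "\<lambda>s q. curvature G c j k s q p"
    have "pd c i (curvature_low Om G c j k s l) p
      = (\<Sum>q\<in>UNIV. pd c i (curvature G c j k s q) p * om q l p)
       + (\<Sum>q\<in>UNIV. ?C s q * (\<Sum>r\<in>UNIV. G c i q r p * om r l p)) + (\<Sum>q\<in>UNIV. ?C s q * (\<Sum>r\<in>UNIV. G c i l r p * om q r p))"
      unfolding curvature_low_def[abs_def] by (simp add: pd_rules p pd_om distrib_left sum.distrib)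
    moreover have "(\<Sum>q\<in>UNIV. ?C s q * (\<Sum>r\<in>UNIV. G c i q r p * om r l p))
      = (\<Sum>q\<in>UNIV. (\<Sum>r\<in>UNIV. ?C s r * G c i r q p) * om q l p)"
      using mm_assoc[of ?C "\<lambda>q r. G c i q r p" "\<lambda>r l. om r l p" s l] by (simp add: mm_def)
    moreover have "(\<Sum>q\<in>UNIV. ?C s q * (\<Sum>r\<in>UNIV. G c i l r p * om q r p))
      = (\<Sum>r\<in>UNIV. G c i l r p * ?R j k s r)"
    proof -
      have "(\<Sum>q\<in>UNIV. ?C s q * (\<Sum>r\<in>UNIV. G c i l r p * om q r p)) = (\<Sum>q\<in>UNIV. \<Sum>r\<in>UNIV. G c i l r p * (?C s q * om q r p))"
        by (simp add: sum_distrib_left mult_ac)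
      also have "\<dots> = (\<Sum>r\<in>UNIV. \<Sum>q\<in>UNIV. G c i l r p * (?C s q * om q r p))"
        by (rule sum.swap)
      finally show ?thesis by (simp add: curvature_low_def sum_distrib_left)
    qed
    moreover have "(\<Sum>q\<in>UNIV. G c i s q p * ?R j k q l) = (\<Sum>q\<in>UNIV. (\<Sum>r\<in>UNIV. G c i s r p * ?C r q) * om q l p)"
      using mm_assoc[of "\<lambda>s q. G c i s q p" ?C "\<lambda>r l. om r l p" s l] by (simp add: mm_def curvature_low_def)
    ultimately show ?thesis
      by (simp add: nab_def RL_def distrib_right left_diff_distrib sum.distrib sum_subtractf)
  qed
  have neg: "(\<Sum>q\<in>UNIV. G c a b q p * ?R e q s l) = - (\<Sum>q\<in>UNIV. G c b a q p * ?R q e s l)" for a b e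
    unfolding sum_negf[symmetric]
    by (intro sum.cong refl) (simp add: curvature_low_antisym[of e] G_sym[OF p, of a b])
  have "nab G c i RL [j, k, s, l] p + nab G c j RL [k, i, s, l] p + nab G c k RL [i, j, s, l] p
    = (\<Sum>q\<in>UNIV. ?D i j k s q * om q l p) + (\<Sum>q\<in>UNIV. ?D j k i s q * om q l p) + (\<Sum>q\<in>UNIV. ?D k i j s q * om q l p)"
    unfolding N neg by simp
  also have "\<dots> = (\<Sum>q\<in>UNIV. (?D i j k s q + ?D j k i s q + ?D k i j s q) * om q l p)"
    by (simp only: distrib_right sum.distrib)
  also have "\<dots> = 0"
    by (simp only: bianchi2_aux[OF p] mult_zero_left sum.neutral_const)
  finally show ?thesis .
qed

text \<open>Solving \<open>bianchi2\<close> for one term and contracting, one of the other two terms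
  reproduces the left-hand side, by antisymmetry of \<open>w\<close> and of the curvature. The last
  one is the derivative of the trace \<open>curvature_low_trace12\<close>, whose factor 2 disappears
  on dividing.\<close>

lemma bianchi2_contracted:
  assumes p: "p \<in> dom"
  shows "(\<Sum>i\<in>UNIV. \<Sum>a\<in>UNIV. w i a p * nab G c i RL [a, b, e, f] p) = - nab G c b RicL [e, f] p"
proof -
  let ?N = "\<lambda>i a b. nab G c i RL [a, b, e, f] p"
  have "?N i a b = - ?N a b i - ?N b i a" for i a
    using bianchi2[OF p, of i a b e f] by simp
  then have "(\<Sum>i\<in>UNIV. \<Sum>a\<in>UNIV. w i a p * ?N i a b)
    = - (\<Sum>i\<in>UNIV. \<Sum>a\<in>UNIV. w i a p * ?N a b i) - (\<Sum>i\<in>UNIV. \<Sum>a\<in>UNIV. w i a p * ?N b i a)"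
    by (simp add: right_diff_distrib sum_subtractf sum_negf)
  moreover have "(\<Sum>i\<in>UNIV. \<Sum>a\<in>UNIV. w i a p * ?N a b i) = (\<Sum>i\<in>UNIV. \<Sum>a\<in>UNIV. w i a p * ?N i a b)"
  proof -
    have "(\<Sum>i\<in>UNIV. \<Sum>a\<in>UNIV. w i a p * ?N a b i) = (\<Sum>i\<in>UNIV. \<Sum>a\<in>UNIV. w a i p * ?N i b a)"
      by (rule sum.swap)
    also have "\<dots> = (\<Sum>i\<in>UNIV. \<Sum>a\<in>UNIV. w i a p * ?N i a b)"
    proof (intro sum.cong refl)
      fix i a
      show "w a i p * ?N i b a = w i a p * ?N i a b"
        using w_antisym[OF p, of a i] nab_RL_antisym[OF p, of i b a e f] by simp
    qed
    finally show ?thesis .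
  qed
  moreover have "(\<Sum>i\<in>UNIV. \<Sum>a\<in>UNIV. w i a p * ?N b i a) = 2 * nab G c b RicL [e, f] p"
  proof -
    have "(\<Sum>i\<in>UNIV. \<Sum>a\<in>UNIV. w i a p * ?N b i a)
      = nab G c b (\<lambda>I p. \<Sum>i\<in>UNIV. \<Sum>a\<in>UNIV. w i a p * RL (i # a # I) p) [e, f] p"
      by (rule nab_trace[OF p, symmetric]) simp
    also have "\<dots> = nab G c b (\<lambda>I p. 2 * RicL I p) [e, f] p"
      by (rule nab_cong[OF p]) (simp add: RL_def RicL_def curvature_low_trace12)
    also have "\<dots> = 2 * nab G c b RicL [e, f] p"
      using nab_mult[of "\<lambda>_. 2" RicL p b "[e, f]"] p by simp
    finally show ?thesis .
  qed
  ultimately show ?thesis by simp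
qed

definition div_ricci where
  "div_ricci i p = (\<Sum>j\<in>UNIV. \<Sum>b\<in>UNIV. w j b p * nabla_cov2 G (ricci G) c b i j p)"

lemma sm_nabla_cov2: "(\<And>i j. sm c (T c i j)) \<Longrightarrow> sm c (nabla_cov2 G T c i j k)"
  unfolding nabla_cov2_def[abs_def] by simp

text \<open>The connection term of the contracted index vanishes by symmetry of the connection, so a
  single Christoffel factor remains beside the Ricci tensor.\<close>

lemma div_ricci_eq:
  assumes p: "p \<in> dom"
  shows "div_ricci i p = (\<Sum>j\<in>UNIV. \<Sum>b\<in>UNIV. w j b p *
    (pd c b (ricci G c i j) p - (\<Sum>q\<in>UNIV. G c b i q p * ricci G c q j p)))"
  using antisym_sym_sum[of "\<lambda>j b. w j b p" "\<lambda>j b. \<Sum>q\<in>UNIV. G c b j q p * ricci G c i q p", OF w_antisym[OF p]]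
  by (simp add: div_ricci_def nabla_cov2_def right_diff_distrib sum_subtractf G_sym[OF p])

text \<open>
  Since \<open>\<nabla>\<Omega> = 0\<close> and \<open>\<nabla>\<close> is torsion-free, the divergence of a covector does not involve the connection.
\<close>

lemma divdiv_ricci_eq:
  assumes p: "p \<in> dom"
  shows "divdiv_ricci Om G c p = (\<Sum>i\<in>UNIV. \<Sum>a\<in>UNIV. w i a p * pd c a (div_ricci i) p)"
proof -
  let ?T = "\<lambda>L. nabla_cov2 G (ricci G) c (L ! 1) (L ! 2) (L ! 0)"
  have T: "(\<lambda>I p. \<Sum>j\<in>UNIV. \<Sum>b\<in>UNIV. w j b p * ?T (j # b # I) p) = (\<lambda>I. div_ricci (I ! 0))"
    by (simp add: div_ricci_def[abs_def])
  have "divdiv_ricci Om G c p = (\<Sum>i\<in>UNIV. \<Sum>j\<in>UNIV. \<Sum>a\<in>UNIV. \<Sum>b\<in>UNIV. w i a p * (w j b p * nab G c a ?T [j, b, i] p))"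
    unfolding divdiv_ricci_def by (simp add: nab_def nabla_cov3_def algebra_simps)
  also have "\<dots> = (\<Sum>i\<in>UNIV. \<Sum>a\<in>UNIV. \<Sum>j\<in>UNIV. \<Sum>b\<in>UNIV. w i a p * (w j b p * nab G c a ?T [j, b, i] p))"
    by (intro sum.cong refl sum.swap)
  also have "\<dots> = (\<Sum>i\<in>UNIV. \<Sum>a\<in>UNIV. w i a p * (\<Sum>j\<in>UNIV. \<Sum>b\<in>UNIV. w j b p * nab G c a ?T [j, b, i] p))"
    by (simp add: sum_distrib_left)
  also have "\<dots> = (\<Sum>i\<in>UNIV. \<Sum>a\<in>UNIV. w i a p * nab G c a (\<lambda>I. div_ricci (I ! 0)) [i] p)"
    using nab_trace[OF p, of ?T, unfolded T] by (simp add: sm_nabla_cov2)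
  also have "\<dots> = (\<Sum>i\<in>UNIV. \<Sum>a\<in>UNIV. w i a p * pd c a (div_ricci i) p)
      - (\<Sum>i\<in>UNIV. \<Sum>a\<in>UNIV. w i a p * (\<Sum>q\<in>UNIV. G c a i q p * div_ricci q p))"
    by (simp add: nab_def right_diff_distrib sum_subtractf)
  also have "(\<Sum>i\<in>UNIV. \<Sum>a\<in>UNIV. w i a p * (\<Sum>q\<in>UNIV. G c a i q p * div_ricci q p)) = 0"
    by (rule antisym_sym_sum[OF w_antisym[OF p]]) (simp add: G_sym[OF p])
  finally show ?thesis by simp
qed

end

section \<open>The first variation\<close>

text \<open>A family polynomial in \<open>t\<close> with smooth coefficients, together with its
  value and derivative at 0. Polynomials are kept rather than derivatives alone because the
  coefficients are later glued over charts and integrated one by one. Coefficients beyond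
  \<open>N\<close> are set to 0 so that \<open>C 1\<close> makes sense for \<open>N = 0\<close> and
  products are plain convolutions.\<close>

definition jet :: "('m, 'n::finite) chart \<Rightarrow> nat \<Rightarrow> (real \<Rightarrow> 'm \<Rightarrow> real) \<Rightarrow> ('m \<Rightarrow> real) \<Rightarrow> ('m \<Rightarrow> real) \<Rightarrow> bool" where
  "jet c N h a b \<longleftrightarrow> (\<exists>C. (\<forall>k. sm c (C k)) \<and> (\<forall>k>N. \<forall>p\<in>chart_dom c. C k p = 0) \<and>
     (\<forall>t. \<forall>p\<in>chart_dom c. h t p = (\<Sum>k\<le>N. C k p * t ^ k)) \<and>
     (\<forall>p\<in>chart_dom c. C 0 p = a p \<and> C 1 p = b p))"

lemma jet_cong:
  assumes "jet c N h a b" "\<And>t p. p \<in> chart_dom c \<Longrightarrow> h t p = h' t p"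
    "\<And>p. p \<in> chart_dom c \<Longrightarrow> a p = a' p" "\<And>p. p \<in> chart_dom c \<Longrightarrow> b p = b' p"
  shows "jet c N h' a' b'"
  using assms unfolding jet_def by (elim exE, rule_tac x = C in exI) auto

lemma jet_mono:
  assumes "jet c N h a b" "N \<le> M"
  shows "jet c M h a b"
proof -
  obtain C where C: "\<And>k. sm c (C k)" "\<And>k p. k > N \<Longrightarrow> p \<in> chart_dom c \<Longrightarrow> C k p = 0"
    "\<And>t p. p \<in> chart_dom c \<Longrightarrow> h t p = (\<Sum>k\<le>N. C k p * t ^ k)"
    "\<And>p. p \<in> chart_dom c \<Longrightarrow> C 0 p = a p \<and> C 1 p = b p"
    using assms(1) unfolding jet_def by blast
  have "(\<Sum>k\<le>N. C k p * t ^ k) = (\<Sum>k\<le>M. C k p * t ^ k)" if "p \<in> chart_dom c" for t p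
    using assms(2) C(2)[OF _ that] by (intro sum.mono_neutral_left) auto
  then show ?thesis
    unfolding jet_def using C assms(2) by (intro exI[of _ C]) auto
qed

section \<open>Arithmetic of families polynomial in \<open>t\<close>\<close>

context chart
begin

lemma jet_const: "sm c f \<Longrightarrow> jet c 0 (\<lambda>t. f) f (\<lambda>p. 0)"
  unfolding jet_def by (intro exI[of _ "\<lambda>k. if k = 0 then f else (\<lambda>p. 0)"]) (auto simp: sm_const)

lemma jet_linear: "sm c f \<Longrightarrow> sm c g \<Longrightarrow> jet c 1 (\<lambda>t p. f p + t * g p) f g"
  unfolding jet_def
  by (intro exI[of _ "\<lambda>k. if k = 0 then f else if k = 1 then g else (\<lambda>p. 0)"]) (auto simp: sm_const)

lemma jet_add_same:
  assumes "jet c N h a b" "jet c N h' a' b'"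
  shows "jet c N (\<lambda>t p. h t p + h' t p) (\<lambda>p. a p + a' p) (\<lambda>p. b p + b' p)"
proof -
  obtain C where C: "\<And>k. sm c (C k)" "\<And>k p. k > N \<Longrightarrow> p \<in> dom \<Longrightarrow> C k p = 0"
    "\<And>t p. p \<in> dom \<Longrightarrow> h t p = (\<Sum>k\<le>N. C k p * t ^ k)"
    "\<And>p. p \<in> dom \<Longrightarrow> C 0 p = a p \<and> C 1 p = b p"
    using assms(1) unfolding jet_def by blast
  obtain C' where C': "\<And>k. sm c (C' k)" "\<And>k p. k > N \<Longrightarrow> p \<in> dom \<Longrightarrow> C' k p = 0"
    "\<And>t p. p \<in> dom \<Longrightarrow> h' t p = (\<Sum>k\<le>N. C' k p * t ^ k)"
    "\<And>p. p \<in> dom \<Longrightarrow> C' 0 p = a' p \<and> C' 1 p = b' p"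
    using assms(2) unfolding jet_def by blast
  show ?thesis
    unfolding jet_def using C C'
    by (intro exI[of _ "\<lambda>k p. C k p + C' k p"]) (auto simp: sm_add distrib_right sum.distrib)
qed

lemma jet_add:
  assumes "jet c N h a b" "jet c M h' a' b'"
  shows "jet c (max N M) (\<lambda>t p. h t p + h' t p) (\<lambda>p. a p + a' p) (\<lambda>p. b p + b' p)"
  by (rule jet_add_same) (rule jet_mono[OF assms(1)] jet_mono[OF assms(2)], simp)+

lemma jet_mult:
  assumes "jet c N h a b" "jet c M h' a' b'"
  shows "jet c (N + M) (\<lambda>t p. h t p * h' t p) (\<lambda>p. a p * a' p) (\<lambda>p. a p * b' p + b p * a' p)"
proof -
  obtain C where C: "\<And>k. sm c (C k)" "\<And>k p. k > N \<Longrightarrow> p \<in> dom \<Longrightarrow> C k p = 0"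
    "\<And>t p. p \<in> dom \<Longrightarrow> h t p = (\<Sum>k\<le>N. C k p * t ^ k)"
    "\<And>p. p \<in> dom \<Longrightarrow> C 0 p = a p \<and> C 1 p = b p"
    using assms(1) unfolding jet_def by blast
  obtain C' where C': "\<And>k. sm c (C' k)" "\<And>k p. k > M \<Longrightarrow> p \<in> dom \<Longrightarrow> C' k p = 0"
    "\<And>t p. p \<in> dom \<Longrightarrow> h' t p = (\<Sum>k\<le>M. C' k p * t ^ k)"
    "\<And>p. p \<in> dom \<Longrightarrow> C' 0 p = a' p \<and> C' 1 p = b' p"
    using assms(2) unfolding jet_def by blast
  let ?D = "\<lambda>k p. \<Sum>j\<le>k. C j p * C' (k - j) p"
  have "?D k p = 0" if "k > N + M" "p \<in> dom" for k p
  proof (rule sum.neutral, rule ballI)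
    fix j
    have "j > N \<or> k - j > M" using that by linarith
    then show "C j p * C' (k - j) p = 0" using C(2) C'(2) that by auto
  qed
  moreover have "h t p * h' t p = (\<Sum>k\<le>N + M. ?D k p * t ^ k)" if "p \<in> dom" for t p
    using polynomial_product[of N "\<lambda>k. C k p" M "\<lambda>k. C' k p" t] C(2,3) C'(2,3) that by simp
  moreover have "?D 0 p = a p * a' p \<and> ?D 1 p = a p * b' p + b p * a' p" if "p \<in> dom" for p
    using C(4)[OF that] C'(4)[OF that] by simp
  ultimately show ?thesis
    unfolding jet_def using C(1) C'(1) by (intro exI[of _ ?D]) (auto intro!: sm_sum sm_mult)
qed

lemma jet_cmult: "jet c N h a b \<Longrightarrow> jet c N (\<lambda>t p. k * h t p) (\<lambda>p. k * a p) (\<lambda>p. k * b p)"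
  using jet_mult[OF jet_const[OF sm_const[of k]]] by simp

lemma jet_sm_mult: "sm c f \<Longrightarrow> jet c N h a b \<Longrightarrow> jet c N (\<lambda>t p. f p * h t p) (\<lambda>p. f p * a p) (\<lambda>p. f p * b p)"
  using jet_mult[OF jet_const[of f]] by simp

lemma jet_diff:
  assumes "jet c N h a b" "jet c M h' a' b'"
  shows "jet c (max N M) (\<lambda>t p. h t p - h' t p) (\<lambda>p. a p - a' p) (\<lambda>p. b p - b' p)"
  using jet_add[OF assms(1) jet_cmult[OF assms(2), of "- 1"]] by simp

lemma jet_sum:
  assumes "finite I" "\<And>x. x \<in> I \<Longrightarrow> jet c N (h x) (a x) (b x)"
  shows "jet c N (\<lambda>t p. \<Sum>x\<in>I. h x t p) (\<lambda>p. \<Sum>x\<in>I. a x p) (\<lambda>p. \<Sum>x\<in>I. b x p)"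
  using assms
proof (induction I rule: finite_induct)
  case empty
  show ?case using jet_mono[OF jet_const[OF sm_const[of 0]]] by simp
next
  case (insert x F)
  then show ?case using jet_add_same[of N "h x" "a x" "b x"] by simp
qed

lemma jet_pd:
  assumes "jet c N h a b"
  shows "jet c N (\<lambda>t. pd c i (h t)) (pd c i a) (pd c i b)"
proof -
  obtain C where C: "\<And>k. sm c (C k)" "\<And>k p. k > N \<Longrightarrow> p \<in> dom \<Longrightarrow> C k p = 0"
    "\<And>t p. p \<in> dom \<Longrightarrow> h t p = (\<Sum>k\<le>N. C k p * t ^ k)"
    "\<And>p. p \<in> dom \<Longrightarrow> C 0 p = a p \<and> C 1 p = b p"
    using assms unfolding jet_def by blast
  have 1: "pd c i (h t) p = (\<Sum>k\<le>N. pd c i (C k) p * t ^ k)" if p: "p \<in> dom" for t p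
  proof -
    have "pd c i (h t) p = pd c i (\<lambda>p. \<Sum>k\<le>N. C k p * t ^ k) p"
      by (rule pd_cong_dom[OF p C(3)])
    then show ?thesis
      using C(1) p by (simp add: pd_sum mdiff_mult sm_mdiff pd_mult')
  qed
  have 2: "pd c i (C k) p = 0" if "k > N" "p \<in> dom" for k p
    using pd_cong_dom[OF that(2), of "C k" "\<lambda>p. 0"] C(2)[OF that(1)] by simp
  have 3: "pd c i (C 0) p = pd c i a p \<and> pd c i (C 1) p = pd c i b p" if "p \<in> dom" for p
    using C(4) pd_cong_dom[OF that] by blast
  show ?thesis
    unfolding jet_def using C(1) 1 2 3 by (intro exI[of _ "\<lambda>k. pd c i (C k)"]) auto
qed

end

lemma sum4_rev:
  "(\<Sum>j\<in>UNIV. \<Sum>b\<in>UNIV. \<Sum>q\<in>UNIV. \<Sum>s\<in>UNIV. F j b q s) = (\<Sum>s\<in>UNIV. \<Sum>q\<in>UNIV. \<Sum>b\<in>UNIV. \<Sum>j\<in>UNIV. F j b q s)"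
  for F :: "'n::finite \<Rightarrow> 'n \<Rightarrow> 'n \<Rightarrow> 'n \<Rightarrow> real"
  unfolding sum.cartesian_product
  by (rule sum.reindex_bij_witness[where i = "\<lambda>(s, q, b, j). (j, b, q, s)" and j = "\<lambda>(j, b, q, s). (s, q, b, j)"]) auto

text \<open>\<open>raise4\<close> sums over one index of each factor \<open>w\<close> first,
  \<open>pairing\<close> over the two indices of a factor together.\<close>

lemma sum8_interleave:
  "(\<Sum>i\<in>UNIV. \<Sum>j\<in>UNIV. \<Sum>k\<in>UNIV. \<Sum>l\<in>UNIV. \<Sum>a\<in>UNIV. \<Sum>b\<in>UNIV. \<Sum>e\<in>UNIV. \<Sum>f\<in>UNIV. F i j k l a b e f)
    = (\<Sum>i\<in>UNIV. \<Sum>a\<in>UNIV. \<Sum>j\<in>UNIV. \<Sum>b\<in>UNIV. \<Sum>k\<in>UNIV. \<Sum>e\<in>UNIV. \<Sum>l\<in>UNIV. \<Sum>f\<in>UNIV. F i j k l a b e f)"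
  for F :: "'n::finite \<Rightarrow> 'n \<Rightarrow> 'n \<Rightarrow> 'n \<Rightarrow> 'n \<Rightarrow> 'n \<Rightarrow> 'n \<Rightarrow> 'n \<Rightarrow> real"
  unfolding sum.cartesian_product
  by (rule sum.reindex_bij_witness[where i = "\<lambda>(i, a, j, b, k, e, l, f). (i, j, k, l, a, b, e, f)"
        and j = "\<lambda>(i, j, k, l, a, b, e, f). (i, a, j, b, k, e, l, f)"]) auto

text \<open>Exchanging the two lists transposes each of the \<open>n\<close> antisymmetric factors;
  pairings of even rank are therefore symmetric.\<close>

lemma pairing_swap:
  assumes "\<And>i j. w i j = - w j i"
  shows "pairing w n (\<lambda>B C. Q C B) = (- 1) ^ n * pairing w n Q"
proof (induction n arbitrary: Q)
  case (Suc n)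
  have "pairing w (Suc n) (\<lambda>B C. Q C B) = (\<Sum>i\<in>UNIV. \<Sum>a\<in>UNIV. w i a * ((- 1) ^ n * pairing w n (\<lambda>A I. Q (i # A) (a # I))))"
    using Suc[of "\<lambda>B C. Q (_ # B) (_ # C)"] by simp
  also have "\<dots> = (\<Sum>i\<in>UNIV. \<Sum>a\<in>UNIV. w a i * ((- 1) ^ n * pairing w n (\<lambda>A I. Q (a # A) (i # I))))"
    by (rule sum.swap)
  also have "\<dots> = (\<Sum>i\<in>UNIV. \<Sum>a\<in>UNIV. - ((- 1) ^ n * (w i a * pairing w n (\<lambda>A I. Q (a # A) (i # I)))))"
    by (intro sum.cong refl) (subst assms, simp)
  finally show ?case by (simp add: sum_negf sum_distrib_left)
qed simp

context sympl_chart
begin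

lemma jet_pairing:
  shows "(\<And>B. jet c N (\<lambda>t. T t B) (T0 B) (T1 B)) \<Longrightarrow> (\<And>B. jet c M (\<lambda>t. S t B) (S0 B) (S1 B)) \<Longrightarrow>
    jet c (N + M) (\<lambda>t. pr n (\<lambda>B C p. T t B p * S t C p)) (pr n (\<lambda>B C p. T0 B p * S0 C p))
      (\<lambda>p. pr n (\<lambda>B C p. T0 B p * S1 C p) p + pr n (\<lambda>B C p. T1 B p * S0 C p) p)"
proof (induction n arbitrary: T T0 T1 S S0 S1)
  case 0
  show ?case using jet_mult[OF 0(1)[of "[]"] 0(2)[of "[]"]] by simp
next
  case (Suc n)
  have "jet c (N + M) (\<lambda>t. pr n (\<lambda>B C p. T t (a # B) p * S t (i # C) p)) (pr n (\<lambda>B C p. T0 (a # B) p * S0 (i # C) p))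
      (\<lambda>p. pr n (\<lambda>B C p. T0 (a # B) p * S1 (i # C) p) p + pr n (\<lambda>B C p. T1 (a # B) p * S0 (i # C) p) p)" for a i
    by (rule Suc.IH) (rule Suc.prems)+
  from jet_sum[OF finite jet_sum[OF finite jet_sm_mult[OF sm_w this]]]
  show ?case
    by (rule jet_cong) (simp_all add: distrib_left sum.distrib)
qed

lemma K_in_chart_pairing:
  assumes p: "p \<in> dom"
  shows "K_in_chart Om G c p = (\<Sum>i\<in>UNIV. \<Sum>a\<in>UNIV. w i a p * pd c a (div_ricci i) p)
     - 1 / 2 * pr 2 (\<lambda>B C p. RicL B p * RicL C p) p + 1 / 4 * pr 4 (\<lambda>B C p. RL B p * RL C p) p"
proof -
  have "(\<Sum>i\<in>UNIV. \<Sum>j\<in>UNIV. raise2 Om (ricci G) c i j p * ricci G c i j p) = pr 2 (\<lambda>B C p. RicL B p * RicL C p) p"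
    unfolding raise2_def
    by (simp add: numeral_2_eq_2 RicL_def sum_distrib_left sum_distrib_right mult_ac) (intro sum.cong refl sum.swap)
  moreover have "(\<Sum>i\<in>UNIV. \<Sum>j\<in>UNIV. \<Sum>k\<in>UNIV. \<Sum>l\<in>UNIV.
         raise4 Om (curvature_low Om G) c i j k l p * curvature_low Om G c i j k l p)
     = pr 4 (\<lambda>B C p. RL B p * RL C p) p"
    unfolding raise4_def sum_distrib_right
    by (subst sum8_interleave) (simp add: eval_nat_numeral RL_def sum_distrib_left mult_ac)
  ultimately show ?thesis
    by (simp add: K_in_chart_def divdiv_ricci_eq[OF p])
qed

end

section \<open>The variation of the curvature and of \<K>\<close>

locale varied_chart = sympl_chart X c Om G
  for X :: "'m topology" and c :: "('m, 'n::finite) chart" and Om :: "('m, 'n) field2" and G :: "('m, 'n) field3" +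
  fixes P :: "('m, 'n) field3"
  assumes sm_P [simp]: "sm c (P c i j k)"
    and P_sym: "p \<in> chart_dom c \<Longrightarrow> P c i j k p = P c j i k p" "p \<in> chart_dom c \<Longrightarrow> P c i j k p = P c i k j p"
begin

abbreviation Gt where "Gt t \<equiv> varied_connection Om G t P"

text \<open>The difference tensor: \<Pi> with its last index raised.\<close>

definition U where "U i j k p = (\<Sum>q\<in>UNIV. w k q p * P c i j q p)"

lemma sm_U [simp]: "sm c (U i j k)"
  unfolding U_def[abs_def] by simp

lemma Gt_eq: "Gt t c i j k p = G c i j k p + t * U i j k p"
  by (simp add: varied_connection_def U_def)

lemma U_sym: "p \<in> dom \<Longrightarrow> U i j k p = U j i k p"
  by (simp add: U_def P_sym(1)[of p i j])

lemma U_om: 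
  assumes p: "p \<in> dom"
  shows "(\<Sum>k\<in>UNIV. U i j k p * om k l p) = P c i j l p"
proof -
  have "(\<Sum>k\<in>UNIV. U i j k p * om k l p) = (\<Sum>k\<in>UNIV. \<Sum>q\<in>UNIV. - (P c i j q p * (w q k p * om k l p)))"
    unfolding U_def sum_distrib_right by (intro sum.cong refl) (subst w_antisym[OF p], simp)
  also have "\<dots> = (\<Sum>q\<in>UNIV. \<Sum>k\<in>UNIV. - (P c i j q p * (w q k p * om k l p)))"
    by (rule sum.swap)
  also have "\<dots> = (\<Sum>q\<in>UNIV. - (P c i j q p * (\<Sum>k\<in>UNIV. w q k p * om k l p)))"
    by (simp add: sum_distrib_left sum_negf)
  also have "\<dots> = P c i j l p"
    by (simp add: w_om[OF p] if_distrib cong: if_cong)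
  finally show ?thesis .
qed

text \<open>Symmetry of \<Pi> in its first two indices keeps the connection torsion-free. The
  covariant derivative of \<Omega> changes by a multiple of \<Pi> antisymmetrised in its last two
  indices, which is zero.\<close>

lemma sympl_chart_Gt: "sympl_chart X c Om (Gt t)"
proof (unfold_locales, goal_cases)
  case (2 i j k)
  have "Gt t c i j k = (\<lambda>p. G c i j k p + t * U i j k p)"
    by (simp add: fun_eq_iff Gt_eq)
  then show ?case by simp
next
  case (5 p i j k)
  then show ?case using G_sym[of p i j k] U_sym[of p i j k] by (simp add: Gt_eq)
next
  case (6 p i j k)
  have "(\<Sum>q\<in>UNIV. U i j q p * om q k p) + (\<Sum>q\<in>UNIV. U i k q p * om j q p) = 0"
  proof -
    have "(\<Sum>q\<in>UNIV. U i k q p * om j q p) = - (\<Sum>q\<in>UNIV. U i k q p * om q j p)"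
      unfolding sum_negf[symmetric] by (intro sum.cong refl) (simp add: Om_antisym[OF 6, of j])
    then show ?thesis using P_sym(2)[OF 6, of i j k] by (simp add: U_om[OF 6])
  qed
  moreover have "nabla_cov2 (Gt t) Om c i j k p = nabla_cov2 G Om c i j k p
     - t * ((\<Sum>q\<in>UNIV. U i j q p * om q k p) + (\<Sum>q\<in>UNIV. U i k q p * om j q p))"
    by (simp add: nabla_cov2_def Gt_eq distrib_right distrib_left sum.distrib sum_distrib_left mult.assoc)
  ultimately show ?case using parallel[OF 6, of i j k] by simp
next
  case 1 show ?case by (rule sm_Om)
next
  case (3 p) then show ?case by (rule Om_antisym)
next
  case (4 p) then show ?case by (rule Om_inv)
qed

text \<open>
  \<open>Acurv\<close>, \<open>SL\<close>, \<open>AL\<close> and \<open>K1\<close> are the derivatives at \<open>t = 0\<close> of \<open>R\<^sub>i\<^sub>j\<^sub>s\<^sup>k\<close>, \<open>R\<^sub>i\<^sub>j\<close>, \<open>R\<^sub>i\<^sub>j\<^sub>k\<^sub>l\<close> and \<open>\<K>\<close>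
  along \<open>\<nabla> + t\<Pi>\<close>.
\<close>

definition Acurv where
  "Acurv i j s k p = pd c i (U j s k) p - pd c j (U i s k) p
    + (\<Sum>q\<in>UNIV. G c i q k p * U j s q p + U i q k p * G c j s q p)
    - (\<Sum>q\<in>UNIV. G c j q k p * U i s q p + U j q k p * G c i s q p)"

definition SL where "SL L p = (\<Sum>q\<in>UNIV. Acurv q (L ! 0) (L ! 1) q p)"

definition AL where "AL L p = (\<Sum>q\<in>UNIV. Acurv (L ! 0) (L ! 1) (L ! 2) q p * om q (L ! 3) p)"

text \<open>The derivative at \<open>t = 0\<close> of \<open>div_ricci\<close>; the summand with
  \<open>U\<close> comes from the Christoffel symbol in \<open>div_ricci_eq\<close>.\<close>

definition X1 where
  "X1 i p = (\<Sum>j\<in>UNIV. \<Sum>b\<in>UNIV. w j b p * (pd c b (SL [i, j]) p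
     - (\<Sum>q\<in>UNIV. G c b i q p * SL [q, j] p + U b i q p * ricci G c q j p)))"

definition K1 where
  "K1 p = (\<Sum>i\<in>UNIV. \<Sum>a\<in>UNIV. w i a p * pd c a (X1 i) p)
     - pr 2 (\<lambda>B C p. RicL B p * SL C p) p + 1 / 2 * pr 4 (\<lambda>B C p. RL B p * AL C p) p"

lemma sm_Acurv [simp]: "sm c (Acurv i j s k)"
  unfolding Acurv_def[abs_def] by simp

lemma sm_SL [simp]: "sm c (SL L)"
  unfolding SL_def[abs_def] by simp

lemma sm_X1 [simp]: "sm c (X1 i)"
  unfolding X1_def[abs_def] by simp

lemma jet_Gt: "jet c 1 (\<lambda>t. Gt t c i j k) (G c i j k) (U i j k)"
  using jet_linear[of "G c i j k" "U i j k"] by (rule jet_cong) (simp_all add: Gt_eq)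

lemma jet_curvature: "jet c 2 (\<lambda>t. curvature (Gt t) c i j s k) (curvature G c i j s k) (Acurv i j s k)"
proof -
  have m: "jet c 2 (\<lambda>t p. \<Sum>q\<in>UNIV. Gt t c i q k p * Gt t c j s q p) (\<lambda>p. \<Sum>q\<in>UNIV. G c i q k p * G c j s q p)
    (\<lambda>p. \<Sum>q\<in>UNIV. G c i q k p * U j s q p + U i q k p * G c j s q p)" for i j
    using jet_sum[OF finite jet_mult[OF jet_Gt jet_Gt]] by (simp add: numeral_2_eq_2)
  from jet_diff[OF jet_add[OF jet_diff[OF jet_pd[OF jet_Gt] jet_pd[OF jet_Gt]] m] m, of i j s k j i s k i j j i]
  have "jet c 2 (\<lambda>t p. pd c i (Gt t c j s k) p - pd c j (Gt t c i s k) p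
      + (\<Sum>q\<in>UNIV. Gt t c i q k p * Gt t c j s q p) - (\<Sum>q\<in>UNIV. Gt t c j q k p * Gt t c i s q p))
    (\<lambda>p. pd c i (G c j s k) p - pd c j (G c i s k) p
      + (\<Sum>q\<in>UNIV. G c i q k p * G c j s q p) - (\<Sum>q\<in>UNIV. G c j q k p * G c i s q p)) (Acurv i j s k)"
    unfolding Acurv_def[abs_def] by (simp add: numeral_2_eq_2)
  then show ?thesis
    by (rule jet_cong) (simp_all add: curvature_eq sympl_chart.curvature_eq[OF sympl_chart_Gt])
qed

lemma jet_ricci: "jet c 2 (\<lambda>t. ricci (Gt t) c i j) (ricci G c i j) (SL [i, j])"
proof -
  have "jet c 2 (\<lambda>t p. \<Sum>q\<in>UNIV. curvature (Gt t) c q i j q p) (\<lambda>p. \<Sum>q\<in>UNIV. curvature G c q i j q p)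
    (\<lambda>p. \<Sum>q\<in>UNIV. Acurv q i j q p)"
    by (rule jet_sum[OF finite jet_curvature])
  then show ?thesis
    by (simp add: ricci_def[abs_def] SL_def[abs_def])
qed

lemma jet_curvature_low:
  "jet c 2 (\<lambda>t. curvature_low Om (Gt t) c i j k l) (curvature_low Om G c i j k l) (AL [i, j, k, l])"
proof -
  have "jet c 2 (\<lambda>t p. \<Sum>q\<in>UNIV. om q l p * curvature (Gt t) c i j k q p) (\<lambda>p. \<Sum>q\<in>UNIV. om q l p * curvature G c i j k q p)
    (\<lambda>p. \<Sum>q\<in>UNIV. om q l p * Acurv i j k q p)"
    by (rule jet_sum[OF finite jet_sm_mult[OF sm_Om jet_curvature]])
  then show ?thesis
    by (simp add: curvature_low_def[abs_def] AL_def[abs_def] mult.commute eval_nat_numeral)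
qed

lemma jet_div_ricci:
  "jet c 3 (\<lambda>t. sympl_chart.div_ricci c Om (Gt t) i) (div_ricci i) (X1 i)"
proof -
  have "jet c 3 (\<lambda>t p. \<Sum>j\<in>UNIV. \<Sum>b\<in>UNIV. w j b p *
    (pd c b (ricci (Gt t) c i j) p - (\<Sum>q\<in>UNIV. Gt t c b i q p * ricci (Gt t) c q j p)))
   (\<lambda>p. \<Sum>j\<in>UNIV. \<Sum>b\<in>UNIV. w j b p *
    (pd c b (ricci G c i j) p - (\<Sum>q\<in>UNIV. G c b i q p * ricci G c q j p))) (X1 i)"
    unfolding X1_def[abs_def]
  proof (intro jet_sum finite jet_sm_mult sm_w)
    fix j b
    have "jet c 3 (\<lambda>t p. \<Sum>q\<in>UNIV. Gt t c b i q p * ricci (Gt t) c q j p)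
      (\<lambda>p. \<Sum>q\<in>UNIV. G c b i q p * ricci G c q j p)
      (\<lambda>p. \<Sum>q\<in>UNIV. G c b i q p * SL [q, j] p + U b i q p * ricci G c q j p)"
    proof (rule jet_sum[OF finite])
      fix q
      from jet_mult[OF jet_Gt[of b i q] jet_ricci[of q j]]
      show "jet c 3 (\<lambda>t p. Gt t c b i q p * ricci (Gt t) c q j p) (\<lambda>p. G c b i q p * ricci G c q j p)
        (\<lambda>p. G c b i q p * SL [q, j] p + U b i q p * ricci G c q j p)" by (simp add: eval_nat_numeral)
    qed
    from jet_diff[OF jet_pd[OF jet_ricci, of b i j] this]
    show "jet c 3 (\<lambda>t p. pd c b (ricci (Gt t) c i j) p - (\<Sum>q\<in>UNIV. Gt t c b i q p * ricci (Gt t) c q j p))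
        (\<lambda>p. pd c b (ricci G c i j) p - (\<Sum>q\<in>UNIV. G c b i q p * ricci G c q j p))
        (\<lambda>p. pd c b (SL [i, j]) p - (\<Sum>q\<in>UNIV. G c b i q p * SL [q, j] p + U b i q p * ricci G c q j p))"
      by simp
  qed
  then show ?thesis
    by (rule jet_cong) (simp_all add: div_ricci_eq sympl_chart.div_ricci_eq[OF sympl_chart_Gt])
qed

text \<open>The degrees add up as follows: the curvature is quadratic in the connection,
  \<open>div_ricci\<close> cubic, its divergence brings in no further Christoffel symbol by
  \<open>divdiv_ricci_eq\<close>, and the squared curvatures are quartic.\<close>

lemma jet_K: "jet c 4 (\<lambda>t. K_in_chart Om (Gt t) c) (K_in_chart Om G c) K1"
proof -
  have 1: "jet c 3 (\<lambda>t p. \<Sum>i\<in>UNIV. \<Sum>a\<in>UNIV. w i a p * pd c a (sympl_chart.div_ricci c Om (Gt t) i) p)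
      (\<lambda>p. \<Sum>i\<in>UNIV. \<Sum>a\<in>UNIV. w i a p * pd c a (div_ricci i) p)
      (\<lambda>p. \<Sum>i\<in>UNIV. \<Sum>a\<in>UNIV. w i a p * pd c a (X1 i) p)"
    by (intro jet_sum finite jet_sm_mult sm_w jet_pd jet_div_ricci)
  have 2: "jet c 4 (\<lambda>t. pr 2 (\<lambda>B C p. sympl_chart.RicL c (Gt t) B p * sympl_chart.RicL c (Gt t) C p))
      (pr 2 (\<lambda>B C p. RicL B p * RicL C p))
      (\<lambda>p. pr 2 (\<lambda>B C p. RicL B p * SL C p) p + pr 2 (\<lambda>B C p. SL B p * RicL C p) p)"
  proof -
    have "jet c 2 (\<lambda>t. sympl_chart.RicL c (Gt t) B) (RicL B) (SL B)" for B
      using jet_ricci[of "B ! 0" "B ! 1"] by (simp add: RicL_def sympl_chart.RicL_def[OF sympl_chart_Gt] SL_def[abs_def])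
    from jet_pairing[of 2 "\<lambda>t. sympl_chart.RicL c (Gt t)" RicL SL 2 "\<lambda>t. sympl_chart.RicL c (Gt t)" RicL SL 2, OF this this]
    show ?thesis by simp
  qed
  have 3: "jet c 4 (\<lambda>t. pr 4 (\<lambda>B C p. sympl_chart.RL c Om (Gt t) B p * sympl_chart.RL c Om (Gt t) C p))
      (pr 4 (\<lambda>B C p. RL B p * RL C p))
      (\<lambda>p. pr 4 (\<lambda>B C p. RL B p * AL C p) p + pr 4 (\<lambda>B C p. AL B p * RL C p) p)"
  proof -
    have "jet c 2 (\<lambda>t. sympl_chart.RL c Om (Gt t) B) (RL B) (AL B)" for B
      using jet_curvature_low[of "B ! 0" "B ! 1" "B ! 2" "B ! 3"]
      by (simp add: RL_def sympl_chart.RL_def[OF sympl_chart_Gt] AL_def[abs_def] eval_nat_numeral)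
    from jet_pairing[of 2 "\<lambda>t. sympl_chart.RL c Om (Gt t)" RL AL 2 "\<lambda>t. sympl_chart.RL c Om (Gt t)" RL AL 4, OF this this]
    show ?thesis by simp
  qed
  \<comment> \<open>By symmetry of pairings of even rank the two cross terms of each square
    coincide, which turns the coefficients 1/2 and 1/4 of \<K> into the 1 and 1/2 of
    \<open>K1\<close>.\<close>
  have s2: "pr 2 (\<lambda>B C p. SL B p * RicL C p) p = pr 2 (\<lambda>B C p. RicL B p * SL C p) p" if p: "p \<in> dom" for p
    using pairing_swap[of "\<lambda>i j. w i j p" 2 "\<lambda>B C. RicL B p * SL C p", OF w_antisym[OF p]] by (simp add: mult.commute)
  have s4: "pr 4 (\<lambda>B C p. AL B p * RL C p) p = pr 4 (\<lambda>B C p. RL B p * AL C p) p" if p: "p \<in> dom" for p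
    using pairing_swap[of "\<lambda>i j. w i j p" 4 "\<lambda>B C. RL B p * AL C p", OF w_antisym[OF p]] by (simp add: mult.commute)
  show ?thesis
    by (rule jet_cong[OF jet_mono[OF jet_add[OF jet_diff[OF 1 jet_cmult[OF 2, of "1 / 2"]] jet_cmult[OF 3, of "1 / 4"]], of 4]])
       (simp_all add: K_in_chart_pairing sympl_chart.K_in_chart_pairing[OF sympl_chart_Gt] K1_def s2 s4)
qed

end

section \<open>The Lie derivative of the connection along a Hamiltonian field, with lowered
  index\<close>

context sympl_chart
begin

lemma pd_zero: "openin X V \<Longrightarrow> V \<subseteq> dom \<Longrightarrow> p \<in> V \<Longrightarrow> (\<And>q. q \<in> V \<Longrightarrow> h q = 0) \<Longrightarrow> pd c i h p = 0"
  using pd_cong[of V p h "\<lambda>_. 0" i] by simp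

text \<open>Lowering an index commutes with covariant differentiation, as \<Omega> is
  parallel.\<close>

lemma lower_derivative:
  assumes p: "p \<in> dom" and y: "\<And>k. sm c (y k)"
  shows "(\<Sum>k\<in>UNIV. (pd c i (y k) p + (\<Sum>q\<in>UNIV. G c i q k p * y q p)) * om k l p)
    = pd c i (\<lambda>p. \<Sum>k\<in>UNIV. y k p * om k l p) p - (\<Sum>r\<in>UNIV. G c i l r p * (\<Sum>k\<in>UNIV. y k p * om k r p))"
proof -
  have "pd c i (\<lambda>p. \<Sum>k\<in>UNIV. y k p * om k l p) p
    = (\<Sum>k\<in>UNIV. pd c i (y k) p * om k l p)
      + (\<Sum>k\<in>UNIV. y k p * (\<Sum>r\<in>UNIV. G c i k r p * om r l p)) + (\<Sum>k\<in>UNIV. y k p * (\<Sum>r\<in>UNIV. G c i l r p * om k r p))"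
    by (simp add: pd_rules p y pd_om distrib_left sum.distrib)
  moreover have "(\<Sum>k\<in>UNIV. y k p * (\<Sum>r\<in>UNIV. G c i k r p * om r l p))
      = (\<Sum>k\<in>UNIV. (\<Sum>q\<in>UNIV. G c i q k p * y q p) * om k l p)"
    using mm_assoc[of "\<lambda>_ q. y q p" "\<lambda>q k. G c i q k p" "\<lambda>k l. om k l p" undefined l]
    by (simp add: mm_def mult.commute)
  moreover have "(\<Sum>k\<in>UNIV. y k p * (\<Sum>r\<in>UNIV. G c i l r p * om k r p))
      = (\<Sum>r\<in>UNIV. G c i l r p * (\<Sum>k\<in>UNIV. y k p * om k r p))"
    by (simp add: sum_distrib_left mult_ac) (rule sum.swap)
  ultimately show ?thesis by (simp add: distrib_right sum.distrib)
qed

context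
  fixes f :: "'m \<Rightarrow> real"
  assumes sm_f [simp]: "sm c f"
begin

definition dfL where "dfL L = pd c (L ! 0) f"
definition EL where "EL L = nab G c (hd L) dfL (tl L)"
text \<open>Minus the Lie derivative of the connection along the Hamiltonian field of
  \<open>f\<close>, with the upper index lowered (\<open>lie_connection_om\<close>).
  \<open>EL\<close> is the Hessian of \<open>f\<close>; the sum over \<open>i\<close> is the
  component of the Hamiltonian field with index \<open>q\<close>.\<close>

definition Lhat where
  "Lhat L p = nab G c (hd L) EL (tl L) p - (\<Sum>q\<in>UNIV. \<Sum>i\<in>UNIV. w i q p * (pd c i f p * RL (q # L) p))"

lemma sm_dfL [simp]: "sm c (dfL L)"
  by (auto simp: dfL_def)

lemma sm_EL [simp]: "sm c (EL L)"
  by (simp add: EL_def)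

lemma sm_Lhat [simp]: "sm c (Lhat L)"
  unfolding Lhat_def[abs_def] by (simp add: sm_pd)

lemma hamiltonian_om:
  assumes p: "p \<in> dom"
  shows "(\<Sum>k\<in>UNIV. hamiltonian_vec Om f c k p * om k l p) = - pd c l f p"
proof -
  have "(\<Sum>k\<in>UNIV. hamiltonian_vec Om f c k p * om k l p)
    = (\<Sum>k\<in>UNIV. \<Sum>q\<in>UNIV. pd c q f p * (w q k p * om k l p))"
    by (simp add: hamiltonian_vec_def sum_distrib_left mult_ac)
  also have "\<dots> = (\<Sum>q\<in>UNIV. pd c q f p * (\<Sum>k\<in>UNIV. w q k p * om k l p))"
    by (subst sum.swap) (simp add: sum_distrib_left)
  finally show ?thesis
    by (simp add: w_om[OF p] if_distrib cong: if_cong)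
qed

lemma sm_hamiltonian [simp]: "sm c (hamiltonian_vec Om f c k)"
  unfolding hamiltonian_vec_def[abs_def] by (simp add: sm_pd)

lemma nabla_hamiltonian_om:
  assumes p: "p \<in> dom"
  shows "(\<Sum>k\<in>UNIV. nabla_vec G (hamiltonian_vec Om f) c j k p * om k l p) = - EL [j, l] p"
proof -
  have "pd c j (\<lambda>p. \<Sum>k\<in>UNIV. hamiltonian_vec Om f c k p * om k l p) p = pd c j (\<lambda>p. - pd c l f p) p"
    by (rule pd_cong_dom[OF p]) (simp add: hamiltonian_om)
  then show ?thesis
    using lower_derivative[OF p, of "hamiltonian_vec Om f c" j l]
    by (simp add: nabla_vec_def EL_def nab_def dfL_def hamiltonian_om[OF p] pd_sm_uminus p sm_pd sum_negf)
qed

lemma lie_connection_om: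
  assumes p: "p \<in> dom"
  shows "(\<Sum>k\<in>UNIV. lie_connection (hamiltonian_vec Om f) G c i j k p * om k l p) = - Lhat [i, j, l] p"
proof -
  let ?H = "hamiltonian_vec Om f"
  have sm_Y: "sm c (nabla_vec G ?H c j k)" for k
    unfolding nabla_vec_def[abs_def] by (simp add: sm_pd)
  have "pd c i (\<lambda>p. \<Sum>k\<in>UNIV. nabla_vec G ?H c j k p * om k l p) p = pd c i (\<lambda>p. - EL [j, l] p) p"
    by (rule pd_cong_dom[OF p nabla_hamiltonian_om])
  moreover have "(\<Sum>k\<in>UNIV. (\<Sum>q\<in>UNIV. G c i j q p * nabla_vec G ?H c q k p) * om k l p) = - (\<Sum>q\<in>UNIV. G c i j q p * EL [q, l] p)"
    using mm_assoc[of "\<lambda>_ q. G c i j q p" "\<lambda>q k. nabla_vec G ?H c q k p" "\<lambda>k l. om k l p" undefined l]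
    by (simp add: mm_def nabla_hamiltonian_om[OF p] sum_negf)
  ultimately have 1: "(\<Sum>k\<in>UNIV. nabla_endo G (nabla_vec G ?H) c i j k p * om k l p) = - nab G c i EL [j, l] p"
    using lower_derivative[where y = "nabla_vec G ?H c j" and i = i and l = l, OF p sm_Y]
    by (simp add: nabla_endo_def nab_def nabla_hamiltonian_om[OF p] pd_sm_uminus p sum_negf
        left_diff_distrib distrib_right sum_subtractf sum.distrib)
  have "(\<Sum>k\<in>UNIV. (\<Sum>q\<in>UNIV. ?H c q p * curvature G c q i j k p) * om k l p) = (\<Sum>q\<in>UNIV. ?H c q p * RL [q, i, j, l] p)"
    using mm_assoc[of "\<lambda>_ q. ?H c q p" "\<lambda>q k. curvature G c q i j k p" "\<lambda>k l. om k l p" undefined l]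
    by (simp add: mm_def RL_def curvature_low_def)
  also have "\<dots> = (\<Sum>q\<in>UNIV. \<Sum>a\<in>UNIV. w a q p * (pd c a f p * RL [q, i, j, l] p))"
    by (simp add: hamiltonian_vec_def sum_distrib_right mult.assoc)
  finally show ?thesis
    by (simp add: lie_connection_def Lhat_def distrib_right sum.distrib 1)
qed

text \<open>Lowering the upper index loses nothing: contracting with \<open>w\<close> recovers it up
  to sign.\<close>

lemma lie_connection_zero_iff:
  assumes p: "p \<in> dom"
  shows "(\<forall>i j k. lie_connection (hamiltonian_vec Om f) G c i j k p = 0) \<longleftrightarrow> (\<forall>i j l. Lhat [i, j, l] p = 0)"
proof
  assume "\<forall>i j k. lie_connection (hamiltonian_vec Om f) G c i j k p = 0"
  then show "\<forall>i j l. Lhat [i, j, l] p = 0"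
    using lie_connection_om[OF p] by simp
next
  assume L: "\<forall>i j l. Lhat [i, j, l] p = 0"
  show "\<forall>i j k. lie_connection (hamiltonian_vec Om f) G c i j k p = 0"
  proof (intro allI)
    fix i j m
    let ?l = "\<lambda>k. lie_connection (hamiltonian_vec Om f) G c i j k p"
    have "mm (mm (\<lambda>_. ?l) (\<lambda>k l. om k l p)) (\<lambda>k l. w k l p) m m = 0"
      using lie_connection_om[OF p, of i j] L by (simp add: mm_def)
    moreover have "mm (mm (\<lambda>_. ?l) (\<lambda>k l. om k l p)) (\<lambda>k l. w k l p) m m = - ?l m"
      by (simp add: mm_assoc mm_neg_delta(2)[of "mm (\<lambda>k l. om k l p) (\<lambda>k l. w k l p)", OF mm_om_w[OF p]])
    ultimately show "?l m = 0" by simp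
  qed
qed

lemma EL_sym: "p \<in> dom \<Longrightarrow> EL [i, j] p = EL [j, i] p"
  using sm_pd_commute[OF sm_f, of p i j] by (simp add: EL_def nab_def dfL_def G_sym[of p i j])

text \<open>Both parts are symmetric separately: the Hessian, and the curvature in its last two
  indices.\<close>

lemma Lhat_sym23:
  assumes p: "p \<in> dom"
  shows "Lhat [i, j, l] p = Lhat [i, l, j] p"
proof -
  have "pd c i (EL [j, l]) p = pd c i (EL [l, j]) p"
    by (rule pd_cong_dom[OF p EL_sym])
  then have "nab G c i EL [j, l] p = nab G c i EL [l, j] p"
    by (simp add: nab_def EL_sym[OF p, of _ l] EL_sym[OF p, of j])
  moreover have "RL [q, i, j, l] p = RL [q, i, l, j] p" for q
    using curvature_low_sym[OF p] by (simp add: RL_def)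
  ultimately show ?thesis by (simp add: Lhat_def)
qed

text \<open>Exchanging the first two indices changes the third derivative of \<open>f\<close> by the
  Ricci identity for \<open>df\<close>, and the curvature part by the same amount, by the first
  Bianchi identity.\<close>

lemma Lhat_sym12:
  assumes p: "p \<in> dom"
  shows "Lhat [i, j, l] p = Lhat [j, i, l] p"
proof -
  let ?H = "\<lambda>q. hamiltonian_vec Om f c q p" and ?R = "\<lambda>i j k l. curvature_low Om G c i j k l p"
  have 1: "Lhat [i, j, l] p = nab G c i (nab G c j dfL) [l] p - (\<Sum>q\<in>UNIV. G c i j q p * EL [q, l] p)
    - (\<Sum>q\<in>UNIV. ?H q * ?R q i j l)" for i j
    by (simp add: Lhat_def nab_Cons[of i EL] EL_def RL_def hamiltonian_vec_def sum_distrib_right mult.assoc)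
  have "nab G c i (nab G c j dfL) [l] p - nab G c j (nab G c i dfL) [l] p = - (\<Sum>r\<in>UNIV. curvature G c i j l r p * pd c r f p)"
    using nab_commutator[OF p, of dfL i j "[l]"] by (simp add: dfL_def)
  moreover have "(\<Sum>q\<in>UNIV. ?H q * ?R q i j l) - (\<Sum>q\<in>UNIV. ?H q * ?R q j i l) = - (\<Sum>r\<in>UNIV. curvature G c i j l r p * pd c r f p)"
  proof -
    have "?R q i j l - ?R q j i l = (\<Sum>r\<in>UNIV. curvature G c i j l r p * om q r p)" for q
    proof -
      have "?R q i j l - ?R q j i l = - ?R i j l q"
        using bianchi1_low[OF p, of q i j l] curvature_low_antisym[of q j i l p] curvature_low_sym[OF p, of i j q l] by simp
      also have "\<dots> = (\<Sum>r\<in>UNIV. curvature G c i j l r p * om q r p)"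
        unfolding curvature_low_def sum_negf[symmetric]
        by (intro sum.cong refl) (simp add: Om_antisym[OF p, of q])
      finally show ?thesis .
    qed
    then have "(\<Sum>q\<in>UNIV. ?H q * ?R q i j l) - (\<Sum>q\<in>UNIV. ?H q * ?R q j i l)
      = (\<Sum>q\<in>UNIV. \<Sum>r\<in>UNIV. curvature G c i j l r p * (?H q * om q r p))"
      by (simp add: sum_subtractf[symmetric] right_diff_distrib[symmetric] sum_distrib_left mult_ac)
    also have "\<dots> = (\<Sum>r\<in>UNIV. curvature G c i j l r p * (\<Sum>q\<in>UNIV. ?H q * om q r p))"
      by (subst sum.swap) (simp add: sum_distrib_left)
    finally show ?thesis by (simp add: hamiltonian_om[OF p] sum_negf)
  qed
  ultimately show ?thesis
    unfolding 1 by (simp add: G_sym[OF p, of i j])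
qed

end

end

section \<open>The linearised curvature and pointwise integration by parts\<close>

context varied_chart
begin

definition PL where "PL L = P c (L ! 0) (L ! 1) (L ! 2)"

lemma sm_PL [simp]: "sm c (PL L)"
  by (simp add: PL_def)

lemma nab_PL_sym:
  assumes p: "p \<in> dom"
  shows "nab G c i PL [a, b, e] p = nab G c i PL [b, a, e] p"
    "nab G c i PL [a, b, e] p = nab G c i PL [a, e, b] p"
proof -
  have "pd c i (P c a b e) p = pd c i (P c b a e) p" "pd c i (P c a b e) p = pd c i (P c a e b) p"
    by (rule pd_cong_dom[OF p P_sym(1)], assumption, rule pd_cong_dom[OF p P_sym(2)])
  then show "nab G c i PL [a, b, e] p = nab G c i PL [b, a, e] p"
    "nab G c i PL [a, b, e] p = nab G c i PL [a, e, b] p"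
    using p by (simp_all add: nab_def PL_def P_sym)
qed

text \<open>The linearised curvature is the covariant derivative of \<Pi>, antisymmetrised. The sum
  \<open>?C\<close> occurs with both signs: from differentiating \<open>om\<close> when the index is
  lowered, and from the terms quadratic in the connection.\<close>

lemma AL_eq:
  assumes p: "p \<in> dom"
  shows "AL [i, j, k, l] p = nab G c i PL [j, k, l] p - nab G c j PL [i, k, l] p"
proof -
  let ?C = "\<lambda>i j. \<Sum>q\<in>UNIV. U j k q p * (\<Sum>r\<in>UNIV. G c i q r p * om r l p)"
  have 1: "(\<Sum>q\<in>UNIV. pd c i (U j k q) p * om q l p) = pd c i (P c j k l) p - ?C i j - (\<Sum>r\<in>UNIV. G c i l r p * P c j k r p)" for i j
  proof -
    have "pd c i (P c j k l) p = pd c i (\<lambda>p. \<Sum>q\<in>UNIV. U j k q p * om q l p) p"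
      by (rule pd_cong_dom[OF p]) (simp add: U_om)
    also have "\<dots> = (\<Sum>q\<in>UNIV. pd c i (U j k q) p * om q l p) + ?C i j
        + (\<Sum>q\<in>UNIV. U j k q p * (\<Sum>r\<in>UNIV. G c i l r p * om q r p))"
      by (simp add: pd_rules p pd_om distrib_left sum.distrib)
    also have "(\<Sum>q\<in>UNIV. U j k q p * (\<Sum>r\<in>UNIV. G c i l r p * om q r p)) = (\<Sum>r\<in>UNIV. G c i l r p * P c j k r p)"
    proof -
      have "(\<Sum>q\<in>UNIV. U j k q p * (\<Sum>r\<in>UNIV. G c i l r p * om q r p))
        = (\<Sum>q\<in>UNIV. \<Sum>r\<in>UNIV. G c i l r p * (U j k q p * om q r p))"
        by (simp add: sum_distrib_left mult_ac)
      also have "\<dots> = (\<Sum>r\<in>UNIV. \<Sum>q\<in>UNIV. G c i l r p * (U j k q p * om q r p))"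
        by (rule sum.swap)
      finally show ?thesis by (simp add: sum_distrib_left[symmetric] U_om[OF p])
    qed
    finally show ?thesis by simp
  qed
  have 2: "(\<Sum>q\<in>UNIV. (\<Sum>r\<in>UNIV. G c i r q p * U j k r p + U i r q p * G c j k r p) * om q l p)
    = ?C i j + (\<Sum>r\<in>UNIV. G c j k r p * P c i r l p)" for i j
  proof -
    have "(\<Sum>q\<in>UNIV. (\<Sum>r\<in>UNIV. G c i r q p * U j k r p) * om q l p) = ?C i j"
      using mm_assoc[of "\<lambda>k r. U j k r p" "\<lambda>r q. G c i r q p" "\<lambda>q l. om q l p" k l]
      by (simp add: mm_def mult.commute)
    moreover have "(\<Sum>q\<in>UNIV. (\<Sum>r\<in>UNIV. U i r q p * G c j k r p) * om q l p) = (\<Sum>r\<in>UNIV. G c j k r p * P c i r l p)"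
      unfolding mult.commute[of "U i _ _ p" "G c j k _ p"]
      using mm_assoc[of "\<lambda>k r. G c j k r p" "\<lambda>r q. U i r q p" "\<lambda>q l. om q l p" k l]
      by (simp add: mm_def U_om[OF p])
    ultimately show ?thesis by (simp add: sum.distrib distrib_right)
  qed
  have "AL [i, j, k, l] p = (\<Sum>q\<in>UNIV. pd c i (U j k q) p * om q l p) - (\<Sum>q\<in>UNIV. pd c j (U i k q) p * om q l p)
    + (\<Sum>q\<in>UNIV. (\<Sum>r\<in>UNIV. G c i r q p * U j k r p + U i r q p * G c j k r p) * om q l p)
    - (\<Sum>q\<in>UNIV. (\<Sum>r\<in>UNIV. G c j r q p * U i k r p + U j r q p * G c i k r p) * om q l p)"
    by (simp add: AL_def Acurv_def left_diff_distrib distrib_right sum.distrib sum_subtractf)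
  then show ?thesis
    unfolding 1 2 by (simp add: nab_def PL_def G_sym[OF p, of i j])
qed

text \<open>The trace of \<open>AL_eq\<close>. Its second term is a trace of \<open>w\<close> over
  two slots in which the derivative of \<Pi> is symmetric, so only a divergence of \<Pi>
  survives.\<close>

lemma SL_eq:
  assumes p: "p \<in> dom"
  shows "SL [i, j] p = (\<Sum>q\<in>UNIV. \<Sum>l\<in>UNIV. w q l p * nab G c q PL [l, i, j] p)"
proof -
  have "- SL [i, j] p = (\<Sum>k\<in>UNIV. \<Sum>a\<in>UNIV. w k a p * AL [a, i, j, k] p)"
    using om_trace[OF p, of "\<lambda>a q. Acurv a i j q p"] by (simp add: SL_def AL_def)
  also have "\<dots> = (\<Sum>k\<in>UNIV. \<Sum>a\<in>UNIV. w k a p * nab G c a PL [i, j, k] p)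
      - (\<Sum>k\<in>UNIV. \<Sum>a\<in>UNIV. w k a p * nab G c i PL [a, j, k] p)"
    by (simp add: AL_eq[OF p] right_diff_distrib sum_subtractf)
  also have "(\<Sum>k\<in>UNIV. \<Sum>a\<in>UNIV. w k a p * nab G c i PL [a, j, k] p) = 0"
    by (rule antisym_sym_sum[OF w_antisym[OF p]]) (metis nab_PL_sym[OF p])
  also have "(\<Sum>k\<in>UNIV. \<Sum>a\<in>UNIV. w k a p * nab G c a PL [i, j, k] p)
      = (\<Sum>a\<in>UNIV. \<Sum>k\<in>UNIV. - (w a k p * nab G c a PL [k, i, j] p))"
  proof (subst sum.swap, intro sum.cong refl)
    fix a k
    have "nab G c a PL [i, j, k] p = nab G c a PL [k, i, j] p"
      by (metis nab_PL_sym[OF p])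
    then show "w k a p * nab G c a PL [i, j, k] p = - (w a k p * nab G c a PL [k, i, j] p)"
      using w_antisym[OF p, of k a] by simp
  qed
  finally show ?thesis by (simp add: sum_negf)
qed

lemma SL_sym: "p \<in> dom \<Longrightarrow> SL [i, j] p = SL [j, i] p"
  by (simp add: SL_eq nab_PL_sym(2)[where b = i and e = j])

lemma nab_SL_sym:
  assumes p: "p \<in> dom"
  shows "nab G c b SL [i, j] p = nab G c b SL [j, i] p"
proof -
  have "pd c b (SL [i, j]) p = pd c b (SL [j, i]) p"
    by (rule pd_cong_dom[OF p SL_sym])
  then show ?thesis
    by (simp add: nab_def SL_sym[OF p, of _ j] SL_sym[OF p, of i])
qed

text \<open>The divergence of the covector \<open>V\<close> with its index raised; as in
  \<open>divdiv_ricci_eq\<close> no Christoffel symbols occur in it.\<close>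

definition Dv where "Dv V p = (\<Sum>i\<in>UNIV. \<Sum>a\<in>UNIV. w i a p * pd c i (V a) p)"

lemma Dv_add: "(\<And>a. sm c (V a)) \<Longrightarrow> (\<And>a. sm c (W a)) \<Longrightarrow> p \<in> dom \<Longrightarrow>
    Dv (\<lambda>a p. V a p + W a p) p = Dv V p + Dv W p"
  by (simp add: Dv_def pd_rules distrib_left sum.distrib)

lemma Dv_diff: "(\<And>a. sm c (V a)) \<Longrightarrow> (\<And>a. sm c (W a)) \<Longrightarrow> p \<in> dom \<Longrightarrow>
    Dv (\<lambda>a p. V a p - W a p) p = Dv V p - Dv W p"
  by (simp add: Dv_def pd_rules right_diff_distrib sum_subtractf)

lemma pr_swap: "p \<in> dom \<Longrightarrow> pr n (\<lambda>B C p. Q C B p) p = (- 1) ^ n * pr n Q p"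
  using pairing_swap[of "\<lambda>i j. w i j p" n "\<lambda>B C. Q B C p", OF w_antisym] .

text \<open>The part of \<open>X1\<close> in which the variation falls on the connection and not on
  the Ricci tensor.\<close>

definition YR where "YR a p = (\<Sum>j\<in>UNIV. \<Sum>b\<in>UNIV. w j b p * (\<Sum>q\<in>UNIV. U b a q p * ricci G c q j p))"

lemma X1_eq:
  assumes p: "p \<in> dom"
  shows "X1 a p = (\<Sum>j\<in>UNIV. \<Sum>b\<in>UNIV. w j b p * nab G c b SL [a, j] p) - YR a p"
  using antisym_sym_sum[of "\<lambda>j b. w j b p" "\<lambda>j b. \<Sum>q\<in>UNIV. G c b j q p * SL [a, q] p", OF w_antisym[OF p]]
  by (simp add: X1_def YR_def nab_def G_sym[OF p] right_diff_distrib distrib_left sum_subtractf sum.distrib)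

text \<open>Both factors \<open>w\<close> are transposed to match the order of
  \<open>pairing\<close>, so the two signs cancel.\<close>

lemma YR_eq:
  assumes p: "p \<in> dom"
  shows "YR a p = pr 2 (\<lambda>B C p. RicL B p * PL (a # C) p) p"
proof -
  have "YR a p = (\<Sum>j\<in>UNIV. \<Sum>b\<in>UNIV. \<Sum>q\<in>UNIV. \<Sum>s\<in>UNIV. w j b p * (w q s p * (ricci G c q j p * P c b a s p)))"
    by (simp add: YR_def U_def sum_distrib_left sum_distrib_right mult_ac)
  also have "\<dots> = (\<Sum>s\<in>UNIV. \<Sum>q\<in>UNIV. \<Sum>b\<in>UNIV. \<Sum>j\<in>UNIV. w j b p * (w q s p * (ricci G c q j p * P c b a s p)))"
    by (rule sum4_rev)
  also have "\<dots> = (\<Sum>s\<in>UNIV. \<Sum>q\<in>UNIV. \<Sum>b\<in>UNIV. \<Sum>j\<in>UNIV. w s q p * (w b j p * (ricci G c q j p * P c a s b p)))"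
  proof (intro sum.cong refl)
    fix s q b j
    have "P c b a s p = P c a s b p"
      using p by (metis P_sym)
    then show "w j b p * (w q s p * (ricci G c q j p * P c b a s p)) = w s q p * (w b j p * (ricci G c q j p * P c a s b p))"
      using w_antisym[OF p, of j b] w_antisym[OF p, of q s] by simp
  qed
  also have "\<dots> = pr 2 (\<lambda>B C p. RicL B p * PL (a # C) p) p"
    by (simp add: eval_nat_numeral RicL_def PL_def sum_distrib_left)
  finally show ?thesis .
qed

context
  fixes f :: "'m \<Rightarrow> real"
  assumes sm_f [simp]: "sm c f"
begin

text \<open>What the variation \<open>SL\<close> of the Ricci tensor is paired with once the double
  divergence has been moved onto \<open>f\<close>: the Hessian from there, and \<open>- f\<close>
  times Ricci from the squared Ricci term.\<close>

definition FL where "FL L p = EL f L p - f p * RicL L p"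

lemma sm_FL [simp]: "sm c (FL L)"
  unfolding FL_def[abs_def] by simp

text \<open>The four summands are the divergence terms split off by \<open>variation_step1\<close>
  to \<open>variation_step4\<close>, in this order.\<close>

definition Vfield where
  "Vfield a p = - (f p * X1 a p) - pr 1 (\<lambda>B C p. SL (a # B) p * dfL f C p) p
    + pr 2 (\<lambda>B C p. PL (a # B) p * FL C p) p + pr 3 (\<lambda>B C p. (f p * RL (a # B) p) * PL C p) p"

lemma sm_Vfield: "sm c (Vfield a)"
  unfolding Vfield_def[abs_def] by (intro sm_add sm_diff sm_uminus sm_mult sm_pairing) simp_all

text \<open>Moves the outer derivative of the double divergence onto \<open>f\<close>; the sign of
  the divergence term comes from exchanging the indices of \<open>w\<close>.\<close>

lemma variation_step1:
  assumes p: "p \<in> dom"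
  shows "f p * (\<Sum>i\<in>UNIV. \<Sum>a\<in>UNIV. w i a p * pd c a (X1 i) p)
    = Dv (\<lambda>a p. - (f p * X1 a p)) p + (\<Sum>i\<in>UNIV. \<Sum>a\<in>UNIV. w i a p * (pd c i f p * X1 a p))"
proof -
  have "(\<Sum>i\<in>UNIV. \<Sum>a\<in>UNIV. w i a p * pd c a (X1 i) p) = (\<Sum>i\<in>UNIV. \<Sum>a\<in>UNIV. w a i p * pd c i (X1 a) p)"
    by (rule sum.swap)
  also have "\<dots> = (\<Sum>i\<in>UNIV. \<Sum>a\<in>UNIV. - (w i a p * pd c i (X1 a) p))"
    by (intro sum.cong refl) (metis w_antisym[OF p] mult_minus_left)
  finally show ?thesis
    by (simp add: Dv_def pd_rules p sum_negf[symmetric] sum.distrib[symmetric] sum_distrib_left algebra_simps)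
qed

text \<open>Moves the inner derivative as well, which leaves the variation of Ricci against the
  Hessian of \<open>f\<close>. The variation of the connection inside the divergence stays behind as
  the term with \<open>YR\<close>.\<close>

lemma variation_step2:
  assumes p: "p \<in> dom"
  shows "(\<Sum>i\<in>UNIV. \<Sum>a\<in>UNIV. w i a p * (pd c i f p * X1 a p))
    = - Dv (\<lambda>a. pr 1 (\<lambda>B C p. SL (a # B) p * dfL f C p)) p + pr 2 (\<lambda>B C p. SL B p * EL f C p) p
      - (\<Sum>i\<in>UNIV. \<Sum>a\<in>UNIV. w i a p * (pd c i f p * YR a p))"
proof -
  let ?N = "nab G c"
  have "(\<Sum>i\<in>UNIV. \<Sum>a\<in>UNIV. w i a p * (pd c i f p * (\<Sum>j\<in>UNIV. \<Sum>b\<in>UNIV. w j b p * ?N b SL [a, j] p)))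
    = (\<Sum>i\<in>UNIV. \<Sum>a\<in>UNIV. \<Sum>j\<in>UNIV. \<Sum>b\<in>UNIV. w i a p * (w j b p * (pd c i f p * ?N b SL [a, j] p)))"
    by (simp add: sum_distrib_left mult_ac)
  also have "\<dots> = (\<Sum>b\<in>UNIV. \<Sum>j\<in>UNIV. \<Sum>a\<in>UNIV. \<Sum>i\<in>UNIV. w i a p * (w j b p * (pd c i f p * ?N b SL [a, j] p)))"
    by (rule sum4_rev)
  also have "\<dots> = (\<Sum>b\<in>UNIV. \<Sum>j\<in>UNIV. \<Sum>i\<in>UNIV. \<Sum>a\<in>UNIV. w i a p * (w j b p * (pd c i f p * ?N b SL [a, j] p)))"
    by (intro sum.cong refl sum.swap)
  also have "\<dots> = (\<Sum>b\<in>UNIV. \<Sum>j\<in>UNIV. \<Sum>i\<in>UNIV. \<Sum>a\<in>UNIV. - (w b j p * (w i a p * (?N b SL [j, a] p * pd c i f p))))"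
  proof (intro sum.cong refl)
    fix b j i a
    show "w i a p * (w j b p * (pd c i f p * ?N b SL [a, j] p)) = - (w b j p * (w i a p * (?N b SL [j, a] p * pd c i f p)))"
      using w_antisym[OF p, of j b] nab_SL_sym[OF p, of b a j] by simp
  qed
  also have "\<dots> = - (\<Sum>i\<in>UNIV. \<Sum>a\<in>UNIV. w i a p * pr 1 (\<lambda>B C p. ?N i SL (a # B) p * dfL f C p) p)"
    by (simp add: sum_negf sum_distrib_left dfL_def)
  also have "\<dots> = - Dv (\<lambda>a. pr 1 (\<lambda>B C p. SL (a # B) p * dfL f C p)) p + pr 2 (\<lambda>B C p. SL B p * EL f C p) p"
    using divergence_pairing[OF p, of "dfL f" SL 1] by (simp add: Dv_def EL_def numeral_2_eq_2)
  finally show ?thesis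
    by (simp add: X1_eq[OF p] right_diff_distrib sum_subtractf)
qed

text \<open>The variation of Ricci is itself a divergence of \<Pi> by \<open>SL_eq\<close>, so one
  more derivative moves onto \<open>FL\<close>. In the last pairing the lists are exchanged at odd
  rank, hence the plus sign.\<close>

lemma variation_step3:
  assumes p: "p \<in> dom"
  shows "pr 2 (\<lambda>B C p. SL B p * FL C p) p = Dv (\<lambda>a. pr 2 (\<lambda>B C p. PL (a # B) p * FL C p)) p
    + pr 3 (\<lambda>B C p. nab G c (hd B) FL (tl B) p * PL C p) p"
proof -
  have "(\<Sum>i\<in>UNIV. \<Sum>a\<in>UNIV. w i a p * pr 2 (\<lambda>B C p. nab G c i PL (a # B) p * FL C p) p)
    = pr 2 (\<lambda>B C p. (\<Sum>i\<in>UNIV. \<Sum>a\<in>UNIV. w i a p * nab G c i PL (a # B) p) * FL C p) p"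
    by (simp add: sum_distrib_right pairing_sum pairing_cmult mult.assoc)
  also have "\<dots> = pr 2 (\<lambda>B C p. SL B p * FL C p) p"
  proof (rule pairing_cong)
    fix B C :: "'n list" assume "length B = 2"
    then obtain i j where "B = [i, j]"
      by (auto simp: eval_nat_numeral length_Suc_conv)
    then show "(\<Sum>i\<in>UNIV. \<Sum>a\<in>UNIV. w i a p * nab G c i PL (a # B) p) * FL C p = SL B p * FL C p"
      by (simp add: SL_eq[OF p])
  qed
  finally show ?thesis
    using divergence_pairing[OF p, of FL PL 2] pr_swap[OF p, of 3 "\<lambda>B C p. nab G c (hd B) FL (tl B) p * PL C p"]
    by (simp add: Dv_def mult.commute eval_nat_numeral)
qed

lemma nab_FL:
  assumes p: "p \<in> dom"
  shows "nab G c i FL L p = nab G c i (EL f) L p - (f p * nab G c i RicL L p + pd c i f p * RicL L p)"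
proof -
  have "nab G c i FL L p = nab G c i (EL f) L p - nab G c i (\<lambda>L p. f p * RicL L p) L p"
    unfolding FL_def[abs_def] by (rule nab_diff) (simp_all add: p)
  then show ?thesis by (simp add: nab_mult p)
qed

text \<open>The two halves of the antisymmetrised derivative of \<Pi> contribute equally, because
  they are paired with a tensor antisymmetric in the first two indices.\<close>

lemma pr4_AL:
  assumes p: "p \<in> dom"
  shows "pr 4 (\<lambda>B C p. RL B p * AL C p) p = 2 * pr 4 (\<lambda>B C p. RL B p * nab G c (hd C) PL (tl C) p) p"
proof -
  let ?Y = "\<lambda>i j C. nab G c i PL (j # C) p"
  have "pr 4 (\<lambda>B C p. RL B p * AL C p) p
    = (\<Sum>i\<in>UNIV. \<Sum>a\<in>UNIV. w i a p * (\<Sum>j\<in>UNIV. \<Sum>b\<in>UNIV. w j b p *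
        pr 2 (\<lambda>B C p. RL (a # b # B) p * AL (i # j # C) p) p))"
    by (simp add: eval_nat_numeral)
  also have "\<dots> = (\<Sum>i\<in>UNIV. \<Sum>a\<in>UNIV. w i a p * (\<Sum>j\<in>UNIV. \<Sum>b\<in>UNIV. w j b p *
        pr 2 (\<lambda>B C p. RL (a # b # B) p * (?Y i j C - ?Y j i C)) p))"
  proof (intro sum.cong refl arg_cong2[where f = "(*)"] pairing_cong)
    fix i a j b and B C :: "'n list" assume "length C = 2"
    then obtain k l where "C = [k, l]"
      by (auto simp: eval_nat_numeral length_Suc_conv)
    then show "AL (i # j # C) p = ?Y i j C - ?Y j i C"
      by (simp add: AL_eq[OF p])
  qed
  also have "\<dots> = (\<Sum>i\<in>UNIV. \<Sum>a\<in>UNIV. w i a p * (\<Sum>j\<in>UNIV. \<Sum>b\<in>UNIV. w j b p * pr 2 (\<lambda>B C p. RL (a # b # B) p * ?Y i j C) p))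
     - (\<Sum>i\<in>UNIV. \<Sum>a\<in>UNIV. w i a p * (\<Sum>j\<in>UNIV. \<Sum>b\<in>UNIV. w j b p * pr 2 (\<lambda>B C p. RL (a # b # B) p * ?Y j i C) p))"
    by (simp add: right_diff_distrib pairing_diff sum_subtractf)
  also have "(\<Sum>i\<in>UNIV. \<Sum>a\<in>UNIV. w i a p * (\<Sum>j\<in>UNIV. \<Sum>b\<in>UNIV. w j b p * pr 2 (\<lambda>B C p. RL (a # b # B) p * ?Y j i C) p))
    = - (\<Sum>i\<in>UNIV. \<Sum>a\<in>UNIV. w i a p * (\<Sum>j\<in>UNIV. \<Sum>b\<in>UNIV. w j b p * pr 2 (\<lambda>B C p. RL (a # b # B) p * ?Y i j C) p))"
    (is "?L = - ?R")
  proof -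
    have "?L = (\<Sum>i\<in>UNIV. \<Sum>a\<in>UNIV. \<Sum>j\<in>UNIV. \<Sum>b\<in>UNIV. w i a p * (w j b p * pr 2 (\<lambda>B C p. RL (a # b # B) p * ?Y j i C) p))"
      by (simp add: sum_distrib_left)
    also have "\<dots> = (\<Sum>i\<in>UNIV. \<Sum>j\<in>UNIV. \<Sum>a\<in>UNIV. \<Sum>b\<in>UNIV. w i a p * (w j b p * pr 2 (\<lambda>B C p. RL (a # b # B) p * ?Y j i C) p))"
      by (intro sum.cong refl sum.swap)
    also have "\<dots> = (\<Sum>j\<in>UNIV. \<Sum>i\<in>UNIV. \<Sum>b\<in>UNIV. \<Sum>a\<in>UNIV. w i a p * (w j b p * pr 2 (\<lambda>B C p. RL (a # b # B) p * ?Y j i C) p))"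
      by (subst sum.swap) (intro sum.cong refl sum.swap)
    also have "\<dots> = (\<Sum>j\<in>UNIV. \<Sum>b\<in>UNIV. \<Sum>i\<in>UNIV. \<Sum>a\<in>UNIV. w i a p * (w j b p * pr 2 (\<lambda>B C p. RL (a # b # B) p * ?Y j i C) p))"
      by (intro sum.cong refl sum.swap)
    also have "\<dots> = (\<Sum>j\<in>UNIV. \<Sum>b\<in>UNIV. \<Sum>i\<in>UNIV. \<Sum>a\<in>UNIV. - (w j b p * (w i a p * pr 2 (\<lambda>B C p. RL (b # a # B) p * ?Y j i C) p)))"
    proof (intro sum.cong refl)
      fix j b i a
      have "RL (a # b # B) p = - RL (b # a # B) p" for B
        by (simp add: RL_def curvature_low_antisym[of a b])
      then have "pr 2 (\<lambda>B C p. RL (a # b # B) p * ?Y j i C) p = - 1 * pr 2 (\<lambda>B C p. RL (b # a # B) p * ?Y j i C) p"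
        unfolding pairing_cmult[symmetric] by simp
      then show "w i a p * (w j b p * pr 2 (\<lambda>B C p. RL (a # b # B) p * ?Y j i C) p)
        = - (w j b p * (w i a p * pr 2 (\<lambda>B C p. RL (b # a # B) p * ?Y j i C) p))"
        by simp
    qed
    finally show ?thesis by (simp add: sum_negf sum_distrib_left)
  qed
  finally show ?thesis by (simp add: eval_nat_numeral)
qed

text \<open>Moves the derivative from \<Pi> onto \<open>f\<close> times the curvature. By
  \<open>bianchi2_contracted\<close> the derivative of the curvature becomes that of Ricci; the
  derivative of \<open>f\<close> gives the curvature part of \<open>Lhat\<close>.\<close>

lemma variation_step4:
  assumes p: "p \<in> dom"
  shows "f p * pr 4 (\<lambda>B C p. RL B p * nab G c (hd C) PL (tl C) p) p
    = Dv (\<lambda>a. pr 3 (\<lambda>B C p. (f p * RL (a # B) p) * PL C p)) p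
      + f p * pr 3 (\<lambda>B C p. nab G c (hd B) RicL (tl B) p * PL C p) p
      - pr 3 (\<lambda>B C p. (\<Sum>q\<in>UNIV. \<Sum>i\<in>UNIV. w i q p * (pd c i f p * RL (q # B) p)) * PL C p) p"
proof -
  let ?T = "\<lambda>L p. f p * RL L p"
  have "(\<Sum>i\<in>UNIV. \<Sum>a\<in>UNIV. w i a p * pr 3 (\<lambda>B C p. nab G c i ?T (a # B) p * PL C p) p)
    = pr 3 (\<lambda>B C p. (\<Sum>i\<in>UNIV. \<Sum>a\<in>UNIV. w i a p * nab G c i ?T (a # B) p) * PL C p) p"
    by (simp add: sum_distrib_right pairing_sum pairing_cmult mult.assoc)
  also have "\<dots> = pr 3 (\<lambda>B C p. - (f p * (nab G c (hd B) RicL (tl B) p * PL C p))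
       + (\<Sum>q\<in>UNIV. \<Sum>i\<in>UNIV. w i q p * (pd c i f p * RL (q # B) p)) * PL C p) p"
  proof (rule pairing_cong)
    fix B C :: "'n list" assume "length B = 3"
    then obtain b e g where B: "B = [b, e, g]"
      by (auto simp: eval_nat_numeral length_Suc_conv)
    have "(\<Sum>i\<in>UNIV. \<Sum>a\<in>UNIV. w i a p * nab G c i ?T (a # B) p)
      = f p * (\<Sum>i\<in>UNIV. \<Sum>a\<in>UNIV. w i a p * nab G c i RL (a # B) p)
        + (\<Sum>i\<in>UNIV. \<Sum>q\<in>UNIV. w i q p * (pd c i f p * RL (q # B) p))"
      by (simp add: nab_mult p distrib_left sum.distrib sum_distrib_left mult_ac)
    also have "(\<Sum>i\<in>UNIV. \<Sum>q\<in>UNIV. w i q p * (pd c i f p * RL (q # B) p))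
      = (\<Sum>q\<in>UNIV. \<Sum>i\<in>UNIV. w i q p * (pd c i f p * RL (q # B) p))"
      by (rule sum.swap)
    finally show "(\<Sum>i\<in>UNIV. \<Sum>a\<in>UNIV. w i a p * nab G c i ?T (a # B) p) * PL C p
      = - (f p * (nab G c (hd B) RicL (tl B) p * PL C p))
       + (\<Sum>q\<in>UNIV. \<Sum>i\<in>UNIV. w i q p * (pd c i f p * RL (q # B) p)) * PL C p"
      using bianchi2_contracted[OF p, of b e g] by (simp add: B left_diff_distrib mult.assoc)
  qed
  also have "\<dots> = - (f p * pr 3 (\<lambda>B C p. nab G c (hd B) RicL (tl B) p * PL C p) p)
     + pr 3 (\<lambda>B C p. (\<Sum>q\<in>UNIV. \<Sum>i\<in>UNIV. w i q p * (pd c i f p * RL (q # B) p)) * PL C p) p"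
    by (simp add: pairing_diff pairing_cmult)
  finally show ?thesis
    using divergence_pairing[OF p, of PL ?T 3]
      pairing_cmult[of "\<lambda>i j. w i j p" 4 "f p" "\<lambda>B C. RL B p * nab G c (hd C) PL (tl C) p"]
    by (simp add: Dv_def eval_nat_numeral mult.assoc)
qed

text \<open>Brings the remainder of \<open>variation_step2\<close> into the form of the term with
  the derivative of \<open>f\<close> in \<open>nab_FL\<close>, against which it cancels.\<close>

lemma df_ricci_term:
  assumes p: "p \<in> dom"
  shows "(\<Sum>i\<in>UNIV. \<Sum>a\<in>UNIV. w i a p * (pd c i f p * YR a p))
    = - pr 3 (\<lambda>B C p. (pd c (hd B) f p * RicL (tl B) p) * PL C p) p"
proof -
  have "(\<Sum>i\<in>UNIV. \<Sum>a\<in>UNIV. w i a p * (pd c i f p * YR a p)) = (\<Sum>i\<in>UNIV. \<Sum>a\<in>UNIV. w a i p * (pd c a f p * YR i p))"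
    by (rule sum.swap)
  also have "\<dots> = (\<Sum>i\<in>UNIV. \<Sum>a\<in>UNIV. - (w i a p * (pd c a f p * YR i p)))"
    by (intro sum.cong refl) (metis w_antisym[OF p] mult_minus_left)
  also have "\<dots> = - pr 3 (\<lambda>B C p. (pd c (hd B) f p * RicL (tl B) p) * PL C p) p"
  proof -
    have 3: "(3 :: nat) = Suc 2" by simp
    show ?thesis
      unfolding 3 pairing.simps list.sel YR_eq[OF p] mult.assoc pairing_cmult by (simp add: sum_negf)
  qed
  finally show ?thesis .
qed

text \<open>\<open>Dv Vfield\<close> is a divergence, so the \<open>L\<^sup>2\<close> adjoint of \<open>\<Pi> \<mapsto> \<delta>\<^sub>\<Pi>\<K>\<close> is \<open>f \<mapsto> \<LL>\<^bsub>\<H> f\<^esub>\<nabla>\<close>, up to a sign.\<close>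

theorem variation_identity:
  assumes p: "p \<in> dom"
  shows "f p * K1 p = Dv Vfield p + pr 3 (\<lambda>B C p. Lhat f B p * PL C p) p"
proof -
  have V: "Dv Vfield p = Dv (\<lambda>a p. - (f p * X1 a p)) p - Dv (\<lambda>a. pr 1 (\<lambda>B C p. SL (a # B) p * dfL f C p)) p
    + Dv (\<lambda>a. pr 2 (\<lambda>B C p. PL (a # B) p * FL C p)) p + Dv (\<lambda>a. pr 3 (\<lambda>B C p. (f p * RL (a # B) p) * PL C p)) p"
    unfolding Vfield_def[abs_def] using p by (simp add: Dv_add Dv_diff del: pairing.simps One_nat_def)
  have R: "pr 2 (\<lambda>B C p. SL B p * RicL C p) p = pr 2 (\<lambda>B C p. RicL B p * SL C p) p"
    using pr_swap[OF p, of 2 "\<lambda>B C p. RicL B p * SL C p"] by (simp add: mult.commute)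
  have F: "pr 2 (\<lambda>B C p. SL B p * FL C p) p
    = pr 2 (\<lambda>B C p. SL B p * EL f C p) p - f p * pr 2 (\<lambda>B C p. SL B p * RicL C p) p"
    unfolding FL_def by (simp add: right_diff_distrib pairing_diff mult.left_commute[of _ "f p"] pairing_cmult)
  have NF: "pr 3 (\<lambda>B C p. nab G c (hd B) FL (tl B) p * PL C p) p
    = pr 3 (\<lambda>B C p. nab G c (hd B) (EL f) (tl B) p * PL C p) p
      - (f p * pr 3 (\<lambda>B C p. nab G c (hd B) RicL (tl B) p * PL C p) p
      + pr 3 (\<lambda>B C p. (pd c (hd B) f p * RicL (tl B) p) * PL C p) p)"
    by (simp add: nab_FL[OF p] left_diff_distrib distrib_right pairing_diff pairing_add mult.assoc pairing_cmult)
  have L: "pr 3 (\<lambda>B C p. Lhat f B p * PL C p) p = pr 3 (\<lambda>B C p. nab G c (hd B) (EL f) (tl B) p * PL C p) p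
    - pr 3 (\<lambda>B C p. (\<Sum>q\<in>UNIV. \<Sum>i\<in>UNIV. w i q p * (pd c i f p * RL (q # B) p)) * PL C p) p"
    by (simp add: Lhat_def left_diff_distrib pairing_diff)
  have "f p * K1 p = f p * (\<Sum>i\<in>UNIV. \<Sum>a\<in>UNIV. w i a p * pd c a (X1 i) p)
    - f p * pr 2 (\<lambda>B C p. RicL B p * SL C p) p
    + f p * pr 4 (\<lambda>B C p. RL B p * nab G c (hd C) PL (tl C) p) p"
    by (simp add: K1_def pr4_AL[OF p] distrib_left right_diff_distrib)
  \<comment> \<open>All Ricci terms cancel: \<open>f\<close> times the derivative of Ricci between
    \<open>variation_step3\<close> and \<open>variation_step4\<close>, the products of
    \<open>df\<close> and Ricci between \<open>nab_FL\<close> and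
    \<open>df_ricci_term\<close>.\<close>
  then show ?thesis
    unfolding variation_step1[OF p] variation_step2[OF p] variation_step4[OF p] df_ricci_term[OF p] V L
    using variation_step3[OF p] R F NF by simp
qed

end

end

section \<open>Supports of the variation\<close>

context varied_chart
begin

text \<open>Each quantity is built from \<Pi> linearly and with derivatives; the set
  \<open>V\<close> is open so that derivatives of functions vanishing on it vanish too.\<close>

lemma support:
  assumes V: "openin X V" "V \<subseteq> dom" and P0: "\<And>q i j k. q \<in> V \<Longrightarrow> P c i j k q = 0" and p: "p \<in> V"
  shows "PL L p = 0" "SL L p = 0" "AL L p = 0" "X1 a p = 0" "K1 p = 0"
proof -
  note zero = pd_zero[OF V]
  have U: "U i j k q = 0" if "q \<in> V" for i j k q
    using P0[OF that] by (simp add: U_def)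
  have A: "Acurv i j k l q = 0" if "q \<in> V" for i j k l q
    using U zero[OF that, of "U _ _ _"] that by (simp add: Acurv_def)
  have S: "SL L q = 0" if "q \<in> V" for L q
    using A[OF that] by (simp add: SL_def)
  have X: "X1 a q = 0" if "q \<in> V" for a q
    using U[OF that] S[OF that] zero[OF that, of "SL _"] S by (simp add: X1_def)
  show "PL L p = 0" "SL L p = 0" "X1 a p = 0" and AL: "AL L p = 0" for L
    using P0[OF p] S[OF p] A[OF p] X[OF p] by (simp_all add: PL_def AL_def)
  show "K1 p = 0"
    using S[OF p] AL zero[OF p, of "X1 _"] X by (simp add: K1_def)
qed

lemma Vfield_support:
  assumes "sm c f" and V: "openin X V" "V \<subseteq> dom" "\<And>q i j k. q \<in> V \<Longrightarrow> P c i j k q = 0" "p \<in> V"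
  shows "Vfield f a p = 0"
  by (simp add: Vfield_def[OF assms(1)] support[OF V])

end

section \<open>Cutoff functions\<close>

text \<open>For \<open>k = 0\<close> the classical flat function exp(-1/t). The powers of 1/t make
  the family closed under differentiation (\<open>has_real_derivative_flat\<close>), so smoothness
  follows by induction for all \<open>k\<close> at once.\<close>

definition flat :: "nat \<Rightarrow> real \<Rightarrow> real" where
  "flat k t = (if t > 0 then inverse t ^ k / exp (inverse t) else 0)"

lemma flat_at_right_0: "(flat k \<longlongrightarrow> 0) (at_right 0)"
proof -
  have "((\<lambda>t. inverse t ^ k / exp (inverse t)) \<longlongrightarrow> (0::real)) (at_right 0)"
    by (rule filterlim_compose[OF tendsto_power_div_exp_0 filterlim_inverse_at_top_right])
  then show ?thesis
    by (rule Lim_transform_eventually) (auto simp: flat_def eventually_at_right_less eventually_at_filter)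
qed

lemma has_real_derivative_flat:
  "(flat k has_real_derivative (- real k * flat (Suc k) t + flat (Suc (Suc k)) t)) (at t)"
proof -
  consider "t > 0" | "t < 0" | "t = 0" by linarith
  then show ?thesis
  proof cases
    case 1
    have "((\<lambda>t. inverse t ^ k * exp (- inverse t)) has_real_derivative
        (- real k * (inverse t ^ Suc k * exp (- inverse t)) + inverse t ^ Suc (Suc k) * exp (- inverse t))) (at t)"
    proof -
      have "((\<lambda>t. inverse t ^ k) has_real_derivative (- real k * inverse t ^ Suc k)) (at t)"
      proof (induction k)
        case (Suc k)
        have "((\<lambda>t. inverse t * inverse t ^ k) has_real_derivative
            (- (inverse t ^ Suc (Suc 0)) * inverse t ^ k + (- real k * inverse t ^ Suc k) * inverse t)) (at t)"
          using DERIV_mult[OF DERIV_inverse Suc, of] 1 by simp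
        then show ?case by (simp add: algebra_simps)
      qed simp
      moreover have "((\<lambda>t. exp (- inverse t)) has_real_derivative inverse t ^ Suc (Suc 0) * exp (- inverse t)) (at t)"
        using 1 by (auto intro!: derivative_eq_intros)
      ultimately show ?thesis
        by (rule DERIV_mult[THEN DERIV_cong]) (simp add: algebra_simps)
    qed
    then have "(flat k has_real_derivative
        (- real k * (inverse t ^ Suc k * exp (- inverse t)) + inverse t ^ Suc (Suc k) * exp (- inverse t))) (at t)"
      by (rule DERIV_cong_ev[THEN iffD1, rotated 3])
         (use 1 in \<open>auto simp: flat_def exp_minus divide_inverse eventually_nhds intro!: exI[of _ "{0<..}"]\<close>)
    then show ?thesis using 1 by (simp add: flat_def exp_minus divide_inverse)
  next
    case 2
    have "((\<lambda>t. 0) has_real_derivative 0) (at t)" by simp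
    then have "(flat k has_real_derivative 0) (at t)"
      by (rule DERIV_cong_ev[THEN iffD1, rotated 3])
         (use 2 in \<open>auto simp: flat_def eventually_nhds intro!: exI[of _ "{..<0}"]\<close>)
    then show ?thesis using 2 by (simp add: flat_def)
  next
    case 3
    have "((\<lambda>h. flat (Suc k) h) \<longlongrightarrow> 0) (at_left 0)"
      by (rule Lim_transform_eventually[of "\<lambda>_. 0"]) (auto simp: flat_def eventually_at_filter)
    then have "(flat (Suc k) \<longlongrightarrow> 0) (at 0)"
      using flat_at_right_0[of "Suc k"] by (simp add: filterlim_at_split)
    \<comment> \<open>At 0 the difference quotient of \<open>flat k\<close> is
      \<open>flat (Suc k)\<close> itself.\<close>
    then have "((\<lambda>h. (flat k (0 + h) - flat k 0) / h) \<longlongrightarrow> 0) (at 0)"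
      by (rule Lim_transform_eventually) (auto simp: flat_def divide_inverse eventually_at_filter)
    then show ?thesis using 3 by (simp add: DERIV_def flat_def)
  qed
qed

lemma diffn_flat:
  fixes g :: "real ^ 'n::finite \<Rightarrow> real"
  assumes S: "open S" and g: "smooth_on_open S g"
  shows "diffn n S (\<lambda>x. flat k (g x))"
proof (induction n arbitrary: k)
  have D: "((\<lambda>x. flat k (g x)) has_derivative
      (\<lambda>h. frechet_derivative g (at x) h * (- real k * flat (Suc k) (g x) + flat (Suc (Suc k)) (g x)))) (at x)"
    if "x \<in> S" for k x
    using DERIV_compose_FDERIV[OF has_real_derivative_flat] g that smooth_on_openD frechet_derivative_works by blast
  {
    case 0
    show ?case using D by (auto simp: differentiable_def)
  next
    case (Suc n)
    have "diffn n S (partial_deriv i (\<lambda>x. flat k (g x)))" for i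
    proof (rule diffn_cong[OF S])
      show "diffn n S (\<lambda>x. partial_deriv i g x * (- real k * flat (Suc k) (g x) + flat (Suc (Suc k)) (g x)))"
        by (rule diffn_mult[OF S], use smooth_on_open_partial[OF g] smooth_on_open_iff in blast,
            rule diffn_add[OF S diffn_mult[OF S diffn_const Suc.IH] Suc.IH])
      show "partial_deriv i g x * (- real k * flat (Suc k) (g x) + flat (Suc (Suc k)) (g x)) = partial_deriv i (\<lambda>x. flat k (g x)) x"
        if "x \<in> S" for x
        by (simp add: partial_deriv_eqI[OF D[OF that]]) (simp add: partial_deriv_def)
    qed
    then show ?case using D by (auto simp: differentiable_def)
  }
qed

lemma smooth_on_open_flat: "open S \<Longrightarrow> smooth_on_open S g \<Longrightarrow> smooth_on_open S (\<lambda>x. flat k (g x))"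
  by (simp add: smooth_on_open_iff diffn_flat[unfolded smooth_on_open_iff])

lemma plateau:
  fixes x0 :: "real ^ 'n::finite"
  assumes r: "r > 0"
  obtains \<psi> :: "real ^ 'n \<Rightarrow> real" where "smooth_on_open UNIV \<psi>" "\<And>x. 0 \<le> \<psi> x" "\<And>x. \<psi> x \<le> 1"
    "\<And>x. x \<in> ball x0 r \<Longrightarrow> \<psi> x = 1" "\<And>x. x \<notin> cball x0 (2 * r) \<Longrightarrow> \<psi> x = 0"
proof -
  \<comment> \<open>A polynomial in the coordinates that is at least 1 on the ball of radius
    \<open>r\<close> and at most 0 beyond radius sqrt 2 times \<open>r\<close>, hence beyond
    \<open>2 * r\<close>. As \<open>q\<close> and \<open>1 - q\<close> are never both nonpositive,
    the denominator \<open>D\<close> is positive.\<close>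
  define q where "q x = 2 - (dist x0 x)\<^sup>2 / r\<^sup>2" for x :: "real ^ 'n"
  define D where "D x = flat 0 (q x) + flat 0 (1 - q x)" for x
  define \<psi> where "\<psi> x = flat 0 (q x) * inverse (D x)" for x
  have fp: "flat 0 t > 0" if "t > 0" for t using that by (simp add: flat_def)
  have f0: "flat 0 t = 0" if "t \<le> 0" for t using that by (simp add: flat_def)
  have fn: "flat 0 t \<ge> 0" for t by (simp add: flat_def)
  have Dp: "D x > 0" for x
  proof (cases "q x > 0")
    case True
    then show ?thesis using fp[of "q x"] fn[of "1 - q x"] by (simp add: D_def)
  next
    case False
    then show ?thesis using fp[of "1 - q x"] fn[of "q x"] by (simp add: D_def)
  qed
  have d: "dist x0 x = norm (x - x0)" for x
    by (metis dist_norm dist_commute)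
  have q_eq: "q = (\<lambda>x. 2 + (\<Sum>i\<in>UNIV. (x $ i + - x0 $ i) * ((x $ i + - x0 $ i) * (- 1 / r\<^sup>2))))"
    unfolding q_def d by (simp add: fun_eq_iff norm_vec_def L2_set_def sum_nonneg
        power2_eq_square sum_divide_distrib sum_negf)
  have sum_smooth: "smooth_on_open UNIV (\<lambda>x. \<Sum>i\<in>I. (x $ i + - x0 $ i) * ((x $ i + - x0 $ i) * (- 1 / r\<^sup>2)))" for I
  proof (induction I rule: infinite_finite_induct)
    case (insert i F)
    then show ?case
      unfolding sum.insert[OF insert.hyps]
      by (intro smooth_on_open_add smooth_on_open_mult smooth_on_open_component smooth_on_open_const open_UNIV)
  qed (simp_all add: smooth_on_open_const)
  have q: "smooth_on_open UNIV q"
    unfolding q_eq by (intro smooth_on_open_add smooth_on_open_const open_UNIV sum_smooth)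
  have q': "smooth_on_open UNIV (\<lambda>x. 1 - q x)"
    using smooth_on_open_add[OF open_UNIV smooth_on_open_const[of _ 1] smooth_on_open_mult[OF open_UNIV smooth_on_open_const[of _ "- 1"] q]]
    by simp
  have "smooth_on_open UNIV \<psi>"
    unfolding \<psi>_def D_def
    using Dp by (intro smooth_on_open_mult smooth_on_open_inverse smooth_on_open_add smooth_on_open_flat q q' open_UNIV)
      (metis D_def less_irrefl)
  moreover have "0 \<le> \<psi> x" for x
    using fn[of "q x"] Dp[of x] by (simp add: \<psi>_def)
  moreover have "\<psi> x \<le> 1" for x
    using fn[of "1 - q x"] Dp[of x] by (simp add: \<psi>_def D_def divide_inverse[symmetric])
  moreover have "\<psi> x = 1" if "x \<in> ball x0 r" for x
  proof -
    have "(dist x0 x)\<^sup>2 \<le> r\<^sup>2" using that r by (intro power_mono) auto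
    then have "q x \<ge> 1" using r by (simp add: q_def field_simps)
    then show ?thesis using f0[of "1 - q x"] fp[of "q x"] by (simp add: \<psi>_def D_def)
  qed
  moreover have "\<psi> x = 0" if "x \<notin> cball x0 (2 * r)" for x
  proof -
    have "(2 * r)\<^sup>2 \<le> (dist x0 x)\<^sup>2" using that r by (intro power_mono) auto
    then have "2 * r\<^sup>2 \<le> (dist x0 x)\<^sup>2"
      using zero_le_power2[of r] unfolding power_mult_distrib power2_eq_square[of 2] by linarith
    then have "q x \<le> 0" using r by (simp add: q_def field_simps)
    then show ?thesis using f0 by (simp add: \<psi>_def)
  qed
  ultimately show ?thesis using that by blast
qed

section \<open>Cutoff functions on the manifold\<close>

context chart
begin

lemma compactin_preimage_cball:
  assumes "cball x r \<subseteq> coords c ` dom"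
  shows "compactin X {q \<in> dom. coords c q \<in> cball x r}"
proof -
  have "coords c ` {q \<in> dom. coords c q \<in> cball x r} = cball x r"
    using assms by auto
  then have "compactin (subtopology X dom) {q \<in> dom. coords c q \<in> cball x r}"
    unfolding homeomorphic_map_compactness_eq[OF homeo] using assms dom_subset
    by (simp only: compactin_subtopology) auto
  then show ?thesis by (simp add: compactin_subtopology)
qed

end

context smooth_mfd
begin

definition smooth_fun :: "('m \<Rightarrow> real) \<Rightarrow> bool" where
  "smooth_fun f \<longleftrightarrow> (\<forall>d\<in>A. sm d f)"

text \<open>\<open>K\<close> is closed because the space is Hausdorff. Any chart domain is thus the
  union of two open sets, its overlap with \<open>c\<close> and the complement of \<open>K\<close>,
  and \<open>f\<close> is smooth on both.\<close>

lemma smooth_fun_extend: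
  assumes c: "c \<in> A" "sm c f" and K: "compactin X K" "K \<subseteq> chart_dom c" "\<And>q. q \<notin> K \<Longrightarrow> f q = 0"
  shows "smooth_fun f"
  unfolding smooth_fun_def
proof
  fix d assume d: "d \<in> A"
  interpret d: chart X d by (rule chart_ax[OF d])
  let ?V = "chart_dom c \<inter> chart_dom d" and ?W = "chart_dom d - K"
  have V: "openin X ?V" by (rule openin_overlap[OF c(1) d])
  have "closedin X K" using K(1) Hausdorff compactin_imp_closedin by blast
  then have W: "openin X ?W" using d.openin_dom by blast
  have "smooth_in_chart d ?V f"
    by (rule smooth_change[OF d c(1) V]) (use smooth_in_chart_subset[OF c(2)] in auto)
  moreover have "smooth_in_chart d ?W f"
  proof -
    have "smooth_in_chart d ?W (\<lambda>_. 0)"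
      by (simp add: smooth_in_chart_def o_def smooth_on_open_const)
    then show ?thesis
      using d.smooth_cong[OF W, of f "\<lambda>_. 0"] K(3) by auto
  qed
  moreover have "coords d ` chart_dom d = coords d ` ?V \<union> coords d ` ?W"
    using K(2) by auto
  ultimately show "sm d f"
    unfolding smooth_in_chart_def by (metis smooth_on_open_Un)
qed

lemma cutoff:
  assumes c: "c \<in> A" and W: "openin X W" "p \<in> W" "W \<subseteq> chart_dom c"
  obtains h K N where "smooth_fun h" "\<And>q. 0 \<le> h q" "\<And>q. h q \<le> 1" "compactin X K" "K \<subseteq> W"
    "\<And>q. q \<notin> K \<Longrightarrow> h q = 0" "openin X N" "p \<in> N" "N \<subseteq> W" "\<And>q. q \<in> N \<Longrightarrow> h q = 1"
proof -
  interpret chart X c by (rule chart_ax[OF c])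
  let ?x = "coords c p"
  have "open (coords c ` W)" "?x \<in> coords c ` W"
    using open_coords W by auto
  then obtain R where R: "R > 0" "cball ?x R \<subseteq> coords c ` W"
    using open_contains_cball by blast
  define r where "r = R / 2"
  have r: "r > 0" "cball ?x (2 * r) \<subseteq> coords c ` W" using R by (auto simp: r_def)
  obtain \<psi> where \<psi>: "smooth_on_open UNIV \<psi>" "\<And>x. 0 \<le> \<psi> x" "\<And>x. \<psi> x \<le> 1"
    "\<And>x. x \<in> ball ?x r \<Longrightarrow> \<psi> x = 1" "\<And>x. x \<notin> cball ?x (2 * r) \<Longrightarrow> \<psi> x = 0"
    using plateau[OF r(1)] by blast
  define K where "K = {q \<in> dom. coords c q \<in> cball ?x (2 * r)}"
  define N where "N = {q \<in> dom. coords c q \<in> ball ?x r}"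
  define h where "h q = (if q \<in> dom then \<psi> (coords c q) else 0)" for q
  have sub: "coords c ` W \<subseteq> coords c ` dom" using W by auto
  have inW: "q \<in> W" if "q \<in> dom" "coords c q \<in> coords c ` W" for q
    using that W inj_coords by (auto simp: inj_on_def subset_iff)
  have K: "compactin X K"
    unfolding K_def by (rule compactin_preimage_cball) (use r sub in blast)
  have KW: "K \<subseteq> W" using r inW by (auto simp: K_def)
  have NK: "N \<subseteq> K" using r by (auto simp: N_def K_def)
  have "sm c h"
  proof -
    have "smooth_on_open (coords c ` dom) \<psi>" using \<psi>(1) smooth_on_open_subset by blast
    then have "smooth_on_open (coords c ` dom) (h \<circ> param c)"
      by (rule smooth_on_open_cong[OF open_coords_dom, THEN iffD1, rotated]) (simp add: h_def param_dom)
    then show ?thesis by (simp add: smooth_in_chart_def)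
  qed
  then have "smooth_fun h"
    by (rule smooth_fun_extend[OF c _ K]) (use KW W \<psi>(5) in \<open>auto simp: h_def K_def\<close>)
  moreover have "openin X N"
    unfolding N_def by (rule openin_preimage) simp
  moreover have "p \<in> N" using W r by (auto simp: N_def)
  ultimately show ?thesis
    using that[of h K N] K KW NK \<psi> by (auto simp: h_def K_def N_def)
qed

text \<open>A linear function of the coordinates times a cutoff function. It provides global
  functions with prescribed differential at a point, both to test the transformation of the
  curvature and to build \<Pi> from cubes of differentials.\<close>

lemma linear_function:
  assumes c: "c \<in> A" "p \<in> chart_dom c"
  obtains u N where "smooth_fun u" "openin X N" "p \<in> N" "N \<subseteq> chart_dom c"
    "\<And>q i. q \<in> N \<Longrightarrow> pd c i u q = \<xi> i"
proof -
  interpret chart X c by (rule chart_ax[OF c(1)])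
  obtain h K N where h: "smooth_fun h" "compactin X K" "K \<subseteq> dom" "\<And>q. q \<notin> K \<Longrightarrow> h q = 0"
    "openin X N" "p \<in> N" "N \<subseteq> dom" "\<And>q. q \<in> N \<Longrightarrow> h q = 1"
    using cutoff[OF c(1) openin_dom c(2)] by (metis order_refl)
  let ?l = "\<lambda>q. \<Sum>a\<in>UNIV. \<xi> a * coords c q $ a"
  have coord: "sm c (\<lambda>q. coords c q $ a)" for a
    using transition[OF c(1) c(1)] by simp
  then have l: "sm c ?l" by (intro sm_sum sm_mult sm_const)
  have "smooth_fun (\<lambda>q. h q * ?l q)"
  proof (rule smooth_fun_extend[OF c(1) _ h(2,3)])
    show "sm c (\<lambda>q. h q * ?l q)" using h(1) c l by (intro sm_mult) (auto simp: smooth_fun_def)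
  qed (simp add: h(4))
  moreover have "pd c i (\<lambda>q. h q * ?l q) q = \<xi> i" if q: "q \<in> N" for q i
  proof -
    have qd: "q \<in> dom" using q h(7) by auto
    have "pd c i (\<lambda>q. h q * ?l q) q = pd c i ?l q"
      by (rule pd_cong[OF h(5) q h(7)]) (simp add: h(8))
    also have "\<dots> = (\<Sum>a\<in>UNIV. \<xi> a * (if i = a then 1 else 0))"
      using coord qd by (simp add: pd_sum mdiff_mult sm_mdiff pd_mult' pd_coord)
    finally show ?thesis by (simp add: if_distrib cong: if_cong)
  qed
  ultimately show ?thesis using that h by blast
qed

end

section \<open>Invariance of \<open>\<K>(\<nabla>)\<close> under changes of coordinates\<close>

locale symplectic_mfd = smooth_mfd X A for X :: "'m topology" and A :: "('m, 'n::finite) chart set" +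
  fixes Om :: "('m, 'n) field2"
  assumes Om: "symplectic_form A Om"

locale symplectic_conn = symplectic_mfd X A Om
  for X :: "'m topology" and A :: "('m, 'n::finite) chart set" and Om :: "('m, 'n) field2" +
  fixes G :: "('m, 'n) field3"
  assumes G: "symplectic_connection A Om G"
begin

lemma sympl_chart_ax: "c \<in> A \<Longrightarrow> sympl_chart X c Om G"
proof (rule sympl_chart.intro[OF chart_ax], assumption, unfold_locales)
  assume c: "c \<in> A"
  show "sm c (Om c i j)" "sm c (G c i j k)" for i j k
    using c Om G unfolding symplectic_form_def covariant_tensor2_def symplectic_connection_def affine_connection_def by blast+
  fix p assume p: "p \<in> chart_dom c"
  show "Om c i j p = - Om c j i p" "invertible (\<chi> i j. Om c i j p)" for i j
    using c p Om unfolding symplectic_form_def by blast+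
  show "G c i j k p = G c j i k p" "nabla_cov2 G Om c i j k p = 0" for i j k
    using c p G unfolding symplectic_connection_def torsion_free_def by blast+
qed

lemma affine: "affine_connection A G"
  using G by (simp add: symplectic_connection_def)

end

context symplectic_mfd
begin

lemma Om_trans:
  assumes "c \<in> A" "d \<in> A" "p \<in> chart_dom c \<inter> chart_dom d"
  shows "Om c i j p = (\<Sum>a\<in>UNIV. \<Sum>b\<in>UNIV. jac c d i a p * jac c d j b p * Om d a b p)"
  using assms Om unfolding symplectic_form_def covariant_tensor2_def by blast

lemma w_om':
  assumes "c \<in> A" "p \<in> chart_dom c"
  shows "mm (\<lambda>i j. Om_up Om c i j p) (\<lambda>i j. Om c i j p) i j = (if i = j then - 1 else 0)"
    "mm (\<lambda>i j. Om c i j p) (\<lambda>i j. Om_up Om c i j p) i j = (if i = j then - 1 else 0)"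
proof -
  have "invertible (\<chi> i j. Om c i j p)"
    using assms Om unfolding symplectic_form_def by blast
  from matrix_inv_inverse[OF this]
  show "mm (\<lambda>i j. Om_up Om c i j p) (\<lambda>i j. Om c i j p) i j = (if i = j then - 1 else 0)"
    "mm (\<lambda>i j. Om c i j p) (\<lambda>i j. Om_up Om c i j p) i j = (if i = j then - 1 else 0)"
    by (simp_all add: mm_def Om_up_def vec_eq_iff matrix_matrix_mult_def mat_def sum_negf)
qed

text \<open>The law for \<open>Om\<close> and the invertibility of the Jacobian show that the
  transformed matrix \<open>V\<close> inverts \<open>Om d\<close> up to sign; comparison with
  \<open>Om_up Om d\<close> gives equality.\<close>

lemma w_trans:
  assumes cd: "c \<in> A" "d \<in> A" "p \<in> chart_dom c \<inter> chart_dom d"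
  shows "(\<Sum>i\<in>UNIV. \<Sum>k\<in>UNIV. Om_up Om c i k p * (jac c d i a p * jac c d k b p)) = Om_up Om d a b p"
proof -
  let ?J = "\<lambda>i a. jac c d i a p" and ?J' = "\<lambda>a i. jac d c a i p"
  let ?T = "\<lambda>a i. jac c d i a p" and ?T' = "\<lambda>i a. jac d c a i p"
  let ?w = "\<lambda>i j. Om_up Om c i j p" and ?o = "\<lambda>i j. Om c i j p"
  let ?w' = "\<lambda>i j. Om_up Om d i j p" and ?o' = "\<lambda>i j. Om d i j p"
  define V where "V = mm ?T (mm ?w ?J)"
  have p: "p \<in> chart_dom c" "p \<in> chart_dom d" using cd by auto
  have V: "V a b = (\<Sum>i\<in>UNIV. \<Sum>k\<in>UNIV. ?w i k * (?J i a * ?J k b))" for a b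
    by (simp add: V_def mm_def sum_distrib_left mult_ac)
  have o: "mm ?J (mm ?o' ?T) = ?o"
    by (intro ext) (simp add: mm_def Om_trans[OF cd] sum_distrib_left mult_ac)
  have TT: "mm ?T ?T' a b = (if a = b then 1 else 0)" for a b
    using jac_inverse[OF cd(2,1), of p b a] cd(3) by (simp add: mm_def mult.commute Int_commute eq_commute)
  have id: "mm M (mm ?T ?T') i j = M i j" for M i j
    by (simp add: mm_def TT[unfolded mm_def] if_distrib cong: if_cong)
  have "mm (mm V ?o') ?T i j = - ?T i j" for i j
  proof -
    have "mm (mm V ?o') ?T i j = mm ?T (mm ?w (mm ?J (mm ?o' ?T))) i j"
      by (simp add: V_def mm_assoc[abs_def])
    also have "\<dots> = - ?T i j"
      unfolding o by (simp add: mm_neg_delta(2)[of "mm ?w ?o", OF w_om'(1)[OF cd(1) p(1)]])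
    finally show ?thesis .
  qed
  then have 1: "mm (mm (mm V ?o') ?T) ?T' i j = - mm ?T ?T' i j" for i j
    by (simp add: mm_def sum_negf)
  have Vo: "mm V ?o' i j = (if i = j then - 1 else 0)" for i j
    using 1[of i j] id[of "mm V ?o'" i j] by (simp add: mm_assoc[of "mm V ?o'"] TT)
  have "- V a b = mm V (mm ?o' ?w') a b"
    by (simp add: mm_neg_delta(2)[of "mm ?o' ?w'", OF w_om'(2)[OF cd(2) p(2)]])
  also have "\<dots> = mm (mm V ?o') ?w' a b"
    by (simp add: mm_assoc)
  also have "\<dots> = - ?w' a b"
    by (simp add: mm_neg_delta(1)[of "mm V ?o'", OF Vo])
  finally show ?thesis using V by simp
qed

end

section \<open>The curvature is a tensor and \<K> a scalar\<close>

context symplectic_conn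
begin

lemma smooth_fun_mdiff: "smooth_fun u \<Longrightarrow> d \<in> A \<Longrightarrow> p \<in> chart_dom d \<Longrightarrow> mdiff d u p"
  unfolding smooth_fun_def by (rule smooth_in_chart_mdiff) auto

lemma tensorial_d: "smooth_fun u \<Longrightarrow> tensorial 1 (\<lambda>c I. pd c (hd I) u)"
  unfolding tensorial_def
proof (intro conjI ballI allI impI)
  assume u: "smooth_fun u"
  show "sm c (pd c (hd I) u)" if "c \<in> A" for c I
    using u chart.sm_pd[OF chart_ax[OF that]] that by (simp add: smooth_fun_def)
  fix c d p I assume cd: "c \<in> A" "d \<in> A" "p \<in> chart_dom c \<inter> chart_dom d" and "length (I :: 'n list) = 1"
  then obtain i where I: "I = [i]" by (auto simp: length_Suc_conv)
  have "mdiff d u p" using smooth_fun_mdiff[OF u cd(2)] cd(3) by simp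
  from pd_chain(2)[OF cd this] show "pd c (hd I) u p = transf (\<lambda>j a. jac c d j a p) I (\<lambda>B. pd d (hd B) u p)"
    by (simp add: I)
qed

text \<open>Contracted with a differential, the curvature is the antisymmetrised second covariant
  derivative of that differential, which is a covariant tensor by \<open>tensorial_nab\<close>. In
  this way the second derivatives of the transition maps are dealt with by
  \<open>tensorial_nab\<close> alone.\<close>

lemma curvature_d_trans:
  assumes cd: "c \<in> A" "d \<in> A" "p \<in> chart_dom c \<inter> chart_dom d" and u: "smooth_fun u"
  shows "(\<Sum>k\<in>UNIV. curvature G c i j s k p * pd c k u p)
    = transf (\<lambda>j a. jac c d j a p) [i, j, s] (\<lambda>B. \<Sum>k\<in>UNIV. curvature G d (B ! 0) (B ! 1) (B ! 2) k p * pd d k u p)"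
proof -
  define T1 where "T1 c I = pd c (hd I) u" for c :: "('m, 'n) chart" and I
  define T2 where "T2 c I = nab G c (hd I) (T1 c) (tl I)" for c I
  define T3 where "T3 c I = nab G c (hd I) (T2 c) (tl I)" for c I
  have T3: "tensorial 3 T3"
    using tensorial_nab[OF affine tensorial_nab[OF affine tensorial_d[OF u]]]
    by (simp add: T3_def[abs_def] T2_def[abs_def] T1_def[abs_def] eval_nat_numeral)
  have R: "T3 c [i, j, s] p - T3 c [j, i, s] p = - (\<Sum>k\<in>UNIV. curvature G c i j s k p * pd c k u p)"
    if c: "c \<in> A" "p \<in> chart_dom c" for c i j s
  proof -
    interpret sympl_chart X c Om G by (rule sympl_chart_ax[OF c(1)])
    have T1: "sm c (T1 c B)" for B
      using u c(1) sm_pd by (simp add: T1_def smooth_fun_def)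
    have "T3 c [i, j, s] p = nab G c i (nab G c j (T1 c)) [s] p - (\<Sum>q\<in>UNIV. G c i j q p * T2 c [q, s] p)" for i j
      by (simp add: T3_def nab_Cons[of _ "T2 c"]) (simp add: T2_def)
    then show ?thesis
      using nab_commutator[where T = "T1 c" and i = i and j = j and I = "[s]", OF c(2) T1] G_sym[OF c(2), of i j] by (simp add: T1_def)
  qed
  have "T3 c [i, j, s] p - T3 c [j, i, s] p
    = transf (\<lambda>j a. jac c d j a p) [i, j, s] (\<lambda>B. T3 d B p) - transf (\<lambda>j a. jac c d j a p) [j, i, s] (\<lambda>B. T3 d B p)"
    using tensorialD(2)[OF T3 cd(1) _ cd(2,3)] by simp
  also have "transf (\<lambda>j a. jac c d j a p) [j, i, s] (\<lambda>B. T3 d B p)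
    = transf (\<lambda>j a. jac c d j a p) [i, j, s] (\<lambda>B. T3 d [B ! 1, B ! 0, B ! 2] p)"
    by (simp add: sum_distrib_left mult.left_commute) (rule sum.swap)
  also have "transf (\<lambda>j a. jac c d j a p) [i, j, s] (\<lambda>B. T3 d B p) - \<dots>
    = transf (\<lambda>j a. jac c d j a p) [i, j, s] (\<lambda>B. - (\<Sum>k\<in>UNIV. curvature G d (B ! 0) (B ! 1) (B ! 2) k p * pd d k u p))"
    unfolding transf_diff[symmetric]
  proof (rule transf_cong)
    fix B :: "'n list" assume "length B = length [i, j, s]"
    then obtain a b e where "B = [a, b, e]" by (auto simp: length_Suc_conv)
    then show "T3 d B p - T3 d [B ! 1, B ! 0, B ! 2] p
      = - (\<Sum>k\<in>UNIV. curvature G d (B ! 0) (B ! 1) (B ! 2) k p * pd d k u p)"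
      using R[OF cd(2), of a b e] cd(3) by simp
  qed
  also have "\<dots> = - transf (\<lambda>j a. jac c d j a p) [i, j, s] (\<lambda>B. \<Sum>k\<in>UNIV. curvature G d (B ! 0) (B ! 1) (B ! 2) k p * pd d k u p)"
    by (rule transf_cmult[of _ _ "- 1", simplified])
  finally show ?thesis using R[OF cd(1), of i j s] cd(3) by simp
qed

text \<open>\<open>curvature_d_trans\<close> for a function whose differential is that of the
  coordinate \<open>a\<close> of \<open>d\<close> near \<open>p\<close>; this isolates a single
  upper index.\<close>

lemma curvature_trans:
  assumes cd: "c \<in> A" "d \<in> A" "p \<in> chart_dom c \<inter> chart_dom d"
  shows "(\<Sum>k\<in>UNIV. curvature G c i j s k p * jac c d k a p)
    = transf (\<lambda>j a. jac c d j a p) [i, j, s] (\<lambda>B. curvature G d (B ! 0) (B ! 1) (B ! 2) a p)"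
proof -
  obtain u N where u: "smooth_fun u" "p \<in> N" "\<And>q i. q \<in> N \<Longrightarrow> pd d i u q = (if i = a then 1 else 0)"
    by (rule linear_function[OF cd(2), of p "\<lambda>i. if i = a then 1 else 0"]) (use cd(3) in blast)+
  have "mdiff d u p" using smooth_fun_mdiff[OF u(1) cd(2)] cd(3) by simp
  then have "pd c k u p = jac c d k a p" for k
    using pd_chain(2)[OF cd] u(2,3) by (simp add: mm_delta_sum)
  then show ?thesis
    using curvature_d_trans[OF cd u(1), of i j s] u(2,3) by (simp add: mm_delta_sum)
qed

lemma tensorial_curvature_low: "tensorial 4 (\<lambda>c. sympl_chart.RL c Om G)"
  unfolding tensorial_def
proof (intro conjI ballI allI impI)
  show "sm c (sympl_chart.RL c Om G I)" if "c \<in> A" for c I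
    by (rule sympl_chart.sm_RL[OF sympl_chart_ax[OF that]])
  fix c d p I assume cd: "c \<in> A" "d \<in> A" "p \<in> chart_dom c \<inter> chart_dom d" and "length (I :: 'n list) = 4"
  then obtain i j k l where I: "I = [i, j, k, l]" by (auto simp: length_Suc_conv eval_nat_numeral)
  let ?J = "\<lambda>j a. jac c d j a p"
  have "curvature_low Om G c i j k l p
    = (\<Sum>q\<in>UNIV. \<Sum>a\<in>UNIV. \<Sum>b\<in>UNIV. curvature G c i j k q p * ?J q a * (?J l b * Om d a b p))"
    by (simp add: curvature_low_def Om_trans[OF cd] sum_distrib_left mult_ac)
  also have "\<dots> = (\<Sum>a\<in>UNIV. \<Sum>q\<in>UNIV. \<Sum>b\<in>UNIV. curvature G c i j k q p * ?J q a * (?J l b * Om d a b p))"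
    by (rule sum.swap)
  also have "\<dots> = (\<Sum>a\<in>UNIV. (\<Sum>q\<in>UNIV. curvature G c i j k q p * ?J q a) * (\<Sum>b\<in>UNIV. ?J l b * Om d a b p))"
    by (simp add: sum_distrib_left sum_distrib_right mult_ac)
  also have "\<dots> = transf ?J [i, j, k] (\<lambda>B. \<Sum>a\<in>UNIV. (\<Sum>b\<in>UNIV. ?J l b * Om d a b p) * curvature G d (B ! 0) (B ! 1) (B ! 2) a p)"
    unfolding curvature_trans[OF cd] transf_lin by (simp only: mult.commute)
  also have "\<dots> = transf ?J [i, j, k] (\<lambda>B. \<Sum>b\<in>UNIV. ?J l b * curvature_low Om G d (B ! 0) (B ! 1) (B ! 2) b p)"
  proof -
    have "(\<Sum>a\<in>UNIV. (\<Sum>b\<in>UNIV. ?J l b * Om d a b p) * curvature G d x y z a p)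
      = (\<Sum>b\<in>UNIV. ?J l b * curvature_low Om G d x y z b p)" for x y z
    proof -
      have "(\<Sum>a\<in>UNIV. (\<Sum>b\<in>UNIV. ?J l b * Om d a b p) * curvature G d x y z a p)
        = (\<Sum>a\<in>UNIV. \<Sum>b\<in>UNIV. ?J l b * (curvature G d x y z a p * Om d a b p))"
        by (simp add: sum_distrib_left sum_distrib_right mult_ac)
      also have "\<dots> = (\<Sum>b\<in>UNIV. \<Sum>a\<in>UNIV. ?J l b * (curvature G d x y z a p * Om d a b p))"
        by (rule sum.swap)
      finally show ?thesis by (simp add: curvature_low_def sum_distrib_left)
    qed
    then show ?thesis by simp
  qed
  also have "\<dots> = transf ?J [i, j, k, l] (\<lambda>B. sympl_chart.RL d Om G B p)"
    by (simp add: sympl_chart.RL_def[OF sympl_chart_ax[OF cd(2)]])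
  finally show "sympl_chart.RL c Om G I p = transf ?J I (\<lambda>B. sympl_chart.RL d Om G B p)"
    by (simp add: I sympl_chart.RL_def[OF sympl_chart_ax[OF cd(1)]])
qed

text \<open>The trace is rewritten by inserting a Jacobian and its inverse, so that
  \<open>curvature_trans\<close> applies to the upper index. The other Jacobian comes from the
  contracted lower index, and the two cancel.\<close>

lemma tensorial_ricci: "tensorial 2 (\<lambda>c. sympl_chart.RicL c G)"
  unfolding tensorial_def
proof (intro conjI ballI allI impI)
  show "sm c (sympl_chart.RicL c G I)" if "c \<in> A" for c I
    by (rule sympl_chart.sm_RicL[OF sympl_chart_ax[OF that]])
  fix c d p I assume cd: "c \<in> A" "d \<in> A" "p \<in> chart_dom c \<inter> chart_dom d" and "length (I :: 'n list) = 2"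
  then obtain i j where I: "I = [i, j]" by (auto simp: length_Suc_conv eval_nat_numeral)
  let ?J = "\<lambda>j a. jac c d j a p" and ?J' = "\<lambda>j a. jac d c j a p"
  have inv: "(\<Sum>a\<in>UNIV. ?J k a * ?J' a q) = (if k = q then 1 else 0)" for k q
    by (rule jac_inverse[OF cd])
  have inv': "(\<Sum>q\<in>UNIV. ?J' a q * ?J q b) = (if a = b then 1 else 0)" for a b
    using jac_inverse[OF cd(2,1)] cd(3) by blast
  have R: "curvature G c q i j q p = (\<Sum>a\<in>UNIV. ?J' a q * (\<Sum>k\<in>UNIV. curvature G c q i j k p * ?J k a))" for q
  proof -
    have "(\<Sum>a\<in>UNIV. ?J' a q * (\<Sum>k\<in>UNIV. curvature G c q i j k p * ?J k a))
      = (\<Sum>a\<in>UNIV. \<Sum>k\<in>UNIV. curvature G c q i j k p * (?J k a * ?J' a q))"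
      by (simp add: sum_distrib_left mult_ac)
    also have "\<dots> = (\<Sum>k\<in>UNIV. curvature G c q i j k p * (\<Sum>a\<in>UNIV. ?J k a * ?J' a q))"
      by (subst sum.swap) (simp add: sum_distrib_left)
    finally show ?thesis by (simp add: inv mm_delta_sum)
  qed
  define Z where "Z a b = transf ?J [i, j] (\<lambda>B. curvature G d b (B ! 0) (B ! 1) a p)" for a b
  have "ricci G c i j p = (\<Sum>q\<in>UNIV. \<Sum>a\<in>UNIV. ?J' a q * (\<Sum>b\<in>UNIV. ?J q b * Z a b))"
    unfolding ricci_def by (subst R) (simp add: curvature_trans[OF cd] Z_def)
  also have "\<dots> = (\<Sum>a\<in>UNIV. \<Sum>q\<in>UNIV. \<Sum>b\<in>UNIV. (?J' a q * ?J q b) * Z a b)"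
    by (subst sum.swap) (simp add: sum_distrib_left mult.assoc)
  also have "\<dots> = (\<Sum>a\<in>UNIV. \<Sum>b\<in>UNIV. (\<Sum>q\<in>UNIV. ?J' a q * ?J q b) * Z a b)"
    by (simp add: sum_distrib_right) (intro sum.cong refl sum.swap)
  also have "\<dots> = (\<Sum>a\<in>UNIV. Z a a)"
    by (simp add: inv' if_distrib if_distribR cong: if_cong)
  also have "\<dots> = transf ?J [i, j] (\<lambda>B. ricci G d (B ! 0) (B ! 1) p)"
    unfolding Z_def ricci_def transf_sum ..
  finally show "sympl_chart.RicL c G I p = transf ?J I (\<lambda>B. sympl_chart.RicL d G B p)"
    by (simp add: I sympl_chart.RicL_def[OF sympl_chart_ax[OF cd(1)]] sympl_chart.RicL_def[OF sympl_chart_ax[OF cd(2)]])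
qed

lemma pairing_invariant:
  assumes cd: "c \<in> A" "d \<in> A" "p \<in> chart_dom c \<inter> chart_dom d" and S: "tensorial r S" and T: "tensorial r T"
  shows "pairing (\<lambda>i j. Om_up Om c i j p) r (\<lambda>B C. S c B p * T c C p)
    = pairing (\<lambda>i j. Om_up Om d i j p) r (\<lambda>B C. S d B p * T d C p)"
proof -
  let ?J = "\<lambda>j a. jac c d j a p"
  have "pairing (\<lambda>i j. Om_up Om c i j p) r (\<lambda>B C. S c B p * T c C p)
    = pairing (\<lambda>i j. Om_up Om c i j p) r (\<lambda>B C. transf ?J B (\<lambda>B'. transf ?J C (\<lambda>C'. S d B' p * T d C' p)))"
  proof (rule pairing_cong)
    fix B C :: "'n list" assume BC: "length B = r" "length C = r"
    note t = tensorialD(2)[OF S cd(1) BC(1) cd(2,3)] tensorialD(2)[OF T cd(1) BC(2) cd(2,3)]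
    have "transf ?J C (\<lambda>C'. S d B' p * T d C' p) = T c C p * S d B' p" for B'
      unfolding t(2) transf_cmult by (rule mult.commute)
    then show "S c B p * T c C p = transf ?J B (\<lambda>B'. transf ?J C (\<lambda>C'. S d B' p * T d C' p))"
      by (simp only: transf_cmult t(1)[symmetric]) (rule mult.commute)
  qed
  then show ?thesis
    using pairing_trans[of "\<lambda>i j. Om_up Om c i j p" ?J "\<lambda>i j. Om_up Om d i j p", OF w_trans[OF cd]] by simp
qed

text \<open>The second covariant derivative of Ricci is one tensor of rank 4 whose first two indices
  are contracted with its last two; \<open>pairing\<close> sees it as a function of two lists of
  length 2.\<close>

lemma divdiv_ricci_invariant:
  assumes cd: "c \<in> A" "d \<in> A" "p \<in> chart_dom c \<inter> chart_dom d"
  shows "divdiv_ricci Om G c p = divdiv_ricci Om G d p"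
proof -
  define T where "T c I = nab G c (hd I) (\<lambda>I. nab G c (hd I) (sympl_chart.RicL c G) (tl I)) (tl I)" for c I
  have T: "tensorial 4 T"
    using tensorial_nab[OF affine tensorial_nab[OF affine tensorial_ricci]]
    by (simp add: T_def[abs_def] eval_nat_numeral)
  have eq: "divdiv_ricci Om G c p = pairing (\<lambda>i j. Om_up Om c i j p) 2 (\<lambda>B C. T c (B @ C) p)"
    if c: "c \<in> A" "p \<in> chart_dom c" for c
  proof -
    interpret sympl_chart X c Om G by (rule sympl_chart_ax[OF c(1)])
    have "nabla_cov3 G (nabla_cov2 G (ricci G)) c a b i j p = T c [a, b, i, j] p" for a b i j
    proof -
      have "nab G c b RicL [i, j] = nabla_cov2 G (ricci G) c b i j" for b i j
        by (simp add: fun_eq_iff nab_def nabla_cov2_def RicL_def)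
      then show ?thesis
        by (simp add: T_def nab_def[of G c a] nabla_cov3_def)
    qed
    then show ?thesis
      unfolding divdiv_ricci_def
      by (simp add: eval_nat_numeral sum_distrib_left mult_ac) (intro sum.cong refl sum.swap)
  qed
  let ?J = "\<lambda>j a. jac c d j a p"
  have "pairing (\<lambda>i j. Om_up Om c i j p) 2 (\<lambda>B C. T c (B @ C) p)
    = pairing (\<lambda>i j. Om_up Om c i j p) 2 (\<lambda>B C. transf ?J B (\<lambda>B'. transf ?J C (\<lambda>C'. T d (B' @ C') p)))"
  proof (rule pairing_cong)
    fix B C :: "'n list" assume BC: "length B = 2" "length C = 2"
    have app: "transf ?J (B @ C) F = transf ?J B (\<lambda>B'. transf ?J C (\<lambda>C'. F (B' @ C')))" for B C F
      by (induction B arbitrary: F) simp_all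
    show "T c (B @ C) p = transf ?J B (\<lambda>B'. transf ?J C (\<lambda>C'. T d (B' @ C') p))"
      using app[of B C "\<lambda>L. T d L p"] tensorialD(2)[OF T cd(1) _ cd(2,3), of "B @ C"] BC by simp
  qed
  also have "\<dots> = pairing (\<lambda>i j. Om_up Om d i j p) 2 (\<lambda>B C. T d (B @ C) p)"
    using pairing_trans[of "\<lambda>i j. Om_up Om c i j p" ?J "\<lambda>i j. Om_up Om d i j p", OF w_trans[OF cd]] by simp
  finally show ?thesis using eq cd by auto
qed

lemma K_in_chart_invariant:
  assumes cd: "c \<in> A" "d \<in> A" "p \<in> chart_dom c \<inter> chart_dom d"
  shows "K_in_chart Om G c p = K_in_chart Om G d p"
proof -
  have "K_in_chart Om G c p = divdiv_ricci Om G c p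
     - 1 / 2 * pairing (\<lambda>i j. Om_up Om c i j p) 2 (\<lambda>B C. sympl_chart.RicL c G B p * sympl_chart.RicL c G C p)
     + 1 / 4 * pairing (\<lambda>i j. Om_up Om c i j p) 4 (\<lambda>B C. sympl_chart.RL c Om G B p * sympl_chart.RL c Om G C p)"
    if c: "c \<in> A" "p \<in> chart_dom c" for c
    using sympl_chart.K_in_chart_pairing[OF sympl_chart_ax] sympl_chart.divdiv_ricci_eq[OF sympl_chart_ax] c by simp
  then show ?thesis
    using cd divdiv_ricci_invariant[OF cd] pairing_invariant[OF cd tensorial_ricci tensorial_ricci]
      pairing_invariant[OF cd tensorial_curvature_low tensorial_curvature_low] by simp
qed

lemma K_curv_eq:
  assumes "c \<in> A" "p \<in> chart_dom c"
  shows "K_curv A Om G p = K_in_chart Om G c p"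
proof -
  define d where "d = (SOME c. c \<in> A \<and> p \<in> chart_dom c)"
  have "d \<in> A \<and> p \<in> chart_dom d"
    unfolding d_def by (rule someI[of _ c]) (use assms in simp)
  then show ?thesis
    unfolding K_curv_def d_def[symmetric] using K_in_chart_invariant[of d c p] assms by simp
qed

end

section \<open>The volume form\<close>

lemma prod_pairs: "(\<Prod>x<2 * m. g x) = (\<Prod>k<m. g (2 * k) * g (2 * k + 1))"
  for g :: "nat \<Rightarrow> 'a::comm_monoid_mult"
  by (induction m) (simp_all add: mult_ac)

text \<open>The Pfaffian, up to a constant factor, of a matrix whose index type is enumerated by \<open>e\<close>.\<close>

definition pf :: "nat \<Rightarrow> (nat \<Rightarrow> 'n::finite) \<Rightarrow> ('n \<Rightarrow> 'n \<Rightarrow> real) \<Rightarrow> real" where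
  "pf m e B = (\<Sum>s | s permutes {..<2 * m}. of_int (sign s) * (\<Prod>k<m. B (e (s (2 * k))) (e (s (2 * k + 1)))))"

text \<open>The standard symplectic matrix, with \<open>2 * k\<close> and \<open>2 * k + 1\<close>
  as conjugate indices.\<close>

definition std :: "nat \<Rightarrow> nat \<Rightarrow> real" where
  "std x y = (if even x \<and> y = Suc x then 1 else if even y \<and> x = Suc y then - 1 else 0)"

text \<open>\<open>std\<close> depends only on whether two indices lie in the same conjugate pair
  and on their positions in it, and \<tau> exchanges whole pairs.\<close>

lemma std_transpose:
  assumes "even j" "even l"
  defines "\<tau> \<equiv> Transposition.transpose j l \<circ> Transposition.transpose (Suc j) (Suc l)"
  shows "std (\<tau> x) (\<tau> y) = std x y"
proof -
  obtain a b where ab: "j = 2 * a" "l = 2 * b" using assms(1,2) by (auto elim!: evenE)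
  have div_mod: "\<tau> x div 2 = Transposition.transpose a b (x div 2) \<and> \<tau> x mod 2 = x mod 2" for x
  proof -
    have "x = 2 * (x div 2) \<or> x = Suc (2 * (x div 2))" by presburger
    then obtain d where "x = 2 * d \<or> x = Suc (2 * d)" by blast
    then show ?thesis
      by (auto simp: \<tau>_def ab Transposition.transpose_def double_not_eq_Suc_double Suc_double_not_eq_double)
  qed
  have std: "std x y = (if x div 2 = y div 2 then real (y mod 2) - real (x mod 2) else 0)" for x y
  proof -
    have "x = 2 * (x div 2) \<or> x = Suc (2 * (x div 2))" by presburger
    then obtain d where "x = 2 * d \<or> x = Suc (2 * d)" by blast
    moreover obtain d' where "y = 2 * d' \<or> y = Suc (2 * d')"
      using oddE[of y] evenE[of y] by (metis Suc_eq_plus1)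
    ultimately show ?thesis
      by (auto simp: std_def double_not_eq_Suc_double Suc_double_not_eq_double)
  qed
  have "Transposition.transpose a b u = Transposition.transpose a b v \<longleftrightarrow> u = v" for u v
    by (metis transpose_involutory)
  then show ?thesis
    by (simp add: std div_mod)
qed

text \<open>No cancellation occurs in the Pfaffian of \<open>std\<close>. The image of the last pair
  must be a conjugate pair if the product is nonzero; moving that pair to the end with an even
  permutation leaves a permutation of the smaller index set.\<close>

lemma std_perm_nonneg:
  "s permutes {..<2 * m} \<Longrightarrow> of_int (sign s) * (\<Prod>k<m. std (s (2 * k)) (s (2 * k + 1))) \<ge> 0"
proof (induction m arbitrary: s)
  case 0
  then show ?case by simp
next
  case (Suc m)
  let ?a = "s (2 * m)" and ?b = "s (2 * m + 1)"
  have fin: "finite {..<2 * Suc m}" by simp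
  show ?case
  proof (cases "std ?a ?b = 0")
    case True
    then show ?thesis by simp
  next
    case False
    then obtain j where j: "even j" "(?a = j \<and> ?b = Suc j) \<or> (?a = Suc j \<and> ?b = j)"
      by (auto simp: std_def split: if_splits)
    have lt: "?a < 2 * Suc m" "?b < 2 * Suc m"
      using permutes_in_image[OF Suc.prems, of "2 * m"] permutes_in_image[OF Suc.prems, of "2 * m + 1"] by auto
    have jm: "j \<le> 2 * m" "Suc j \<le> 2 * m + 1" using lt j by auto
    \<comment> \<open>Exchanges the pair that starts at \<open>j\<close> with the last pair: two
      transpositions, so the sign does not change.\<close>
    define \<tau> where "\<tau> = Transposition.transpose j (2 * m) \<circ> Transposition.transpose (Suc j) (Suc (2 * m))"
    have \<tau>: "\<tau> permutes {..<2 * Suc m}"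
      unfolding \<tau>_def using jm by (intro permutes_compose permutes_swap_id) auto
    have sign_\<tau>: "sign \<tau> = 1"
      unfolding \<tau>_def by (subst sign_compose) (auto simp: sign_swap_id permutation_swap_id)
    have \<tau>j: "\<tau> j = 2 * m" "\<tau> (Suc j) = Suc (2 * m)"
      using j(1) by (auto simp: \<tau>_def Transposition.transpose_def)
    define s1 where "s1 = \<tau> \<circ> s"
    have s1: "s1 permutes {..<2 * Suc m}"
      unfolding s1_def using permutes_compose[OF Suc.prems \<tau>] .
    have perm: "permutation s" "permutation \<tau>" "permutation s1"
      using Suc.prems \<tau> s1 fin permutation_permutes by blast+
    have sign1: "sign s1 = sign s"
      unfolding s1_def using perm by (simp add: sign_compose sign_\<tau>)
    have std1: "std (s1 x) (s1 y) = std (s x) (s y)" for x y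
      unfolding s1_def \<tau>_def o_def using std_transpose[OF j(1), of "2 * m" "s x" "s y"] by (simp add: o_def)
    consider "s1 (2 * m) = 2 * m" "s1 (2 * m + 1) = 2 * m + 1"
      | "s1 (2 * m) = 2 * m + 1" "s1 (2 * m + 1) = 2 * m"
      using j(2) \<tau>j by (auto simp: s1_def)
    then have "of_int (sign s1) * (\<Prod>k<Suc m. std (s1 (2 * k)) (s1 (2 * k + 1))) \<ge> 0"
    proof cases
      case 1
      have "s1 permutes {..<2 * m}"
        using s1 1 by (rule_tac permutes_superset[of _ "{..<2 * Suc m}"]) (auto simp: less_Suc_eq)
      from Suc.IH[OF this] show ?thesis
        using 1 by (simp add: std_def)
    next
      case 2
      \<comment> \<open>Restores the order of the last pair. The change of sign is offset by the
        value -1 of \<open>std\<close> on the reversed pair.\<close>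
      define s2 where "s2 = Transposition.transpose (2 * m) (2 * m + 1) \<circ> s1"
      have "s2 permutes {..<2 * Suc m}"
        unfolding s2_def using s1 by (intro permutes_compose permutes_swap_id) auto
      then have s2: "s2 permutes {..<2 * m}"
        using 2 by (rule_tac permutes_superset[of _ "{..<2 * Suc m}"]) (auto simp: less_Suc_eq s2_def)
      have sign2: "sign s2 = - sign s1"
        unfolding s2_def using perm by (simp add: sign_compose sign_swap_id permutation_swap_id)
      have eq: "s2 x = s1 x" if "x < 2 * m" for x
      proof -
        have "s1 x \<noteq> s1 (2 * m)" "s1 x \<noteq> s1 (2 * m + 1)"
          using that by (simp_all add: inj_eq[OF permutes_inj[OF s1]])
        then show ?thesis using 2 by (simp add: s2_def Transposition.transpose_def)
      qed
      have "(\<Prod>k<m. std (s2 (2 * k)) (s2 (2 * k + 1))) = (\<Prod>k<m. std (s1 (2 * k)) (s1 (2 * k + 1)))"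
        by (intro prod.cong refl) (simp add: eq)
      with Suc.IH[OF s2] show ?thesis
        using 2 by (simp add: sign2 std_def)
    qed
    then show ?thesis by (simp add: sign1 std1)
  qed
qed

lemma sum_std_pos: "(\<Sum>s | s permutes {..<2 * m}. of_int (sign s) * (\<Prod>k<m. std (s (2 * k)) (s (2 * k + 1)))) > 0"
proof (rule sum_pos2[of _ id])
  show "finite {s. s permutes {..<2 * m}}" by (simp add: finite_permutations)
  show "0 < of_int (sign id) * (\<Prod>k<m. std (id (2 * k)) (id (2 * k + 1)))"
    by (simp add: std_def)
  show "0 \<le> of_int (sign s) * (\<Prod>k<m. std (s (2 * k)) (s (2 * k + 1)))" if "s \<in> {s. s permutes {..<2 * m}}" for s
    using that std_perm_nonneg by blast
qed (simp add: permutes_id)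

context
  fixes m :: nat and e :: "nat \<Rightarrow> 'n::finite"
  assumes e: "bij_betw e {..<2 * m} UNIV"
begin

lemma pf_eq_sum_UNIV:
  "pf m e B = (\<Sum>\<sigma> | \<sigma> permutes (UNIV :: 'n set). of_int (sign \<sigma>) * (\<Prod>k<m. B (\<sigma> (e (2 * k))) (\<sigma> (e (2 * k + 1)))))"
proof -
  let ?I = "{..<2 * m}"
  have inj: "inj_on e ?I" and im: "e ` ?I = UNIV"
    using e by (auto simp: bij_betw_def)
  have e': "bij_betw (inv_into ?I e) UNIV ?I"
    using bij_betw_inv_into[OF e] .
  have ap: "map_permutation ?I e s (e x) = e (s x)" if "x \<in> ?I" "s permutes ?I" for s x
    using that inj by (auto intro!: map_permutation_apply)
  show ?thesis
    unfolding pf_def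
  proof (rule sum.reindex_bij_witness[where i = "map_permutation UNIV (inv_into ?I e)" and j = "map_permutation ?I e"])
    fix s assume "s \<in> {s. s permutes ?I}"
    then have s: "s permutes ?I" by simp
    show "map_permutation UNIV (inv_into ?I e) (map_permutation ?I e s) = s"
      by (rule map_permutation_compose_inv[OF e s]) (use inj in auto)
    show "map_permutation ?I e s \<in> {\<sigma>. \<sigma> permutes UNIV}"
      using map_permutation_permutes[OF e s] by simp
    show "of_int (sign (map_permutation ?I e s)) * (\<Prod>k<m. B (map_permutation ?I e s (e (2 * k))) (map_permutation ?I e s (e (2 * k + 1))))
      = of_int (sign s) * (\<Prod>k<m. B (e (s (2 * k))) (e (s (2 * k + 1))))"
      using ap[OF _ s] sign_map_permutation[OF inj s] by (auto intro!: prod.cong)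
  next
    fix \<sigma> assume "\<sigma> \<in> {\<sigma>. \<sigma> permutes (UNIV :: 'n set)}"
    then have s: "\<sigma> permutes UNIV" by simp
    show "map_permutation UNIV (inv_into ?I e) \<sigma> \<in> {s. s permutes ?I}"
      using map_permutation_permutes[OF e' s] by simp
    show "map_permutation ?I e (map_permutation UNIV (inv_into ?I e) \<sigma>) = \<sigma>"
      by (rule map_permutation_compose_inv[OF e' s]) (use f_inv_into_f[where f = e and A = "{..<2 * m}", unfolded im] in auto)
  qed
qed

text \<open>The distributive law, where a choice of one pair of indices for each factor is the same
  as a map \<psi> of the index type to itself.\<close>

lemma prod_pair_sum:
  fixes f :: "nat \<Rightarrow> 'n \<Rightarrow> 'n \<Rightarrow> real"
  shows "(\<Prod>k<m. \<Sum>a\<in>UNIV. \<Sum>b\<in>UNIV. f k a b) = (\<Sum>\<psi>\<in>UNIV. \<Prod>k<m. f k (\<psi> (e (2 * k))) (\<psi> (e (2 * k + 1))))"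
proof -
  let ?e' = "inv_into {..<2 * m} e"
  have e'e: "?e' (e x) = x" if "x < 2 * m" for x
    using e that by (auto simp: bij_betw_def)
  have ee': "e (?e' i) = i" and lt: "?e' i < 2 * m" for i
    using e f_inv_into_f[of i e "{..<2 * m}"] inv_into_into[of i e "{..<2 * m}"] by (auto simp: bij_betw_def)
  have "(\<Prod>k<m. \<Sum>a\<in>UNIV. \<Sum>b\<in>UNIV. f k a b) = (\<Prod>k<m. \<Sum>y\<in>UNIV. f k (fst y) (snd y))"
    by (simp add: sum.cartesian_product case_prod_beta)
  also have "\<dots> = (\<Sum>h\<in>PiE {..<m} (\<lambda>_. UNIV). \<Prod>k<m. f k (fst (h k)) (snd (h k)))"
    by (rule prod_sum_PiE) auto
  also have "\<dots> = (\<Sum>\<psi>\<in>UNIV. \<Prod>k<m. f k (\<psi> (e (2 * k))) (\<psi> (e (2 * k + 1))))"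
  proof (rule sum.reindex_bij_witness[where
      i = "\<lambda>\<psi>. \<lambda>k\<in>{..<m}. (\<psi> (e (2 * k)), \<psi> (e (2 * k + 1)))" and
      j = "\<lambda>h i. if even (?e' i) then fst (h (?e' i div 2)) else snd (h (?e' i div 2))"])
    fix h assume h: "h \<in> PiE {..<m} (\<lambda>_. UNIV :: ('n \<times> 'n) set)"
    show "(\<lambda>k\<in>{..<m}. (if even (?e' (e (2 * k))) then fst (h (?e' (e (2 * k)) div 2)) else snd (h (?e' (e (2 * k)) div 2)),
        if even (?e' (e (2 * k + 1))) then fst (h (?e' (e (2 * k + 1)) div 2)) else snd (h (?e' (e (2 * k + 1)) div 2)))) = h"
      using h by (auto simp: e'e fun_eq_iff PiE_def extensional_def)
    show "(\<Prod>k<m. f k (if even (?e' (e (2 * k))) then fst (h (?e' (e (2 * k)) div 2)) else snd (h (?e' (e (2 * k)) div 2)))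
        (if even (?e' (e (2 * k + 1))) then fst (h (?e' (e (2 * k + 1)) div 2)) else snd (h (?e' (e (2 * k + 1)) div 2))))
      = (\<Prod>k<m. f k (fst (h k)) (snd (h k)))"
      by (intro prod.cong refl) (simp add: e'e)
  next
    fix \<psi> :: "'n \<Rightarrow> 'n"
    show "(\<lambda>i. if even (?e' i) then fst ((\<lambda>k\<in>{..<m}. (\<psi> (e (2 * k)), \<psi> (e (2 * k + 1)))) (?e' i div 2))
        else snd ((\<lambda>k\<in>{..<m}. (\<psi> (e (2 * k)), \<psi> (e (2 * k + 1)))) (?e' i div 2))) = \<psi>"
    proof
      fix i
      have "?e' i div 2 < m" using lt[of i] by linarith
      then show "(if even (?e' i) then fst ((\<lambda>k\<in>{..<m}. (\<psi> (e (2 * k)), \<psi> (e (2 * k + 1)))) (?e' i div 2))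
        else snd ((\<lambda>k\<in>{..<m}. (\<psi> (e (2 * k)), \<psi> (e (2 * k + 1)))) (?e' i div 2))) = \<psi> i"
        using ee'[of i] by (auto simp: odd_two_times_div_two_succ)
    qed
  qed auto
  finally show ?thesis .
qed

lemma prod_UNIV_pairs: "(\<Prod>i\<in>UNIV. g i) = (\<Prod>k<m. g (e (2 * k)) * g (e (2 * k + 1)))"
  for g :: "'n \<Rightarrow> real"
  using prod.reindex_bij_betw[OF e, of g] prod_pairs[of "\<lambda>x. g (e x)" m] by simp

text \<open>Expanding the product gives a sum over all maps \<psi>. For fixed \<psi> the sum over
  the permutations is the determinant of the matrix with rows chosen by \<psi>: zero unless \<psi>
  is a permutation, and otherwise its sign times det.\<close>

lemma pf_congruence:
  "pf m e (\<lambda>i j. \<Sum>a\<in>UNIV. \<Sum>b\<in>UNIV. J i a * J j b * B a b) = det (\<chi> i a. J i a) * pf m e B"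
proof -
  let ?S = "{\<sigma>. \<sigma> permutes (UNIV :: 'n set)}"
  let ?P = "\<lambda>\<psi>. \<Prod>k<m. B (\<psi> (e (2 * k))) (\<psi> (e (2 * k + 1)))"
  \<comment> \<open>The transpose of \<open>J\<close>, so that \<psi> selects rows.\<close>
  let ?M = "\<chi> a i. J i a"
  have 1: "(\<Prod>k<m. \<Sum>a\<in>UNIV. \<Sum>b\<in>UNIV. J (\<sigma> (e (2 * k))) a * J (\<sigma> (e (2 * k + 1))) b * B a b)
    = (\<Sum>\<psi>\<in>UNIV. ?P \<psi> * (\<Prod>i\<in>UNIV. J (\<sigma> i) (\<psi> i)))" for \<sigma>
    unfolding prod_pair_sum prod_UNIV_pairs by (simp add: prod.distrib mult_ac)
  have 2: "(\<Sum>\<sigma>\<in>?S. of_int (sign \<sigma>) * (\<Prod>i\<in>UNIV. J (\<sigma> i) (\<psi> i)))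
    = (if \<psi> permutes UNIV then of_int (sign \<psi>) * det ?M else 0)" for \<psi> :: "'n \<Rightarrow> 'n"
  proof -
    have d: "(\<Sum>\<sigma>\<in>?S. of_int (sign \<sigma>) * (\<Prod>i\<in>UNIV. J (\<sigma> i) (\<psi> i))) = det (\<chi> i. ?M $ \<psi> i)"
      by (simp add: det_def)
    show ?thesis
    proof (cases "inj \<psi>")
      case True
      then have "\<psi> permutes UNIV"
        by (intro bij_imp_permutes) (auto simp: bij_betw_def finite_UNIV_inj_surj)
      then show ?thesis
        unfolding d using det_permute_rows[of \<psi> ?M] by simp
    next
      case False
      then obtain i j where "i \<noteq> j" "\<psi> i = \<psi> j" by (auto simp: inj_def)
      then have "det (\<chi> i. ?M $ \<psi> i) = 0"
        by (intro det_identical_rows[of i j]) (auto simp: row_def vec_eq_iff)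
      moreover have "\<not> \<psi> permutes UNIV" using False permutes_inj by blast
      ultimately show ?thesis unfolding d by simp
    qed
  qed
  have "pf m e (\<lambda>i j. \<Sum>a\<in>UNIV. \<Sum>b\<in>UNIV. J i a * J j b * B a b)
    = (\<Sum>\<sigma>\<in>?S. \<Sum>\<psi>\<in>UNIV. ?P \<psi> * (of_int (sign \<sigma>) * (\<Prod>i\<in>UNIV. J (\<sigma> i) (\<psi> i))))"
    unfolding pf_eq_sum_UNIV 1 by (simp add: sum_distrib_left mult_ac)
  also have "\<dots> = (\<Sum>\<psi>\<in>UNIV. ?P \<psi> * (\<Sum>\<sigma>\<in>?S. of_int (sign \<sigma>) * (\<Prod>i\<in>UNIV. J (\<sigma> i) (\<psi> i))))"
    by (subst sum.swap) (simp add: sum_distrib_left)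
  also have "\<dots> = (\<Sum>\<psi>\<in>UNIV. if \<psi> permutes UNIV then det ?M * (of_int (sign \<psi>) * ?P \<psi>) else 0)"
    unfolding 2 by (intro sum.cong refl) simp
  also have "\<dots> = det ?M * pf m e B"
    unfolding pf_eq_sum_UNIV sum_distrib_left by (subst sum.If_cases) (auto simp: Int_def)
  also have "det ?M = det (\<chi> i a. J i a)"
    using det_transpose[of ?M] by (simp add: transpose_def)
  finally show ?thesis .
qed

end

section \<open>Nondegenerate forms have nonzero Pfaffian\<close>

lemma delta_sum: "(\<Sum>q\<in>UNIV. (if s = q then 1 else (0::real)) * f q) = f (s :: 'n::finite)"
  using mm_delta_sum[of f s] by (simp add: mult.commute eq_commute[of s])

text \<open>Symplectic Gram-Schmidt: a conjugate pair orthogonal to the vectors already found is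
  added in each step.\<close>

lemma symplectic_family:
  fixes M :: "real ^ 'n::finite ^ 'n"
  assumes anti: "\<And>u v. u \<bullet> (M *v v) = - (v \<bullet> (M *v u))"
    and nondeg: "\<And>u. u \<noteq> 0 \<Longrightarrow> \<exists>z. u \<bullet> (M *v z) \<noteq> 0"
  shows "2 * k \<le> CARD('n) \<Longrightarrow> \<exists>v :: nat \<Rightarrow> real ^ 'n. \<forall>x<2 * k. \<forall>y<2 * k. v x \<bullet> (M *v v y) = std x y"
proof (induction k)
  case 0
  then show ?case by simp
next
  case (Suc k)
  define \<beta> where "\<beta> u v = u \<bullet> (M *v v)" for u v
  have lin: "\<beta> (u + u') v = \<beta> u v + \<beta> u' v" "\<beta> (u - u') v = \<beta> u v - \<beta> u' v" "\<beta> (r *\<^sub>R u) v = r * \<beta> u v"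
      "\<beta> (sum h I) v = (\<Sum>x\<in>I. \<beta> (h x) v)" for u u' v r and h :: "nat \<Rightarrow> real ^ 'n" and I
    by (simp_all add: \<beta>_def inner_add_left inner_diff_left inner_sum_left)
  have anti': "\<beta> u v = - \<beta> v u" for u v
    unfolding \<beta>_def by (rule anti)
  obtain v where v: "\<And>x y. x < 2 * k \<Longrightarrow> y < 2 * k \<Longrightarrow> \<beta> (v x) (v y) = std x y"
    using Suc unfolding \<beta>_def by fastforce
  \<comment> \<open>Removes the component of \<open>w\<close> in the span of the earlier vectors
    with respect to the form; the coefficients are read off from conjugate partners.\<close>
  define proj where "proj w = w - (\<Sum>j<k. \<beta> w (v (2 * j + 1)) *\<^sub>R v (2 * j) - \<beta> w (v (2 * j)) *\<^sub>R v (2 * j + 1))" for w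
  have proj: "\<beta> (proj w) (v y) = 0" if y: "y < 2 * k" for w y
  proof -
    have "\<beta> (proj w) (v y) = \<beta> w (v y) - (\<Sum>j<k. \<beta> w (v (2 * j + 1)) * std (2 * j) y - \<beta> w (v (2 * j)) * std (2 * j + 1) y)"
      using y by (simp add: proj_def lin v)
    also have "(\<Sum>j<k. \<beta> w (v (2 * j + 1)) * std (2 * j) y - \<beta> w (v (2 * j)) * std (2 * j + 1) y)
      = (\<Sum>j<k. if j = y div 2 then \<beta> w (v y) else 0)"
    proof (rule sum.cong[OF refl])
      fix j
      show "\<beta> w (v (2 * j + 1)) * std (2 * j) y - \<beta> w (v (2 * j)) * std (2 * j + 1) y
          = (if j = y div 2 then \<beta> w (v y) else 0)"
        by (cases "even y") (auto simp: std_def elim!: evenE oddE)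
    qed
    also have "\<dots> = \<beta> w (v y)"
      using y by simp
    finally show ?thesis by simp
  qed
  \<comment> \<open>There are at most \<open>2 * k\<close> vectors so far, fewer than the dimension,
    so some vector lies outside their span and has a nonzero projection.\<close>
  have "span (v ` {..<2 * k}) \<noteq> UNIV"
  proof
    assume "span (v ` {..<2 * k}) = UNIV"
    then have "dim (v ` {..<2 * k}) = CARD('n)"
      by (metis dim_span dim_UNIV DIM_cart DIM_real mult.right_neutral)
    moreover have "dim (v ` {..<2 * k}) \<le> 2 * k"
      using dim_le_card'[of "v ` {..<2 * k}"] card_image_le[of "{..<2 * k}" v] by simp
    ultimately show False using Suc.prems by simp
  qed
  then obtain u0 where u0: "u0 \<notin> span (v ` {..<2 * k})" by blast
  define u where "u = proj u0"
  have "u \<noteq> 0"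
  proof
    assume "u = 0"
    then have "u0 = (\<Sum>j<k. \<beta> u0 (v (2 * j + 1)) *\<^sub>R v (2 * j) - \<beta> u0 (v (2 * j)) *\<^sub>R v (2 * j + 1))"
      by (simp add: u_def proj_def)
    moreover have "\<dots> \<in> span (v ` {..<2 * k})"
      by (intro span_sum span_diff span_scale span_base imageI) auto
    ultimately show False using u0 by metis
  qed
  then obtain z0 where z0: "\<beta> u z0 \<noteq> 0" using nondeg unfolding \<beta>_def by blast
  \<comment> \<open>Scaled so that the form is 1 on \<open>u\<close> and \<open>z\<close>; the
    projection does not affect this value because \<open>u\<close> is orthogonal to the earlier
    vectors.\<close>
  define z where "z = proj ((1 / \<beta> u z0) *\<^sub>R z0)"
  have uv: "\<beta> u (v y) = 0" "\<beta> (v y) u = 0" "\<beta> z (v y) = 0" "\<beta> (v y) z = 0" if "y < 2 * k" for y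
    using proj[OF that] anti'[of "v y"] by (auto simp: u_def z_def)
  have self: "\<beta> a a = 0" for a using anti'[of a a] by simp
  have zu: "\<beta> z u = - 1"
  proof -
    have "\<beta> z u = \<beta> ((1 / \<beta> u z0) *\<^sub>R z0) u"
      unfolding z_def by (subst proj_def) (simp add: lin uv)
    then show ?thesis using z0 by (simp add: lin anti'[of z0 u])
  qed
  define v' where "v' x = (if x = 2 * k then u else if x = 2 * k + 1 then z else v x)" for x
  have "\<beta> (v' x) (v' y) = std x y" if "x < 2 * Suc k" "y < 2 * Suc k" for x y
  proof -
    have "x < 2 * k \<or> x = 2 * k \<or> x = 2 * k + 1" "y < 2 * k \<or> y = 2 * k \<or> y = 2 * k + 1"
      using that by auto
    then show ?thesis
      using anti'[of u z] by (elim disjE) (auto simp: v'_def v uv self zu, auto simp: std_def, presburger+)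
  qed
  then show ?case unfolding \<beta>_def by blast
qed

text \<open>In a symplectic basis the form becomes \<open>std\<close>, so by
  \<open>pf_congruence\<close> a determinant times the Pfaffian equals the positive number of
  \<open>sum_std_pos\<close>.\<close>

lemma pf_nonzero:
  fixes B :: "'n::finite \<Rightarrow> 'n \<Rightarrow> real"
  assumes e: "bij_betw e {..<2 * m} (UNIV :: 'n set)"
    and anti: "\<And>i j. B i j = - B j i" and inv: "invertible (\<chi> i j. B i j)"
  shows "pf m e B \<noteq> 0"
proof -
  let ?M = "\<chi> i j. B i j" and ?e' = "inv_into {..<2 * m} e"
  have card: "CARD('n) = 2 * m"
    using bij_betw_same_card[OF e] by simp
  have M: "u \<bullet> (?M *v v) = (\<Sum>a\<in>UNIV. \<Sum>b\<in>UNIV. u $ a * v $ b * B a b)" for u v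
    by (simp add: inner_vec_def matrix_vector_mult_def sum_distrib_left mult_ac)
  have "\<exists>v :: nat \<Rightarrow> real ^ 'n. \<forall>x<2 * m. \<forall>y<2 * m. v x \<bullet> (?M *v v y) = std x y"
  proof (rule symplectic_family)
    show "u \<bullet> (?M *v v) = - (v \<bullet> (?M *v u))" for u v
    proof -
      have "u \<bullet> (?M *v v) = (\<Sum>b\<in>UNIV. \<Sum>a\<in>UNIV. u $ a * v $ b * B a b)"
        unfolding M by (rule sum.swap)
      also have "\<dots> = (\<Sum>b\<in>UNIV. \<Sum>a\<in>UNIV. - (v $ b * u $ a * B b a))"
        by (intro sum.cong refl) (subst anti, simp)
      finally show ?thesis by (simp add: M sum_negf)
    qed
    \<comment> \<open>With \<open>z\<close> the preimage of \<open>u\<close> under the matrix, the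
      form takes the value of \<open>u\<close> with itself under the inner product.\<close>
    show "\<exists>z. u \<bullet> (?M *v z) \<noteq> 0" if "u \<noteq> 0" for u
    proof (rule exI[of _ "matrix_inv ?M *v u"])
      show "u \<bullet> (?M *v (matrix_inv ?M *v u)) \<noteq> 0"
        using that by (simp add: matrix_vector_mul_assoc matrix_inv_inverse[OF inv])
    qed
  qed (simp add: card)
  then obtain v where v: "\<And>x y. x < 2 * m \<Longrightarrow> y < 2 * m \<Longrightarrow> v x \<bullet> (?M *v v y) = std x y"
    by blast
  let ?J = "\<lambda>i a. v (?e' i) $ a"
  have lt: "?e' i < 2 * m" for i
    using e inv_into_into[of i e "{..<2 * m}"] by (auto simp: bij_betw_def)
  have e'e: "?e' (e x) = x" if "x < 2 * m" for x
    using e that by (auto simp: bij_betw_def)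
  have "(\<lambda>i j. \<Sum>a\<in>UNIV. \<Sum>b\<in>UNIV. ?J i a * ?J j b * B a b) = (\<lambda>i j. std (?e' i) (?e' j))"
    using v[OF lt lt] by (simp add: M)
  then have "det (\<chi> i a. ?J i a) * pf m e B = pf m e (\<lambda>i j. std (?e' i) (?e' j))"
    using pf_congruence[OF e, of ?J B] by simp
  also have "\<dots> = (\<Sum>s | s permutes {..<2 * m}. of_int (sign s) * (\<Prod>k<m. std (s (2 * k)) (s (2 * k + 1))))"
    unfolding pf_def
  proof (intro sum.cong refl arg_cong2[where f = "(*)"] prod.cong)
    fix s k assume s: "s \<in> {s. s permutes {..<2 * m}}" and k: "k \<in> {..<m}"
    then have "s (2 * k) < 2 * m" "s (2 * k + 1) < 2 * m"
      using permutes_in_image[of s "{..<2 * m}" "2 * k"] permutes_in_image[of s "{..<2 * m}" "2 * k + 1"] by auto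
    then show "std (?e' (e (s (2 * k)))) (?e' (e (s (2 * k + 1)))) = std (s (2 * k)) (s (2 * k + 1))"
      by (simp add: e'e)
  qed
  finally show ?thesis using sum_std_pos[of m] by auto
qed

section \<open>Derivatives of Pfaffians and determinants\<close>

lemma has_real_derivative_prod:
  assumes "finite I" "\<And>i. i \<in> I \<Longrightarrow> (f i has_real_derivative f' i) (at t)"
  shows "((\<lambda>t. \<Prod>i\<in>I. f i t) has_real_derivative (\<Sum>i\<in>I. f' i * (\<Prod>j\<in>I - {i}. f j t))) (at t)"
proof -
  have "((\<lambda>t. \<Prod>i\<in>I. f i t) has_derivative (\<lambda>y. \<Sum>i\<in>I. (f' i * y) * (\<Prod>j\<in>I - {i}. f j t))) (at t)"
    by (rule has_derivative_prod) (use assms in \<open>simp add: has_field_derivative_def\<close>)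
  moreover have "(\<lambda>y. \<Sum>i\<in>I. (f' i * y) * (\<Prod>j\<in>I - {i}. f j t)) = (*) (\<Sum>i\<in>I. f' i * (\<Prod>j\<in>I - {i}. f j t))"
    by (auto simp: fun_eq_iff sum_distrib_left sum_distrib_right mult_ac)
  ultimately show ?thesis
    by (simp add: has_field_derivative_def)
qed

definition pf_deriv :: "nat \<Rightarrow> (nat \<Rightarrow> 'n::finite) \<Rightarrow> ('n \<Rightarrow> 'n \<Rightarrow> real) \<Rightarrow> ('n \<Rightarrow> 'n \<Rightarrow> real) \<Rightarrow> real" where
  "pf_deriv m e B B' = (\<Sum>s | s permutes {..<2 * m}. of_int (sign s) *
     (\<Sum>k<m. B' (e (s (2 * k))) (e (s (2 * k + 1))) * (\<Prod>l\<in>{..<m} - {k}. B (e (s (2 * l))) (e (s (2 * l + 1))))))"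

lemma has_real_derivative_pf:
  assumes "\<And>i j. (b i j has_real_derivative b' i j) (at t)"
  shows "((\<lambda>t. pf m e (\<lambda>i j. b i j t)) has_real_derivative pf_deriv m e (\<lambda>i j. b i j t) b') (at t)"
  unfolding pf_def pf_deriv_def
  by (intro DERIV_sum DERIV_cmult has_real_derivative_prod finite_lessThan assms)

text \<open>A permutation other than the identity moves at least two indices, so after
  differentiating one factor another off-diagonal factor still vanishes at 0. The identity
  contributes the trace.\<close>

lemma has_real_derivative_det:
  fixes g :: "'n::finite \<Rightarrow> 'n \<Rightarrow> real"
  shows "((\<lambda>t. det (\<chi> i a. (if i = a then 1 else 0) + t * g i a)) has_real_derivative (\<Sum>i\<in>UNIV. g i i)) (at 0)"
proof -
  let ?S = "{\<sigma>. \<sigma> permutes (UNIV :: 'n set)}"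
  let ?d = "\<lambda>i a :: 'n. if i = a then 1 else (0::real)"
  have "((\<lambda>t. \<Sum>\<sigma>\<in>?S. of_int (sign \<sigma>) * (\<Prod>i\<in>UNIV. ?d i (\<sigma> i) + t * g i (\<sigma> i))) has_real_derivative
      (\<Sum>\<sigma>\<in>?S. of_int (sign \<sigma>) * (\<Sum>i\<in>UNIV. g i (\<sigma> i) * (\<Prod>j\<in>UNIV - {i}. ?d j (\<sigma> j) + 0 * g j (\<sigma> j))))) (at 0)"
    by (intro DERIV_sum DERIV_cmult has_real_derivative_prod finite) (auto intro!: derivative_eq_intros)
  moreover have "(\<Sum>\<sigma>\<in>?S. of_int (sign \<sigma>) * (\<Sum>i\<in>UNIV. g i (\<sigma> i) * (\<Prod>j\<in>UNIV - {i}. ?d j (\<sigma> j) + 0 * g j (\<sigma> j))))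
    = (\<Sum>\<sigma>\<in>{id}. of_int (sign \<sigma>) * (\<Sum>i\<in>UNIV. g i (\<sigma> i) * (\<Prod>j\<in>UNIV - {i}. ?d j (\<sigma> j) + 0 * g j (\<sigma> j))))"
  proof (rule sum.mono_neutral_right)
    show "\<forall>\<sigma>\<in>?S - {id}. of_int (sign \<sigma>) * (\<Sum>i\<in>UNIV. g i (\<sigma> i) * (\<Prod>j\<in>UNIV - {i}. ?d j (\<sigma> j) + 0 * g j (\<sigma> j))) = 0"
    proof
      fix \<sigma> assume \<sigma>: "\<sigma> \<in> ?S - {id}"
      then have inj: "inj \<sigma>" using permutes_inj by blast
      obtain a where a: "\<sigma> a \<noteq> a" using \<sigma> by (auto simp: fun_eq_iff)
      have zero: "(\<Prod>j\<in>UNIV - {i}. ?d j (\<sigma> j) + 0 * g j (\<sigma> j)) = 0" for i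
      proof (cases "i = a")
        case True
        \<comment> \<open>The second moved index: an injective map that moves \<open>a\<close> also
          moves the image of \<open>a\<close>.\<close>
        have "\<sigma> (\<sigma> a) \<noteq> \<sigma> a" using a inj by (auto simp: inj_eq)
        then show ?thesis using a True by (intro prod_zero bexI[of _ "\<sigma> a"]) auto
      next
        case False
        then show ?thesis using a by (intro prod_zero bexI[of _ a]) auto
      qed
      show "of_int (sign \<sigma>) * (\<Sum>i\<in>UNIV. g i (\<sigma> i) * (\<Prod>j\<in>UNIV - {i}. ?d j (\<sigma> j) + 0 * g j (\<sigma> j))) = 0"
        by (simp only: zero mult_zero_right sum.neutral_const)
    qed
  qed (simp_all add: permutes_id)
  ultimately show ?thesis
    by (simp add: det_def)
qed

section \<open>The volume density in a chart and the divergence\<close>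

context sympl_chart
begin

text \<open>The coefficient of the volume form before normalisation and absolute value, in which
  form it is visibly smooth.\<close>

definition vol_pf :: "'m \<Rightarrow> real" where
  "vol_pf p = pf (CARD('n) div 2) (from_nat_into UNIV) (\<lambda>i j. om i j p)"

abbreviation vd where "vd \<equiv> volume_density Om c"

lemma vd_eq: "vd p = \<bar>vol_pf p\<bar> / (2 ^ (CARD('n) div 2) * fact (CARD('n) div 2))"
  by (simp add: volume_density_def wedge_power_def vol_pf_def pf_def Let_def abs_mult)

lemma sm_vol_pf: "sm c vol_pf"
  unfolding vol_pf_def[abs_def] pf_def by (intro sm_sum sm_mult sm_const sm_prod sm_Om)

context
  assumes even_card: "even CARD('n)"
begin

lemma enum: "bij_betw (from_nat_into (UNIV :: 'n set)) {..<2 * (CARD('n) div 2)} UNIV"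
  using bij_betw_from_nat_into_finite[of "UNIV :: 'n set"] even_card by simp

lemma vol_pf_nonzero: "p \<in> dom \<Longrightarrow> vol_pf p \<noteq> 0"
  unfolding vol_pf_def by (rule pf_nonzero[OF enum Om_antisym Om_inv])

lemma vd_pos: "p \<in> dom \<Longrightarrow> vd p > 0"
  using vol_pf_nonzero by (simp add: vd_eq)

text \<open>The volume form is parallel. Since \<nabla>\<Omega> = 0, the derivative of \<Omega> in
  direction \<open>k\<close> is that at \<open>t = 0\<close> of the congruence of \<Omega> with the
  identity plus \<open>t\<close> times the Christoffel matrix. The Pfaffian of this congruence is a
  determinant times that of \<Omega>, and the determinant has the trace as its derivative.\<close>

lemma pd_vol_pf:
  assumes p: "p \<in> dom"
  shows "pd c k vol_pf p = (\<Sum>q\<in>UNIV. G c k q q p) * vol_pf p"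
proof -
  let ?m = "CARD('n) div 2" and ?e = "from_nat_into (UNIV :: 'n set)"
  let ?x = "coords c p"
  let ?D = "pf_deriv ?m ?e (\<lambda>i j. om i j p) (\<lambda>i j. pd c k (Om c i j) p)"
  have along: "((\<lambda>s. (h \<circ> param c) (?x + s *\<^sub>R axis k 1)) has_real_derivative pd c k h p) (at 0)" if "sm c h" for h
    using has_real_derivative_along_axis[of "h \<circ> param c" ?x 0 k] sm_mdiff[OF that p] by (simp add: mdiff_def pd_def)
  have "((\<lambda>s. pf ?m ?e (\<lambda>i j. (Om c i j \<circ> param c) (?x + s *\<^sub>R axis k 1))) has_real_derivative ?D) (at 0)"
    using has_real_derivative_pf[OF along[OF sm_Om], of ?m ?e] p by simp
  moreover have "((\<lambda>s. (vol_pf \<circ> param c) (?x + s *\<^sub>R axis k 1)) has_real_derivative pd c k vol_pf p) (at 0)"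
    by (rule along[OF sm_vol_pf])
  ultimately have 1: "pd c k vol_pf p = ?D"
    using DERIV_unique by (simp add: vol_pf_def)
  \<comment> \<open>The identity plus \<open>t\<close> times the Christoffel symbols with first
    index \<open>k\<close>, a curve of matrices through the identity.\<close>
  let ?J = "\<lambda>t i a. (if i = a then 1 else 0) + t * G c k i a p"
  have "((\<lambda>t. \<Sum>a\<in>UNIV. \<Sum>b\<in>UNIV. ?J t i a * ?J t j b * om a b p) has_real_derivative pd c k (Om c i j) p) (at 0)" for i j
  proof -
    have "((\<lambda>t. \<Sum>a\<in>UNIV. \<Sum>b\<in>UNIV. ?J t i a * ?J t j b * om a b p) has_real_derivative
      (\<Sum>a\<in>UNIV. \<Sum>b\<in>UNIV. (?J 0 i a * G c k j b p + G c k i a p * ?J 0 j b) * om a b p)) (at 0)"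
      by (intro DERIV_sum DERIV_cmult_right) (auto intro!: derivative_eq_intros)
    also have "(\<Sum>a\<in>UNIV. \<Sum>b\<in>UNIV. (?J 0 i a * G c k j b p + G c k i a p * ?J 0 j b) * om a b p)
      = (\<Sum>a\<in>UNIV. (if i = a then 1 else 0) * (\<Sum>b\<in>UNIV. G c k j b p * om a b p))
        + (\<Sum>a\<in>UNIV. G c k i a p * (\<Sum>b\<in>UNIV. (if j = b then 1 else 0) * om a b p))"
      by (simp only: mult_zero_left add_0_right distrib_right sum.distrib sum_distrib_left mult.assoc)
    also have "\<dots> = pd c k (Om c i j) p"
      unfolding delta_sum pd_om[OF p] by (rule add.commute)
    finally show ?thesis .
  qed
  note D = has_real_derivative_pf[where b = "\<lambda>i j t. \<Sum>a\<in>UNIV. \<Sum>b\<in>UNIV. ?J t i a * ?J t j b * om a b p"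
      and b' = "\<lambda>i j. pd c k (Om c i j) p" and t = 0 and m = ?m and e = ?e, OF this]
  have eq0: "(\<Sum>a\<in>UNIV. \<Sum>b\<in>UNIV. ?J 0 i a * ?J 0 j b * om a b p) = om i j p" for i j
  proof -
    have "(\<Sum>a\<in>UNIV. \<Sum>b\<in>UNIV. ?J 0 i a * ?J 0 j b * om a b p)
      = (\<Sum>a\<in>UNIV. (if i = a then 1 else 0) * (\<Sum>b\<in>UNIV. (if j = b then 1 else 0) * om a b p))"
      by (simp only: mult_zero_left add_0_right sum_distrib_left mult.assoc)
    then show ?thesis by (simp only: delta_sum)
  qed
  from D have "((\<lambda>t. det (\<chi> i a. ?J t i a) * vol_pf p) has_real_derivative ?D) (at 0)"
    unfolding eq0 pf_congruence[OF enum] vol_pf_def[symmetric] .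
  moreover have "((\<lambda>t. det (\<chi> i a. ?J t i a) * vol_pf p) has_real_derivative (\<Sum>q\<in>UNIV. G c k q q p) * vol_pf p) (at 0)"
    by (rule DERIV_cmult_right[OF has_real_derivative_det])
  ultimately show ?thesis
    unfolding 1 by (rule DERIV_unique)
qed

text \<open>\<open>vol_pf\<close> is continuous without zeros, so near \<open>p\<close> its sign is
  constant and taking the absolute value is multiplying by a constant.\<close>

lemma vd_locally:
  assumes "p \<in> dom"
  obtains V r where "openin X V" "p \<in> V" "V \<subseteq> dom" "\<And>q. q \<in> V \<Longrightarrow> vd q = r * vol_pf q"
proof -
  let ?N = "2 ^ (CARD('n) div 2) * fact (CARD('n) div 2) :: real"
  have V: "openin X {q \<in> dom. vol_pf q \<in> S}" if "open S" for S
  proof -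
    have "openin (subtopology X dom) {q \<in> topspace (subtopology X dom). vol_pf q \<in> S}"
      by (rule openin_continuous_map_preimage[OF sm_continuous_map[OF sm_vol_pf]]) (use that in simp)
    then show ?thesis
      using openin_dom openin_trans_full dom_subset by (simp add: inf.absorb2)
  qed
  show ?thesis
  proof (cases "vol_pf p > 0")
    case True
    show ?thesis
      by (rule that[OF V[of "{0<..}"], of "1 / ?N"]) (use True assms in \<open>auto simp: vd_eq\<close>)
  next
    case False
    then have "vol_pf p < 0" using vol_pf_nonzero[OF assms] by simp
    then show ?thesis
      by (intro that[OF V[of "{..<0}"], of "- 1 / ?N"]) (use assms in \<open>auto simp: vd_eq\<close>)
  qed
qed

lemma mdiff_vd: "p \<in> dom \<Longrightarrow> mdiff c vd p"
  and pd_vd: "p \<in> dom \<Longrightarrow> pd c k vd p = (\<Sum>q\<in>UNIV. G c k q q p) * vd p"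
proof -
  assume p: "p \<in> dom"
  obtain V r where V: "openin X V" "p \<in> V" "V \<subseteq> dom" "\<And>q. q \<in> V \<Longrightarrow> vd q = r * vol_pf q"
    using vd_locally[OF p] by blast
  have m: "mdiff c vol_pf p" by (rule sm_mdiff[OF sm_vol_pf p])
  show "mdiff c vd p"
    by (rule mdiff_cong[OF V(1-3), of "\<lambda>q. r * vol_pf q"]) (use V(4) m in auto)
  have "pd c k vd p = pd c k (\<lambda>q. r * vol_pf q) p"
    by (rule pd_cong[OF V])
  then show "pd c k vd p = (\<Sum>q\<in>UNIV. G c k q q p) * vd p"
    using V(2,4) m p by (simp add: pd_mult' pd_vol_pf)
qed

text \<open>The trace of the connection comes from the derivative of \<open>vd\<close> and, with the
  opposite sign, from that of \<open>w\<close>; the other connection term of \<open>w\<close>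
  vanishes by symmetry. So the product with the density is an ordinary coordinate divergence, ready
  for integration.\<close>

lemma divergence_form:
  assumes p: "p \<in> dom" and V: "\<And>a. sm c (V a)"
  shows "vd p * (\<Sum>i\<in>UNIV. \<Sum>a\<in>UNIV. w i a p * pd c i (V a) p)
    = (\<Sum>i\<in>UNIV. pd c i (\<lambda>p. vd p * (\<Sum>a\<in>UNIV. w i a p * V a p)) p)"
proof -
  define tr where "tr k = (\<Sum>q\<in>UNIV. G c k q q p)" for k
  have pd_vd': "pd c k vd p = tr k * vd p" for k
    by (simp add: tr_def pd_vd p)
  have pd1: "pd c i (\<lambda>p. vd p * (\<Sum>a\<in>UNIV. w i a p * V a p)) p
    = vd p * (\<Sum>a\<in>UNIV. w i a p * pd c i (V a) p)
      + vd p * (\<Sum>a\<in>UNIV. (pd c i (Om_up Om c i a) p + tr i * w i a p) * V a p)" for i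
  proof -
    have "sm c (\<lambda>p. \<Sum>a\<in>UNIV. w i a p * V a p)" using V by simp
    then have "pd c i (\<lambda>p. vd p * (\<Sum>a\<in>UNIV. w i a p * V a p)) p
      = vd p * pd c i (\<lambda>p. \<Sum>a\<in>UNIV. w i a p * V a p) p + pd c i vd p * (\<Sum>a\<in>UNIV. w i a p * V a p)"
      by (intro pd_mult' p mdiff_vd sm_mdiff)
    then show ?thesis
      using V by (simp add: pd_rules p pd_vd' distrib_left distrib_right sum.distrib sum_distrib_left mult_ac)
  qed
  have zero: "(\<Sum>i\<in>UNIV. pd c i (Om_up Om c i a) p + tr i * w i a p) = 0" for a
  proof -
    have "(\<Sum>i\<in>UNIV. \<Sum>q\<in>UNIV. G c i q i p * w q a p) = (\<Sum>i\<in>UNIV. tr i * w i a p)"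
      by (subst sum.swap) (simp add: tr_def G_sym[OF p] sum_distrib_right)
    moreover have "(\<Sum>i\<in>UNIV. \<Sum>q\<in>UNIV. w i q p * G c i q a p) = 0"
      by (rule antisym_sym_sum[OF w_antisym[OF p] G_sym[OF p]])
    ultimately show ?thesis
      by (simp add: pd_w[OF p] sum.distrib sum_subtractf sum_negf mult.commute)
  qed
  have "(\<Sum>i\<in>UNIV. vd p * (\<Sum>a\<in>UNIV. (pd c i (Om_up Om c i a) p + tr i * w i a p) * V a p))
    = vd p * (\<Sum>a\<in>UNIV. (\<Sum>i\<in>UNIV. pd c i (Om_up Om c i a) p + tr i * w i a p) * V a p)"
    unfolding sum_distrib_left[symmetric] sum_distrib_right by (subst sum.swap) (rule refl)
  also have "\<dots> = 0"
    by (simp only: zero mult_zero_left mult_zero_right sum.neutral_const)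
  finally have rest: "(\<Sum>i\<in>UNIV. vd p * (\<Sum>a\<in>UNIV. (pd c i (Om_up Om c i a) p + tr i * w i a p) * V a p)) = 0" .
  show ?thesis
    unfolding pd1 sum.distrib rest by (simp add: sum_distrib_left)
qed

end

end

lemma (in symplectic_conn) volume_density_trans:
  assumes cd: "c \<in> A" "d \<in> A" "p \<in> chart_dom c \<inter> chart_dom d" and even: "even CARD('n)"
  shows "volume_density Om c p = \<bar>det (\<chi> i a. jac c d i a p)\<bar> * volume_density Om d p"
proof -
  interpret c: sympl_chart X c Om G by (rule sympl_chart_ax[OF cd(1)])
  interpret d: sympl_chart X d Om G by (rule sympl_chart_ax[OF cd(2)])
  have "c.vol_pf p = det (\<chi> i a. jac c d i a p) * d.vol_pf p"
    unfolding c.vol_pf_def d.vol_pf_def Om_trans[OF cd]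
    by (rule pf_congruence[OF c.enum[OF even]])
  then show ?thesis by (simp add: c.vd_eq d.vd_eq abs_mult)
qed

section \<open>Integration\<close>

text \<open>
  The change of variables theorem of the library needs a well-ordered index type, so it is
  transferred to arbitrary finite index types through a copy of the type.
\<close>

typedef (overloaded) ('n::finite) wo = "UNIV :: 'n set"
  by simp

instantiation wo :: (finite) finite
begin
instance
proof
  have "finite (range (Abs_wo :: 'a \<Rightarrow> 'a wo))" by simp
  moreover have "range (Abs_wo :: 'a \<Rightarrow> 'a wo) = UNIV"
    by (metis Rep_wo_inverse surjI)
  ultimately show "finite (UNIV :: 'a wo set)" by simp
qed
end

instantiation wo :: (finite) wellorder
begin

definition less_eq_wo :: "'a wo \<Rightarrow> 'a wo \<Rightarrow> bool" where
  "x \<le> y \<longleftrightarrow> to_nat_on (UNIV :: 'a set) (Rep_wo x) \<le> to_nat_on (UNIV :: 'a set) (Rep_wo y)"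

definition less_wo :: "'a wo \<Rightarrow> 'a wo \<Rightarrow> bool" where
  "x < y \<longleftrightarrow> to_nat_on (UNIV :: 'a set) (Rep_wo x) < to_nat_on (UNIV :: 'a set) (Rep_wo y)"

instance
proof
  fix x y z :: "'a wo" and P :: "'a wo \<Rightarrow> bool"
  have inj: "to_nat_on (UNIV :: 'a set) (Rep_wo x) = to_nat_on UNIV (Rep_wo y) \<longleftrightarrow> x = y"
    using inj_on_to_nat_on[of "UNIV :: 'a set"] by (auto simp: inj_on_def Rep_wo_inject countable_finite)
  show "(x < y) = (x \<le> y \<and> \<not> y \<le> x)" "x \<le> x" "x \<le> y \<Longrightarrow> y \<le> z \<Longrightarrow> x \<le> z" "x \<le> y \<or> y \<le> x"
    by (auto simp: less_eq_wo_def less_wo_def)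
  show "x = y" if "x \<le> y" "y \<le> x"
    by (rule inj[THEN iffD1], rule antisym) (use that in \<open>simp_all only: less_eq_wo_def\<close>)
  assume step: "\<And>x. (\<And>y. y < x \<Longrightarrow> P y) \<Longrightarrow> P x"
  show "P z"
    by (induction z rule: measure_induct_rule[of "\<lambda>x. to_nat_on (UNIV :: 'a set) (Rep_wo x)"])
       (rule step, simp add: less_wo_def)
qed
end

lemma bij_Rep_wo: "bij (Rep_wo :: 'n::finite wo \<Rightarrow> 'n)"
  by (rule bij_betw_byWitness[where f' = Abs_wo]) (auto simp: Abs_wo_inverse Rep_wo_inverse)

definition to_wo :: "real ^ 'n::finite \<Rightarrow> real ^ 'n wo" where
  "to_wo x = (\<chi> i. x $ Rep_wo i)"

definition of_wo :: "real ^ 'n wo \<Rightarrow> real ^ 'n::finite" where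
  "of_wo x = (\<chi> i. x $ Abs_wo i)"

lemma of_to_wo [simp]: "of_wo (to_wo x) = x" "to_wo (of_wo y) = y"
  by (simp_all add: of_wo_def to_wo_def vec_eq_iff Abs_wo_inverse Rep_wo_inverse)

lemma linear_wo: "linear (to_wo :: real ^ 'n::finite \<Rightarrow> _)" "linear (of_wo :: _ \<Rightarrow> real ^ 'n::finite)"
  by (auto intro!: linearI simp: to_wo_def of_wo_def vec_eq_iff)

lemma bounded_linear_wo: "bounded_linear (to_wo :: real ^ 'n::finite \<Rightarrow> _)" "bounded_linear (of_wo :: _ \<Rightarrow> real ^ 'n::finite)"
  using linear_wo linear_conv_bounded_linear by blast+

lemma continuous_on_wo: "continuous_on S (to_wo :: real ^ 'n::finite \<Rightarrow> _)" "continuous_on T (of_wo :: _ \<Rightarrow> real ^ 'n::finite)"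
  using bounded_linear_wo linear_continuous_on by blast+

lemma measurable_wo [measurable]: "(to_wo :: real ^ 'n::finite \<Rightarrow> _) \<in> borel_measurable borel" "(of_wo :: _ \<Rightarrow> real ^ 'n::finite) \<in> borel_measurable borel"
  by (auto intro!: borel_measurable_continuous_onI continuous_on_wo)

lemma lborel_wo: "distr lborel borel (of_wo :: _ \<Rightarrow> real ^ 'n::finite) = lborel"
proof (rule lborel_eqI[symmetric])
  fix l u :: "real ^ 'n" assume le: "\<And>b. b \<in> Basis \<Longrightarrow> l \<bullet> b \<le> u \<bullet> b"
  have le': "l $ i \<le> u $ i" for i
    using le[of "axis i 1"] by (simp add: axis_in_Basis_iff inner_axis)
  have "of_wo -` box l u = box (to_wo l) (to_wo u)"
  proof -
    have "(\<forall>i. l $ i < x $ Abs_wo i \<and> x $ Abs_wo i < u $ i) \<longleftrightarrow> (\<forall>i. l $ Rep_wo i < x $ i \<and> x $ i < u $ Rep_wo i)" for x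
      by (metis Rep_wo_inverse Abs_wo_inverse UNIV_I)
    then show ?thesis by (auto simp: mem_box_cart of_wo_def to_wo_def)
  qed
  then have "emeasure (distr lborel borel of_wo) (box l u) = emeasure lborel (box (to_wo l) (to_wo u))"
    by (simp add: emeasure_distr)
  also have "\<dots> = ennreal (\<Prod>b\<in>Basis. (to_wo u - to_wo l) \<bullet> b)"
  proof (rule emeasure_lborel_box)
    fix b :: "real ^ 'n wo" assume "b \<in> Basis"
    then obtain i where "b = axis i 1" by (auto simp: Basis_vec_def)
    then show "to_wo l \<bullet> b \<le> to_wo u \<bullet> b" using le' by (simp add: inner_axis to_wo_def)
  qed
  also have "(\<Prod>b\<in>Basis. (to_wo u - to_wo l) \<bullet> b) = (\<Prod>i\<in>UNIV. (u - l) $ Rep_wo i)"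
    by (simp add: Basis_vec_def UNION_singleton_eq_range prod.reindex inj_on_def axis_eq_axis inner_axis to_wo_def)
  also have "\<dots> = (\<Prod>i\<in>UNIV. (u - l) $ i)"
    using prod.reindex_bij_betw[OF bij_Rep_wo, of "\<lambda>i. (u - l) $ i"] by simp
  also have "\<dots> = (\<Prod>b\<in>Basis. (u - l) \<bullet> b)"
    by (simp add: Basis_vec_def UNION_singleton_eq_range prod.reindex inj_on_def axis_eq_axis inner_axis)
  finally show "emeasure (distr lborel borel of_wo) (box l u) = ennreal (\<Prod>b\<in>Basis. (u - l) \<bullet> b)" .
qed simp

lemma nn_integral_wo:
  fixes f :: "real ^ 'n::finite \<Rightarrow> ennreal"
  assumes "f \<in> borel_measurable borel"
  shows "(\<integral>\<^sup>+x. f x \<partial>lborel) = (\<integral>\<^sup>+y. f (of_wo y) \<partial>lborel)"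
  using assms by (subst lborel_wo[symmetric]) (simp add: nn_integral_distr)

lemma det_wo:
  fixes M :: "real ^ 'n::finite ^ 'n"
  shows "det (\<chi> i j. M $ Rep_wo i $ Rep_wo j) = det M"
proof -
  have inj: "inj (Rep_wo :: 'n wo \<Rightarrow> 'n)" using bij_Rep_wo bij_is_inj by blast
  have ap: "map_permutation UNIV Rep_wo \<sigma> (Rep_wo i) = Rep_wo (\<sigma> i)" if "\<sigma> permutes UNIV" for \<sigma> and i :: "'n wo"
    using that inj by (intro map_permutation_apply) auto
  have inv: "bij_betw (Abs_wo :: 'n \<Rightarrow> 'n wo) UNIV UNIV"
    by (rule bij_betw_byWitness[where f' = Rep_wo]) (auto simp: Abs_wo_inverse Rep_wo_inverse)
  show ?thesis
    unfolding det_def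
  proof (rule sum.reindex_bij_witness[where i = "map_permutation UNIV Abs_wo" and j = "map_permutation UNIV Rep_wo"])
    fix \<sigma> :: "'n wo \<Rightarrow> 'n wo" assume "\<sigma> \<in> {p. p permutes UNIV}"
    then have \<sigma>: "\<sigma> permutes UNIV" by simp
    show "map_permutation UNIV Abs_wo (map_permutation UNIV Rep_wo \<sigma>) = \<sigma>"
      by (rule map_permutation_compose_inv[OF bij_Rep_wo \<sigma>]) (simp add: Rep_wo_inverse)
    show "map_permutation UNIV Rep_wo \<sigma> \<in> {p. p permutes UNIV}"
      using map_permutation_permutes[OF bij_Rep_wo \<sigma>] by simp
    have "(\<Prod>i\<in>UNIV. M $ i $ map_permutation UNIV Rep_wo \<sigma> i) = (\<Prod>i\<in>UNIV. M $ Rep_wo i $ Rep_wo (\<sigma> i))"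
      using prod.reindex_bij_betw[OF bij_Rep_wo, of "\<lambda>i. M $ i $ map_permutation UNIV Rep_wo \<sigma> i"] by (simp add: ap[OF \<sigma>])
    then show "of_int (sign (map_permutation UNIV Rep_wo \<sigma>)) * (\<Prod>i\<in>UNIV. M $ i $ map_permutation UNIV Rep_wo \<sigma> i)
      = of_int (sign \<sigma>) * (\<Prod>i\<in>UNIV. (\<chi> i j. M $ Rep_wo i $ Rep_wo j) $ i $ \<sigma> i)"
      using sign_map_permutation[OF inj \<sigma>] by simp
  next
    fix \<sigma> :: "'n \<Rightarrow> 'n" assume "\<sigma> \<in> {p. p permutes UNIV}"
    then have \<sigma>: "\<sigma> permutes UNIV" by simp
    show "map_permutation UNIV Abs_wo \<sigma> \<in> {p. p permutes UNIV}"
      using map_permutation_permutes[OF inv \<sigma>] by simp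
    show "map_permutation UNIV Rep_wo (map_permutation UNIV Abs_wo \<sigma>) = \<sigma>"
      by (rule map_permutation_compose_inv[OF inv \<sigma>]) (simp add: Abs_wo_inverse)
  qed
qed

text \<open>The change of variables theorem is an equivalence for each value \<open>b\<close> of the
  integral. Letting \<open>b\<close> vary gives equivalence of integrability and equality of the
  integrals.\<close>

lemma conj_eq_transfer: "(\<And>b. (P \<and> x = b) \<longleftrightarrow> (Q \<and> y = b)) \<Longrightarrow> (P \<longleftrightarrow> Q) \<and> (Q \<longrightarrow> x = y)"
  by metis

text \<open>For a nonnegative function the nonnegative integral is the ordinary one if that exists
  and infinite otherwise (\<open>conv\<close>), so the theorem for absolutely integrable functions
  covers both cases.\<close>

lemma nn_integral_change_of_variables_wo:
  fixes g :: "real ^ 'm::{finite, wellorder} \<Rightarrow> real ^ 'm::_" and f :: "real ^ 'm::_ \<Rightarrow> real"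
  assumes S: "S \<in> sets borel" and gS: "g ` S \<in> sets borel"
    and der: "\<And>x. x \<in> S \<Longrightarrow> (g has_derivative g' x) (at x)" and inj: "inj_on g S"
    and f: "(\<lambda>x. indicator (g ` S) x * f x) \<in> borel_measurable borel" "\<And>x. x \<in> g ` S \<Longrightarrow> f x \<ge> 0"
    and fg: "(\<lambda>x. indicator S x * (\<bar>det (matrix (g' x))\<bar> * f (g x))) \<in> borel_measurable borel"
  shows "(\<integral>\<^sup>+x\<in>g ` S. ennreal (f x) \<partial>lborel) = (\<integral>\<^sup>+x\<in>S. ennreal (\<bar>det (matrix (g' x))\<bar> * f (g x)) \<partial>lborel)"
proof -
  let ?h = "\<lambda>x. \<bar>det (matrix (g' x))\<bar> * f (g x)"
  have conv: "(\<integral>\<^sup>+x\<in>T. ennreal (k x) \<partial>lborel) = (if k absolutely_integrable_on T then ennreal (integral T k) else \<infinity>)"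
    if T: "T \<in> sets borel" "\<And>x. x \<in> T \<Longrightarrow> k x \<ge> 0" "(\<lambda>x. indicator T x * k x) \<in> borel_measurable borel"
    for T and k :: "real ^ 'm::_ \<Rightarrow> real"
  proof -
    have eq: "(\<integral>\<^sup>+x\<in>T. ennreal (k x) \<partial>lborel) = (\<integral>\<^sup>+x. ennreal (indicator T x * k x) \<partial>lborel)"
      by (intro nn_integral_cong) (simp split: split_indicator)
    have abs: "k absolutely_integrable_on T \<longleftrightarrow> integrable lborel (\<lambda>x. indicator T x * k x)"
      unfolding set_integrable_def using integrable_completion[of "\<lambda>x. indicator T x * k x" lborel] T(3) by simp
    show ?thesis
    proof (cases "k absolutely_integrable_on T")
      case True
      then have int: "integrable lborel (\<lambda>x. indicator T x * k x)" by (simp add: abs)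
      have "integral T k = (LINT x|lebesgue. indicator T x *\<^sub>R k x)"
        using set_lebesgue_integral_eq_integral(2)[OF True] by (simp add: set_lebesgue_integral_def)
      also have "\<dots> = (LINT x|lborel. indicator T x * k x)"
        using integral_completion[of "\<lambda>x. indicator T x * k x" lborel] T(3) by simp
      finally show ?thesis
        unfolding eq using nn_integral_eq_integral[OF int] T(2) True by (simp add: indicator_def)
    next
      case False
      then have "\<not> integrable lborel (\<lambda>x. indicator T x * k x)" by (simp add: abs)
      then have "\<not> (\<integral>\<^sup>+x. ennreal (norm (indicator T x * k x)) \<partial>lborel) < \<infinity>"
        using T(3) by (simp add: integrable_iff_bounded)
      moreover have "norm (indicator T x * k x) = indicator T x * k x" for x
        using T(2) by (simp add: indicator_def)
      ultimately have "\<not> (\<integral>\<^sup>+x. ennreal (indicator T x * k x) \<partial>lborel) < \<infinity>"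
        by simp
      then have "(\<integral>\<^sup>+x. ennreal (indicator T x * k x) \<partial>lborel) = \<infinity>"
        by (metis infinity_ennreal_def top.not_eq_extremum)
      then show ?thesis
        unfolding eq using False by simp
    qed
  qed
  have "(?h absolutely_integrable_on S \<and> integral S ?h = b) \<longleftrightarrow> (f absolutely_integrable_on g ` S \<and> integral (g ` S) f = b)" for b
  proof -
    \<comment> \<open>That theorem speaks of vector-valued functions, hence the values in
      \<open>real ^ 1\<close>.\<close>
    have "(\<lambda>x. \<bar>det (matrix (g' x))\<bar> *\<^sub>R (\<chi> i. f (g x) :: real ^ 1)) absolutely_integrable_on S \<and>
           integral S (\<lambda>x. \<bar>det (matrix (g' x))\<bar> *\<^sub>R (\<chi> i. f (g x) :: real ^ 1)) = (\<chi> i. b)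
     \<longleftrightarrow> (\<lambda>x. (\<chi> i. f x) :: real ^ 1) absolutely_integrable_on (g ` S) \<and> integral (g ` S) (\<lambda>x. (\<chi> i. f x) :: real ^ 1) = (\<chi> i. b)"
      by (rule has_absolute_integral_change_of_variables[OF _ has_derivative_at_withinI[OF der] inj, of "\<lambda>x. \<chi> i. f x"])
         (use S in simp_all)
    moreover have "(\<lambda>x. \<bar>det (matrix (g' x))\<bar> *\<^sub>R (\<chi> i. f (g x)) :: real ^ 1) = (\<lambda>x. vec (?h x))"
      "(\<lambda>x. (\<chi> i. f x) :: real ^ 1) = (\<lambda>x. vec (f x))" "(\<chi> i. b) = (vec b :: real ^ 1)"
      by (simp_all add: fun_eq_iff vec_eq_iff)
    ultimately show ?thesis
      by (simp add: absolutely_integrable_on_1_iff integral_on_1_eq)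
  qed
  from conj_eq_transfer[OF this]
  have "?h absolutely_integrable_on S \<longleftrightarrow> f absolutely_integrable_on g ` S"
    "f absolutely_integrable_on g ` S \<Longrightarrow> integral S ?h = integral (g ` S) f"
    by blast+
  then show ?thesis
    using conv[OF gS f(2,1)] conv[OF S _ fg] f(2) by simp
qed

lemma vimage_of_wo_image: "of_wo -` S = to_wo ` S"
  by (force simp: image_iff)

lemma nn_integral_change_of_variables:
  fixes g :: "real ^ 'n::finite \<Rightarrow> real ^ 'n" and f :: "real ^ 'n \<Rightarrow> real"
  assumes S: "S \<in> sets borel" and gS: "g ` S \<in> sets borel"
    and der: "\<And>x. x \<in> S \<Longrightarrow> (g has_derivative g' x) (at x)" and inj: "inj_on g S"
    and f: "(\<lambda>x. indicator (g ` S) x * f x) \<in> borel_measurable borel" "\<And>x. x \<in> g ` S \<Longrightarrow> f x \<ge> 0"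
    and fg: "(\<lambda>x. indicator S x * (\<bar>det (matrix (g' x))\<bar> * f (g x))) \<in> borel_measurable borel"
  shows "(\<integral>\<^sup>+x\<in>g ` S. ennreal (f x) \<partial>lborel) = (\<integral>\<^sup>+x\<in>S. ennreal (\<bar>det (matrix (g' x))\<bar> * f (g x)) \<partial>lborel)"
proof -
  let ?S = "of_wo -` S :: (real ^ 'n wo) set"
  let ?g = "\<lambda>y. to_wo (g (of_wo y)) :: real ^ 'n wo" and ?f = "\<lambda>y :: real ^ 'n wo. f (of_wo y)"
  let ?g' = "\<lambda>y h. to_wo (g' (of_wo y) (of_wo h)) :: real ^ 'n wo"
  have of_wo_axis: "of_wo (axis j 1) = axis (Rep_wo j) (1::real)" for j :: "'n wo"
    by (auto simp: of_wo_def axis_def vec_eq_iff Abs_wo_inverse Rep_wo_inverse)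
  have im: "?g ` ?S = of_wo -` (g ` S)"
    unfolding vimage_of_wo_image by (force simp: image_iff)
  have det: "det (matrix (?g' y)) = det (matrix (g' (of_wo y)))" for y
    using det_wo[of "matrix (g' (of_wo y))"] by (simp add: matrix_def of_wo_axis to_wo_def)
  have ind: "indicator (of_wo -` T) y = (indicator T (of_wo y) :: 'c::zero_neq_one)" for T and y :: "real ^ 'n wo"
    by (simp add: indicator_def)
  have meas: "(\<lambda>x. indicator T x * ennreal (k x)) \<in> borel_measurable borel"
    if "(\<lambda>x. indicator T x * k x) \<in> borel_measurable borel" for T and k :: "real ^ 'n \<Rightarrow> real"
  proof -
    have "(\<lambda>x. ennreal (indicator T x * k x)) \<in> borel_measurable borel" using that by measurable
    then show ?thesis
      by (rule measurable_cong[THEN iffD1, rotated]) (simp split: split_indicator)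
  qed
  have 1: "(\<integral>\<^sup>+x\<in>T. ennreal (k x) \<partial>lborel) = (\<integral>\<^sup>+y\<in>of_wo -` T. ennreal (k (of_wo y)) \<partial>lborel)"
    if "(\<lambda>x. indicator T x * k x) \<in> borel_measurable borel" for T and k :: "real ^ 'n \<Rightarrow> real"
    using nn_integral_wo[OF meas[OF that]] by (simp add: ind mult.commute)
  have "(\<integral>\<^sup>+y\<in>?g ` ?S. ennreal (?f y) \<partial>lborel) = (\<integral>\<^sup>+y\<in>?S. ennreal (\<bar>det (matrix (?g' y))\<bar> * ?f (?g y)) \<partial>lborel)"
  proof (rule nn_integral_change_of_variables_wo)
    show "?S \<in> sets borel" "?g ` ?S \<in> sets borel"
      unfolding im using measurable_sets[OF measurable_wo(2)] S gS by simp_all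
    show "(?g has_derivative ?g' y) (at y)" if "y \<in> ?S" for y
    proof -
      have d1: "(of_wo has_derivative of_wo) (at y)"
        by (rule bounded_linear_imp_has_derivative[OF bounded_linear_wo(2)])
      have d2: "(to_wo has_derivative to_wo) (at (g (of_wo y)))"
        by (rule bounded_linear_imp_has_derivative[OF bounded_linear_wo(1)])
      have d3: "(g has_derivative g' (of_wo y)) (at (of_wo y))"
        using der that by simp
      show ?thesis
        using has_derivative_compose[OF has_derivative_compose[OF d1 d3] d2] .
    qed
    show "inj_on ?g ?S"
      using inj unfolding inj_on_def by (metis of_to_wo vimage_eq)
    show "(\<lambda>y. indicator (?g ` ?S) y * ?f y) \<in> borel_measurable borel"
      unfolding im ind using measurable_compose[OF measurable_wo(2) f(1)] .
    show "(\<lambda>y. indicator ?S y * (\<bar>det (matrix (?g' y))\<bar> * ?f (?g y))) \<in> borel_measurable borel"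
      unfolding ind det of_to_wo using measurable_compose[OF measurable_wo(2) fg] .
    show "?f y \<ge> 0" if "y \<in> ?g ` ?S" for y
      using f(2)[of "of_wo y"] that unfolding im by simp
  qed
  then show ?thesis
    unfolding 1[OF f(1)] 1[OF fg] im det of_to_wo .
qed

text \<open>The difference quotients have integral 0 by translation invariance and converge to the
  partial derivative. The mean value theorem bounds them by the maximum \<open>C\<close> of the
  derivative, so dominated convergence applies.\<close>

lemma integral_partial_deriv_zero:
  fixes h :: "real ^ 'n::finite \<Rightarrow> real"
  assumes h: "smooth_on_open UNIV h" and K: "compact K" "\<And>x. x \<notin> K \<Longrightarrow> h x = 0"
  shows "(LINT x|lborel. partial_deriv i h x) = 0"
proof -
  let ?p = "partial_deriv i h" and ?e = "axis i 1 :: real ^ 'n"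
  have diff: "h differentiable (at x)" for x
    using h smooth_on_openD by blast
  have conth: "continuous_on UNIV h" and contp: "continuous_on UNIV ?p"
    using smooth_on_open_continuous_on[OF h] smooth_on_open_continuous_on[OF smooth_on_open_partial[OF h]] by auto
  have p0: "?p x = 0" if "x \<notin> K" for x
    using partial_deriv_cong[of "- K" x h "\<lambda>_. 0" i] that K compact_imp_closed by (auto simp: open_Compl)
  obtain C where C: "\<And>x. \<bar>?p x\<bar> \<le> C"
  proof -
    have "bounded (?p ` K)"
      using compact_imp_bounded[OF compact_continuous_image[OF continuous_on_subset[OF contp] K(1)]] by auto
    then obtain C where "\<And>x. x \<in> K \<Longrightarrow> \<bar>?p x\<bar> \<le> C"
      by (auto simp: bounded_iff)
    then have "\<bar>?p x\<bar> \<le> max C 0" for x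
      using p0[of x] by (cases "x \<in> K") (auto simp: le_max_iff_disj)
    then show ?thesis using that by blast
  qed
  have C0: "C \<ge> 0" using C[of 0] by linarith
  obtain R where R: "\<And>x. x \<in> K \<Longrightarrow> norm x \<le> R"
    using compact_imp_bounded[OF K(1)] by (auto simp: bounded_iff)
  define D where "D k x = real (Suc k) * (h (x + (1 / real (Suc k)) *\<^sub>R ?e) - h x)" for k x
  have deriv: "((\<lambda>s. h (x + s *\<^sub>R ?e)) has_real_derivative ?p (x + s *\<^sub>R ?e)) (at s)" for x s
    by (rule has_real_derivative_along_axis[OF diff])
  have lip: "\<bar>h (x + s *\<^sub>R ?e) - h x\<bar> \<le> C * s" if s: "s > 0" for x s
  proof -
    obtain z where "h (x + s *\<^sub>R ?e) - h (x + 0 *\<^sub>R ?e) = (s - 0) * ?p (x + z *\<^sub>R ?e)"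
      using MVT2[OF s, of "\<lambda>s. h (x + s *\<^sub>R ?e)" "\<lambda>s. ?p (x + s *\<^sub>R ?e)"] deriv by blast
    then show ?thesis
      using C[of "x + z *\<^sub>R ?e"] s by (simp add: abs_mult mult.commute mult_right_mono)
  qed
  have hm: "h \<in> borel_measurable borel" "?p \<in> borel_measurable borel"
    using conth contp borel_measurable_continuous_onI by auto
  have inth: "integrable lborel h"
  proof -
    have "integrable lborel (\<lambda>x. indicator K x *\<^sub>R h x)"
      using borel_integrable_compact[OF K(1) continuous_on_subset[OF conth]] by (simp add: indicator_def if_distrib cong: if_cong)
    moreover have "(\<lambda>x. indicator K x *\<^sub>R h x) = h"
      using K(2) by (auto simp: indicator_def fun_eq_iff)
    ultimately show ?thesis by simp
  qed
  have shift: "integrable lborel (\<lambda>x. h (x + a)) \<and> (LINT x|lborel. h (x + a)) = (LINT x|lborel. h x)" for a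
  proof -
    have "integrable (distr lborel borel ((+) a)) h" using inth by (simp add: lborel_distr_plus)
    then have "integrable lborel (\<lambda>x. h (a + x))"
      by (subst (asm) integrable_distr_eq) (use hm in auto)
    moreover have "(LINT x|distr lborel borel ((+) a). h x) = (LINT x|lborel. h (a + x))"
      by (rule integral_distr) (use hm in auto)
    ultimately show ?thesis by (simp add: lborel_distr_plus add.commute)
  qed
  have "(\<lambda>k. LINT x|lborel. D k x) \<longlonglongrightarrow> (LINT x|lborel. ?p x)"
  \<comment> \<open>\<open>K\<close> lies in the ball of radius \<open>R\<close> and the
    translations have length at most 1, so all quotients vanish outside radius
    \<open>R + 1\<close>.\<close>
  proof (rule integral_dominated_convergence[where w = "\<lambda>x. indicator (cball 0 (R + 1)) x *\<^sub>R C"])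
    show "?p \<in> borel_measurable lborel" using hm by simp
    show "D k \<in> borel_measurable lborel" for k
      unfolding D_def using hm(1) by measurable
    show "integrable lborel (\<lambda>x::real ^ 'n. indicator (cball 0 (R + 1)) x *\<^sub>R C)"
      using borel_integrable_compact[OF compact_cball[of 0 "R + 1"] continuous_on_const[of _ C]]
      by (simp add: indicator_def if_distrib cong: if_cong)
    show "AE x in lborel. (\<lambda>k. D k x) \<longlonglongrightarrow> ?p x"
    proof (rule AE_I2)
      fix x
      have "((\<lambda>s. (h (x + s *\<^sub>R ?e) - h x) / s) \<longlongrightarrow> ?p x) (at 0)"
        using deriv[of x 0] by (simp add: DERIV_def)
      moreover have "filterlim (\<lambda>k. 1 / real (Suc k)) (at 0) sequentially"
        using LIMSEQ_inverse_real_of_nat by (auto simp: filterlim_at inverse_eq_divide)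
      ultimately have "(\<lambda>k. (h (x + (1 / real (Suc k)) *\<^sub>R ?e) - h x) / (1 / real (Suc k))) \<longlonglongrightarrow> ?p x"
        by (rule filterlim_compose)
      then show "(\<lambda>k. D k x) \<longlonglongrightarrow> ?p x"
        by (simp add: D_def mult.commute)
    qed
    show "AE x in lborel. norm (D k x) \<le> indicator (cball 0 (R + 1)) x *\<^sub>R C" for k
    proof (rule AE_I2)
      fix x :: "real ^ 'n"
      show "norm (D k x) \<le> indicator (cball 0 (R + 1)) x *\<^sub>R C"
      proof (cases "x \<in> cball 0 (R + 1)")
        case True
        have "\<bar>D k x\<bar> = real (Suc k) * \<bar>h (x + (1 / real (Suc k)) *\<^sub>R ?e) - h x\<bar>"
          unfolding D_def abs_mult by simp
        also have "\<dots> \<le> real (Suc k) * (C * (1 / real (Suc k)))"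
          by (intro mult_left_mono lip) auto
        finally show ?thesis using True by simp
      next
        case False
        have "norm x \<le> norm (x + (1 / real (Suc k)) *\<^sub>R ?e) + norm ((1 / real (Suc k)) *\<^sub>R ?e)"
          by (metis add_diff_cancel norm_triangle_ineq4)
        moreover have "norm ((1 / real (Suc k)) *\<^sub>R ?e) \<le> 1" by simp
        moreover have "norm x > R + 1" using False by simp
        ultimately have "norm (x + (1 / real (Suc k)) *\<^sub>R ?e) > R" "norm x > R"
          by linarith+
        then have "x + (1 / real (Suc k)) *\<^sub>R ?e \<notin> K" "x \<notin> K" using R by force+
        then show ?thesis using False by (simp add: D_def K(2))
      qed
    qed
  qed
  moreover have "(LINT x|lborel. D k x) = 0" for k
    using shift[of "(1 / real (Suc k)) *\<^sub>R ?e"] inth by (simp add: D_def)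
  ultimately show ?thesis
    using LIMSEQ_unique[of "\<lambda>_. 0::real"] by auto
qed

section \<open>Borel sets in charts and the construction of the measure\<close>

context chart
begin

abbreviation MB where "MB \<equiv> sigma_sets (topspace X) {U. openin X U}"

lemma borel_preimage_param:
  assumes "B \<in> MB"
  shows "{x \<in> coords c ` dom. param c x \<in> B} \<in> sets borel"
  using assms
proof induction
  case (Basic V)
  then have "openin X (V \<inter> dom)" using openin_dom by blast
  moreover have "{x \<in> coords c ` dom. param c x \<in> V} = coords c ` (V \<inter> dom)"
    using param_dom by force
  ultimately show ?case using open_coords[of "V \<inter> dom"] by simp
next
  case (Compl V)
  have "{x \<in> coords c ` dom. param c x \<in> topspace X - V} = coords c ` dom - {x \<in> coords c ` dom. param c x \<in> V}"
    using param_dom dom_subset by blast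
  then show ?case using Compl open_coords_dom by auto
next
  case (Union F)
  have "{x \<in> coords c ` dom. param c x \<in> (\<Union>i. F i)} = (\<Union>i. {x \<in> coords c ` dom. param c x \<in> F i})"
    by blast
  then show ?case using Union by auto
qed simp

lemma coords_image_eq: "B \<subseteq> dom \<Longrightarrow> coords c ` B = {x \<in> coords c ` dom. param c x \<in> B}"
  by force

lemma borel_coords: "B \<in> MB \<Longrightarrow> B \<subseteq> dom \<Longrightarrow> coords c ` B \<in> sets borel"
  by (subst coords_image_eq, assumption, rule borel_preimage_param)

lemma dom_MB: "dom \<in> MB"
  using openin_dom by blast

lemma borel_measurable_indicator_param:
  assumes "sm c f" "B \<in> MB" "B \<subseteq> dom"
  shows "(\<lambda>x. indicator (coords c ` B) x * f (param c x)) \<in> borel_measurable borel"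
proof -
  have "continuous_on (coords c ` B) (f \<circ> param c)"
    using assms smooth_on_open_continuous_on continuous_on_subset unfolding smooth_in_chart_def by (metis image_mono)
  from borel_measurable_continuous_on_indicator[OF borel_coords[OF assms(2,3)] this]
  show ?thesis by (simp add: o_def)
qed

end

lemma (in sympl_chart) sm_vd:
  assumes "even CARD('n)"
  shows "sm c vd"
  unfolding smooth_in_chart_def smooth_on_open_def
proof (intro allI ballI)
  fix "is" x assume "x \<in> coords c ` dom"
  then obtain p where p: "p \<in> dom" "x = coords c p" by blast
  obtain V r where V: "openin X V" "p \<in> V" "V \<subseteq> dom" "\<And>q. q \<in> V \<Longrightarrow> vd q = r * vol_pf q"
    using vd_locally[OF assms p(1)] by blast
  have "sm c (\<lambda>q. r * vol_pf q)" using sm_vol_pf by simp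
  then have "smooth_in_chart c V (\<lambda>q. r * vol_pf q)"
    by (rule smooth_in_chart_subset[OF _ V(3)])
  then have "smooth_in_chart c V vd"
    using smooth_cong[OF V(1,3), of vd "\<lambda>q. r * vol_pf q"] V(4) by simp
  then show "iterated_partial_deriv is (vd \<circ> param c) differentiable at x"
    using V(2) p(2) unfolding smooth_in_chart_def smooth_on_open_def by blast
qed

context symplectic_conn
begin

lemma volume_change_of_chart:
  assumes cd: "c \<in> A" "d \<in> A" and even: "even CARD('n)"
    and B: "B \<in> sigma_sets (topspace X) {U. openin X U}" "B \<subseteq> chart_dom c \<inter> chart_dom d"
  shows "(\<integral>\<^sup>+x\<in>coords d ` B. ennreal (volume_density Om d (param d x)) \<partial>lborel)
    = (\<integral>\<^sup>+x\<in>coords c ` B. ennreal (volume_density Om c (param c x)) \<partial>lborel)"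
proof -
  interpret c: sympl_chart X c Om G by (rule sympl_chart_ax[OF cd(1)])
  interpret d: sympl_chart X d Om G by (rule sympl_chart_ax[OF cd(2)])
  let ?g = "\<lambda>x. coords d (param c x)"
  let ?g' = "\<lambda>x h. \<chi> a. \<Sum>i\<in>UNIV. h $ i * jac c d i a (param c x)"
  have Bc: "B \<subseteq> chart_dom c" and Bd: "B \<subseteq> chart_dom d" using B by auto
  have im: "?g ` coords c ` B = coords d ` B"
    using Bc by (force simp: image_image)
  have mat: "det (matrix (?g' x)) = det (\<chi> i a. jac c d i a (param c x))" for x
  proof -
    have "matrix (?g' x) = transpose (\<chi> i a. jac c d i a (param c x))"
      by (simp add: matrix_def transpose_def vec_eq_iff axis_def if_distrib if_distribR cong: if_cong)
    then show ?thesis by (simp only: det_transpose)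
  qed
  have vol: "\<bar>det (matrix (?g' x))\<bar> * volume_density Om d (param d (?g x)) = volume_density Om c (param c x)"
    if "x \<in> coords c ` B" for x
  proof -
    obtain p where p: "p \<in> B" "x = coords c p" using \<open>x \<in> coords c ` B\<close> by blast
    then have "p \<in> chart_dom c \<inter> chart_dom d" using B by auto
    then show ?thesis
      unfolding mat using volume_density_trans[OF cd _ even, of p] p by simp
  qed
  have fg: "(\<lambda>x. indicator (coords c ` B) x * (\<bar>det (matrix (?g' x))\<bar> * volume_density Om d (param d (?g x))))
      = (\<lambda>x. indicator (coords c ` B) x * volume_density Om c (param c x))"
    by (rule ext) (simp add: vol split: split_indicator)
  have "(\<integral>\<^sup>+x\<in>?g ` coords c ` B. ennreal (volume_density Om d (param d x)) \<partial>lborel)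
    = (\<integral>\<^sup>+x\<in>coords c ` B. ennreal (\<bar>det (matrix (?g' x))\<bar> * volume_density Om d (param d (?g x))) \<partial>lborel)"
  proof (rule nn_integral_change_of_variables)
    show "coords c ` B \<in> sets borel" "?g ` coords c ` B \<in> sets borel"
      unfolding im using c.borel_coords[OF B(1) Bc] d.borel_coords[OF B(1) Bd] by auto
    show "(?g has_derivative ?g' x) (at x)" if x: "x \<in> coords c ` B" for x
    proof -
      obtain p where p: "p \<in> B" "x = coords c p" using x by blast
      have "((\<lambda>x. coords d (param c x) $ a) has_derivative (\<lambda>h. \<Sum>i\<in>UNIV. h $ i * jac c d i a (param c x))) (at x)" for a
      proof -
        have "mdiff c (\<lambda>q. coords d q $ a) p"
          using smooth_in_chart_mdiff[OF transition[OF cd]] p B by blast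
        from has_derivative_partial_deriv[OF this[unfolded mdiff_def]]
        show ?thesis using p Bc by (auto simp: jac_def pd_def o_def)
      qed
      then show ?thesis
        by (subst has_derivative_componentwise_within) (auto simp: Basis_vec_def inner_axis)
    qed
    show "inj_on ?g (coords c ` B)"
      using Bc Bd d.inj_coords by (auto simp: inj_on_def subset_iff) metis
    show "(\<lambda>x. indicator (?g ` coords c ` B) x * volume_density Om d (param d x)) \<in> borel_measurable borel"
      unfolding im by (rule d.borel_measurable_indicator_param[OF d.sm_vd[OF even] B(1) Bd])
    show "(\<lambda>x. indicator (coords c ` B) x * (\<bar>det (matrix (?g' x))\<bar> * volume_density Om d (param d (?g x)))) \<in> borel_measurable borel"
      unfolding fg by (rule c.borel_measurable_indicator_param[OF c.sm_vd[OF even] B(1) Bc])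
  qed (simp add: volume_density_def Let_def)
  also have "\<dots> = (\<integral>\<^sup>+x\<in>coords c ` B. ennreal (volume_density Om c (param c x)) \<partial>lborel)"
    by (intro nn_integral_cong) (simp add: vol split: split_indicator)
  finally show ?thesis unfolding im .
qed

text \<open>The property by which \<open>symplectic_measure\<close> is chosen. Existence
  (\<open>vol_exists\<close>) is what gives the choice its meaning.\<close>

definition is_vol :: "'m measure \<Rightarrow> bool" where
  "is_vol \<mu> \<longleftrightarrow> space \<mu> = topspace X \<and>
     sets \<mu> = sigma_sets (topspace X) {U. openin X U} \<and>
     (\<forall>c\<in>A. \<forall>B\<in>sets \<mu>. B \<subseteq> chart_dom c \<longrightarrow>
        emeasure \<mu> B =
          (\<integral>\<^sup>+x\<in>coords c ` B. ennreal (volume_density Om c (param c x)) \<partial>lborel))"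

text \<open>For each member of a countable base that fits into some chart domain one such chart is
  chosen; these members already cover the space.\<close>

lemma countable_subatlas:
  obtains C where "C \<subseteq> A" "countable C" "(\<Union>c\<in>C. chart_dom c) = topspace X"
proof -
  from second_countable[unfolded second_countable_def]
  obtain \<B> where B0: "countable \<B> \<and> (\<forall>V\<in>\<B>. openin X V) \<and> (\<forall>U x. openin X U \<and> x \<in> U \<longrightarrow> (\<exists>V\<in>\<B>. x \<in> V \<and> V \<subseteq> U))" ..
  then have B: "countable \<B>" "\<And>U x. openin X U \<Longrightarrow> x \<in> U \<Longrightarrow> \<exists>V\<in>\<B>. x \<in> V \<and> V \<subseteq> U"
    by simp_all
  define f where "f V = (SOME c. c \<in> A \<and> V \<subseteq> chart_dom c)" for V
  let ?B = "{V \<in> \<B>. \<exists>c\<in>A. V \<subseteq> chart_dom c}"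
  have f: "f V \<in> A \<and> V \<subseteq> chart_dom (f V)" if "V \<in> ?B" for V
    unfolding f_def by (rule someI_ex) (use that in blast)
  have 1: "topspace X \<subseteq> (\<Union>c\<in>f ` ?B. chart_dom c)"
  proof
    fix x assume "x \<in> topspace X"
    then obtain c where c: "c \<in> A" "x \<in> chart_dom c" using cover by blast
    then obtain V where "V \<in> \<B>" "x \<in> V" "V \<subseteq> chart_dom c"
      using B(2)[OF chart.openin_dom[OF chart_ax[OF c(1)]] c(2)] by blast
    then have "V \<in> ?B" "x \<in> V" using c by auto
    then show "x \<in> (\<Union>c\<in>f ` ?B. chart_dom c)" using f by blast
  qed
  have fA: "f ` ?B \<subseteq> A"
    by (rule image_subsetI) (rule f[THEN conjunct1])
  have "(\<Union>c\<in>f ` ?B. chart_dom c) \<subseteq> topspace X"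
    by (rule UN_least) (rule chart.dom_subset[OF chart_ax[OF subsetD[OF fA]]])
  with 1 have "(\<Union>c\<in>f ` ?B. chart_dom c) = topspace X" by (intro equalityI)
  moreover have "countable (f ` ?B)" using B(1) by (intro countable_image countable_subset[OF _ B(1)]) auto
  ultimately show ?thesis by (intro that[OF fA])
qed

text \<open>The manifold is cut into countably many disjoint Borel pieces \<open>D j\<close>, each
  inside one chart, and the measures of the pieces in their charts are added. By
  \<open>volume_change_of_chart\<close> any other chart computes the same measure.\<close>

lemma vol_exists:
  assumes even: "even CARD('n)"
  shows "\<exists>\<mu>. is_vol \<mu>"
proof (cases "A = {}")
  case True
  have "{U. openin X U} \<subseteq> Pow (topspace X)"
    using openin_subset by blast
  then have "is_vol (sigma (topspace X) {U. openin X U})"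
    unfolding is_vol_def using True by (simp add: sets_measure_of space_measure_of_conv)
  then show ?thesis by blast
next
  case False
  let ?M = "sigma_sets (topspace X) {U. openin X U}"
  have sa: "sigma_algebra (topspace X) ?M"
    by (rule sigma_algebra_sigma_sets) (auto dest: openin_subset)
  obtain C where C: "C \<subseteq> A" "countable C" "(\<Union>c\<in>C. chart_dom c) = topspace X"
    by (rule countable_subatlas)
  obtain k :: "nat \<Rightarrow> ('m, 'n) chart" where k: "range k \<subseteq> A" "(\<Union>j. chart_dom (k j)) = topspace X"
  proof (cases "C = {}")
    case True
    then have "topspace X = {}" using C(3) by simp
    moreover obtain c where "c \<in> A" using False by blast
    moreover then have "chart_dom c = {}" using calculation chart.dom_subset[OF chart_ax] by blast
    ultimately show ?thesis using that[of "\<lambda>_. c"] by simp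
  next
    case False
    then show ?thesis using that[of "from_nat_into C"] C range_from_nat_into[OF False C(2)] by (metis image_image)
  qed
  have kA: "k j \<in> A" for j using k by blast
  define D where "D = disjointed (\<lambda>j. chart_dom (k j))"
  have D: "disjoint_family D" "(\<Union>j. D j) = topspace X" "D j \<subseteq> chart_dom (k j)" "D j \<in> ?M" for j
  proof -
    show "disjoint_family D" "(\<Union>j. D j) = topspace X"
      unfolding D_def by (simp_all add: disjoint_family_disjointed UN_disjointed_eq k)
    show "D j \<subseteq> chart_dom (k j)"
      unfolding D_def by (rule disjointed_subset)
    interpret sigma_algebra "topspace X" ?M by (rule sa)
    show "D j \<in> ?M"
      unfolding D_def disjointed_def using chart.dom_MB[OF chart_ax[OF kA]] by auto
  qed
  define v where "v c x = ennreal (volume_density Om c (param c x))" for c x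
  \<comment> \<open>The sum over the pieces is written as an integral over
    \<open>count_space\<close>, so that exchanging it with the sum in countable additivity is
    \<open>nn_integral_suminf\<close>.\<close>
  define m where "m B = (\<integral>\<^sup>+j. (\<integral>\<^sup>+x\<in>coords (k j) ` (B \<inter> D j). v (k j) x \<partial>lborel) \<partial>count_space (UNIV :: nat set))" for B
  have meas: "(\<lambda>x. v c x * indicator (coords c ` B) x) \<in> borel_measurable lborel"
    if "c \<in> A" "B \<in> ?M" "B \<subseteq> chart_dom c" for c B
  proof -
    interpret sympl_chart X c Om G by (rule sympl_chart_ax[OF that(1)])
    have "(\<lambda>x. ennreal (indicator (coords c ` B) x * volume_density Om c (param c x))) \<in> borel_measurable lborel"
      using borel_measurable_indicator_param[OF sm_vd[OF even] that(2,3)] by simp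
    then show ?thesis
      by (rule measurable_cong[THEN iffD1, rotated]) (simp add: v_def split: split_indicator)
  qed
  have split: "(\<integral>\<^sup>+x\<in>coords c ` (\<Union>i. F i). v c x \<partial>lborel) = (\<Sum>i. \<integral>\<^sup>+x\<in>coords c ` F i. v c x \<partial>lborel)"
    if c: "c \<in> A" and F: "\<And>i. F i \<in> ?M" "\<And>i. F i \<subseteq> chart_dom c" "disjoint_family F" for c and F :: "nat \<Rightarrow> 'm set"
  proof -
    have inj: "inj_on (coords c) (chart_dom c)"
      by (rule chart.inj_coords[OF chart_ax[OF c]])
    have "disjoint_family (\<lambda>i. coords c ` F i)"
      using F(2,3) inj unfolding disjoint_family_on_def by (metis image_empty inj_on_image_Int)
    then have "(\<integral>\<^sup>+x\<in>coords c ` (\<Union>i. F i). v c x \<partial>lborel) = (\<integral>\<^sup>+x. (\<Sum>i. v c x * indicator (coords c ` F i) x) \<partial>lborel)"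
      by (intro nn_integral_cong) (simp add: image_UN suminf_indicator[symmetric] ennreal_suminf_cmult)
    also have "\<dots> = (\<Sum>i. \<integral>\<^sup>+x\<in>coords c ` F i. v c x \<partial>lborel)"
      by (rule nn_integral_suminf) (rule meas[OF c F(1,2)])
    finally show ?thesis .
  qed
  interpret sigma_algebra "topspace X" ?M by (rule sa)
  let ?\<mu> = "measure_of (topspace X) ?M m"
  have em: "emeasure ?\<mu> B = m B" if "B \<in> ?M" for B
  proof (rule emeasure_measure_of_sigma[OF sa _ _ that])
    show "positive ?M m" by (simp add: positive_def m_def)
    show "countably_additive ?M m"
    proof (rule countably_additiveI)
      fix F :: "nat \<Rightarrow> 'm set" assume F: "range F \<subseteq> ?M" "disjoint_family F" "(\<Union>i. F i) \<in> ?M"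
      have "(\<integral>\<^sup>+x\<in>coords (k j) ` ((\<Union>i. F i) \<inter> D j). v (k j) x \<partial>lborel)
        = (\<Sum>i. \<integral>\<^sup>+x\<in>coords (k j) ` (F i \<inter> D j). v (k j) x \<partial>lborel)" for j
      proof -
        have eq: "(\<Union>i. F i) \<inter> D j = (\<Union>i. F i \<inter> D j)" by blast
        have FD: "F i \<inter> D j \<in> ?M" for i
          by (rule Int) (use F(1) D(4) in auto)
        have "F i \<inter> D j \<subseteq> chart_dom (k j)" for i using D(3) by blast
        moreover have "disjoint_family (\<lambda>i. F i \<inter> D j)"
          using F(2) unfolding disjoint_family_on_def by blast
        ultimately show ?thesis
          unfolding eq by (rule split[OF kA FD])
      qed
      then show "(\<Sum>i. m (F i)) = m (\<Union>i. F i)"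
        unfolding m_def by (simp add: nn_integral_suminf)
    qed
  qed
  have "is_vol ?\<mu>"
    unfolding is_vol_def
  proof (intro conjI ballI impI)
    show "space ?\<mu> = topspace X" by (simp add: space_measure_of_conv)
    show sets: "sets ?\<mu> = ?M" by (simp add: sets_measure_of_eq)
    fix c B assume c: "c \<in> A" and "B \<in> sets ?\<mu>" and Bc: "B \<subseteq> chart_dom c"
    then have B: "B \<in> ?M" using sets by simp
    have "m B = (\<Sum>j. \<integral>\<^sup>+x\<in>coords (k j) ` (B \<inter> D j). v (k j) x \<partial>lborel)"
      unfolding m_def by (rule nn_integral_count_space_nat)
    also have "\<dots> = (\<Sum>j. \<integral>\<^sup>+x\<in>coords c ` (B \<inter> D j). v c x \<partial>lborel)"
      unfolding v_def using B Bc D(3,4) by (intro suminf_cong volume_change_of_chart[OF c kA even]) auto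
    also have "\<dots> = (\<integral>\<^sup>+x\<in>coords c ` (\<Union>j. B \<inter> D j). v c x \<partial>lborel)"
      using B Bc D(1,4) by (intro split[OF c, symmetric]) (auto simp: disjoint_family_on_def)
    also have "(\<Union>j. B \<inter> D j) = B"
      using D(2) Bc chart.dom_subset[OF chart_ax[OF c]] by auto
    finally show "emeasure ?\<mu> B = (\<integral>\<^sup>+x\<in>coords c ` B. ennreal (volume_density Om c (param c x)) \<partial>lborel)"
      unfolding em[OF B] v_def .
  qed
  then show ?thesis by blast
qed

lemma is_vol_symplectic_measure: "even CARD('n) \<Longrightarrow> is_vol (symplectic_measure X A Om)"
  using someI_ex[OF vol_exists] unfolding symplectic_measure_def is_vol_def .

end

section \<open>Functions with compact support in a chart, read in coordinates\<close>

context chart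
begin

lemma compact_coords: "compactin X K \<Longrightarrow> K \<subseteq> dom \<Longrightarrow> compact (coords c ` K)"
  using image_compactin[OF _ homeomorphic_imp_continuous_map[OF homeo], of K]
  by (simp add: compactin_subtopology)

text \<open>Extension by zero to the whole coordinate space. It is smooth for functions with compact
  support in the chart, which is what lets \<open>integral_partial_deriv_zero\<close> apply.\<close>

definition push :: "('m \<Rightarrow> real) \<Rightarrow> real ^ 'n \<Rightarrow> real" where
  "push f x = (if x \<in> coords c ` dom then f (param c x) else 0)"

context
  fixes f :: "'m \<Rightarrow> real" and K :: "'m set"
  assumes f: "sm c f" and K: "compactin X K" "K \<subseteq> dom" "\<And>q. q \<in> dom \<Longrightarrow> q \<notin> K \<Longrightarrow> f q = 0"
begin

lemma push_zero: "x \<notin> coords c ` K \<Longrightarrow> push f x = 0"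
proof (cases "x \<in> coords c ` dom")
  assume "x \<notin> coords c ` K"
  case True
  then obtain q where q: "q \<in> dom" "x = coords c q" by blast
  then have "q \<notin> K" using \<open>x \<notin> coords c ` K\<close> by blast
  then show ?thesis using q K(3) by (simp add: push_def)
qed (simp add: push_def)

lemma smooth_push: "smooth_on_open UNIV (push f)"
proof -
  have op: "open (- coords c ` K)"
    using compact_imp_closed[OF compact_coords[OF K(1,2)]] by (simp add: open_Compl)
  have "smooth_on_open (coords c ` dom) (push f)"
    using f unfolding smooth_in_chart_def
    by (rule smooth_on_open_cong[OF open_coords_dom, THEN iffD1, rotated]) (simp add: push_def)
  moreover have "smooth_on_open (- coords c ` K) (push f)"
    using smooth_on_open_cong[OF op, of "push f" "\<lambda>_. 0"] push_zero smooth_on_open_const by simp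
  ultimately have "smooth_on_open (coords c ` dom \<union> - coords c ` K) (push f)"
    by (rule smooth_on_open_Un)
  moreover have "coords c ` dom \<union> - coords c ` K = UNIV" using K(2) by auto
  ultimately show ?thesis by simp
qed

lemma integrable_push: "integrable lborel (push f)"
proof -
  have "continuous_on (coords c ` K) (push f)"
    using smooth_on_open_continuous_on[OF smooth_push] continuous_on_subset by blast
  from borel_integrable_compact[OF compact_coords[OF K(1,2)] this]
  have "integrable lborel (\<lambda>x. indicator (coords c ` K) x *\<^sub>R push f x)"
    by (simp add: indicator_def if_distrib cong: if_cong)
  moreover have "(\<lambda>x. indicator (coords c ` K) x *\<^sub>R push f x) = push f"
    using push_zero by (auto simp: indicator_def fun_eq_iff)
  ultimately show ?thesis by simp
qed

lemma push_pd: "push (pd c i f) = partial_deriv i (push f)"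
proof
  fix x
  show "push (pd c i f) x = partial_deriv i (push f) x"
  proof (cases "x \<in> coords c ` dom")
    case True
    have "partial_deriv i (push f) x = partial_deriv i (f \<circ> param c) x"
      by (rule partial_deriv_cong[OF open_coords_dom True]) (simp add: push_def)
    then show ?thesis using True by (simp add: push_def pd_def)
  next
    case False
    have op: "open (- coords c ` K)"
      using compact_imp_closed[OF compact_coords[OF K(1,2)]] by (simp add: open_Compl)
    have "partial_deriv i (push f) x = partial_deriv i (\<lambda>_. 0) x"
      by (rule partial_deriv_cong[OF op]) (use False K(2) push_zero in auto)
    then show ?thesis using False by (simp add: push_def)
  qed
qed

lemma integral_push_pd: "(LINT x|lborel. push (pd c i f) x) = 0"
  unfolding push_pd by (rule integral_partial_deriv_zero[OF smooth_push compact_coords[OF K(1,2)] push_zero])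

end

end

section \<open>Integration against the symplectic measure\<close>

context symplectic_conn
begin

abbreviation \<mu> where "\<mu> \<equiv> symplectic_measure X A Om"

context
  assumes even: "even CARD('n)"
begin

lemma space_\<mu>: "space \<mu> = topspace X"
  and sets_\<mu>: "sets \<mu> = sigma_sets (topspace X) {U. openin X U}"
  and emeasure_\<mu>: "c \<in> A \<Longrightarrow> B \<in> sets \<mu> \<Longrightarrow> B \<subseteq> chart_dom c \<Longrightarrow>
    emeasure \<mu> B = (\<integral>\<^sup>+x\<in>coords c ` B. ennreal (volume_density Om c (param c x)) \<partial>lborel)"
  using is_vol_symplectic_measure[OF even] unfolding is_vol_def by blast+

lemma open_sets: "openin X U \<Longrightarrow> U \<in> sets \<mu>"
  unfolding sets_\<mu> by blast

lemma openin_smooth_preimage: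
  assumes "smooth_fun f" "open S"
  shows "openin X {p \<in> topspace X. f p \<in> S}"
proof -
  have "openin X {p \<in> chart_dom c. f p \<in> S}" if c: "c \<in> A" for c
  proof -
    interpret chart X c by (rule chart_ax[OF c])
    have "openin (subtopology X dom) {q \<in> topspace (subtopology X dom). f q \<in> S}"
      by (rule openin_continuous_map_preimage[OF sm_continuous_map])
        (use assms c in \<open>auto simp: smooth_fun_def\<close>)
    then show ?thesis
      using openin_dom openin_trans_full dom_subset by (simp add: inf.absorb2)
  qed
  then have "openin X (\<Union>c\<in>A. {p \<in> chart_dom c. f p \<in> S})" by blast
  moreover have "(\<Union>c\<in>A. {p \<in> chart_dom c. f p \<in> S}) = {p \<in> topspace X. f p \<in> S}"
    using cover by blast
  ultimately show ?thesis by simp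
qed

lemma measurable_smooth: "smooth_fun f \<Longrightarrow> f \<in> borel_measurable \<mu>"
proof (rule borel_measurableI)
  fix S :: "real set" assume "smooth_fun f" "open S"
  from open_sets[OF openin_smooth_preimage[OF this]]
  show "f -` S \<inter> space \<mu> \<in> sets \<mu>"
    by (simp add: space_\<mu> vimage_def Int_def conj_commute)
qed

lemma continuous_smooth: "smooth_fun f \<Longrightarrow> continuous_map X euclideanreal f"
  unfolding continuous_map_def using openin_smooth_preimage by auto

text \<open>The density is bounded on small coordinate balls, so each point has an open
  neighbourhood of finite measure, and finitely many of these cover \<open>K\<close>.\<close>

lemma finite_compact:
  assumes K: "compactin X K"
  shows "emeasure \<mu> K < \<infinity>" "K \<in> sets \<mu>"
proof -
  have closed: "closedin X K"
    using K Hausdorff compactin_imp_closedin by blast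
  have "topspace X - (topspace X - K) \<in> sets \<mu>"
    using closed by (metis Diff_Diff_Int closedin_def inf.absorb2 open_sets openin_topspace sets.Diff)
  moreover have "topspace X - (topspace X - K) = K" using compactin_subset_topspace[OF K] by blast
  ultimately show KS: "K \<in> sets \<mu>" by simp
  have "\<exists>N. openin X N \<and> p \<in> N \<and> emeasure \<mu> N < \<infinity>" if "p \<in> K" for p
  proof -
    obtain c where c: "c \<in> A" "p \<in> chart_dom c"
      using cover compactin_subset_topspace[OF K] \<open>p \<in> K\<close> by blast
    interpret sympl_chart X c Om G by (rule sympl_chart_ax[OF c(1)])
    obtain r where r: "r > 0" "cball (coords c p) r \<subseteq> coords c ` dom"
      using open_coords_dom c(2) open_contains_cball by blast
    define N where "N = {q \<in> dom. coords c q \<in> ball (coords c p) r}"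
    have N: "openin X N" unfolding N_def by (rule openin_preimage) simp
    have im: "coords c ` N \<subseteq> cball (coords c p) r" by (auto simp: N_def)
    have "continuous_on (cball (coords c p) r) (vd \<circ> param c)"
      using smooth_on_open_continuous_on[of "coords c ` dom" "vd \<circ> param c"] sm_vd[OF even] r(2) continuous_on_subset
      unfolding smooth_in_chart_def by blast
    then have "bounded ((vd \<circ> param c) ` cball (coords c p) r)"
      by (intro compact_imp_bounded compact_continuous_image compact_cball)
    then obtain C where C: "\<And>x. x \<in> cball (coords c p) r \<Longrightarrow> vd (param c x) \<le> C"
      unfolding bounded_iff by (metis abs_le_D1 comp_apply image_eqI real_norm_def)
    have "emeasure \<mu> N = (\<integral>\<^sup>+x\<in>coords c ` N. ennreal (vd (param c x)) \<partial>lborel)"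
      by (rule emeasure_\<mu>[OF c(1) open_sets[OF N]]) (auto simp: N_def)
    also have "\<dots> \<le> (\<integral>\<^sup>+x. ennreal C * indicator (cball (coords c p) r) x \<partial>lborel)"
      using im C by (intro nn_integral_mono) (auto simp: indicator_def subset_iff intro!: ennreal_leI)
    also have "\<dots> < \<infinity>"
      using emeasure_lborel_cball_finite[of "coords c p" r]
      by (simp add: nn_integral_cmult_indicator ennreal_mult_less_top)
    finally show ?thesis using N c(2) r(1) by (auto simp: N_def intro!: exI[of _ N])
  qed
  then obtain N where N: "\<And>p. p \<in> K \<Longrightarrow> openin X (N p)" "\<And>p. p \<in> K \<Longrightarrow> p \<in> N p" "\<And>p. p \<in> K \<Longrightarrow> emeasure \<mu> (N p) < \<infinity>"
    by metis
  then obtain F where F: "finite F" "F \<subseteq> N ` K" "K \<subseteq> \<Union>F"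
    using K unfolding compactin_def by (metis (no_types, lifting) UN_iff imageE subsetI)
  have "emeasure \<mu> K \<le> emeasure \<mu> (\<Union>V\<in>F. V)"
    using F N(1) open_sets by (intro emeasure_mono sets.finite_UN) auto
  also have "\<dots> \<le> (\<Sum>V\<in>F. emeasure \<mu> V)"
    using F N(1) open_sets by (intro emeasure_subadditive_finite) auto
  also have "\<dots> < \<infinity>"
    using F N(3) by (auto simp: ennreal_sum_less_top less_top[symmetric])
  finally show "emeasure \<mu> K < \<infinity>" .
qed

lemma integrable_smooth:
  assumes f: "smooth_fun f" and K: "compactin X K" "\<And>p. p \<in> topspace X \<Longrightarrow> p \<notin> K \<Longrightarrow> f p = 0"
  shows "integrable \<mu> f"
proof -
  have "compact (f ` K)"
    using image_compactin[OF K(1) continuous_smooth[OF f]] by simp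
  then obtain C where C: "\<And>p. p \<in> K \<Longrightarrow> norm (f p) \<le> C"
    using compact_imp_bounded[of "f ` K"] by (auto simp: bounded_iff)
  show ?thesis
    by (rule integrableI_bounded_set[OF finite_compact(2)[OF K(1)] measurable_smooth[OF f] finite_compact(1)[OF K(1)]])
       (use C K(2) in \<open>auto simp: space_\<mu>\<close>)
qed

text \<open>The coordinates carry the restriction of the measure to the chart domain to Lebesgue
  measure with density \<open>push vd\<close>.\<close>

lemma integral_chart:
  assumes c: "c \<in> A" and f: "smooth_fun f" and K: "K \<subseteq> chart_dom c" "\<And>p. p \<in> topspace X \<Longrightarrow> p \<notin> K \<Longrightarrow> f p = 0"
  shows "(\<integral>p. f p \<partial>\<mu>) = (LINT x|lborel. chart.push c (\<lambda>p. volume_density Om c p * f p) x)"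
proof -
  interpret sympl_chart X c Om G by (rule sympl_chart_ax[OF c])
  have domS: "dom \<in> sets \<mu>" using open_sets openin_dom by blast
  let ?M = "restrict_space \<mu> dom"
  have spM: "space ?M = dom" using dom_subset by (simp add: space_restrict_space space_\<mu> inf.absorb1)
  have pre: "coords c -` S \<inter> dom \<in> sets \<mu>" if "S \<in> sets borel" for S
  proof -
    have "coords c \<in> borel_measurable ?M"
    proof (rule borel_measurableI)
      fix S :: "(real ^ 'n) set" assume "open S"
      from open_sets[OF openin_preimage[OF this]]
      have "coords c -` S \<inter> dom \<in> sets \<mu>"
        by (simp add: vimage_def Int_def conj_commute)
      then show "coords c -` S \<inter> space ?M \<in> sets ?M"
        using domS by (simp add: spM sets_restrict_space_iff)
    qed
    from measurable_sets[OF this that] show ?thesis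
      using domS by (simp add: spM sets_restrict_space_iff)
  qed
  have cm: "coords c \<in> borel_measurable ?M"
    using pre domS by (auto intro!: measurableI simp: spM sets_restrict_space_iff)
  have vm: "push vd \<in> borel_measurable borel"
    using borel_measurable_indicator_param[OF sm_vd[OF even] dom_MB order_refl]
    by (rule measurable_cong[THEN iffD1, rotated]) (simp add: push_def indicator_def)
  have smf: "sm c f" using f c by (simp add: smooth_fun_def)
  have fm: "push f \<in> borel_measurable borel"
    using borel_measurable_indicator_param[OF smf dom_MB order_refl]
    by (rule measurable_cong[THEN iffD1, rotated]) (simp add: push_def indicator_def)
  have v0: "push vd x \<ge> 0" for x
    by (simp add: push_def volume_density_def Let_def)
  have distr: "distr ?M borel (coords c) = density lborel (\<lambda>x. ennreal (push vd x))"
  proof (rule measure_eqI)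
    fix S assume "S \<in> sets (distr ?M borel (coords c))"
    then have S: "S \<in> sets borel" by simp
    let ?B = "coords c -` S \<inter> dom"
    have im: "coords c ` ?B = S \<inter> coords c ` dom" by auto
    have "emeasure (distr ?M borel (coords c)) S = emeasure \<mu> ?B"
      using S cm domS by (simp add: emeasure_distr spM emeasure_restrict_space)
    also have "\<dots> = (\<integral>\<^sup>+x\<in>coords c ` ?B. ennreal (vd (param c x)) \<partial>lborel)"
      by (rule emeasure_\<mu>[OF c pre[OF S]]) simp
    also have "\<dots> = (\<integral>\<^sup>+x. ennreal (push vd x) * indicator S x \<partial>lborel)"
      unfolding im by (intro nn_integral_cong) (auto simp: push_def indicator_def)
    also have "\<dots> = emeasure (density lborel (\<lambda>x. ennreal (push vd x))) S"
      using S vm by (simp add: emeasure_density)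
    finally show "emeasure (distr ?M borel (coords c)) S = emeasure (density lborel (\<lambda>x. ennreal (push vd x))) S" .
  qed simp
  have "(\<integral>p. f p \<partial>\<mu>) = (\<integral>p. indicator dom p *\<^sub>R f p \<partial>\<mu>)"
    using K by (intro Bochner_Integration.integral_cong refl) (auto simp: space_\<mu> indicator_def)
  also have "\<dots> = (\<integral>p. f p \<partial>?M)"
    using domS dom_subset by (subst integral_restrict_space) (auto simp: space_\<mu> inf.absorb1)
  also have "\<dots> = (\<integral>p. push f (coords c p) \<partial>?M)"
    by (intro Bochner_Integration.integral_cong refl) (auto simp: spM push_def)
  also have "\<dots> = (\<integral>x. push f x \<partial>distr ?M borel (coords c))"
    by (rule integral_distr[OF cm fm, symmetric])
  also have "\<dots> = (LINT x|lborel. push vd x * push f x)"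
    unfolding distr using vm fm v0 by (subst integral_density) auto
  also have "\<dots> = (LINT x|lborel. push (\<lambda>p. vd p * f p) x)"
    by (intro Bochner_Integration.integral_cong refl) (simp add: push_def)
  finally show ?thesis .
qed

end

end

section \<open>The first variation integrated in a chart\<close>

context varied_chart
begin

text \<open>\<open>variation_identity\<close> times the density: by \<open>divergence_form\<close>
  the divergence becomes a sum of coordinate derivatives of functions supported in \<open>K\<close>,
  whose integrals vanish.\<close>

lemma chart_variation:
  assumes even: "even CARD('n)" and K: "compactin X K" "K \<subseteq> dom" "\<And>q i j k. q \<in> dom \<Longrightarrow> q \<notin> K \<Longrightarrow> P c i j k q = 0"
    and Haus: "Hausdorff_space X" and f: "sm c f"
  shows "(LINT x|lborel. push (\<lambda>p. vd p * (f p * K1 p)) x)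
    = (LINT x|lborel. push (\<lambda>p. vd p * pr 3 (\<lambda>B C p. Lhat f B p * PL C p) p) x)"
proof -
  have "closedin X K" using K(1) Haus compactin_imp_closedin by blast
  then have op: "openin X (dom - K)" using openin_dom by blast
  have P0: "P c i j k q = 0" if "q \<in> dom - K" for q i j k using K(3) that by blast
  let ?Y = "\<lambda>i p. vd p * (\<Sum>a\<in>UNIV. w i a p * Vfield f a p)"
  let ?L = "\<lambda>p. vd p * pr 3 (\<lambda>B C p. Lhat f B p * PL C p) p"
  have smv: "sm c vd" by (rule sm_vd[OF even])
  have smV: "sm c (Vfield f a)" for a by (rule sm_Vfield[OF f])
  have smY: "sm c (?Y i)" for i using smv smV by simp
  have smL: "sm c ?L" using smv f by (simp del: pairing.simps)
  have V0: "?Y i q = 0" if "q \<in> dom" "q \<notin> K" for i q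
    using Vfield_support[OF f op _ P0, of q] that by simp
  have L0: "?L q = 0" if "q \<in> dom" "q \<notin> K" for q
    using support(1)[OF op _ P0, of q] that by simp
  have eq: "push (\<lambda>p. vd p * (f p * K1 p)) x = (\<Sum>i\<in>UNIV. push (pd c i (?Y i)) x) + push ?L x" for x
  proof (cases "x \<in> coords c ` dom")
    case True
    then have "param c x \<in> dom" by (rule param_dom)
    then show ?thesis
      using True variation_identity[OF f] divergence_form[OF even _ smV]
      by (simp add: push_def distrib_left Dv_def del: pairing.simps)
  qed (simp add: push_def)
  have intY: "integrable lborel (push (pd c i (?Y i)))" for i
  proof (rule integrable_push[OF sm_pd[OF smY] K(1,2)])
    show "pd c i (?Y i) q = 0" if "q \<in> dom" "q \<notin> K" for q
      by (rule pd_zero[OF op]) (use that V0 in auto)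
  qed
  have "(LINT x|lborel. push (\<lambda>p. vd p * (f p * K1 p)) x)
    = (\<Sum>i\<in>UNIV. LINT x|lborel. push (pd c i (?Y i)) x) + (LINT x|lborel. push ?L x)"
    unfolding eq using intY integrable_push[OF smL K(1,2) L0]
    by (subst Bochner_Integration.integral_add) (auto simp del: pairing.simps)
  also have "(\<Sum>i\<in>UNIV. LINT x|lborel. push (pd c i (?Y i)) x) = 0"
    using integral_push_pd[OF smY K(1,2) V0] by simp
  finally show ?thesis by simp
qed

end

section \<open>Critical connections\<close>

context symplectic_conn
begin

lemma varied_ax: "c \<in> A \<Longrightarrow> symmetric_tensor3 A P \<Longrightarrow> varied_chart X c Om G P"
proof (rule varied_chart.intro[OF sympl_chart_ax], assumption, unfold_locales)
  assume c: "c \<in> A" and P: "symmetric_tensor3 A P"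
  show "sm c (P c i j k)" for i j k
    using c P unfolding symmetric_tensor3_def covariant_tensor3_def by blast
  show "P c i j k p = P c j i k p" "P c i j k p = P c i k j p" if "p \<in> chart_dom c" for i j k p
    using c P that unfolding symmetric_tensor3_def by blast+
qed

text \<open>Makes chart invariance of \<K> available for every \<open>t\<close>, so that
  \<open>K_curv\<close> of the varied connection may be computed in any chart.\<close>

lemma varied_conn:
  assumes P: "symmetric_tensor3 A P"
  shows "symplectic_conn X A Om (varied_connection Om G t P)"
proof (rule symplectic_conn.intro[OF symplectic_mfd_axioms], unfold_locales)
  let ?G = "varied_connection Om G t P"
  have ax: "sympl_chart X c Om ?G" if "c \<in> A" for c
    by (rule varied_chart.sympl_chart_Gt[OF varied_ax[OF that P]])
  have U_trans: "(\<Sum>k\<in>UNIV. varied_chart.U c Om P i j k p * jac c d k a p)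
      = (\<Sum>b\<in>UNIV. \<Sum>e\<in>UNIV. jac c d i b p * jac c d j e p * varied_chart.U d Om P b e a p)"
    if cd: "c \<in> A" "d \<in> A" "p \<in> chart_dom c \<inter> chart_dom d" for c d p i j a
  proof -
    let ?J = "\<lambda>i a. jac c d i a p"
    define Y where "Y f = (\<Sum>b\<in>UNIV. \<Sum>e\<in>UNIV. ?J i b * ?J j e * P d b e f p)" for f
    have "P c i j q p = (\<Sum>b\<in>UNIV. \<Sum>e\<in>UNIV. \<Sum>f\<in>UNIV. ?J i b * ?J j e * ?J q f * P d b e f p)" for q
      using P cd unfolding symmetric_tensor3_def covariant_tensor3_def by blast
    also have "\<dots> q = (\<Sum>f\<in>UNIV. ?J q f * Y f)" for q
    proof -
      have "(\<Sum>b\<in>UNIV. \<Sum>e\<in>UNIV. \<Sum>f\<in>UNIV. ?J i b * ?J j e * ?J q f * P d b e f p)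
        = (\<Sum>b\<in>UNIV. \<Sum>f\<in>UNIV. \<Sum>e\<in>UNIV. ?J i b * ?J j e * ?J q f * P d b e f p)"
        by (rule sum.cong[OF refl sum.swap])
      also have "\<dots> = (\<Sum>f\<in>UNIV. \<Sum>b\<in>UNIV. \<Sum>e\<in>UNIV. ?J i b * ?J j e * ?J q f * P d b e f p)"
        by (rule sum.swap)
      finally show ?thesis by (simp add: Y_def sum_distrib_left mult_ac)
    qed
    finally have Pc: "P c i j q p = (\<Sum>f\<in>UNIV. ?J q f * Y f)" for q .
    have "(\<Sum>k\<in>UNIV. varied_chart.U c Om P i j k p * ?J k a)
      = (\<Sum>k\<in>UNIV. \<Sum>q\<in>UNIV. \<Sum>f\<in>UNIV. Om_up Om c k q p * (?J k a * ?J q f) * Y f)"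
      unfolding varied_chart.U_def[OF varied_ax[OF cd(1) P]] Pc
      by (simp add: sum_distrib_left sum_distrib_right mult_ac)
    also have "\<dots> = (\<Sum>k\<in>UNIV. \<Sum>f\<in>UNIV. \<Sum>q\<in>UNIV. Om_up Om c k q p * (?J k a * ?J q f) * Y f)"
      by (rule sum.cong[OF refl sum.swap])
    also have "\<dots> = (\<Sum>f\<in>UNIV. \<Sum>k\<in>UNIV. \<Sum>q\<in>UNIV. Om_up Om c k q p * (?J k a * ?J q f) * Y f)"
      by (rule sum.swap)
    also have "\<dots> = (\<Sum>f\<in>UNIV. Om_up Om d a f p * Y f)"
      by (simp add: sum_distrib_right[symmetric] w_trans[OF cd])
    also have "\<dots> = (\<Sum>f\<in>UNIV. \<Sum>b\<in>UNIV. \<Sum>e\<in>UNIV. ?J i b * ?J j e * (Om_up Om d a f p * P d b e f p))"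
      by (simp add: Y_def sum_distrib_left mult_ac)
    also have "\<dots> = (\<Sum>b\<in>UNIV. \<Sum>f\<in>UNIV. \<Sum>e\<in>UNIV. ?J i b * ?J j e * (Om_up Om d a f p * P d b e f p))"
      by (rule sum.swap)
    also have "\<dots> = (\<Sum>b\<in>UNIV. \<Sum>e\<in>UNIV. \<Sum>f\<in>UNIV. ?J i b * ?J j e * (Om_up Om d a f p * P d b e f p))"
      by (rule sum.cong[OF refl sum.swap])
    finally show ?thesis
      by (simp add: varied_chart.U_def[OF varied_ax[OF cd(2) P]] sum_distrib_left)
  qed
  have "affine_connection A ?G"
    unfolding affine_connection_def
  proof (intro conjI ballI allI)
    show "sm c (?G c i j k)" if "c \<in> A" for c i j k
      by (rule sympl_chart.sm_G[OF ax[OF that]])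
    fix c d p i j a assume cd: "c \<in> A" "d \<in> A" "p \<in> chart_dom c \<inter> chart_dom d"
    have law: "(\<Sum>k\<in>UNIV. G c i j k p * jac c d k a p) = pd c i (jac c d j a) p +
          (\<Sum>b\<in>UNIV. \<Sum>e\<in>UNIV. jac c d i b p * jac c d j e p * G d b e a p)"
      using affine cd unfolding affine_connection_def by blast
    have "(\<Sum>k\<in>UNIV. ?G c i j k p * jac c d k a p)
      = (\<Sum>k\<in>UNIV. G c i j k p * jac c d k a p) + t * (\<Sum>k\<in>UNIV. varied_chart.U c Om P i j k p * jac c d k a p)"
      by (simp add: varied_chart.Gt_eq[OF varied_ax[OF cd(1) P]] distrib_right sum.distrib sum_distrib_left mult.assoc)
    also have "\<dots> = pd c i (jac c d j a) p + (\<Sum>b\<in>UNIV. \<Sum>e\<in>UNIV. jac c d i b p * jac c d j e p * ?G d b e a p)"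
      unfolding law U_trans[OF cd]
      by (simp add: varied_chart.Gt_eq[OF varied_ax[OF cd(2) P]] distrib_left sum.distrib sum_distrib_left mult_ac)
    finally show "(\<Sum>k\<in>UNIV. ?G c i j k p * jac c d k a p) = pd c i (jac c d j a) p
      + (\<Sum>b\<in>UNIV. \<Sum>e\<in>UNIV. jac c d i b p * jac c d j e p * ?G d b e a p)" .
  qed
  then show "symplectic_connection A Om ?G"
    unfolding symplectic_connection_def torsion_free_def
    using sympl_chart.G_sym[OF ax] sympl_chart.parallel[OF ax] by blast
qed

end

context varied_chart
begin

text \<open>Stronger than the vanishing of \<open>K1\<close>: off the support of \<Pi> the
  coefficients of all positive powers of \<open>t\<close> vanish, which is what makes them
  integrable.\<close>

lemma K_unchanged:
  assumes V: "openin X V" "V \<subseteq> dom" and P0: "\<And>q i j k. q \<in> V \<Longrightarrow> P c i j k q = 0" and p: "p \<in> V"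
  shows "K_in_chart Om (Gt t) c p = K_in_chart Om G c p"
proof -
  have dom: "q \<in> dom" if "q \<in> V" for q using that V(2) by blast
  have G: "Gt t c i j k q = G c i j k q" if "q \<in> V" for q i j k
    using P0[OF that] by (simp add: Gt_eq U_def)
  have pdG: "pd c l (Gt t c i j k) q = pd c l (G c i j k) q" if "q \<in> V" for q i j k l
    by (rule pd_cong[OF V(1) that V(2) G])
  have R: "curvature (Gt t) c i j s k q = curvature G c i j s k q" if "q \<in> V" for q i j s k
    by (simp add: curvature_eq sympl_chart.curvature_eq[OF sympl_chart_Gt] dom that pdG G)
  have Rl: "curvature_low Om (Gt t) c i j s k q = curvature_low Om G c i j s k q" if "q \<in> V" for q i j s k
    by (simp add: curvature_low_def R that)
  have Ric: "ricci (Gt t) c i j q = ricci G c i j q" if "q \<in> V" for q i j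
    by (simp add: ricci_def R that)
  have pdRic: "pd c l (ricci (Gt t) c i j) q = pd c l (ricci G c i j) q" if "q \<in> V" for q i j l
    by (rule pd_cong[OF V(1) that V(2) Ric])
  have div: "sympl_chart.div_ricci c Om (Gt t) i q = div_ricci i q" if "q \<in> V" for q i
    by (simp add: div_ricci_eq sympl_chart.div_ricci_eq[OF sympl_chart_Gt] dom that pdRic Ric G)
  have pddiv: "pd c l (sympl_chart.div_ricci c Om (Gt t) i) p = pd c l (div_ricci i) p" for i l
    by (rule pd_cong[OF V(1) p V(2) div])
  show ?thesis
    by (simp add: K_in_chart_pairing sympl_chart.K_in_chart_pairing[OF sympl_chart_Gt] dom p pddiv
        RL_def RicL_def sympl_chart.RL_def[OF sympl_chart_Gt] sympl_chart.RicL_def[OF sympl_chart_Gt] Rl Ric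
        del: pairing.simps)
qed

end

lemma (in sympl_chart) K1_add:
  assumes P: "varied_chart X c Om G P" and Q: "varied_chart X c Om G Q"
    and S: "varied_chart X c Om G (\<lambda>c i j k p. P c i j k p + Q c i j k p)" and p: "p \<in> dom"
  shows "varied_chart.K1 c Om G (\<lambda>c i j k p. P c i j k p + Q c i j k p) p = varied_chart.K1 c Om G P p + varied_chart.K1 c Om G Q p"
proof -
  interpret P: varied_chart X c Om G P by (rule P)
  interpret Q: varied_chart X c Om G Q by (rule Q)
  interpret S: varied_chart X c Om G "\<lambda>c i j k p. P c i j k p + Q c i j k p" by (rule S)
  have U: "S.U i j k = (\<lambda>p. P.U i j k p + Q.U i j k p)" for i j k
    by (simp add: fun_eq_iff S.U_def P.U_def Q.U_def distrib_left sum.distrib)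
  have A: "S.Acurv i j s k q = P.Acurv i j s k q + Q.Acurv i j s k q" if "q \<in> dom" for i j s k q
    using that by (simp add: S.Acurv_def P.Acurv_def Q.Acurv_def U pd_rules distrib_left distrib_right sum.distrib)
  have SL: "S.SL L q = P.SL L q + Q.SL L q" if "q \<in> dom" for L q
    using that by (simp add: S.SL_def P.SL_def Q.SL_def A sum.distrib)
  have AL: "S.AL L q = P.AL L q + Q.AL L q" if "q \<in> dom" for L q
    using that by (simp add: S.AL_def P.AL_def Q.AL_def A distrib_right sum.distrib)
  have pdSL: "pd c l (S.SL L) q = pd c l (P.SL L) q + pd c l (Q.SL L) q" if q: "q \<in> dom" for l L q
    using pd_cong_dom[OF q, of "S.SL L" "\<lambda>q. P.SL L q + Q.SL L q"] q by (simp add: SL pd_rules)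
  have X1: "S.X1 i q = P.X1 i q + Q.X1 i q" if "q \<in> dom" for i q
    using that by (simp add: S.X1_def P.X1_def Q.X1_def U SL pdSL distrib_left distrib_right right_diff_distrib
        sum.distrib sum_subtractf)
  have pdX1: "pd c l (S.X1 i) p = pd c l (P.X1 i) p + pd c l (Q.X1 i) p" for l i
    using pd_cong_dom[OF p, of "S.X1 i" "\<lambda>q. P.X1 i q + Q.X1 i q"] p by (simp add: X1 pd_rules)
  show ?thesis
    by (simp add: S.K1_def P.K1_def Q.K1_def pdX1 SL AL p distrib_left sum.distrib pairing_add del: pairing.simps)
qed

definition tri :: "('n::finite \<Rightarrow> 'n \<Rightarrow> 'n \<Rightarrow> real) \<Rightarrow> ('n \<Rightarrow> real) \<Rightarrow> ('n \<Rightarrow> real) \<Rightarrow> ('n \<Rightarrow> real) \<Rightarrow> real" where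
  "tri L u v y = (\<Sum>a\<in>UNIV. u a * (\<Sum>b\<in>UNIV. v b * (\<Sum>e\<in>UNIV. y e * L a b e)))"

text \<open>Polarisation: a symmetric trilinear form is determined by its values on the diagonal. In
  the expansion at a sum of three vectors all terms but 6 times the mixed one vanish, by
  \<open>zero\<close> and \<open>two\<close>.\<close>

lemma symmetric_trilinear_zero:
  fixes L :: "'n::finite \<Rightarrow> 'n \<Rightarrow> 'n \<Rightarrow> real"
  assumes sym: "\<And>a b e. L a b e = L b a e" "\<And>a b e. L a b e = L a e b"
    and zero: "\<And>u. tri L u u u = 0"
  shows "L a b e = 0"
proof -
  have s12: "tri L u v y = tri L v u y" for u v y
  proof -
    have "tri L u v y = (\<Sum>a\<in>UNIV. \<Sum>b\<in>UNIV. u a * (v b * (\<Sum>e\<in>UNIV. y e * L a b e)))"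
      by (simp add: tri_def sum_distrib_left)
    also have "\<dots> = (\<Sum>b\<in>UNIV. \<Sum>a\<in>UNIV. u a * (v b * (\<Sum>e\<in>UNIV. y e * L a b e)))"
      by (rule sum.swap)
    also have "\<dots> = (\<Sum>b\<in>UNIV. \<Sum>a\<in>UNIV. v b * (u a * (\<Sum>e\<in>UNIV. y e * L b a e)))"
    proof (intro sum.cong refl)
      fix a b
      show "u a * (v b * (\<Sum>e\<in>UNIV. y e * L a b e)) = v b * (u a * (\<Sum>e\<in>UNIV. y e * L b a e))"
        by (simp add: sym(1)[of b a] mult.left_commute)
    qed
    finally show ?thesis by (simp add: tri_def sum_distrib_left)
  qed
  have s23: "tri L u v y = tri L u y v" for u v y
    unfolding tri_def
  proof (rule sum.cong[OF refl])
    fix a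
    have "(\<Sum>b\<in>UNIV. v b * (\<Sum>e\<in>UNIV. y e * L a b e)) = (\<Sum>b\<in>UNIV. \<Sum>e\<in>UNIV. v b * (y e * L a b e))"
      by (simp add: sum_distrib_left)
    also have "\<dots> = (\<Sum>e\<in>UNIV. \<Sum>b\<in>UNIV. v b * (y e * L a b e))"
      by (rule sum.swap)
    also have "\<dots> = (\<Sum>e\<in>UNIV. \<Sum>b\<in>UNIV. y e * (v b * L a e b))"
      by (intro sum.cong refl) (metis sym(2) mult.left_commute)
    finally show "u a * (\<Sum>b\<in>UNIV. v b * (\<Sum>e\<in>UNIV. y e * L a b e)) = u a * (\<Sum>e\<in>UNIV. y e * (\<Sum>b\<in>UNIV. v b * L a e b))"
      by (simp add: sum_distrib_left)
  qed
  have add: "tri L (\<lambda>a. u a + u' a) v y = tri L u v y + tri L u' v y" for u u' v y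
    by (simp add: tri_def distrib_right sum.distrib)
  have add2: "tri L v (\<lambda>a. u a + u' a) y = tri L v u y + tri L v u' y" for u u' v y
    using add s12 by metis
  have add3: "tri L v y (\<lambda>a. u a + u' a) = tri L v y u + tri L v y u'" for u u' v y
    using add2 s23 by metis
  let ?T = "tri L"
  \<comment> \<open>The two sums are kept together because this is how they occur in the expansion
    at three vectors.\<close>
  have two: "3 * ?T u u v + 3 * ?T u v v = 0" for u v
  proof -
    have e: "?T v u u = ?T u u v" "?T u v u = ?T u u v" "?T v v u = ?T u v v" "?T v u v = ?T u v v"
      by (metis s12 s23)+
    have "?T (\<lambda>a. u a + v a) (\<lambda>a. u a + v a) (\<lambda>a. u a + v a) = 0"
      by (rule zero)
    then have "(?T u u u + ?T u u v + (?T u u v + ?T u v v)) + (?T u u v + ?T u v v + (?T u v v + ?T v v v)) = 0"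
      by (simp only: add add2 add3 e)
    then show ?thesis using zero[of u] zero[of v] by linarith
  qed
  have "6 * ?T u v y = 0" for u v y
  proof -
    have e: "?T v u u = ?T u u v" "?T u v u = ?T u u v" "?T y u u = ?T u u y" "?T u y u = ?T u u y"
      "?T v v u = ?T u v v" "?T v u v = ?T u v v" "?T v y v = ?T v v y" "?T y v v = ?T v v y"
      "?T y y u = ?T u y y" "?T y u y = ?T u y y" "?T y y v = ?T v y y" "?T y v y = ?T v y y"
      "?T u y v = ?T u v y" "?T v u y = ?T u v y" "?T v y u = ?T u v y" "?T y u v = ?T u v y" "?T y v u = ?T u v y"
      by (metis s12 s23)+
    have "?T (\<lambda>a. (u a + v a) + y a) (\<lambda>a. (u a + v a) + y a) (\<lambda>a. (u a + v a) + y a) = 0"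
      by (rule zero)
    then have "?T u u u + ?T v v v + ?T y y y + (3 * ?T u u v + 3 * ?T u v v) + (3 * ?T u u y + 3 * ?T u y y)
        + (3 * ?T v v y + 3 * ?T v y y) + 6 * ?T u v y = 0"
      by (simp only: add add2 add3 e)
    then show ?thesis
      using zero[of u] zero[of v] zero[of y] two[of u v] two[of u y] two[of v y] by linarith
  qed
  then have "tri L (\<lambda>q. if a = q then 1 else 0) (\<lambda>q. if b = q then 1 else 0) (\<lambda>q. if e = q then 1 else 0) = 0"
    by simp
  then show ?thesis by (simp only: tri_def delta_sum)
qed

context smooth_mfd
begin

lemma smooth_fun_const: "smooth_fun (\<lambda>_. k)"
  unfolding smooth_fun_def by (blast intro: chart.sm_const[OF chart_ax])

lemma smooth_fun_add: "smooth_fun f \<Longrightarrow> smooth_fun g \<Longrightarrow> smooth_fun (\<lambda>p. f p + g p)"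
  unfolding smooth_fun_def by (blast intro: chart.sm_add[OF chart_ax])

lemma smooth_fun_mult: "smooth_fun f \<Longrightarrow> smooth_fun g \<Longrightarrow> smooth_fun (\<lambda>p. f p * g p)"
  unfolding smooth_fun_def by (blast intro: chart.sm_mult[OF chart_ax])

lemma smooth_fun_sum: "(\<And>a. smooth_fun (f a)) \<Longrightarrow> smooth_fun (\<lambda>p. \<Sum>a\<in>I. f a p)"
  unfolding smooth_fun_def by (intro ballI chart.sm_sum[OF chart_ax]) auto

end

section \<open>\<K> along the variation and the derivative of the energy\<close>

context symplectic_conn
begin

definition dK :: "('m, 'n) field3 \<Rightarrow> 'm \<Rightarrow> real" where
  "dK P p = varied_chart.K1 (SOME c. c \<in> A \<and> p \<in> chart_dom c) Om G P p"

text \<open>In each chart \<K> is a polynomial in \<open>t\<close>. Its values are independent of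
  the chart and determine its coefficients, so the local coefficients fit together to global smooth
  functions; in degree 1 this makes \<open>K1\<close> independent of the chart.\<close>

lemma K_curv_polynomial:
  assumes P: "symmetric_tensor3 A P"
  obtains C where "\<And>k. smooth_fun (C k)" "\<And>k p. k > 4 \<Longrightarrow> C k p = 0"
    "\<And>t p. p \<in> topspace X \<Longrightarrow> K_curv A Om (varied_connection Om G t P) p = (\<Sum>k\<le>4. C k p * t ^ k)"
    "\<And>p. p \<in> topspace X \<Longrightarrow> C 0 p = K_curv A Om G p"
    "\<And>p. C 1 p = dK P p"
    "\<And>c p. c \<in> A \<Longrightarrow> p \<in> chart_dom c \<Longrightarrow> C 1 p = varied_chart.K1 c Om G P p"
    "\<And>c V k p. c \<in> A \<Longrightarrow> openin X V \<Longrightarrow> V \<subseteq> chart_dom c \<Longrightarrow> \<forall>q\<in>V. \<forall>i j k. P c i j k q = 0 \<Longrightarrow>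
      p \<in> V \<Longrightarrow> k > 0 \<Longrightarrow> C k p = 0"
proof -
  let ?G = "\<lambda>t. varied_connection Om G t P"
  have "\<forall>c\<in>A. \<exists>C. (\<forall>k. sm c (C k)) \<and> (\<forall>k>4. \<forall>p\<in>chart_dom c. C k p = 0) \<and>
     (\<forall>t. \<forall>p\<in>chart_dom c. K_in_chart Om (?G t) c p = (\<Sum>k\<le>4. C k p * t ^ k)) \<and>
     (\<forall>p\<in>chart_dom c. C 0 p = K_in_chart Om G c p \<and> C 1 p = varied_chart.K1 c Om G P p)"
    using varied_chart.jet_K[OF varied_ax[OF _ P]] unfolding jet_def by blast
  from bchoice[OF this] obtain CC where
    CC: "\<And>c k. c \<in> A \<Longrightarrow> sm c (CC c k)" "\<And>c k p. c \<in> A \<Longrightarrow> k > 4 \<Longrightarrow> p \<in> chart_dom c \<Longrightarrow> CC c k p = 0"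
      "\<And>c t p. c \<in> A \<Longrightarrow> p \<in> chart_dom c \<Longrightarrow> K_in_chart Om (?G t) c p = (\<Sum>k\<le>4. CC c k p * t ^ k)"
      "\<And>c p. c \<in> A \<Longrightarrow> p \<in> chart_dom c \<Longrightarrow> CC c 0 p = K_in_chart Om G c p"
      "\<And>c p. c \<in> A \<Longrightarrow> p \<in> chart_dom c \<Longrightarrow> CC c 1 p = varied_chart.K1 c Om G P p"
    by blast
  have K: "K_curv A Om (?G t) p = (\<Sum>k\<le>4. CC c k p * t ^ k)" if "c \<in> A" "p \<in> chart_dom c" for c t p
    using symplectic_conn.K_curv_eq[OF varied_conn[OF P] that] CC(3)[OF that] by simp
  have unique: "CC c k p = CC d k p" if c: "c \<in> A" "p \<in> chart_dom c" and d: "d \<in> A" "p \<in> chart_dom d" for c d k p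
  proof (cases "k > 4")
    case True
    then show ?thesis using CC(2) c d by simp
  next
    case False
    have "\<forall>t. (\<Sum>k\<le>4. CC c k p * t ^ k) = (\<Sum>k\<le>4. CC d k p * t ^ k)"
      using K[OF c] K[OF d] by simp
    then show ?thesis using False unfolding polyfun_eq_coeffs by simp
  qed
  define ch where "ch p = (SOME c. c \<in> A \<and> p \<in> chart_dom c)" for p
  have ch: "ch p \<in> A \<and> p \<in> chart_dom (ch p)" if "p \<in> topspace X" for p
  proof -
    have "\<exists>c. c \<in> A \<and> p \<in> chart_dom c" using that cover by blast
    from someI_ex[OF this] show ?thesis unfolding ch_def .
  qed
  have top: "p \<in> topspace X" if "c \<in> A" "p \<in> chart_dom c" for c p
    using that cover by blast
  \<comment> \<open>Outside of the manifold the coefficient of degree 1 is set to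
    \<open>dK P\<close>, so that \<open>C 1\<close> and \<open>dK P\<close> are equal as functions
    and smoothness carries over.\<close>
  define C where "C k p = (if k > 4 then 0 else if p \<in> topspace X then CC (ch p) k p else if k = 1 then dK P p else 0)" for k p
  have C: "C k p = CC c k p" if c: "c \<in> A" "p \<in> chart_dom c" for c k p
    using unique[OF c, of "ch p" k] ch[OF top[OF c]] CC(2)[OF c(1) _ c(2), of k] top[OF c] by (simp add: C_def)
  show ?thesis
  proof (rule that[of C])
    show "smooth_fun (C k)" for k
      unfolding smooth_fun_def
    proof
      fix c assume c: "c \<in> A"
      interpret chart X c by (rule chart_ax[OF c])
      show "sm c (C k)"
        using sm_cong[of "C k" "CC c k"] C[OF c] CC(1)[OF c] by simp
    qed
    show "C k p = 0" if "k > 4" for k p using that by (simp add: C_def)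
    show "K_curv A Om (?G t) p = (\<Sum>k\<le>4. C k p * t ^ k)" if "p \<in> topspace X" for t p
      using K[of "ch p" p] C[of "ch p" p] ch[OF that] by simp
    show "C 0 p = K_curv A Om G p" if "p \<in> topspace X" for p
      using K_curv_eq[of "ch p" p] C[of "ch p" p] ch[OF that] CC(4) by simp
    show C1: "C 1 p = varied_chart.K1 c Om G P p" if "c \<in> A" "p \<in> chart_dom c" for c p
      using C[OF that] CC(5)[OF that] by simp
    show "C 1 p = dK P p" for p
    proof (cases "p \<in> topspace X")
      case True
      then show ?thesis using C1[of "ch p" p] ch[OF True] by (simp add: dK_def ch_def)
    next
      case False
      then show ?thesis by (simp add: C_def)
    qed
    show "C k p = 0" if c: "c \<in> A" and V: "openin X V" "V \<subseteq> chart_dom c" and P0: "\<forall>q\<in>V. \<forall>i j k. P c i j k q = 0"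
      and pV: "p \<in> V" and k: "k > 0" for c V k p
    proof (cases "k > 4")
      case True
      then show ?thesis by (simp add: C_def)
    next
      case False
      have p: "p \<in> chart_dom c" using V pV by blast
      have "(\<Sum>k\<le>4. CC c k p * t ^ k) = (\<Sum>k\<le>4. (if k = 0 then K_in_chart Om G c p else 0) * t ^ k)" for t
      proof -
        have "(\<Sum>k\<le>4. (if k = 0 then K_in_chart Om G c p else 0) * t ^ k) = K_in_chart Om G c p"
          by (simp add: eval_nat_numeral)
        then show ?thesis
          using varied_chart.K_unchanged[OF varied_ax[OF c P] V _ pV, of t] P0 CC(3)[OF c p, of t] by simp
      qed
      then have "CC c k p = (if k = 0 then K_in_chart Om G c p else 0)"
        using polyfun_eq_coeffs[of "\<lambda>k. CC c k p" 4 "\<lambda>k. if k = 0 then K_in_chart Om G c p else 0"] False by simp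
      then show ?thesis using k C[OF c p] by simp
    qed
  qed
qed

lemma smooth_dK: "symmetric_tensor3 A P \<Longrightarrow> smooth_fun (dK P)"
  by (rule K_curv_polynomial, assumption) (metis ext)

lemma dK_eq:
  assumes "symmetric_tensor3 A P" "c \<in> A" "p \<in> chart_dom c"
  shows "dK P p = varied_chart.K1 c Om G P p"
  using K_curv_polynomial[OF assms(1)] assms(2,3) by metis

lemma smooth_K_curv:
  "smooth_fun (K_curv A Om G)"
proof -
  \<comment> \<open>\<K> is the constant coefficient of the trivial variation.\<close>
  have "symmetric_tensor3 A (\<lambda>c i j k p. 0)"
    using chart.sm_const[OF chart_ax] by (auto simp: symmetric_tensor3_def covariant_tensor3_def)
  from K_curv_polynomial[OF this] obtain C where
    C: "smooth_fun (C (0::nat))" "\<And>p. p \<in> topspace X \<Longrightarrow> C 0 p = K_curv A Om G p" by metis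
  show ?thesis
    unfolding smooth_fun_def
  proof
    fix c assume c: "c \<in> A"
    interpret chart X c by (rule chart_ax[OF c])
    show "sm c (K_curv A Om G)"
      using sm_cong[of "C 0" "K_curv A Om G"] C dom_subset c by (auto simp: smooth_fun_def)
  qed
qed

lemma dK_support:
  assumes "symmetric_tensor3 A P" "c \<in> A" "openin X V" "V \<subseteq> chart_dom c" "\<And>q i j k. q \<in> V \<Longrightarrow> P c i j k q = 0" "p \<in> V"
  shows "dK P p = 0"
  using dK_eq[of P c p] varied_chart.support(5)[OF varied_ax[OF assms(2,1)] assms(3-6)] assms by auto

text \<open>\<open>S r\<close> is the coefficient of the power \<open>r\<close> of \<open>t\<close>
  in the square of \<K>. For positive \<open>r\<close> it has compact support, so the energy
  difference is a polynomial in \<open>t\<close> of degree at most 8 whose coefficients are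
  integrals. The linear one comes from \<open>S 1\<close>, twice the product of \<K> and
  \<open>dK P\<close>.\<close>

lemma energy_derivative:
  assumes even: "even CARD('n)" and P: "symmetric_tensor3 A P" and K: "compactin X K"
    and P0: "\<And>c p i j k. c \<in> A \<Longrightarrow> p \<in> chart_dom c \<Longrightarrow> p \<notin> K \<Longrightarrow> P c i j k p = 0"
  shows "(energy_difference X A Om G P has_real_derivative 2 * (\<integral>p. K_curv A Om G p * dK P p \<partial>\<mu>)) (at 0)"
proof -
  note fin = integrable_smooth[OF even _ K]
  obtain C where C: "\<And>k. smooth_fun (C k)" "\<And>k p. k > 4 \<Longrightarrow> C k p = 0"
    "\<And>t p. p \<in> topspace X \<Longrightarrow> K_curv A Om (varied_connection Om G t P) p = (\<Sum>k\<le>4. C k p * t ^ k)"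
    "\<And>p. p \<in> topspace X \<Longrightarrow> C 0 p = K_curv A Om G p"
    "\<And>p. C 1 p = dK P p"
    "\<And>c p. c \<in> A \<Longrightarrow> p \<in> chart_dom c \<Longrightarrow> C 1 p = varied_chart.K1 c Om G P p"
    "\<And>c V k p. c \<in> A \<Longrightarrow> openin X V \<Longrightarrow> V \<subseteq> chart_dom c \<Longrightarrow> \<forall>q\<in>V. \<forall>i j k. P c i j k q = 0 \<Longrightarrow>
      p \<in> V \<Longrightarrow> k > 0 \<Longrightarrow> C k p = 0"
    by (rule K_curv_polynomial[OF P]) (rule that)
  have C0: "C k p = 0" if p: "p \<in> topspace X" "p \<notin> K" and k: "k > 0" for k p
  proof -
    obtain c where c: "c \<in> A" "p \<in> chart_dom c" using p cover by blast
    have "closedin X K" using K Hausdorff compactin_imp_closedin by blast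
    then have V: "openin X (chart_dom c - K)" using chart.openin_dom[OF chart_ax[OF c(1)]] by blast
    show ?thesis
      by (rule C(7)[OF c(1) V]) (use P0[OF c(1)] c(2) p(2) k in auto)
  qed
  define S where "S r p = (\<Sum>i\<le>r. C i p * C (r - i) p)" for r p
  have S: "smooth_fun (S r)" for r
    unfolding S_def by (intro smooth_fun_sum smooth_fun_mult C)
  have S0: "S r p = 0" if p: "p \<in> topspace X" "p \<notin> K" and r: "r > 0" for r p
    unfolding S_def
  proof (rule sum.neutral, rule ballI)
    fix i assume "i \<in> {..r}"
    then have "i > 0 \<or> r - i > 0" using r by auto
    then show "C i p * C (r - i) p = 0" using C0[OF p] by auto
  qed
  have int: "integrable \<mu> (S r)" if "r > 0" for r
    by (rule fin[OF S S0]) (use that in auto)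
  have "energy_difference X A Om G P t = (\<integral>p. (\<Sum>r\<in>{1..8}. S r p * t ^ r) \<partial>\<mu>)" for t
    unfolding energy_difference_def
  proof (rule Bochner_Integration.integral_cong[OF refl])
    fix p assume "p \<in> space \<mu>"
    then have p: "p \<in> topspace X" by (simp add: space_\<mu>[OF even])
    have "(K_curv A Om (varied_connection Om G t P) p)\<^sup>2 = (\<Sum>r\<le>8. S r p * t ^ r)"
      using polynomial_product[of 4 "\<lambda>k. C k p" 4 "\<lambda>k. C k p" t] C(2) by (simp add: C(3)[OF p] power2_eq_square S_def)
    \<comment> \<open>The term of degree 0 is the square of \<K>(\<nabla>). It is subtracted before
      integrating, as its support may fail to be compact.\<close>
    moreover have "{..8} = insert 0 {1..8::nat}" by auto
    ultimately show "(K_curv A Om (varied_connection Om G t P) p)\<^sup>2 - (K_curv A Om G p)\<^sup>2 = (\<Sum>r\<in>{1..8}. S r p * t ^ r)"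
      by (simp add: S_def C(4)[OF p] power2_eq_square)
  qed
  also have "\<dots> t = (\<Sum>r\<in>{1..8}. (\<integral>p. S r p \<partial>\<mu>) * t ^ r)" for t
    by (subst Bochner_Integration.integral_sum) (auto intro!: int)
  finally have E: "energy_difference X A Om G P = (\<lambda>t. \<Sum>r\<in>{1..8}. (\<integral>p. S r p \<partial>\<mu>) * t ^ r)"
    by (rule ext)
  have "(energy_difference X A Om G P has_real_derivative
      (\<Sum>r\<in>{1..8}. (\<integral>p. S r p \<partial>\<mu>) * (real r * 0 ^ (r - 1)))) (at 0)"
    unfolding E by (auto intro!: derivative_eq_intros simp: mult_ac)
  moreover have "(\<Sum>r\<in>{1..8}. (\<integral>p. S r p \<partial>\<mu>) * (real r * 0 ^ (r - 1))) = (\<integral>p. S 1 p \<partial>\<mu>)"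
    by (simp add: eval_nat_numeral sum.atLeast_Suc_atMost)
  moreover have "(\<integral>p. S 1 p \<partial>\<mu>) = (\<integral>p. 2 * (K_curv A Om G p * dK P p) \<partial>\<mu>)"
    by (rule Bochner_Integration.integral_cong[OF refl])
      (use C(5) in \<open>simp add: S_def space_\<mu>[OF even] C(4)\<close>)
  ultimately show ?thesis by simp
qed

lemma critical_iff:
  assumes even: "even CARD('n)"
  shows "critical_connection X A Om G \<longleftrightarrow>
    (\<forall>P. symmetric_tensor3 A P \<and> compactly_supported3 X A P \<longrightarrow> (\<integral>p. K_curv A Om G p * dK P p \<partial>\<mu>) = 0)"
proof -
  have "(energy_difference X A Om G P has_real_derivative 0) (at 0) \<longleftrightarrow> (\<integral>p. K_curv A Om G p * dK P p \<partial>\<mu>) = 0"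
    if P: "symmetric_tensor3 A P" "compactly_supported3 X A P" for P
  proof -
    obtain K where K: "compactin X K" "\<And>c p i j k. c \<in> A \<Longrightarrow> p \<in> chart_dom c \<Longrightarrow> p \<notin> K \<Longrightarrow> P c i j k p = 0"
      using P(2) unfolding compactly_supported3_def by blast
    note D = energy_derivative[OF even P(1) K]
    show ?thesis
    proof
      assume "(energy_difference X A Om G P has_real_derivative 0) (at 0)"
      from DERIV_unique[OF this D] show "(\<integral>p. K_curv A Om G p * dK P p \<partial>\<mu>) = 0" by simp
    next
      assume "(\<integral>p. K_curv A Om G p * dK P p \<partial>\<mu>) = 0"
      then show "(energy_difference X A Om G P has_real_derivative 0) (at 0)" using D by simp
    qed
  qed
  then show ?thesis unfolding critical_connection_def by blast
qed

end

section \<open>Infinitesimal automorphisms give critical connections\<close>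

context symplectic_conn
begin

definition supp3 :: "('m, 'n) field3 \<Rightarrow> 'm set \<Rightarrow> bool" where
  "supp3 P K \<longleftrightarrow> compactin X K \<and> (\<forall>c\<in>A. \<forall>p\<in>chart_dom c - K. \<forall>i j k. P c i j k p = 0)"

lemma symmetric_tensor3_scale:
  assumes f: "smooth_fun f" and P: "symmetric_tensor3 A P"
  shows "symmetric_tensor3 A (\<lambda>c i j k p. f p * P c i j k p)"
  unfolding symmetric_tensor3_def covariant_tensor3_def
proof (intro conjI ballI allI)
  fix c i j k assume c: "c \<in> A"
  show "sm c (\<lambda>p. f p * P c i j k p)"
    using f P c unfolding smooth_fun_def symmetric_tensor3_def covariant_tensor3_def
    by (intro chart.sm_mult[OF chart_ax[OF c]]) blast+
  fix p assume p: "p \<in> chart_dom c"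
  have "P c i j k p = P c j i k p" "P c i j k p = P c i k j p"
    using P c p unfolding symmetric_tensor3_def by blast+
  then show "f p * P c i j k p = f p * P c j i k p" "f p * P c i j k p = f p * P c i k j p"
    by simp_all
next
  fix c d p i j k assume cd: "c \<in> A" "d \<in> A" "p \<in> chart_dom c \<inter> chart_dom d"
  have "P c i j k p = (\<Sum>a\<in>UNIV. \<Sum>b\<in>UNIV. \<Sum>e\<in>UNIV. jac c d i a p * jac c d j b p * jac c d k e p * P d a b e p)"
    using P cd unfolding symmetric_tensor3_def covariant_tensor3_def by blast
  then show "f p * P c i j k p = (\<Sum>a\<in>UNIV. \<Sum>b\<in>UNIV. \<Sum>e\<in>UNIV. jac c d i a p * jac c d j b p * jac c d k e p * (f p * P d a b e p))"
    by (simp add: sum_distrib_left mult_ac)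
qed

lemma supp3_zero: "supp3 P K \<Longrightarrow> c \<in> A \<Longrightarrow> p \<in> chart_dom c \<Longrightarrow> p \<notin> K \<Longrightarrow> P c i j k p = 0"
  unfolding supp3_def by blast

lemma dK_off_support:
  assumes P: "symmetric_tensor3 A P" "supp3 P K" and p: "p \<in> topspace X" "p \<notin> K"
  shows "dK P p = 0"
proof -
  obtain c where c: "c \<in> A" "p \<in> chart_dom c" using p cover by blast
  have "closedin X K" using P(2) Hausdorff compactin_imp_closedin unfolding supp3_def by blast
  then have V: "openin X (chart_dom c - K)" using chart.openin_dom[OF chart_ax[OF c(1)]] by blast
  show ?thesis
    by (rule dK_support[OF P(1) c(1) V]) (use supp3_zero[OF P(2) c(1)] c(2) p(2) in auto)
qed

lemma dK_add:
  assumes P: "symmetric_tensor3 A P" and Q: "symmetric_tensor3 A Q"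
    and S: "symmetric_tensor3 A (\<lambda>c i j k p. P c i j k p + Q c i j k p)" and p: "p \<in> topspace X"
  shows "dK (\<lambda>c i j k p. P c i j k p + Q c i j k p) p = dK P p + dK Q p"
proof -
  obtain c where c: "c \<in> A" "p \<in> chart_dom c" using p cover by blast
  show ?thesis
    unfolding dK_eq[OF P c] dK_eq[OF Q c] dK_eq[OF S c]
    by (rule sympl_chart.K1_add[OF sympl_chart_ax[OF c(1)] varied_ax[OF c(1) P] varied_ax[OF c(1) Q] varied_ax[OF c(1) S] c(2)])
qed

context
  assumes even: "even CARD('n)"
begin

text \<open>The first variation in terms of the lowered Lie derivative, for \<Pi> supported in one
  chart; both directions of the equivalence use it.\<close>

lemma chart_pairing:
  assumes c: "c \<in> A" and P: "symmetric_tensor3 A P" "supp3 P K" and K: "K \<subseteq> chart_dom c"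
  shows "(\<integral>p. K_curv A Om G p * dK P p \<partial>\<mu>)
    = (LINT x|lborel. chart.push c (\<lambda>p. volume_density Om c p * pairing (\<lambda>i j. Om_up Om c i j p) 3
        (\<lambda>B C. sympl_chart.Lhat c Om G (K_curv A Om G) B p * P c (C ! 0) (C ! 1) (C ! 2) p)) x)"
proof -
  interpret varied_chart X c Om G P by (rule varied_ax[OF c P(1)])
  have f: "smooth_fun (\<lambda>p. K_curv A Om G p * dK P p)"
    by (rule smooth_fun_mult[OF smooth_K_curv smooth_dK[OF P(1)]])
  have cK: "compactin X K" using P(2) by (simp add: supp3_def)
  have "(\<integral>p. K_curv A Om G p * dK P p \<partial>\<mu>)
    = (LINT x|lborel. push (\<lambda>p. volume_density Om c p * (K_curv A Om G p * dK P p)) x)"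
    by (rule integral_chart[OF even c f K]) (simp add: dK_off_support[OF P])
  also have "push (\<lambda>p. volume_density Om c p * (K_curv A Om G p * dK P p))
    = push (\<lambda>p. volume_density Om c p * (K_curv A Om G p * K1 p))"
    using dK_eq[OF P(1) c] param_dom by (simp add: push_def fun_eq_iff)
  also have "(LINT x|lborel. push (\<lambda>p. volume_density Om c p * (K_curv A Om G p * K1 p)) x)
    = (LINT x|lborel. push (\<lambda>p. vd p * pr 3 (\<lambda>B C p. Lhat (K_curv A Om G) B p * PL C p) p) x)"
    by (rule chart_variation[OF even cK K supp3_zero[OF P(2) c] Hausdorff])
      (use smooth_K_curv c in \<open>auto simp: smooth_fun_def\<close>)
  finally show ?thesis by (simp only: PL_def)
qed

text \<open>Induction on a finite cover of the support, in place of a partition of unity. With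
  \<open>h\<close> a cutoff function equal to 1 on the first set \<open>N\<close>, the part
  \<open>h\<close> times \<Pi> lies in one chart and falls under \<open>loc\<close>; the rest is
  supported in \<open>K - N\<close>, which the remaining sets cover.\<close>

lemma integral_zero_if_automorphism:
  assumes zero: "\<And>c p i j l. c \<in> A \<Longrightarrow> p \<in> chart_dom c \<Longrightarrow> sympl_chart.Lhat c Om G (K_curv A Om G) [i, j, l] p = 0"
    and P: "symmetric_tensor3 A P" "supp3 P K"
  shows "(\<integral>p. K_curv A Om G p * dK P p \<partial>\<mu>) = 0"
proof -
  have loc: "(\<integral>p. K_curv A Om G p * dK P p \<partial>\<mu>) = 0"
    if c: "c \<in> A" and P: "symmetric_tensor3 A P" "supp3 P K" and K: "K \<subseteq> chart_dom c" for c P K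
  proof -
    interpret chart X c by (rule chart_ax[OF c])
    have "pairing (\<lambda>i j. Om_up Om c i j p) 3
        (\<lambda>B C. sympl_chart.Lhat c Om G (K_curv A Om G) B p * P c (C ! 0) (C ! 1) (C ! 2) p)
      = pairing (\<lambda>i j. Om_up Om c i j p) 3 (\<lambda>B C. 0)" if p: "p \<in> dom" for p
    proof (rule pairing_cong)
      fix B C :: "'n list" assume "length B = 3"
      then obtain i j l where "B = [i, j, l]" by (auto simp: length_Suc_conv eval_nat_numeral)
      then show "sympl_chart.Lhat c Om G (K_curv A Om G) B p * P c (C ! 0) (C ! 1) (C ! 2) p = 0"
        using zero[OF c p] by simp
    qed
    then have "push (\<lambda>p. volume_density Om c p * pairing (\<lambda>i j. Om_up Om c i j p) 3
        (\<lambda>B C. sympl_chart.Lhat c Om G (K_curv A Om G) B p * P c (C ! 0) (C ! 1) (C ! 2) p)) = (\<lambda>x. 0)"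
      using param_dom by (simp add: push_def fun_eq_iff del: pairing.simps One_nat_def)
    then show ?thesis
      unfolding chart_pairing[OF c P K] by (simp only: Bochner_Integration.integral_zero)
  qed
  \<comment> \<open>An open set \<open>N\<close> with a cutoff function \<open>h\<close> that is 1
    on \<open>N\<close> and has its compact support in the chart \<open>c\<close>.\<close>
  define Q where "Q N c h K \<longleftrightarrow> openin X N \<and> c \<in> A \<and> smooth_fun h \<and> compactin X K \<and> K \<subseteq> chart_dom c \<and>
    (\<forall>q. q \<notin> K \<longrightarrow> h q = 0) \<and> (\<forall>q\<in>N. h q = 1)" for N c h K
  define \<N> where "\<N> = {N. \<exists>c h K. Q N c h K}"
  have "\<exists>N\<in>\<N>. p \<in> N" if p: "p \<in> topspace X" for p
  proof -
    obtain c where c: "c \<in> A" "p \<in> chart_dom c" using p cover by blast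
    obtain h K N where h: "smooth_fun h" "\<And>q. 0 \<le> h q" "\<And>q. h q \<le> 1" "compactin X K" "K \<subseteq> chart_dom c"
      "\<And>q. q \<notin> K \<Longrightarrow> h q = 0" "openin X N" "p \<in> N" "N \<subseteq> chart_dom c" "\<And>q. q \<in> N \<Longrightarrow> h q = 1"
      by (rule cutoff[OF c(1) chart.openin_dom[OF chart_ax[OF c(1)]] c(2) order_refl]) (rule that)
    have "Q N c h K" using c(1) h by (simp add: Q_def)
    then have "N \<in> \<N>" unfolding \<N>_def by blast
    then show ?thesis using h(8) by blast
  qed
  then have "K \<subseteq> \<Union>\<N>" using P(2) compactin_subset_topspace unfolding supp3_def by blast
  moreover have "\<forall>N\<in>\<N>. openin X N" by (auto simp: \<N>_def Q_def)
  ultimately obtain \<F> where \<F>: "finite \<F>" "\<F> \<subseteq> \<N>" "K \<subseteq> \<Union>\<F>"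
    using P(2) unfolding supp3_def compactin_def by meson
  from \<F> P show ?thesis
  proof (induction \<F> arbitrary: P K)
    case empty
    then have "dK P p = 0" if "p \<in> topspace X" for p
      using dK_off_support[OF empty.prems(3,4) that] by blast
    then have "(\<integral>p. K_curv A Om G p * dK P p \<partial>\<mu>) = (\<integral>p. 0 \<partial>\<mu>)"
      by (intro Bochner_Integration.integral_cong) (simp_all add: space_\<mu>[OF even])
    then show ?case by simp
  next
    case (insert N \<F>)
    obtain c h L where "Q N c h L" using insert.prems(1) unfolding \<N>_def by blast
    then have h: "c \<in> A" "smooth_fun h" "compactin X L" "L \<subseteq> chart_dom c"
      "\<And>q. q \<notin> L \<Longrightarrow> h q = 0" "\<And>q. q \<in> N \<Longrightarrow> h q = 1" and N: "openin X N"
      by (simp_all add: Q_def)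
    let ?P = "\<lambda>c i j k p. h p * P c i j k p" and ?Q = "\<lambda>c i j k p. (1 + (- 1) * h p) * P c i j k p"
    have sP: "symmetric_tensor3 A ?P"
      by (rule symmetric_tensor3_scale[OF h(2) insert.prems(3)])
    have sQ: "symmetric_tensor3 A ?Q"
      by (rule symmetric_tensor3_scale[OF _ insert.prems(3)]) (intro smooth_fun_add smooth_fun_mult smooth_fun_const h)
    have sum: "(\<lambda>c i j k p. ?P c i j k p + ?Q c i j k p) = P"
      by (simp add: fun_eq_iff algebra_simps)
    have suppP: "supp3 ?P L" using h(3,5) by (auto simp: supp3_def)
    have suppQ: "supp3 ?Q (K - N)"
    proof -
      have "compactin X K" using insert.prems(4) by (simp add: supp3_def)
      moreover have "closedin X (topspace X - N)" using N by blast
      ultimately have "compactin X ((topspace X - N) \<inter> K)" by (rule closed_Int_compactin[rotated])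
      moreover have "(topspace X - N) \<inter> K = K - N"
        using compactin_subset_topspace[OF \<open>compactin X K\<close>] by blast
      ultimately show ?thesis using insert.prems(4) h(6) by (auto simp: supp3_def)
    qed
    have dKs: "dK P p = dK ?P p + dK ?Q p" if "p \<in> topspace X" for p
      using dK_add[OF sP sQ _ that] insert.prems(3) by (simp only: sum)
    have int: "integrable \<mu> (\<lambda>p. K_curv A Om G p * dK R p)" if R: "symmetric_tensor3 A R" "supp3 R K" for R K
      by (rule integrable_smooth[OF even smooth_fun_mult[OF smooth_K_curv smooth_dK[OF R(1)]]])
        (use R(2) dK_off_support[OF R] in \<open>auto simp: supp3_def\<close>)
    have "(\<integral>p. K_curv A Om G p * dK P p \<partial>\<mu>) = (\<integral>p. K_curv A Om G p * dK ?P p + K_curv A Om G p * dK ?Q p \<partial>\<mu>)"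
      by (rule Bochner_Integration.integral_cong[OF refl]) (simp only: dKs space_\<mu>[OF even] distrib_left)
    also have "\<dots> = (\<integral>p. K_curv A Om G p * dK ?P p \<partial>\<mu>) + (\<integral>p. K_curv A Om G p * dK ?Q p \<partial>\<mu>)"
      by (rule Bochner_Integration.integral_add[OF int[OF sP suppP] int[OF sQ suppQ]])
    also have "(\<integral>p. K_curv A Om G p * dK ?P p \<partial>\<mu>) = 0"
      by (rule loc[OF h(1) sP suppP h(4)])
    also have "(\<integral>p. K_curv A Om G p * dK ?Q p \<partial>\<mu>) = 0"
      by (rule insert.IH[OF _ _ sQ suppQ]) (use insert.prems in auto)
    finally show ?case by simp
  qed
qed

end

end

text \<open>Contracting with the cube of a covector \<xi> is evaluating the trilinear form three
  times at \<xi> with raised index.\<close>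

lemma pairing_cube:
  assumes \<eta>: "\<And>a. \<eta> a = (\<Sum>i\<in>UNIV. w i a * \<xi> i)"
  shows "pairing w 3 (\<lambda>B C. T B * (\<xi> (C ! 0) * (\<xi> (C ! 1) * \<xi> (C ! 2)))) = tri (\<lambda>a b e. T [a, b, e]) \<eta> \<eta> \<eta>"
proof -
  have aux: "(\<Sum>a\<in>UNIV. \<eta> a * Z a) = (\<Sum>i\<in>UNIV. \<Sum>a\<in>UNIV. w i a * (\<xi> i * Z a))" for Z
    unfolding \<eta> by (subst sum.swap) (simp add: sum_distrib_right mult.assoc)
  show ?thesis
    unfolding tri_def aux by (simp add: eval_nat_numeral sum_distrib_left mult_ac)
qed

lemma continuous_zero_if_AE:
  fixes f :: "real ^ 'n::finite \<Rightarrow> real"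
  assumes f: "continuous_on UNIV f" and AE: "AE x in lborel. f x = 0"
  shows "f x = 0"
proof (rule ccontr)
  assume "f x \<noteq> 0"
  then have ne: "{x. f x \<noteq> 0} \<noteq> {}" by blast
  have op: "open {x. f x \<noteq> 0}"
    using f by (intro open_Collect_neq) (auto simp: continuous_on_const)
  have "{x. f x \<noteq> 0} \<in> null_sets lborel"
    using AE AE_iff_null_sets[of "{x. f x \<noteq> 0}" lborel] op by simp
  then have "negligible {x. f x \<noteq> 0}"
    by (simp add: negligible_iff_null_sets null_sets_completionI)
  then show False using open_not_negligible[OF op ne] by blast
qed

section \<open>Critical connections give infinitesimal automorphisms\<close>

context symplectic_conn
begin

lemma symmetric_tensor3_cube:
  assumes u: "smooth_fun u"
  shows "symmetric_tensor3 A (\<lambda>c i j k p. pd c i u p * (pd c j u p * pd c k u p))"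
  unfolding symmetric_tensor3_def covariant_tensor3_def
proof (intro conjI ballI allI)
  fix c i j k assume c: "c \<in> A"
  interpret chart X c by (rule chart_ax[OF c])
  have "sm c u" using u c by (simp add: smooth_fun_def)
  then show "sm c (\<lambda>p. pd c i u p * (pd c j u p * pd c k u p))"
    by (intro sm_mult sm_pd)
  fix p
  show "pd c i u p * (pd c j u p * pd c k u p) = pd c j u p * (pd c i u p * pd c k u p)"
    "pd c i u p * (pd c j u p * pd c k u p) = pd c i u p * (pd c k u p * pd c j u p)"
    by simp_all
next
  fix c d p i j k assume cd: "c \<in> A" "d \<in> A" "p \<in> chart_dom c \<inter> chart_dom d"
  have "pd c i u p = (\<Sum>a\<in>UNIV. jac c d i a p * pd d a u p)" for i
    using pd_chain(2)[OF cd smooth_fun_mdiff[OF u cd(2)]] cd(3) by blast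
  then have "pd c i u p * (pd c j u p * pd c k u p)
    = (\<Sum>a\<in>UNIV. \<Sum>b\<in>UNIV. \<Sum>e\<in>UNIV. (jac c d i a p * pd d a u p) * ((jac c d j b p * pd d b u p) * (jac c d k e p * pd d e u p)))"
    by (simp only: sum_distrib_right) (simp only: sum_distrib_left)
  then show "pd c i u p * (pd c j u p * pd c k u p)
    = (\<Sum>a\<in>UNIV. \<Sum>b\<in>UNIV. \<Sum>e\<in>UNIV. jac c d i a p * jac c d j b p * jac c d k e p * (pd d a u p * (pd d b u p * pd d e u p)))"
    by (simp add: mult_ac)
qed

text \<open>By polarisation it suffices that the cubic form of \<open>Lhat\<close> vanishes at every
  \<eta>. If it did not, \<Pi> = h du du du, with \<open>du\<close> matching \<eta> at
  \<open>p\<close> and \<open>h\<close> a narrow cutoff function, would give an integrand of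
  constant sign that is nonzero at \<open>p\<close>, although its integral is 0.\<close>

lemma automorphism_if_integrals_zero:
  assumes even: "even CARD('n)"
    and crit: "\<And>P K. symmetric_tensor3 A P \<Longrightarrow> supp3 P K \<Longrightarrow> (\<integral>p. K_curv A Om G p * dK P p \<partial>\<mu>) = 0"
    and c: "c \<in> A" and p: "p \<in> chart_dom c"
  shows "sympl_chart.Lhat c Om G (K_curv A Om G) [i, j, l] p = 0"
proof -
  interpret sympl_chart X c Om G by (rule sympl_chart_ax[OF c])
  let ?f = "K_curv A Om G"
  have f: "sm c ?f" using smooth_K_curv c by (simp add: smooth_fun_def)
  have "tri (\<lambda>a b e. Lhat ?f [a, b, e] p) \<eta> \<eta> \<eta> = 0" for \<eta>
  proof (rule ccontr)
    assume nz: "tri (\<lambda>a b e. Lhat ?f [a, b, e] p) \<eta> \<eta> \<eta> \<noteq> 0"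
    \<comment> \<open>\<eta> with its index lowered; the minus sign makes up for the one in the
      product of \<open>om\<close> and \<open>w\<close>.\<close>
    define \<xi> where "\<xi> i = - (\<Sum>b\<in>UNIV. \<eta> b * om b i p)" for i
    have \<eta>: "\<eta> a = (\<Sum>i\<in>UNIV. w i a p * \<xi> i)" for a
    proof -
      have "(\<Sum>i\<in>UNIV. w i a p * \<xi> i) = - (\<Sum>i\<in>UNIV. \<Sum>b\<in>UNIV. \<eta> b * (om b i p * w i a p))"
        by (simp add: \<xi>_def sum_distrib_left sum_negf mult_ac)
      also have "\<dots> = - (\<Sum>b\<in>UNIV. \<eta> b * (\<Sum>i\<in>UNIV. om b i p * w i a p))"
        by (subst sum.swap) (simp add: sum_distrib_left)
      also have "\<dots> = - (\<Sum>b\<in>UNIV. \<eta> b * (if b = a then - 1 else 0))"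
        by (simp only: om_w[OF p])
      also have "\<dots> = \<eta> a" by (simp add: if_distrib cong: if_cong)
      finally show ?thesis by simp
    qed
    obtain u N where u: "smooth_fun u" "openin X N" "p \<in> N" "N \<subseteq> dom" "\<And>q i. q \<in> N \<Longrightarrow> pd c i u q = \<xi> i"
      using linear_function[OF c p, of \<xi>] by blast
    define g where "g q = pr 3 (\<lambda>B C q. Lhat ?f B q * (pd c (C ! 0) u q * (pd c (C ! 1) u q * pd c (C ! 2) u q))) q" for q
    have sm_u: "sm c u" using u(1) c by (simp add: smooth_fun_def)
    have sm_g: "sm c g"
      unfolding g_def[abs_def] by (intro sm_pairing sm_mult sm_pd sm_u sm_Lhat f)
    have gp: "g p \<noteq> 0"
      using nz pairing_cube[of \<eta> "\<lambda>i j. w i j p" \<xi> "\<lambda>B. Lhat ?f B p", OF \<eta>]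
      unfolding g_def by (simp only: u(5)[OF u(3)] not_False_eq_True)
    \<comment> \<open>On \<open>V\<close> the function \<open>g\<close> has the same sign as at
      \<open>p\<close>; the cutoff function is supported there.\<close>
    define V where "V = N \<inter> {q \<in> dom. g q * g p > 0}"
    have "openin (subtopology X dom) {q \<in> topspace (subtopology X dom). g q * g p \<in> {0<..}}"
      by (rule openin_continuous_map_preimage[OF sm_continuous_map]) (intro sm_mult sm_g sm_const, simp)
    then have "openin X {q \<in> dom. g q * g p > 0}"
      using openin_dom openin_trans_full dom_subset by (simp add: inf.absorb2)
    then have V: "openin X V" "V \<subseteq> dom" using u(2) by (auto simp: V_def)
    have pV: "p \<in> V" using u(3) p gp by (auto simp: V_def zero_less_mult_iff)
    obtain h K N' where h: "smooth_fun h" "\<And>q. 0 \<le> h q" "\<And>q. h q \<le> 1" "compactin X K" "K \<subseteq> V"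
      "\<And>q. q \<notin> K \<Longrightarrow> h q = 0" "openin X N'" "p \<in> N'" "N' \<subseteq> V" "\<And>q. q \<in> N' \<Longrightarrow> h q = 1"
      by (rule cutoff[OF c V(1) pV V(2)]) (rule that)
    define P where "P d i j k q = h q * (pd d i u q * (pd d j u q * pd d k u q))"
      for d :: "('m, 'n) chart" and i j k q
    have P: "symmetric_tensor3 A P"
      unfolding P_def[abs_def] by (rule symmetric_tensor3_scale[OF h(1) symmetric_tensor3_cube[OF u(1)]])
    have supp: "supp3 P K" using h(4,6) by (auto simp: supp3_def P_def)
    have KD: "K \<subseteq> dom" using h(5) V by blast
    define F where "F q = vd q * (h q * g q)" for q
    have "pr 3 (\<lambda>B C p. Lhat ?f B p * P c (C ! 0) (C ! 1) (C ! 2) p) q = h q * g q" for q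
      unfolding g_def pairing_cmult[symmetric] P_def by (simp only: mult.left_commute)
    then have int0: "(LINT x|lborel. push F x) = 0"
      using chart_pairing[OF even c P supp KD] crit[OF P supp] by (simp only: F_def[abs_def])
    have sm_h: "sm c h" using h(1) c by (simp add: smooth_fun_def)
    have sm_F: "sm c F"
      unfolding F_def[abs_def] by (intro sm_mult sm_vd[OF even] sm_h sm_g)
    have F0: "F q = 0" if "q \<notin> K" for q using h(6)[OF that] by (simp add: F_def)
    \<comment> \<open>Multiplying by the constant \<open>g p\<close> makes the integrand nonnegative
      whichever sign \<open>g\<close> has on \<open>V\<close>.\<close>
    have Fpos: "0 \<le> push F x * g p" for x
    proof (cases "x \<in> coords c ` dom \<and> param c x \<in> K")
      case True
      then have "param c x \<in> dom" "g (param c x) * g p > 0" using h(5) by (auto simp: V_def)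
      moreover have "push F x * g p = vd (param c x) * (h (param c x) * (g (param c x) * g p))"
        using True by (simp add: push_def F_def mult_ac)
      ultimately show ?thesis
        using vd_pos[OF even, of "param c x"] h(2)[of "param c x"] by (metis mult_nonneg_nonneg less_imp_le)
    next
      case False
      then have "push F x = 0" using F0 by (auto simp: push_def)
      then show ?thesis by simp
    qed
    note pushF = sm_F h(4) KD F0
    have "integrable lborel (\<lambda>x. push F x * g p)"
      by (rule integrable_mult_left[OF integrable_push[OF pushF]])
    from integral_nonneg_eq_0_iff_AE[OF this] have "AE x in lborel. push F x * g p = 0"
      using Fpos int0 by simp
    then have "push F (coords c p) * g p = 0"
      by (rule continuous_zero_if_AE[rotated])
        (intro continuous_on_mult continuous_on_const smooth_on_open_continuous_on[OF smooth_push[OF pushF]])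
    moreover have "push F (coords c p) = vd p * g p"
      using p h(10)[OF h(8)] by (simp add: push_def F_def)
    ultimately show False using gp vd_pos[OF even p] by simp
  qed
  then show ?thesis
    by (rule symmetric_trilinear_zero[of "\<lambda>a b e. Lhat ?f [a, b, e] p", OF Lhat_sym12[OF f p] Lhat_sym23[OF f p]])
qed

lemma critical_iff_automorphism:
  assumes even: "even CARD('n)"
  shows "critical_connection X A Om G \<longleftrightarrow> infinitesimal_automorphism A (hamiltonian_vec Om (K_curv A Om G)) G"
proof -
  let ?f = "K_curv A Om G"
  have lie: "(\<forall>i j k. lie_connection (hamiltonian_vec Om ?f) G c i j k p = 0)
    \<longleftrightarrow> (\<forall>i j l. sympl_chart.Lhat c Om G ?f [i, j, l] p = 0)" if c: "c \<in> A" "p \<in> chart_dom c" for c p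
    by (rule sympl_chart.lie_connection_zero_iff[OF sympl_chart_ax[OF c(1)] _ c(2)])
      (use smooth_K_curv c in \<open>simp add: smooth_fun_def\<close>)
  have supp: "compactly_supported3 X A P \<longleftrightarrow> (\<exists>K. supp3 P K)" for P
    unfolding compactly_supported3_def supp3_def by blast
  show ?thesis
  proof
    assume "critical_connection X A Om G"
    then have int: "(\<integral>p. ?f p * dK P p \<partial>\<mu>) = 0" if "symmetric_tensor3 A P" "supp3 P K" for P K
      using that unfolding critical_iff[OF even] supp by blast
    have "sympl_chart.Lhat c Om G ?f [i, j, l] p = 0" if "c \<in> A" "p \<in> chart_dom c" for c p i j l
      by (rule automorphism_if_integrals_zero[OF even _ that]) (rule int)
    with lie show "infinitesimal_automorphism A (hamiltonian_vec Om ?f) G"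
      unfolding infinitesimal_automorphism_def by blast
  next
    assume "infinitesimal_automorphism A (hamiltonian_vec Om ?f) G"
    then have zero: "sympl_chart.Lhat c Om G ?f [i, j, l] p = 0" if "c \<in> A" "p \<in> chart_dom c" for c p i j l
      using lie[OF that] that unfolding infinitesimal_automorphism_def by blast
    have "(\<integral>p. ?f p * dK P p \<partial>\<mu>) = 0" if "symmetric_tensor3 A P" "supp3 P K" for P K
      by (rule integral_zero_if_automorphism[OF even _ that]) (rule zero)
    then show "critical_connection X A Om G"
      unfolding critical_iff[OF even] supp by blast
  qed
qed

end

theorem theorem1p4:
  fixes X :: "'m topology" and A :: "('m, 'n::finite) chart set"
    and Om :: "('m, 'n) field2" and G :: "('m, 'n) field3" and n :: nat
  assumes "smooth_manifold X A" and "CARD('n) = 2 * n"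
    and "symplectic_form A Om"
    and "symplectic_connection A Om G"
  shows "critical_connection X A Om G \<longleftrightarrow>
    infinitesimal_automorphism A (hamiltonian_vec Om (K_curv A Om G)) G"
proof -
  interpret symplectic_conn X A Om G
    using assms(1,3,4) by unfold_locales
  show ?thesis by (rule critical_iff_automorphism) (simp add: assms(2))
qed

end
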